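(* Let $X_1$ and $X_2$ be complex Banach spaces and let $J$ be an operator ideal between $X_2$ and $X_1$. Let $S=(S_1,\ldots,S_n)$ and $T=(T_1,\ldots,T_m)$ be tuples of commuting bounded linear operators on $X_1$ and $X_2$ respectively, and let $(L_S,R_T)=(L_{S_1},\ldots,L_{S_n},R_{T_1},\ldots,R_{T_m})$ be the $(n+m)$-tuple of left and right multiplication operators on $J$, $L_{S_i}(A)=S_iA$, $R_{T_j}(A)=AT_j$ for $A\in J$. Then: (i) $\sigma_{\mathcal{B}_-}(S)\times\sigma_\pi(T)\cup\sigma_\delta(S)\times\sigma_{\mathcal{B}_+}(T)\subseteq\sigma_{\mathcal{B}_-}(L_S,R_T)\subseteq sp_{\mathcal{B}_-}(L_S,R_T)\subseteq sp_{\mathcal{B}_-}(S)\times sp_\pi(T)\cup sp_\delta(S)\times sp_{\mathcal{B}_+}(T)$; (ii) $\sigma_{\mathcal{B}_+}(S)\times\sigma_\delta(T)\cup\sigma_\pi(S)\times\sigma_{\mathcal{B}_-}(T)\subseteq\sigma_{\mathcal{B}_+}(L_S,R_T)\subseteq sp_{\mathcal{B}_+}(L_S,R_T)\subseteq sp_{\mathcal{B}_+}(S)\times sp_\delta(T)\cup sp_\pi(S)\times sp_{\mathcal{B}_-}(T)$. In addition, if $X_1$ and $X_2$ are Hilbert spaces, all the inclusions in (i) and (ii) are equalities.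
   Context: Joint spectra. Let $X$ be a complex Banach space and $T=(T_1,\ldots,T_n)$ an $n$-tuple of commuting bounded linear operators on $X$. $R(\cdot)$ and $N(\cdot)$ denote range and null space. For $\lambda\in\mathbb{C}^n$, $T-\lambda=(T_1-\lambda_1I,\ldots,T_n-\lambda_nI)$. Define $\hat{T}\colon X^n\to X$, $\hat{T}(x_1,\ldots,x_n)=T_1x_1+\cdots+T_nx_n$, and $\tilde{T}\colon X\to X^n$, $\tilde{T}(x)=(T_1x,\ldots,T_nx)$. For $k\in\mathbb{N}$, $k\ge1$, $M_k(T)=R(T_1^k)+\cdots+R(T_n^k)$; $R^\infty(T)=\bigcap_{k\ge1}M_k(T)$; $N^\infty(T)=\bigcup_{k\ge1}[N(T_1^k)\cap\cdots\cap N(T_n^k)]$. A subspace of a Banach space has a direct complement if there is a closed subspace such that the whole space is the direct sum of the two. - $T$ is lower semi-Browder if $\operatorname{codim}R^\infty(T)<\infty$; $\sigma_{\mathcal{B}_-}(T)$ is the set of $\lambda\in\mathbb{C}^n$ such that $T-\lambda$ is not lower semi-Browder. - $T$ is upper semi-Fredholm if $\dim N(\tilde{T})<\infty$ and $R(\tilde{T})$ is closed. $T$ is upper semi-Browder if it is upper semi-Fredholm and $\dim N^\infty(T)<\infty$; $\sigma_{\mathcal{B}_+}(T)$ is the set of $\lambda\in\mathbb{C}^n$ such that $T-\lambda$ is not upper semi-Browder. - $\sigma_\delta(T)=\{\lambda\in\mathbb{C}^n:\operatorname{codim}M_1(T-\lambda)\ne0\}$ (defect spectrum). - $\sigma_\pi(T)=\{\lambda\in\mathbb{C}^n: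 N(\widetilde{T-\lambda})\ne0$ or $R(\widetilde{T-\lambda})$ is not closed$\}$ (approximate point spectrum). - $\mathcal{C}_-(T)=\{\lambda\in\mathbb{C}^n: N(\widehat{T-\lambda})$ has no direct complement in $X^n\}$ and $\mathcal{C}_+(T)=\{\lambda\in\mathbb{C}^n: R(\widetilde{T-\lambda})$ has no direct complement in $X^n\}$. - $sp_\delta(T)=\sigma_\delta(T)\cup\mathcal{C}_-(T)$ and $sp_\pi(T)=\sigma_\pi(T)\cup\mathcal{C}_+(T)$ (split defect and split approximate point spectra). - $sp_{\mathcal{B}_-}(T)$ (lower split semi-Browder spectrum) is the set of $\lambda\in\mathbb{C}^n$ such that it is not the case that both $\operatorname{codim}R^\infty(T-\lambda)<\infty$ and $N(\widehat{T-\lambda})$ has a direct complement in $X^n$; i.e. $sp_{\mathcal{B}_-}(T)=\sigma_{\mathcal{B}_-}(T)\cup\mathcal{C}_-(T)$. - $sp_{\mathcal{B}_+}(T)$ (upper split semi-Browder spectrum) is the set of $\lambda\in\mathbb{C}^n$ such that it is not the case that both $T-\lambda$ is upper semi-Browder and $R(\widetilde{T-\lambda})$ has a direct complement in $X^n$; i.e. $sp_{\mathcal{B}_+}(T)=\sigma_{\mathcal{B}_+}(T)\cup\mathcal{C}_+(T)$. Operator ideal (in the sense of Eschmeier). $\mathrm{L}(X_2,X_1)$ is the space of bounded linear operators $X_2\to X_1$, $\mathrm{L}(X)=\mathrm{L}(X,X)$, and $X'$ is the dual of $X$. An operator ideal $J$ between $X_2$ and $X_1$ is a linear subspace of $\mathrm{L}(X_2,X_1)$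 equipped with a norm $\alpha$ making it a Banach space such that (i) $x_1\otimes x_2'\in J$ and $\alpha(x_1\otimes x_2')=\|x_1\|\,\|x_2'\|$, (ii) $SAT\in J$ and $\alpha(SAT)\le\|S\|\,\alpha(A)\,\|T\|$, for all $x_1\in X_1$, $x_2'\in X_2'$, $A\in J$, $S\in\mathrm{L}(X_1)$, $T\in\mathrm{L}(X_2)$, where $x_1\otimes x_2'$ is the rank one operator $X_2\to X_1$, $x_2\mapsto x_2'(x_2)\,x_1$. The spectra of $(L_S,R_T)$ are those of a tuple of commuting bounded operators on the Banach space $(J,\alpha)$. *)

theory Defs
  imports "HOL-Analysis.Analysis" "HOL-Library.Function_Algebras" "HOL-Library.Extended_Nat"
begin

section \<open>Complex vector spaces and complex Banach spaces\<close>

class scaleC =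
  fixes scaleC :: "complex \<Rightarrow> 'a \<Rightarrow> 'a"

class complex_vector = scaleC + ab_group_add +
  assumes scaleC_add_right: "scaleC a (x + y) = scaleC a x + scaleC a y"
    and scaleC_add_left: "scaleC (a + b) x = scaleC a x + scaleC b x"
    and scaleC_scaleC: "scaleC a (scaleC b x) = scaleC (a * b) x"
    and scaleC_one: "scaleC 1 x = x"

class complex_normed_vector = complex_vector + real_normed_vector +
  assumes scaleR_scaleC: "scaleR r x = scaleC (complex_of_real r) x"
    and norm_scaleC: "norm (scaleC a x) = cmod a * norm x"

class complex_banach = complex_normed_vector + complete_space

global_interpretation cvec: vector_space "scaleC :: complex \<Rightarrow> 'a \<Rightarrow> 'a::complex_vector"
  by unfold_locales (simp_all add: scaleC_add_right scaleC_add_left scaleC_scaleC scaleC_one)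

abbreviation csubspace :: "'a::complex_vector set \<Rightarrow> bool"
  where "csubspace \<equiv> cvec.subspace"

abbreviation cspan :: "'a::complex_vector set \<Rightarrow> 'a set"
  where "cspan \<equiv> cvec.span"

instantiation complex :: complex_banach
begin

definition scaleC_complex :: "complex \<Rightarrow> complex \<Rightarrow> complex"
  where "scaleC_complex a x = a * x"

instance
  by standard (simp_all add: scaleC_complex_def algebra_simps norm_mult scaleR_conv_of_real)

end

text \<open>
  With the pointwise structure, a function type serves both as the space of maps containing
  \<open>L(X\<^sub>2, X\<^sub>1)\<close> and, for a finite index type \<open>'i\<close>, as the power \<open>X\<^sup>n\<close> with \<open>n = CARD('i)\<close>.
\<close>

instantiation "fun" :: (type, complex_vector) complex_vector
begin

definition scaleC_fun :: "complex \<Rightarrow> ('a \<Rightarrow> 'b) \<Rightarrow> 'a \<Rightarrow> 'b"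
  where "scaleC_fun a f = (\<lambda>x. scaleC a (f x))"

instance
  by standard
    (simp_all add: scaleC_fun_def fun_eq_iff scaleC_add_right scaleC_add_left scaleC_scaleC scaleC_one)

end

definition bounded_clinear :: "('a::complex_normed_vector \<Rightarrow> 'b::complex_normed_vector) \<Rightarrow> bool"
  where "bounded_clinear f \<longleftrightarrow> bounded_linear f \<and> (\<forall>c x. f (scaleC c x) = scaleC c (f x))"

text \<open>
  A complex Banach space is a Hilbert space if its norm comes from an inner product
  (linear in the first argument).
\<close>

definition inner_product_for_norm :: "('a::complex_normed_vector \<Rightarrow> 'a \<Rightarrow> complex) \<Rightarrow> bool"
  where "inner_product_for_norm ip \<longleftrightarrow>
    (\<forall>x y z. ip (x + y) z = ip x z + ip y z) \<and>
    (\<forall>c x y. ip (scaleC c x) y = c * ip x y) \<and>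
    (\<forall>x y. ip y x = cnj (ip x y)) \<and>
    (\<forall>x. ip x x = complex_of_real ((norm x)\<^sup>2))"

section \<open>Subspaces carrying a norm of their own\<close>

text \<open>
  An operator ideal \<open>J\<close> is a subspace of \<open>L(X\<^sub>2, X\<^sub>1)\<close> with its own complete norm, so the spectra
  below are defined for a normed space given by a carrier \<open>V\<close> and a norm \<open>N\<close> on \<open>V\<close>.  The space
  that is a whole type is \<open>(UNIV, norm)\<close>.  Only the values of \<open>N\<close> on \<open>V\<close> matter; the metric is
  set to \<open>0\<close> off \<open>V\<close> because the locale \<open>Metric_space\<close> demands nonnegativity and symmetry there.
\<close>

definition norm_dist :: "'a::ab_group_add set \<Rightarrow> ('a \<Rightarrow> real) \<Rightarrow> 'a \<Rightarrow> 'a \<Rightarrow> real"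
  where "norm_dist V N x y = (if x \<in> V \<and> y \<in> V then N (x - y) else 0)"

definition norm_on :: "'a::complex_vector set \<Rightarrow> ('a \<Rightarrow> real) \<Rightarrow> bool"
  where "norm_on V N \<longleftrightarrow> csubspace V \<and>
    (\<forall>x\<in>V. 0 \<le> N x) \<and>
    (\<forall>x\<in>V. N x = 0 \<longleftrightarrow> x = 0) \<and>
    (\<forall>x\<in>V. \<forall>y\<in>V. N (x + y) \<le> N x + N y) \<and>
    (\<forall>c. \<forall>x\<in>V. N (scaleC c x) = cmod c * N x)"

definition banach_on :: "'a::complex_vector set \<Rightarrow> ('a \<Rightarrow> real) \<Rightarrow> bool"
  where "banach_on V N \<longleftrightarrow> norm_on V N \<and> Metric_space.mcomplete V (norm_dist V N)"

lemma Metric_space_norm_dist: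
  assumes "norm_on V N"
  shows "Metric_space V (norm_dist V N)"
proof
  have sub: "csubspace V" and nn: "\<And>x. x \<in> V \<Longrightarrow> 0 \<le> N x"
    and z: "\<And>x. x \<in> V \<Longrightarrow> N x = 0 \<longleftrightarrow> x = 0"
    and tri: "\<And>x y. x \<in> V \<Longrightarrow> y \<in> V \<Longrightarrow> N (x + y) \<le> N x + N y"
    and sc: "\<And>c x. x \<in> V \<Longrightarrow> N (scaleC c x) = cmod c * N x"
    using assms by (auto simp: norm_on_def)
  have minus: "x - y \<in> V" if "x \<in> V" "y \<in> V" for x y
    using cvec.subspace_diff[OF sub] that by blast
  show "0 \<le> norm_dist V N x y" for x y
    by (simp add: norm_dist_def nn minus)
  show "norm_dist V N x y = norm_dist V N y x" for x y
  proof (cases "x \<in> V \<and> y \<in> V")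
    case True
    have "y - x = scaleC (- 1) (x - y)"
      by (simp add: cvec.scale_minus_left)
    then show ?thesis
      using True sc[of "x - y" "- 1"] minus by (simp add: norm_dist_def)
  qed (auto simp: norm_dist_def)
  show "norm_dist V N x y = 0 \<longleftrightarrow> x = y" if "x \<in> V" "y \<in> V" for x y
    using that z[OF minus[OF that]] by (simp add: norm_dist_def)
  show "norm_dist V N x w \<le> norm_dist V N x y + norm_dist V N y w"
    if "x \<in> V" "y \<in> V" "w \<in> V" for x y w
    using that tri[OF minus minus, of x y y w] by (simp add: norm_dist_def)
qed

definition power_topology :: "'a::ab_group_add set \<Rightarrow> ('a \<Rightarrow> real) \<Rightarrow> ('i \<Rightarrow> 'a) topology"
  where "power_topology V N =
    product_topology (\<lambda>_. Metric_space.mtopology V (norm_dist V N)) UNIV"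

definition cdim :: "'a::complex_vector set \<Rightarrow> enat"
  where "cdim W = (if \<exists>B. finite B \<and> W \<subseteq> cspan B then enat (cvec.dim W) else \<infinity>)"

text \<open>
  The dimension of \<open>V / W\<close> for a subspace \<open>W\<close> of \<open>V\<close>: the least number of vectors spanning \<open>V\<close>
  together with \<open>W\<close>, and \<open>\<infinity>\<close> (the infimum of the empty set) if finitely many never suffice.
\<close>

definition codim :: "'a::complex_vector set \<Rightarrow> 'a set \<Rightarrow> enat"
  where "codim V W = (INF B\<in>{B. finite B \<and> cspan (W \<union> B) = V}. enat (card B))"

definition has_direct_complement :: "'a::complex_vector topology \<Rightarrow> 'a set \<Rightarrow> bool"
  where "has_direct_complement \<tau> W \<longleftrightarrow>
    (\<exists>U. csubspace U \<and> closedin \<tau> U \<and> W \<inter> U = {0} \<and> {w + u | w u. w \<in> W \<and> u \<in> U} = topspace \<tau>)"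

section \<open>Tuples of operators and their joint spectra\<close>

text \<open>
  An \<open>n\<close>-tuple of operators on \<open>V\<close> is a family \<open>T :: 'i \<Rightarrow> 'a \<Rightarrow> 'a\<close> over a finite index type with
  \<open>n = CARD('i)\<close>; a point of \<open>\<complex>\<^sup>n\<close> is a function \<open>'i \<Rightarrow> complex\<close>.
\<close>

definition commuting_tuple :: "('i \<Rightarrow> 'a \<Rightarrow> 'a::complex_normed_vector) \<Rightarrow> bool"
  where "commuting_tuple T \<longleftrightarrow> (\<forall>i. bounded_clinear (T i)) \<and> (\<forall>i j. T i \<circ> T j = T j \<circ> T i)"

definition shift :: "('i \<Rightarrow> 'a \<Rightarrow> 'a::complex_vector) \<Rightarrow> ('i \<Rightarrow> complex) \<Rightarrow> 'i \<Rightarrow> 'a \<Rightarrow> 'a"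
  where "shift T \<zeta> = (\<lambda>i x. T i x - scaleC (\<zeta> i) x)"

definition hat :: "('i::finite \<Rightarrow> 'a \<Rightarrow> 'a::complex_vector) \<Rightarrow> ('i \<Rightarrow> 'a) \<Rightarrow> 'a"
  where "hat T x = (\<Sum>i\<in>UNIV. T i (x i))"

definition tilde :: "('i \<Rightarrow> 'a \<Rightarrow> 'a::complex_vector) \<Rightarrow> 'a \<Rightarrow> 'i \<Rightarrow> 'a"
  where "tilde T x = (\<lambda>i. T i x)"

definition null_hat :: "'a set \<Rightarrow> ('i::finite \<Rightarrow> 'a \<Rightarrow> 'a::complex_vector) \<Rightarrow> ('i \<Rightarrow> 'a) set"
  where "null_hat V T = {x. (\<forall>i. x i \<in> V) \<and> hat T x = 0}"

definition null_tilde :: "'a set \<Rightarrow> ('i \<Rightarrow> 'a \<Rightarrow> 'a::complex_vector) \<Rightarrow> 'a set"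
  where "null_tilde V T = {x \<in> V. tilde T x = 0}"

definition range_tilde :: "'a set \<Rightarrow> ('i \<Rightarrow> 'a \<Rightarrow> 'a::complex_vector) \<Rightarrow> ('i \<Rightarrow> 'a) set"
  where "range_tilde V T = tilde T ` V"

definition M_sum :: "'a set \<Rightarrow> nat \<Rightarrow> ('i::finite \<Rightarrow> 'a \<Rightarrow> 'a::complex_vector) \<Rightarrow> 'a set"
  where "M_sum V k T = {(\<Sum>i\<in>UNIV. y i) | y. \<forall>i. y i \<in> (T i ^^ k) ` V}"

definition R_infty :: "'a set \<Rightarrow> ('i::finite \<Rightarrow> 'a \<Rightarrow> 'a::complex_vector) \<Rightarrow> 'a set"
  where "R_infty V T = (\<Inter>k\<in>{1..}. M_sum V k T)"

definition N_infty :: "'a set \<Rightarrow> ('i \<Rightarrow> 'a \<Rightarrow> 'a::complex_vector) \<Rightarrow> 'a set"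
  where "N_infty V T = (\<Union>k\<in>{1..}. {x \<in> V. \<forall>i. (T i ^^ k) x = 0})"

definition lower_semi_Browder :: "'a set \<Rightarrow> ('i::finite \<Rightarrow> 'a \<Rightarrow> 'a::complex_vector) \<Rightarrow> bool"
  where "lower_semi_Browder V T \<longleftrightarrow> codim V (R_infty V T) < \<infinity>"

definition upper_semi_Fredholm ::
    "'a set \<Rightarrow> ('a \<Rightarrow> real) \<Rightarrow> ('i::finite \<Rightarrow> 'a \<Rightarrow> 'a::complex_vector) \<Rightarrow> bool"
  where "upper_semi_Fredholm V N T \<longleftrightarrow>
    cdim (null_tilde V T) < \<infinity> \<and> closedin (power_topology V N) (range_tilde V T)"

definition upper_semi_Browder ::
    "'a set \<Rightarrow> ('a \<Rightarrow> real) \<Rightarrow> ('i::finite \<Rightarrow> 'a \<Rightarrow> 'a::complex_vector) \<Rightarrow> bool"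
  where "upper_semi_Browder V N T \<longleftrightarrow> upper_semi_Fredholm V N T \<and> cdim (N_infty V T) < \<infinity>"

definition sigma_B_minus ::
    "'a set \<Rightarrow> ('i::finite \<Rightarrow> 'a \<Rightarrow> 'a::complex_vector) \<Rightarrow> ('i \<Rightarrow> complex) set"
  where "sigma_B_minus V T = {\<zeta>. \<not> lower_semi_Browder V (shift T \<zeta>)}"

definition sigma_B_plus ::
    "'a set \<Rightarrow> ('a \<Rightarrow> real) \<Rightarrow> ('i::finite \<Rightarrow> 'a \<Rightarrow> 'a::complex_vector) \<Rightarrow> ('i \<Rightarrow> complex) set"
  where "sigma_B_plus V N T = {\<zeta>. \<not> upper_semi_Browder V N (shift T \<zeta>)}"

definition sigma_delta ::
    "'a set \<Rightarrow> ('i::finite \<Rightarrow> 'a \<Rightarrow> 'a::complex_vector) \<Rightarrow> ('i \<Rightarrow> complex) set"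
  where "sigma_delta V T = {\<zeta>. codim V (M_sum V 1 (shift T \<zeta>)) \<noteq> 0}"

definition sigma_pi ::
    "'a set \<Rightarrow> ('a \<Rightarrow> real) \<Rightarrow> ('i::finite \<Rightarrow> 'a \<Rightarrow> 'a::complex_vector) \<Rightarrow> ('i \<Rightarrow> complex) set"
  where "sigma_pi V N T = {\<zeta>. null_tilde V (shift T \<zeta>) \<noteq> {0} \<or>
    \<not> closedin (power_topology V N) (range_tilde V (shift T \<zeta>))}"

definition C_minus ::
    "'a set \<Rightarrow> ('a \<Rightarrow> real) \<Rightarrow> ('i::finite \<Rightarrow> 'a \<Rightarrow> 'a::complex_vector) \<Rightarrow> ('i \<Rightarrow> complex) set"
  where "C_minus V N T =
    {\<zeta>. \<not> has_direct_complement (power_topology V N) (null_hat V (shift T \<zeta>))}"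

definition C_plus ::
    "'a set \<Rightarrow> ('a \<Rightarrow> real) \<Rightarrow> ('i::finite \<Rightarrow> 'a \<Rightarrow> 'a::complex_vector) \<Rightarrow> ('i \<Rightarrow> complex) set"
  where "C_plus V N T =
    {\<zeta>. \<not> has_direct_complement (power_topology V N) (range_tilde V (shift T \<zeta>))}"

definition sp_delta ::
    "'a set \<Rightarrow> ('a \<Rightarrow> real) \<Rightarrow> ('i::finite \<Rightarrow> 'a \<Rightarrow> 'a::complex_vector) \<Rightarrow> ('i \<Rightarrow> complex) set"
  where "sp_delta V N T = sigma_delta V T \<union> C_minus V N T"

definition sp_pi ::
    "'a set \<Rightarrow> ('a \<Rightarrow> real) \<Rightarrow> ('i::finite \<Rightarrow> 'a \<Rightarrow> 'a::complex_vector) \<Rightarrow> ('i \<Rightarrow> complex) set"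
  where "sp_pi V N T = sigma_pi V N T \<union> C_plus V N T"

definition sp_B_minus ::
    "'a set \<Rightarrow> ('a \<Rightarrow> real) \<Rightarrow> ('i::finite \<Rightarrow> 'a \<Rightarrow> 'a::complex_vector) \<Rightarrow> ('i \<Rightarrow> complex) set"
  where "sp_B_minus V N T = {\<zeta>. \<not> (codim V (R_infty V (shift T \<zeta>)) < \<infinity> \<and>
    has_direct_complement (power_topology V N) (null_hat V (shift T \<zeta>)))}"

definition sp_B_plus ::
    "'a set \<Rightarrow> ('a \<Rightarrow> real) \<Rightarrow> ('i::finite \<Rightarrow> 'a \<Rightarrow> 'a::complex_vector) \<Rightarrow> ('i \<Rightarrow> complex) set"
  where "sp_B_plus V N T = {\<zeta>. \<not> (upper_semi_Browder V N (shift T \<zeta>) \<and>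
    has_direct_complement (power_topology V N) (range_tilde V (shift T \<zeta>)))}"

lemma sp_B_minus_eq: "sp_B_minus V N T = sigma_B_minus V T \<union> C_minus V N T"
  by (auto simp: sp_B_minus_def sigma_B_minus_def C_minus_def lower_semi_Browder_def)

lemma sp_B_plus_eq: "sp_B_plus V N T = sigma_B_plus V N T \<union> C_plus V N T"
  by (auto simp: sp_B_plus_def sigma_B_plus_def C_plus_def)

text \<open>The product of subsets of \<open>\<complex>\<^sup>n\<close> and \<open>\<complex>\<^sup>m\<close>, as a subset of \<open>\<complex>\<^sup>n\<^sup>+\<^sup>m\<close>.\<close>

definition spec_prod :: "('i \<Rightarrow> complex) set \<Rightarrow> ('j \<Rightarrow> complex) set \<Rightarrow> ('i + 'j \<Rightarrow> complex) set"
    (infixr "\<times>\<^sub>s" 80)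
  where "A \<times>\<^sub>s B = {case_sum \<zeta> \<xi> | \<zeta> \<xi>. \<zeta> \<in> A \<and> \<xi> \<in> B}"

section \<open>Operator ideals and multiplication operators\<close>

definition rank_one ::
    "'a::complex_vector \<Rightarrow> ('b \<Rightarrow> complex) \<Rightarrow> 'b \<Rightarrow> 'a"
  where "rank_one x\<^sub>1 x\<^sub>2' = (\<lambda>x\<^sub>2. scaleC (x\<^sub>2' x\<^sub>2) x\<^sub>1)"

definition operator_ideal ::
    "('b::complex_banach \<Rightarrow> 'a::complex_banach) set \<Rightarrow> (('b \<Rightarrow> 'a) \<Rightarrow> real) \<Rightarrow> bool"
  where "operator_ideal J \<alpha> \<longleftrightarrow>
    (\<forall>A\<in>J. bounded_clinear A) \<and> banach_on J \<alpha> \<and>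
    (\<forall>x\<^sub>1 x\<^sub>2'. bounded_clinear x\<^sub>2' \<longrightarrow>
      rank_one x\<^sub>1 x\<^sub>2' \<in> J \<and> \<alpha> (rank_one x\<^sub>1 x\<^sub>2') = norm x\<^sub>1 * onorm x\<^sub>2') \<and>
    (\<forall>A\<in>J. \<forall>S T. bounded_clinear S \<and> bounded_clinear T \<longrightarrow>
      S \<circ> A \<circ> T \<in> J \<and> \<alpha> (S \<circ> A \<circ> T) \<le> onorm S * \<alpha> A * onorm T)"

definition left_right_mult ::
    "('i \<Rightarrow> 'a \<Rightarrow> 'a) \<Rightarrow> ('j \<Rightarrow> 'b \<Rightarrow> 'b) \<Rightarrow> 'i + 'j \<Rightarrow> ('b \<Rightarrow> 'a) \<Rightarrow> 'b \<Rightarrow> 'a"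
  where "left_right_mult S T = case_sum (\<lambda>i A. S i \<circ> A) (\<lambda>j A. A \<circ> T j)"

end

theory Submission
  imports Defs
begin

text \<open>
  Finite codimension of \<open>R\<^sup>\<infinity>(T)\<close> means that the codimensions of \<open>M\<^sub>k(T)\<close> are bounded uniformly in
  \<open>k\<close>, and finite dimension of \<open>N\<^sup>\<infinity>(T)\<close> that the dimensions of the joint null spaces of the
  \<open>k\<close>-th powers are.  So everything reduces to single tuples, applied to the powers \<open>S\<^sub>i\<^sup>k\<close>, \<open>T\<^sub>j\<^sup>k\<close>
  with bounds that do not depend on \<open>k\<close>.

  For the left-hand inclusions, let \<open>\<phi>(z) = 1\<close> at an approximate null vector \<open>z\<close> of \<open>T\<close>.  Solving
  for the rank one operator \<open>x \<otimes> \<phi>\<close> modulo a finite-dimensional subspace of \<open>J\<close> and evaluating at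
  \<open>z\<close> solves for \<open>x\<close> in \<open>X\<^sub>1\<close> up to a small error, which the open mapping theorem absorbs; this
  bounds the codimension for \<open>S\<close> by that for \<open>(L\<^sub>S, R\<^sub>T)\<close>.  The other three cases are its variants
  and duals, with lower estimates modulo precompact seminorms in place of open mappings.

  For the right-hand inclusions, complements yield bounded \<open>C\<^sub>i\<close> and \<open>D\<^sub>j\<close> such that
  \<open>Q = 1 - \<Sum> S\<^sub>i C\<^sub>i\<close> and \<open>Q' = 1 - \<Sum> D\<^sub>j T\<^sub>j\<close> have finite rank.  Then \<open>(L\<^sub>S, R\<^sub>T)\<close> has a right
  inverse modulo \<open>A \<mapsto> Q A Q'\<close>, which has finite rank on \<open>J\<close> and vanishes if \<open>Q\<close> or \<open>Q'\<close> does.  In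
  Hilbert spaces all closed subspaces are complemented.
\<close>

section \<open>Norms on subspaces and finite powers\<close>

text \<open>The obstacle is uniformity in the power. Composing inverses of lower powers inverts
  higher powers modulo finite rank, but the rank of the residual grows with the exponent. These
  inverses are therefore used only to obtain a bounded generalised inverse for each power: its
  residual is a projection whose rank is the codimension of the range of the row, or the dimension
  of the kernel of the column, and those are bounded by hypothesis. Dually, the upper semi-Browder
  condition asks for closed range at the first power only. Closed range is traded for a lower
  estimate modulo a precompact term, which survives powers; Peetre's lemma then exchanges the
  precompact term for as many functionals as the kernel has dimensions. The recurring constants of
  the form \<open>1 / (2 * K)\<close> make an error term at most half of the quantity to be
  estimated, so that it can be absorbed.\<close>

instantiation prod :: (complex_vector, complex_vector) complex_vector
begin

definition scaleC_prod :: "complex \<Rightarrow> 'a \<times> 'b \<Rightarrow> 'a \<times> 'b"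
  where "scaleC_prod c x = (scaleC c (fst x), scaleC c (snd x))"

instance
  by standard (simp_all add: scaleC_prod_def prod_eq_iff scaleC_add_right scaleC_add_left
      scaleC_scaleC scaleC_one)

end

lemma scaleC_minus_one: "scaleC (- 1) x = - (x :: 'a::complex_vector)"
  by (simp add: cvec.scale_minus_left)

context
  fixes V :: "'a::complex_vector set" and N
  assumes norm_on: "norm_on V N"
begin

lemma norm_on_subspace: "csubspace V"
  and norm_on_nonneg: "x \<in> V \<Longrightarrow> 0 \<le> N x"
  and norm_on_eq_0: "x \<in> V \<Longrightarrow> N x = 0 \<longleftrightarrow> x = 0"
  and norm_on_triangle: "x \<in> V \<Longrightarrow> y \<in> V \<Longrightarrow> N (x + y) \<le> N x + N y"
  and norm_on_scale: "x \<in> V \<Longrightarrow> N (scaleC c x) = cmod c * N x"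
  using norm_on by (auto simp: norm_on_def)

lemma norm_on_zero_mem: "0 \<in> V"
  and norm_on_add_mem: "x \<in> V \<Longrightarrow> y \<in> V \<Longrightarrow> x + y \<in> V"
  and norm_on_diff_mem: "x \<in> V \<Longrightarrow> y \<in> V \<Longrightarrow> x - y \<in> V"
  and norm_on_scale_mem: "x \<in> V \<Longrightarrow> scaleC c x \<in> V"
  and norm_on_sum_mem: "(\<And>i. i \<in> A \<Longrightarrow> f i \<in> V) \<Longrightarrow> sum f A \<in> V"
  using norm_on_subspace
  by (auto intro: cvec.subspace_0 cvec.subspace_add cvec.subspace_diff cvec.subspace_scale
      cvec.subspace_sum)

lemma norm_on_zero: "N 0 = 0"
  using norm_on_eq_0[OF norm_on_zero_mem] by simp

lemma norm_on_minus: "x \<in> V \<Longrightarrow> N (- x) = N x"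
  using norm_on_scale[of x "- 1"] by (simp add: scaleC_minus_one)

lemma norm_on_diff_commute: "x \<in> V \<Longrightarrow> y \<in> V \<Longrightarrow> N (x - y) = N (y - x)"
  using norm_on_minus[OF norm_on_diff_mem, of x y] by simp

lemma norm_on_triangle_diff: "x \<in> V \<Longrightarrow> y \<in> V \<Longrightarrow> N (x - y) \<le> N x + N y"
  using norm_on_triangle[of x "- y"] norm_on_minus[of y] norm_on_diff_mem[OF norm_on_zero_mem, of y]
  by simp

lemma norm_on_triangle3:
  "x \<in> V \<Longrightarrow> y \<in> V \<Longrightarrow> z \<in> V \<Longrightarrow> N (x - z) \<le> N (x - y) + N (y - z)"
  using norm_on_triangle[OF norm_on_diff_mem norm_on_diff_mem, of x y y z] by simp

lemma norm_on_sum_le: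
  assumes "\<And>i. i \<in> A \<Longrightarrow> f i \<in> V"
  shows "N (sum f A) \<le> (\<Sum>i\<in>A. N (f i))"
  using assms
proof (induction A rule: infinite_finite_induct)
  case (insert a A)
  then have "N (sum f (insert a A)) \<le> N (f a) + N (sum f A)"
    by (simp add: norm_on_triangle norm_on_sum_mem)
  then show ?case
    using insert by force
qed (auto simp: norm_on_zero)

lemma norm_on_lim_unique:
  assumes s: "\<And>n. s n \<in> V" and "l \<in> V" "l' \<in> V"
    and l: "(\<lambda>n. N (s n - l)) \<longlonglongrightarrow> 0" and l': "(\<lambda>n. N (s n - l')) \<longlonglongrightarrow> 0"
  shows "l = l'"
proof -
  have "N (l - l') \<le> N (s n - l) + N (s n - l')" for n
    using norm_on_triangle3[of l "s n" l'] norm_on_diff_commute[of l "s n"] assms by simp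
  moreover have "(\<lambda>n. N (s n - l) + N (s n - l')) \<longlonglongrightarrow> 0"
    using tendsto_add[OF l l'] by simp
  ultimately have "N (l - l') \<le> 0"
    using LIMSEQ_le_const by blast
  then show ?thesis
    using norm_on_nonneg[of "l - l'"] norm_on_eq_0[of "l - l'"] norm_on_diff_mem[of l l'] assms
    by simp
qed

end

lemma norm_on_norm: "norm_on (UNIV :: 'a::complex_normed_vector set) norm"
  by (auto simp: norm_on_def norm_triangle_ineq norm_scaleC)

lemma norm_on_subset:
  "norm_on V N \<Longrightarrow> W \<subseteq> V \<Longrightarrow> csubspace W \<Longrightarrow> norm_on W N"
  by (auto simp: norm_on_def subset_iff)

section \<open>Limits, completeness and closedness in terms of sequences\<close>

lemma limitin_norm_dist:
  assumes "norm_on V N" "range s \<subseteq> V"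
  shows "limitin (Metric_space.mtopology V (norm_dist V N)) s l sequentially \<longleftrightarrow>
    l \<in> V \<and> (\<lambda>n. N (s n - l)) \<longlonglongrightarrow> 0"
proof -
  interpret Metric_space V "norm_dist V N"
    by (rule Metric_space_norm_dist) fact
  have "norm_dist V N (s n) l = N (s n - l)" if "l \<in> V" for n
    using that assms(2) by (auto simp: norm_dist_def)
  then show ?thesis
    unfolding limitin_metric_dist_null using assms(2) by (auto simp: range_subsetD)
qed

text \<open>Asked of an arbitrary real function instead of a metric, so that it also covers
  seminorms with a nontrivial null space.\<close>

definition cauchy_on :: "('a::ab_group_add \<Rightarrow> real) \<Rightarrow> (nat \<Rightarrow> 'a) \<Rightarrow> bool"
  where "cauchy_on N s \<longleftrightarrow> (\<forall>e>0. \<exists>M. \<forall>m\<ge>M. \<forall>n\<ge>M. N (s m - s n) < e)"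

lemma banach_on_iff_seq:
  "banach_on V N \<longleftrightarrow> norm_on V N \<and>
    (\<forall>s. (\<forall>n. s n \<in> V) \<longrightarrow> cauchy_on N s \<longrightarrow> (\<exists>l\<in>V. (\<lambda>n. N (s n - l)) \<longlonglongrightarrow> 0))"
proof (cases "norm_on V N")
  case True
  interpret Metric_space V "norm_dist V N"
    by (rule Metric_space_norm_dist) fact
  have "MCauchy s \<longleftrightarrow> range s \<subseteq> V \<and> cauchy_on N s" for s
  proof (cases "range s \<subseteq> V")
    case True
    then have "s n \<in> V" for n
      by blast
    then show ?thesis
      using True by (simp add: MCauchy_def cauchy_on_def norm_dist_def)
  qed (simp add: MCauchy_def)
  moreover have "(\<exists>x. limitin mtopology s x sequentially) \<longleftrightarrow>
      (\<exists>l\<in>V. (\<lambda>n. N (s n - l)) \<longlonglongrightarrow> 0)" if "range s \<subseteq> V" for s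
    unfolding limitin_norm_dist[OF True that] by blast
  ultimately have "mcomplete \<longleftrightarrow> (\<forall>s. range s \<subseteq> V \<and> cauchy_on N s \<longrightarrow>
      (\<exists>l\<in>V. (\<lambda>n. N (s n - l)) \<longlonglongrightarrow> 0))"
    unfolding mcomplete_def by presburger
  then show ?thesis
    unfolding banach_on_def using True by (simp add: image_subset_iff imp_conjL)
qed (auto simp: banach_on_def)

lemma cauchy_on_mono:
  assumes "cauchy_on M t" "\<And>m n. N (s m - s n) \<le> M (t m - t n)"
  shows "cauchy_on N s"
  unfolding cauchy_on_def
proof (intro allI impI)
  fix e :: real assume "e > 0"
  then obtain K where "\<forall>m\<ge>K. \<forall>n\<ge>K. M (t m - t n) < e"
    using assms(1) unfolding cauchy_on_def by blast
  then show "\<exists>K. \<forall>m\<ge>K. \<forall>n\<ge>K. N (s m - s n) < e"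
    using assms(2) by (meson le_less_trans)
qed

lemma norm_dist_eq: "x \<in> V \<Longrightarrow> y \<in> V \<Longrightarrow> norm_dist V N x y = N (x - y)"
  by (simp add: norm_dist_def)

lemma banach_on_norm_on: "banach_on V N \<Longrightarrow> norm_on V N"
  by (simp add: banach_on_def)

lemma banach_onD:
  assumes "banach_on V N" "\<And>n. s n \<in> V" "cauchy_on N s"
  obtains l where "l \<in> V" "(\<lambda>n. N (s n - l)) \<longlonglongrightarrow> 0"
proof -
  have "\<exists>l\<in>V. (\<lambda>n. N (s n - l)) \<longlonglongrightarrow> 0"
    using assms(1)[unfolded banach_on_iff_seq, THEN conjunct2, rule_format, of s] assms(2,3)
    by simp
  then show ?thesis
    using that by blast
qed

lemma cauchy_on_norm_iff: "cauchy_on norm s \<longleftrightarrow> Cauchy s"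
  for s :: "nat \<Rightarrow> 'a::real_normed_vector"
  by (auto simp: cauchy_on_def Cauchy_def dist_norm)

lemma banach_on_norm: "banach_on (UNIV :: 'a::complex_banach set) norm"
  unfolding banach_on_iff_seq cauchy_on_norm_iff
proof (intro conjI allI impI norm_on_norm)
  fix s :: "nat \<Rightarrow> 'a" assume "Cauchy s"
  then obtain l where "s \<longlonglongrightarrow> l"
    unfolding Cauchy_convergent_iff convergent_def by blast
  then show "\<exists>l\<in>UNIV. (\<lambda>n. norm (s n - l)) \<longlonglongrightarrow> 0"
    using tendsto_norm_zero[OF LIM_zero] by blast
qed

definition closed_on :: "'a::ab_group_add set \<Rightarrow> ('a \<Rightarrow> real) \<Rightarrow> 'a set \<Rightarrow> bool"
  where "closed_on V N C \<longleftrightarrow> C \<subseteq> V \<and>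
    (\<forall>s l. (\<forall>n. s n \<in> C) \<and> l \<in> V \<and> (\<lambda>n. N (s n - l)) \<longlonglongrightarrow> 0 \<longrightarrow> l \<in> C)"

lemma closedin_norm_dist_iff:
  assumes "norm_on V N"
  shows "closedin (Metric_space.mtopology V (norm_dist V N)) C \<longleftrightarrow> closed_on V N C"
proof -
  interpret Metric_space V "norm_dist V N"
    by (rule Metric_space_norm_dist) fact
  show ?thesis
    unfolding metric_closedin_iff_sequentially_closed closed_on_def
  proof (intro conj_cong refl iff_allI)
    fix s l assume "C \<subseteq> V"
    show "(range s \<subseteq> C \<and> limitin mtopology s l sequentially \<longrightarrow> l \<in> C) \<longleftrightarrow>
      ((\<forall>n. s n \<in> C) \<and> l \<in> V \<and> (\<lambda>n. N (s n - l)) \<longlonglongrightarrow> 0 \<longrightarrow> l \<in> C)"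
    proof (cases "range s \<subseteq> C")
      case True
      then have "range s \<subseteq> V"
        using \<open>C \<subseteq> V\<close> by blast
      then show ?thesis
        using True limitin_norm_dist[OF assms] by (simp add: image_subset_iff)
    qed auto
  qed
qed

lemma banach_on_closed:
  assumes V: "banach_on V N" and C: "closed_on V N C" "csubspace C"
  shows "banach_on C N"
  unfolding banach_on_iff_seq
proof (intro conjI allI impI)
  have sub: "C \<subseteq> V"
    using C by (simp add: closed_on_def)
  then show "norm_on C N"
    using norm_on_subset banach_on_norm_on[OF V] C(2) by blast
  fix s assume s: "\<forall>n. s n \<in> C" "cauchy_on N s"
  obtain l where "l \<in> V" "(\<lambda>n. N (s n - l)) \<longlonglongrightarrow> 0"
    using banach_onD[OF V _ s(2)] s(1) sub by blast
  then show "\<exists>l\<in>C. (\<lambda>n. N (s n - l)) \<longlonglongrightarrow> 0"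
    using C(1) s(1) unfolding closed_on_def by blast
qed

lemma cauchy_onI_lim:
  assumes "norm_on V N" "\<And>n. s n \<in> V" "l \<in> V" "(\<lambda>n. N (s n - l)) \<longlonglongrightarrow> 0"
  shows "cauchy_on N s"
  unfolding cauchy_on_def
proof (intro allI impI)
  fix e :: real assume "e > 0"
  then obtain M where M: "\<And>n. n \<ge> M \<Longrightarrow> N (s n - l) < e / 2"
    using order_tendstoD(2)[OF assms(4), of "e / 2"] by (auto simp: eventually_sequentially)
  show "\<exists>M. \<forall>m\<ge>M. \<forall>n\<ge>M. N (s m - s n) < e"
  proof (intro exI allI impI)
    fix m n assume "M \<le> m" "M \<le> n"
    then show "N (s m - s n) < e"
      using norm_on_triangle3[OF assms(1), of "s m" l "s n"] M[of m] M[of n] assms(2,3)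
        norm_on_diff_commute[OF assms(1), of l "s n"] by simp
  qed
qed

text \<open>Coordinates outside \<open>I\<close> are fixed to 0, so that the sum norm over
  \<open>I\<close> separates points. With \<open>I = UNIV\<close> this is the power of the space;
  with a finite set of vectors as \<open>I\<close> and complex entries it is the space of
  coefficients of their linear combinations.\<close>

definition PiC :: "'i set \<Rightarrow> 'a::zero set \<Rightarrow> ('i \<Rightarrow> 'a) set"
  where "PiC I V = {x. (\<forall>i\<in>I. x i \<in> V) \<and> (\<forall>i. i \<notin> I \<longrightarrow> x i = 0)}"

definition pn :: "'i set \<Rightarrow> ('a \<Rightarrow> real) \<Rightarrow> ('i \<Rightarrow> 'a) \<Rightarrow> real"
  where "pn I N x = (\<Sum>i\<in>I. N (x i))"

lemma PiC_UNIV: "PiC UNIV V = {x. \<forall>i. x i \<in> V}"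
  by (simp add: PiC_def)

lemma PiC_UNIV_UNIV [simp]: "PiC UNIV UNIV = UNIV"
  by (simp add: PiC_def)

lemma csubspace_PiC:
  assumes "csubspace V"
  shows "csubspace (PiC I V)"
  unfolding PiC_def
  by (rule cvec.subspaceI)
    (auto simp: scaleC_fun_def cvec.subspace_0[OF assms] cvec.subspace_add[OF assms]
      cvec.subspace_scale[OF assms])

lemma norm_on_PiC:
  assumes N: "norm_on V N" and "finite I"
  shows "norm_on (PiC I V) (pn I N)"
  unfolding norm_on_def
proof (intro conjI ballI allI)
  show "csubspace (PiC I V)"
    by (rule csubspace_PiC[OF norm_on_subspace[OF N]])
  fix x :: "'b \<Rightarrow> 'a" assume x: "x \<in> PiC I V"
  show "0 \<le> pn I N x"
    using x by (auto simp: pn_def PiC_def intro!: sum_nonneg norm_on_nonneg[OF N])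
  have "pn I N x = 0 \<longleftrightarrow> (\<forall>i\<in>I. N (x i) = 0)"
    unfolding pn_def using x norm_on_nonneg[OF N]
    by (intro sum_nonneg_eq_0_iff[OF assms(2)]) (auto simp: PiC_def)
  also have "\<dots> \<longleftrightarrow> x = 0"
    using x norm_on_eq_0[OF N] by (auto simp: PiC_def fun_eq_iff)
  finally show "pn I N x = 0 \<longleftrightarrow> x = 0" .
  show "pn I N (scaleC c x) = cmod c * pn I N x" for c
    using x by (auto simp: pn_def PiC_def scaleC_fun_def norm_on_scale[OF N] sum_distrib_left
        intro!: sum.cong)
  fix y assume "y \<in> PiC I V"
  then show "pn I N (x + y) \<le> pn I N x + pn I N y"
    using x by (auto simp: pn_def PiC_def sum.distrib[symmetric]
        intro!: sum_mono norm_on_triangle[OF N])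
qed

lemma pn_component_le:
  assumes "norm_on V N" "finite I" "x \<in> PiC I V" "i \<in> I"
  shows "N (x i) \<le> pn I N x"
  unfolding pn_def
  using assms by (intro member_le_sum) (auto simp: PiC_def intro: norm_on_nonneg)

lemma pn_tendsto_iff:
  assumes N: "norm_on V N" and "finite I" and s: "\<And>n. s n \<in> PiC I V" and l: "l \<in> PiC I V"
  shows "(\<lambda>n. pn I N (s n - l)) \<longlonglongrightarrow> 0 \<longleftrightarrow> (\<forall>i\<in>I. (\<lambda>n. N (s n i - l i)) \<longlonglongrightarrow> 0)"
    (is "?L \<longleftrightarrow> ?R")
proof
  have d: "s n - l \<in> PiC I V" for n
    by (rule norm_on_diff_mem[OF norm_on_PiC[OF assms(1,2)] s l])
  assume ?L
  show ?R
  proof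
    fix i assume i: "i \<in> I"
    show "(\<lambda>n. N (s n i - l i)) \<longlonglongrightarrow> 0"
    proof (rule tendsto_sandwich[OF _ _ tendsto_const \<open>?L\<close>])
      show "\<forall>\<^sub>F n in sequentially. 0 \<le> N (s n i - l i)"
        using d i by (intro always_eventually allI norm_on_nonneg[OF N]) (auto simp: PiC_def)
      show "\<forall>\<^sub>F n in sequentially. N (s n i - l i) \<le> pn I N (s n - l)"
        using pn_component_le[OF assms(1,2) d i] by (intro always_eventually) auto
    qed
  qed
next
  assume ?R
  then have "(\<lambda>n. \<Sum>i\<in>I. N (s n i - l i)) \<longlonglongrightarrow> (\<Sum>i\<in>I. 0)"
    by (intro tendsto_sum) auto
  then show ?L
    by (simp add: pn_def)
qed

lemma banach_on_PiC:
  assumes V: "banach_on V N" and "finite I"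
  shows "banach_on (PiC I V) (pn I N)"
  unfolding banach_on_iff_seq
proof (intro conjI allI impI)
  note N = banach_on_norm_on[OF V]
  show nn: "norm_on (PiC I V) (pn I N)"
    by (rule norm_on_PiC[OF N assms(2)])
  fix s :: "nat \<Rightarrow> 'b \<Rightarrow> 'a" assume s: "\<forall>n. s n \<in> PiC I V" and c: "cauchy_on (pn I N) s"
  have "\<exists>l\<in>V. (\<lambda>n. N (s n i - l)) \<longlonglongrightarrow> 0" if i: "i \<in> I" for i
  proof -
    have "s m - s n \<in> PiC I V" for m n
      using norm_on_diff_mem[OF nn] s by blast
    from pn_component_le[OF N assms(2) this i]
    have "cauchy_on N (\<lambda>n. s n i)"
      by (intro cauchy_on_mono[OF c]) simp
    moreover have "s n i \<in> V" for n
      using s i by (auto simp: PiC_def)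
    ultimately show ?thesis
      using banach_onD[OF V] by metis
  qed
  then obtain l where l: "\<And>i. i \<in> I \<Longrightarrow> l i \<in> V \<and> (\<lambda>n. N (s n i - l i)) \<longlonglongrightarrow> 0"
    by metis
  define l' where "l' = (\<lambda>i. if i \<in> I then l i else 0)"
  have l': "l' \<in> PiC I V"
    using l by (auto simp: l'_def PiC_def)
  moreover have "(\<lambda>n. pn I N (s n - l')) \<longlonglongrightarrow> 0"
    using pn_tendsto_iff[OF N assms(2) _ l', of s] s l by (simp add: l'_def)
  ultimately show "\<exists>l\<in>PiC I V. (\<lambda>n. pn I N (s n - l)) \<longlonglongrightarrow> 0"
    by blast
qed

lemma power_topology_eq:
  assumes N: "norm_on V N"
  shows "(power_topology V N :: ('i::finite \<Rightarrow> 'a::complex_vector) topology) =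
    Metric_space.mtopology (PiC UNIV V) (norm_dist (PiC UNIV V) (pn UNIV N))"
proof -
  note NP = norm_on_PiC[OF N finite, of UNIV]
  interpret A: Metric_space V "norm_dist V N"
    by (rule Metric_space_norm_dist) fact
  interpret B: Metric_space "PiC UNIV V :: ('i \<Rightarrow> 'a) set" "norm_dist (PiC UNIV V) (pn UNIV N)"
    by (rule Metric_space_norm_dist) fact
  have *: "openin B.mtopology S" if S: "openin (power_topology V N) S" for S :: "('i \<Rightarrow> 'a) set"
      unfolding B.openin_mtopology
    proof (intro conjI ballI allI impI)
      have "S \<subseteq> Pi\<^sub>E UNIV (\<lambda>_. V)"
        using openin_subset[OF S] by (simp add: power_topology_def)
      then show "S \<subseteq> PiC UNIV V"
        by (auto simp: PiC_def)
      fix x assume x: "x \<in> S"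
      then have "\<exists>U. finite {i \<in> UNIV. U i \<noteq> topspace A.mtopology} \<and>
          (\<forall>i\<in>UNIV. openin A.mtopology (U i)) \<and> x \<in> Pi\<^sub>E UNIV U \<and> Pi\<^sub>E UNIV U \<subseteq> S"
        using S unfolding power_topology_def openin_product_topology_alt by blast
      then obtain U where U: "\<And>i. openin A.mtopology (U i)" "\<And>i. x i \<in> U i" "Pi\<^sub>E UNIV U \<subseteq> S"
        by (auto simp: PiE_iff)
      then have "\<forall>i. \<exists>r>0. A.mball (x i) r \<subseteq> U i"
        unfolding A.openin_mtopology by blast
      then obtain r where r: "\<And>i. r i > 0" "\<And>i. A.mball (x i) (r i) \<subseteq> U i"
        by metis
      show "\<exists>r>0. B.mball x r \<subseteq> S"
      proof (intro exI conjI)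
        show "Min (range r) > 0"
          using r by simp
        show "B.mball x (Min (range r)) \<subseteq> S"
        proof
          fix y assume y: "y \<in> B.mball x (Min (range r))"
          then have xy: "x \<in> PiC UNIV V" "y \<in> PiC UNIV V"
            by (auto simp: B.mball_def)
          have "N (x i - y i) < r i" for i
          proof -
            have "N ((x - y) i) \<le> pn UNIV N (x - y)"
              by (rule pn_component_le[OF N finite norm_on_diff_mem[OF NP xy]]) simp
            also have "\<dots> < Min (range r)"
              using y by (simp only: B.in_mball norm_dist_eq[OF xy])
            also have "\<dots> \<le> r i"
              by simp
            finally show ?thesis
              by simp
          qed
          moreover have "x i \<in> V" "y i \<in> V" for i
            using xy by (auto simp: PiC_def)
          ultimately have "y i \<in> A.mball (x i) (r i)" for i
            by (simp add: norm_dist_eq)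
          then show "y \<in> S"
            using r(2) U(3) by (auto simp: PiE_iff subset_iff)
        qed
      qed
    qed
  have **: "openin (power_topology V N) S" if S: "openin B.mtopology S" for S :: "('i \<Rightarrow> 'a) set"
      unfolding power_topology_def openin_product_topology_alt
    proof (intro ballI)
      fix x assume x: "x \<in> S"
      then obtain r where r: "r > 0" "B.mball x r \<subseteq> S"
        using S unfolding B.openin_mtopology by blast
      have xV: "x i \<in> V" for i
        using x openin_subset[OF S] unfolding B.topspace_mtopology by (auto simp: PiC_def)
      \<comment> \<open>As many errors \<open>d\<close> as there are coordinates add up to less than
        \<open>r\<close>; the summand 1 makes this strict.\<close>
      define d where "d = r / (real CARD('i) + 1)"
      have d: "d > 0" "real CARD('i) * d < r"
        using r by (auto simp: d_def field_simps)
      show "\<exists>U. finite {i \<in> UNIV. U i \<noteq> topspace A.mtopology} \<and>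
          (\<forall>i\<in>UNIV. openin A.mtopology (U i)) \<and> x \<in> Pi\<^sub>E UNIV U \<and> Pi\<^sub>E UNIV U \<subseteq> S"
      proof (intro exI conjI ballI)
        show "x \<in> Pi\<^sub>E UNIV (\<lambda>i. A.mball (x i) d)"
          using d xV by (auto simp: PiE_iff)
        show "Pi\<^sub>E UNIV (\<lambda>i. A.mball (x i) d) \<subseteq> S"
        proof
          fix y assume y: "y \<in> Pi\<^sub>E UNIV (\<lambda>i. A.mball (x i) d)"
          then have "y i \<in> V \<and> N (x i - y i) < d" for i
            using xV by (simp add: PiE_iff) (metis norm_dist_eq)
          then have "\<And>i. y i \<in> V" "\<And>i. N (x i - y i) \<le> d"
            by (auto simp: less_imp_le)
          then have "y \<in> PiC UNIV V" "pn UNIV N (x - y) \<le> (\<Sum>i\<in>(UNIV::'i set). d)"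
            unfolding pn_def by (auto simp: PiC_def intro!: sum_mono simp del: sum_constant)
          moreover have "x \<in> PiC UNIV V"
            using xV by (simp add: PiC_def)
          ultimately have "y \<in> B.mball x r"
            using d by (simp add: norm_dist_eq B.in_mball)
          then show "y \<in> S"
            using r by blast
        qed
      qed auto
    qed
  show ?thesis
  proof (rule topology_eq[THEN iffD2], rule allI, rule iffI)
    show "openin B.mtopology S" if "openin (power_topology V N) S" for S
      by (rule *[OF that])
    show "openin (power_topology V N) S" if "openin B.mtopology S" for S
      by (rule **[OF that])
  qed
qed

lemma closedin_power_topology_iff:
  fixes C :: "('i::finite \<Rightarrow> 'a::complex_vector) set"
  assumes "norm_on V N"
  shows "closedin (power_topology V N) C \<longleftrightarrow> closed_on (PiC UNIV V) (pn UNIV N) C"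
  unfolding power_topology_eq[OF assms]
  by (rule closedin_norm_dist_iff[OF norm_on_PiC[OF assms finite]])

lemma topspace_power_topology:
  assumes "norm_on V N"
  shows "topspace (power_topology V N) = (PiC UNIV V :: ('i::finite \<Rightarrow> 'a::complex_vector) set)"
proof -
  interpret Metric_space V "norm_dist V N"
    by (rule Metric_space_norm_dist) fact
  show ?thesis
    by (auto simp: power_topology_def PiC_def PiE_iff)
qed

lemma banach_on_prod:
  assumes V: "banach_on V N" and W: "banach_on W M"
  shows "banach_on (V \<times> W) (\<lambda>x. N (fst x) + M (snd x))"
  unfolding banach_on_iff_seq
proof (intro conjI allI impI)
  note N = banach_on_norm_on[OF V] and M = banach_on_norm_on[OF W]
  show "norm_on (V \<times> W) (\<lambda>x. N (fst x) + M (snd x))"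
    unfolding norm_on_def
  proof (intro conjI ballI allI)
    show "csubspace (V \<times> W)"
      by (rule cvec.subspaceI)
        (auto simp: zero_prod_def scaleC_prod_def norm_on_zero_mem[OF N] norm_on_zero_mem[OF M]
          norm_on_add_mem[OF N] norm_on_add_mem[OF M] norm_on_scale_mem[OF N] norm_on_scale_mem[OF M])
    fix x assume x: "x \<in> V \<times> W"
    then have nn: "0 \<le> N (fst x)" "0 \<le> M (snd x)"
      by (auto intro: norm_on_nonneg[OF N] norm_on_nonneg[OF M])
    then show "0 \<le> N (fst x) + M (snd x)"
      by simp
    show "N (fst x) + M (snd x) = 0 \<longleftrightarrow> x = 0"
      using nn x norm_on_eq_0[OF N] norm_on_eq_0[OF M]
      by (auto simp: add_nonneg_eq_0_iff zero_prod_def)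
    show "N (fst (scaleC c x)) + M (snd (scaleC c x)) = cmod c * (N (fst x) + M (snd x))" for c
      using x by (auto simp: scaleC_prod_def norm_on_scale[OF N] norm_on_scale[OF M] algebra_simps)
    fix y assume "y \<in> V \<times> W"
    then have "N (fst x + fst y) \<le> N (fst x) + N (fst y)" "M (snd x + snd y) \<le> M (snd x) + M (snd y)"
      using x by (auto intro: norm_on_triangle[OF N] norm_on_triangle[OF M])
    then show "N (fst (x + y)) + M (snd (x + y)) \<le> N (fst x) + M (snd x) + (N (fst y) + M (snd y))"
      by simp
  qed
  fix s assume s: "\<forall>n. s n \<in> V \<times> W" and c: "cauchy_on (\<lambda>x. N (fst x) + M (snd x)) s"
  have sV: "\<And>n. fst (s n) \<in> V" and sW: "\<And>n. snd (s n) \<in> W"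
    using s by (auto simp: mem_Times_iff)
  have nn: "0 \<le> N (fst (s m) - fst (s n))" "0 \<le> M (snd (s m) - snd (s n))" for m n
    using norm_on_nonneg[OF N norm_on_diff_mem[OF N sV sV]]
      norm_on_nonneg[OF M norm_on_diff_mem[OF M sW sW]] by auto
  have cs: "cauchy_on N (\<lambda>n. fst (s n))" "cauchy_on M (\<lambda>n. snd (s n))"
    using nn by (auto intro!: cauchy_on_mono[OF c])
  obtain l where l: "l \<in> V" "(\<lambda>n. N (fst (s n) - l)) \<longlonglongrightarrow> 0"
    by (rule banach_onD[OF V sV cs(1)])
  obtain l' where l': "l' \<in> W" "(\<lambda>n. M (snd (s n) - l')) \<longlonglongrightarrow> 0"
    by (rule banach_onD[OF W sW cs(2)])
  have "(\<lambda>n. N (fst (s n - (l, l'))) + M (snd (s n - (l, l')))) \<longlonglongrightarrow> 0"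
    using tendsto_add[OF l(2) l'(2)] by simp
  then show "\<exists>l\<in>V \<times> W. (\<lambda>n. N (fst (s n - l)) + M (snd (s n - l))) \<longlonglongrightarrow> 0"
    using l(1) l'(1) by (intro bexI[of _ "(l, l')"]) auto
qed

lemma tendsto_0_le_seq:
  fixes f g :: "nat \<Rightarrow> real"
  assumes "g \<longlonglongrightarrow> 0" "\<And>n. 0 \<le> f n" "\<And>n. f n \<le> g n"
  shows "f \<longlonglongrightarrow> 0"
  by (rule tendsto_sandwich[OF _ _ tendsto_const assms(1)]) (simp_all add: assms(2,3))

section \<open>Bounded operators and open mappings\<close>

text \<open>Everything is required on the carriers only, because norms such as that of an operator
  ideal, and maps such as the inverses built with \<open>inv_into\<close>, are controlled only
  there.\<close>

definition blin :: "'a::complex_vector set \<Rightarrow> ('a \<Rightarrow> real) \<Rightarrow> 'b::complex_vector set \<Rightarrow> ('b \<Rightarrow> real)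
    \<Rightarrow> ('a \<Rightarrow> 'b) \<Rightarrow> bool"
  where "blin V N W M f \<longleftrightarrow> (\<forall>x\<in>V. f x \<in> W) \<and> (\<forall>x\<in>V. \<forall>y\<in>V. f (x + y) = f x + f y) \<and>
    (\<forall>c. \<forall>x\<in>V. f (scaleC c x) = scaleC c (f x)) \<and> (\<exists>K. \<forall>x\<in>V. M (f x) \<le> K * N x)"

lemma blinI:
  assumes "\<And>x. x \<in> V \<Longrightarrow> f x \<in> W" "\<And>x y. x \<in> V \<Longrightarrow> y \<in> V \<Longrightarrow> f (x + y) = f x + f y"
    "\<And>c x. x \<in> V \<Longrightarrow> f (scaleC c x) = scaleC c (f x)" "\<And>x. x \<in> V \<Longrightarrow> M (f x) \<le> K * N x"
  shows "blin V N W M f"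
  using assms unfolding blin_def by blast

lemma blin_mem: "blin V N W M f \<Longrightarrow> x \<in> V \<Longrightarrow> f x \<in> W"
  and blin_add: "blin V N W M f \<Longrightarrow> x \<in> V \<Longrightarrow> y \<in> V \<Longrightarrow> f (x + y) = f x + f y"
  and blin_scale: "blin V N W M f \<Longrightarrow> x \<in> V \<Longrightarrow> f (scaleC c x) = scaleC c (f x)"
  by (simp_all add: blin_def)

lemma blin_zero: "norm_on V N \<Longrightarrow> blin V N W M f \<Longrightarrow> f 0 = 0"
  using blin_scale[of V N W M f 0 0] norm_on_zero_mem[of V N] by simp

lemma blin_diff:
  assumes "norm_on V N" "blin V N W M f" "x \<in> V" "y \<in> V"
  shows "f (x - y) = f x - f y"
  using blin_add[OF assms(2) norm_on_diff_mem[OF assms(1,3,4)] assms(4)] by (simp add: algebra_simps)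

lemma blin_sum:
  assumes "norm_on V N" "blin V N W M f" "\<And>i. i \<in> A \<Longrightarrow> g i \<in> V"
  shows "f (\<Sum>i\<in>A. g i) = (\<Sum>i\<in>A. f (g i))"
  using assms(3)
  by (induction A rule: infinite_finite_induct)
    (simp_all add: blin_zero[OF assms(1,2)] blin_add[OF assms(2)] norm_on_sum_mem[OF assms(1)])

lemma blin_bound:
  assumes "norm_on V N" "blin V N W M f"
  obtains K where "K > 0" "\<And>x. x \<in> V \<Longrightarrow> M (f x) \<le> K * N x"
proof -
  obtain K where K: "\<forall>x\<in>V. M (f x) \<le> K * N x"
    using assms(2) unfolding blin_def by blast
  have "M (f x) \<le> (\<bar>K\<bar> + 1) * N x" if "x \<in> V" for x
  proof -
    have "M (f x) \<le> K * N x"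
      using K that by blast
    also have "\<dots> \<le> (\<bar>K\<bar> + 1) * N x"
      by (rule mult_right_mono) (auto simp: norm_on_nonneg[OF assms(1) that])
    finally show ?thesis .
  qed
  then show ?thesis
    using that[of "\<bar>K\<bar> + 1"] by simp
qed

lemma blin_comp:
  assumes f: "blin V N W M f" and g: "blin W M Z L g" and M: "norm_on W M"
  shows "blin V N Z L (\<lambda>x. g (f x))"
proof -
  obtain K where K: "\<forall>x\<in>V. M (f x) \<le> K * N x"
    using f unfolding blin_def by blast
  obtain K' where K': "K' > 0" "\<And>x. x \<in> W \<Longrightarrow> L (g x) \<le> K' * M x"
    using blin_bound[OF M g] by blast
  show ?thesis
  proof (rule blinI[where K = "K' * K"])
    fix x assume x: "x \<in> V"
    have "L (g (f x)) \<le> K' * M (f x)"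
      by (rule K'(2)[OF blin_mem[OF f x]])
    also have "\<dots> \<le> K' * (K * N x)"
      using K x K'(1) by (intro mult_left_mono) auto
    finally show "L (g (f x)) \<le> K' * K * N x"
      by simp
  qed (auto simp: blin_mem[OF f] blin_add[OF f] blin_scale[OF f]
      blin_mem[OF g] blin_add[OF g] blin_scale[OF g])
qed

lemma blin_id: "blin V N V N (\<lambda>x. x)"
  by (rule blinI[where K = 1]) auto

lemma blin_zero_map: "norm_on W M \<Longrightarrow> blin V N W M (\<lambda>x. 0)"
  by (rule blinI[where K = 0]) (auto simp: norm_on_zero_mem norm_on_zero)

lemma blin_add_map:
  assumes f: "blin V N W M f" and g: "blin V N W M g" and M: "norm_on W M"
  shows "blin V N W M (\<lambda>x. f x + g x)"
proof -
  obtain K K' where K: "\<forall>x\<in>V. M (f x) \<le> K * N x" and K': "\<forall>x\<in>V. M (g x) \<le> K' * N x"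
    using f g unfolding blin_def by blast
  show ?thesis
  proof (rule blinI[where K = "K + K'"])
    fix x assume x: "x \<in> V"
    have "M (f x + g x) \<le> M (f x) + M (g x)"
      by (rule norm_on_triangle[OF M blin_mem[OF f x] blin_mem[OF g x]])
    then show "M (f x + g x) \<le> (K + K') * N x"
      using K K' x by (fastforce simp: algebra_simps)
  qed (auto simp: blin_mem[OF f] blin_add[OF f] blin_scale[OF f] scaleC_add_right
      blin_mem[OF g] blin_add[OF g] blin_scale[OF g] norm_on_add_mem[OF M])
qed

lemma blin_scale_map:
  assumes f: "blin V N W M f" and M: "norm_on W M"
  shows "blin V N W M (\<lambda>x. scaleC c (f x))"
proof -
  obtain K where K: "\<forall>x\<in>V. M (f x) \<le> K * N x"
    using f unfolding blin_def by blast
  show ?thesis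
  proof (rule blinI[where K = "cmod c * K"])
    fix x assume x: "x \<in> V"
    then show "M (scaleC c (f x)) \<le> cmod c * K * N x"
      using K x by (simp add: norm_on_scale[OF M blin_mem[OF f x]] mult_left_mono mult.assoc)
  qed (auto simp: blin_mem[OF f] blin_add[OF f] blin_scale[OF f] scaleC_add_right
      norm_on_scale_mem[OF M] scaleC_scaleC mult.commute)
qed

lemma blin_diff_map:
  assumes f: "blin V N W M f" and g: "blin V N W M g" and M: "norm_on W M"
  shows "blin V N W M (\<lambda>x. f x - g x)"
  using blin_add_map[OF f blin_scale_map[OF g M, of "- 1"] M] by (simp add: scaleC_minus_one)

lemma blin_sum_map:
  assumes "\<And>i. i \<in> A \<Longrightarrow> blin V N W M (f i)" and M: "norm_on W M"
  shows "blin V N W M (\<lambda>x. \<Sum>i\<in>A. f i x)"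
  using assms(1)
  by (induction A rule: infinite_finite_induct)
    (simp_all add: blin_zero_map[OF M] blin_add_map[OF _ _ M])

lemma blin_functional_scale:
  assumes f: "blin V N UNIV norm (f :: _ \<Rightarrow> complex)" and M: "norm_on W M" and w: "w \<in> W"
  shows "blin V N W M (\<lambda>x. scaleC (f x) w)"
proof -
  obtain K where K: "\<forall>x\<in>V. norm (f x) \<le> K * N x"
    using f unfolding blin_def by blast
  show ?thesis
  proof (rule blinI[where K = "K * M w"])
    fix x assume x: "x \<in> V"
    then show "M (scaleC (f x) w) \<le> K * M w * N x"
      using mult_right_mono[OF K[rule_format, OF x] norm_on_nonneg[OF M w]]
      by (simp add: norm_on_scale[OF M w] mult_ac)
  qed (auto simp: blin_add[OF f] blin_scale[OF f] scaleC_add_left w scaleC_complex_def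
      norm_on_scale_mem[OF M] scaleC_scaleC)
qed

lemma blin_lim:
  assumes N: "norm_on V N" and M: "norm_on W M" and f: "blin V N W M f"
    and s: "\<And>n. s n \<in> V" "l \<in> V" "(\<lambda>n. N (s n - l)) \<longlonglongrightarrow> 0"
  shows "(\<lambda>n. M (f (s n) - f l)) \<longlonglongrightarrow> 0"
proof -
  obtain K where K: "K > 0" "\<And>x. x \<in> V \<Longrightarrow> M (f x) \<le> K * N x"
    using blin_bound[OF N f] by blast
  have 1: "M (f (s n) - f l) \<le> K * N (s n - l)" for n
    using K(2)[OF norm_on_diff_mem[OF N s(1)[of n] s(2)]] blin_diff[OF N f s(1)[of n] s(2)] by simp
  have 2: "0 \<le> M (f (s n) - f l)" for n
    by (intro norm_on_nonneg[OF M] norm_on_diff_mem[OF M] blin_mem[OF f] s)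
  have "(\<lambda>n. K * N (s n - l)) \<longlonglongrightarrow> 0"
    using tendsto_mult_left[OF s(3), of K] by simp
  then show ?thesis
    using 2 1 by (rule tendsto_0_le_seq)
qed

lemma closed_on_eq_blin:
  assumes N: "norm_on V N" and M: "norm_on W M" and f: "blin V N W M f" and g: "blin V N W M g"
  shows "closed_on V N {x \<in> V. f x = g x}"
  unfolding closed_on_def
proof (intro conjI allI impI)
  fix s l assume a: "(\<forall>n. s n \<in> {x \<in> V. f x = g x}) \<and> l \<in> V \<and> (\<lambda>n. N (s n - l)) \<longlonglongrightarrow> 0"
  then have s: "\<And>n. s n \<in> V" "l \<in> V" "(\<lambda>n. N (s n - l)) \<longlonglongrightarrow> 0" and e: "\<And>n. f (s n) = g (s n)"
    by auto
  have "f l = g l"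
  proof (rule norm_on_lim_unique[OF M])
    show "(\<lambda>n. M (f (s n) - f l)) \<longlonglongrightarrow> 0"
      by (rule blin_lim[OF N M f s])
    show "(\<lambda>n. M (f (s n) - g l)) \<longlonglongrightarrow> 0"
      using blin_lim[OF N M g s] e by simp
  qed (auto intro: blin_mem[OF f] blin_mem[OF g] s)
  then show "l \<in> {x \<in> V. f x = g x}"
    using s by simp
qed auto

lemma csubspace_eq_blin:
  assumes N: "norm_on V N" and f: "blin V N W M f" and g: "blin V N W M g"
  shows "csubspace {x \<in> V. f x = g x}"
  by (rule cvec.subspaceI)
    (auto simp: norm_on_zero_mem[OF N] blin_zero[OF N f] blin_zero[OF N g] norm_on_add_mem[OF N]
      norm_on_scale_mem[OF N] blin_add[OF f] blin_add[OF g] blin_scale[OF f] blin_scale[OF g])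

lemma csubspace_blin_image:
  assumes N: "norm_on V N" and f: "blin V N W M f"
  shows "csubspace (f ` V)"
proof (rule cvec.subspaceI)
  show "0 \<in> f ` V"
    using blin_zero[OF N f] norm_on_zero_mem[OF N] by (metis imageI)
  show "x + y \<in> f ` V" if "x \<in> f ` V" "y \<in> f ` V" for x y
    using that norm_on_add_mem[OF N] by (auto simp: blin_add[OF f, symmetric])
  show "scaleC c x \<in> f ` V" if "x \<in> f ` V" for c x
    using that norm_on_scale_mem[OF N] by (auto simp: blin_scale[OF f, symmetric])
qed

lemma blin_component:
  assumes N: "norm_on V N" and "finite I" "i \<in> I"
  shows "blin (PiC I V) (pn I N) V N (\<lambda>x. x i)"
  by (rule blinI[where K = 1])
    (auto simp: scaleC_fun_def assms(3) pn_component_le[OF assms(1,2) _ assms(3)]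
      PiC_def intro: pn_component_le[OF assms(1,2) _ assms(3), unfolded PiC_def])

lemma blin_tuple:
  assumes M: "norm_on W M" and "finite I" and f: "\<And>i. i \<in> I \<Longrightarrow> blin V N W M (f i)"
  shows "blin V N (PiC I W) (pn I M) (\<lambda>x i. if i \<in> I then f i x else 0)"
proof -
  have "\<forall>i\<in>I. \<exists>K. \<forall>x\<in>V. M (f i x) \<le> K * N x"
    using f unfolding blin_def by blast
  then obtain K where K: "\<And>i x. i \<in> I \<Longrightarrow> x \<in> V \<Longrightarrow> M (f i x) \<le> K i * N x"
    by metis
  show ?thesis
  proof (rule blinI[where K = "sum K I"])
    fix x assume x: "x \<in> V"
    show "(\<lambda>i. if i \<in> I then f i x else 0) \<in> PiC I W"
      using x f by (auto simp: PiC_def blin_def)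
    show "pn I M (\<lambda>i. if i \<in> I then f i x else 0) \<le> sum K I * N x"
      unfolding pn_def sum_distrib_right using K x by (intro sum_mono) auto
    show "(\<lambda>i. if i \<in> I then f i (scaleC c x) else 0) = scaleC c (\<lambda>i. if i \<in> I then f i x else 0)" for c
      using x f by (auto simp: fun_eq_iff scaleC_fun_def blin_def)
    fix y assume "y \<in> V"
    then show "(\<lambda>i. if i \<in> I then f i (x + y) else 0) =
        (\<lambda>i. if i \<in> I then f i x else 0) + (\<lambda>i. if i \<in> I then f i y else 0)"
      using x f by (auto simp: fun_eq_iff blin_def)
  qed
qed

text \<open>Successive approximation: the residual of an approximate solution is again a right-hand
  side, so solving repeatedly produces corrections that decay like the powers of \<open>q\<close>.
  Completeness of the domain sums them; the constant \<open>K / (1 - q)\<close> is the sum of the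
  geometric series.\<close>

lemma approx_surj:
  assumes V: "banach_on V N" and M: "norm_on W M" and f: "blin V N W M f"
    and q: "0 \<le> q" "q < 1"
    and h: "\<And>y. y \<in> W \<Longrightarrow> \<exists>x\<in>V. N x \<le> K * M y \<and> M (y - f x) \<le> q * M y"
    and y: "y \<in> W" and K: "0 \<le> K"
  shows "\<exists>x\<in>V. f x = y \<and> N x \<le> K / (1 - q) * M y"
proof -
  note N = banach_on_norm_on[OF V]
  obtain g where g: "\<And>y. y \<in> W \<Longrightarrow> g y \<in> V \<and> N (g y) \<le> K * M y \<and> M (y - f (g y)) \<le> q * M y"
    using h by metis
  \<comment> \<open>\<open>r n\<close> is what remains to be solved after \<open>n\<close>
    corrections; \<open>s\<close> below sums the corrections and \<open>t\<close> majorises their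
    norms.\<close>
  define r where "r = rec_nat y (\<lambda>_ u. u - f (g u))"
  have r0: "r 0 = y" and rS: "r (Suc n) = r n - f (g (r n))" for n
    by (simp_all add: r_def)
  have gV: "g y \<in> V" if "y \<in> W" for y
    using g[OF that] by blast
  have rW: "r n \<in> W" for n
    by (induction n) (auto simp: r0 rS y intro!: norm_on_diff_mem[OF M] blin_mem[OF f] gV)
  have rM: "M (r n) \<le> q ^ n * M y" for n
  proof (induction n)
    case (Suc n)
    have "M (r (Suc n)) \<le> q * M (r n)"
      using g[OF rW[of n]] by (simp add: rS)
    also have "\<dots> \<le> q * (q ^ n * M y)"
      by (intro mult_left_mono Suc q)
    finally show ?case
      by simp
  qed (simp add: r0)
  define s where "s n = (\<Sum>j<n. g (r j))" for n
  define t where "t n = (\<Sum>j<n. q ^ j * (K * M y))" for n :: nat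
  have gN: "N (g (r j)) \<le> q ^ j * (K * M y)" for j
  proof -
    have "N (g (r j)) \<le> K * M (r j)"
      using g[OF rW] by blast
    also have "\<dots> \<le> K * (q ^ j * M y)"
      by (intro mult_left_mono rM K)
    finally show ?thesis
      by (simp add: mult_ac)
  qed
  have sV: "s n \<in> V" for n
    unfolding s_def by (intro norm_on_sum_mem[OF N]) (use g rW in blast)
  have le: "N (s m - s n) \<le> \<bar>t m - t n\<bar>" if "n \<le> m" for m n
  proof -
    have "s m - s n = (\<Sum>j=n..<m. g (r j))" "t m - t n = (\<Sum>j=n..<m. q ^ j * (K * M y))"
      using that by (simp_all add: s_def t_def lessThan_atLeast0 sum_diff_nat_ivl)
    moreover have "N (\<Sum>j=n..<m. g (r j)) \<le> (\<Sum>j=n..<m. N (g (r j)))"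
      by (intro norm_on_sum_le[OF N]) (use g rW in blast)
    moreover have "\<dots> \<le> (\<Sum>j=n..<m. q ^ j * (K * M y))"
      by (intro sum_mono gN)
    ultimately show ?thesis
      by simp
  qed
  have "summable (\<lambda>j. q ^ j * (K * M y))"
    using q by (intro summable_mult2 summable_geometric) simp
  then have t_lim: "t \<longlonglongrightarrow> (\<Sum>j. q ^ j * (K * M y))"
    unfolding t_def by (rule summable_LIMSEQ)
  have "(\<Sum>j. q ^ j * (K * M y)) = 1 / (1 - q) * (K * M y)"
    using q by (simp add: suminf_mult2[symmetric] suminf_geometric summable_geometric)
  with t_lim have t_lim: "t \<longlonglongrightarrow> K / (1 - q) * M y"
    by simp
  then have "cauchy_on norm t"
    unfolding cauchy_on_norm_iff by (rule LIMSEQ_imp_Cauchy)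
  then have cs: "cauchy_on N s"
  proof (rule cauchy_on_mono)
    show "N (s m - s n) \<le> norm (t m - t n)" for m n
      using le[of n m] le[of m n] norm_on_diff_commute[OF N sV sV, of n m]
      by (cases "n \<le> m") auto
  qed
  obtain l where l: "l \<in> V" "(\<lambda>n. N (s n - l)) \<longlonglongrightarrow> 0"
    by (rule banach_onD[OF V sV cs])
  have "y - f (s n) = r n" for n
  proof (induction n)
    case (Suc n)
    have "f (s (Suc n)) = f (s n) + f (g (r n))"
      using g[OF rW] sV[of n] by (simp add: s_def blin_add[OF f])
    then show ?case
      using Suc by (simp add: rS algebra_simps)
  qed (simp add: r0 s_def blin_zero[OF N f])
  then have res: "M (f (s n) - y) \<le> q ^ n * M y" for n
    using rM[of n] norm_on_diff_commute[OF M blin_mem[OF f sV] y, of n] by simp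
  have "(\<lambda>n. q ^ n * M y) \<longlonglongrightarrow> 0"
    using tendsto_mult_left_zero[OF LIMSEQ_power_zero, of q] q by simp
  then have lim_y: "(\<lambda>n. M (f (s n) - y)) \<longlonglongrightarrow> 0"
    by (rule tendsto_0_le_seq)
      (intro norm_on_nonneg[OF M] norm_on_diff_mem[OF M] blin_mem[OF f] sV y res)+
  have "f l = y"
    by (rule norm_on_lim_unique[OF M _ _ _ blin_lim[OF N M f sV l] lim_y])
      (auto intro: blin_mem[OF f] sV l y)
  moreover have "N l \<le> K / (1 - q) * M y"
  proof -
    have "N l \<le> N (s n - l) + t n" for n
    proof -
      have "N l \<le> N (l - s n) + N (s n)"
        using norm_on_triangle[OF N norm_on_diff_mem[OF N l(1) sV[of n]] sV[of n]] by simp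
      moreover have "N (s n) \<le> t n"
        using le[of 0 n] K q norm_on_nonneg[OF M y]
        by (simp add: s_def t_def sum_nonneg abs_of_nonneg)
      ultimately show ?thesis
        using norm_on_diff_commute[OF N l(1) sV[of n]] by simp
    qed
    moreover have "(\<lambda>n. N (s n - l) + t n) \<longlonglongrightarrow> 0 + K / (1 - q) * M y"
      by (intro tendsto_add l t_lim)
    ultimately show ?thesis
      using LIMSEQ_le_const[of "\<lambda>n. N (s n - l) + t n" "K / (1 - q) * M y" "N l"] by simp
  qed
  ultimately show ?thesis
    using l(1) by blast
qed

text \<open>By Baire's theorem the closure of the image of some ball has interior points.
  Translation and scaling turn this into approximate solutions of bounded norm, and
  \<open>approx_surj\<close> makes them exact.\<close>

theorem open_mapping:
  assumes V: "banach_on V N" and W: "banach_on W M" and f: "blin V N W M f" and surj: "f ` V = W"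
  obtains K where "K > 0" "\<And>y. y \<in> W \<Longrightarrow> \<exists>x\<in>V. f x = y \<and> N x \<le> K * M y"
proof -
  note N = banach_on_norm_on[OF V] and M = banach_on_norm_on[OF W]
  interpret Metric_space W "norm_dist W M"
    by (rule Metric_space_norm_dist) fact
  \<comment> \<open>\<open>C n\<close> is the closure in \<open>W\<close> of the image of the ball
    of radius \<open>n\<close>.\<close>
  define C where "C n = {y \<in> W. \<forall>e>0. \<exists>x\<in>V. N x \<le> real n \<and> M (y - f x) < e}" for n
  have "closed_on W M (C n)" for n
    unfolding closed_on_def
  proof (intro conjI allI impI)
    fix s l assume a: "(\<forall>k. s k \<in> C n) \<and> l \<in> W \<and> (\<lambda>k. M (s k - l)) \<longlonglongrightarrow> 0"
    show "l \<in> C n"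
      unfolding C_def
    proof (intro CollectI conjI allI impI)
      fix e :: real assume "e > 0"
      then obtain k where k: "M (s k - l) < e / 2"
        using order_tendstoD(2)[of "\<lambda>k. M (s k - l)" 0 sequentially "e / 2"] a
        by (auto simp: eventually_sequentially)
      have "s k \<in> C n" "e / 2 > 0"
        using a \<open>e > 0\<close> by auto
      then have s: "s k \<in> W" and "\<exists>x\<in>V. N x \<le> real n \<and> M (s k - f x) < e / 2"
        unfolding C_def by blast+
      then obtain x where x: "x \<in> V" "N x \<le> real n" "M (s k - f x) < e / 2"
        by blast
      have "M (l - f x) \<le> M (l - s k) + M (s k - f x)"
        using a s x by (intro norm_on_triangle3[OF M] blin_mem[OF f]) auto
      then show "\<exists>x\<in>V. N x \<le> real n \<and> M (l - f x) < e"
        using x k norm_on_diff_commute[OF M s, of l] a by (intro bexI[of _ x]) auto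
    qed (use a in auto)
  qed (auto simp: C_def)
  then have "closedin mtopology (C n)" for n
    using closedin_norm_dist_iff[OF M] by blast
  moreover have "(\<Union>n. C n) = W"
  proof (intro equalityI subsetI)
    fix y assume "y \<in> W"
    then obtain x where x: "x \<in> V" "y = f x"
      using surj by blast
    obtain n where "N x \<le> real n"
      using real_arch_simple by blast
    then have "y \<in> C n"
      using x \<open>y \<in> W\<close> by (auto simp: C_def norm_on_zero[OF M] intro!: bexI[of _ x])
    then show "y \<in> (\<Union>n. C n)"
      by blast
  qed (auto simp: C_def)
  moreover have "mtopology interior_of W \<noteq> {}"
    using norm_on_zero_mem[OF M] interior_of_topspace[of mtopology] by auto
  ultimately obtain n where "mtopology interior_of (C n) \<noteq> {}"
    using metric_Baire_category_alt[of "range C"] W unfolding banach_on_def by auto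
  then obtain y0 U where U: "openin mtopology U" "y0 \<in> U" "U \<subseteq> C n"
    by (auto simp: interior_of_def)
  then obtain d where d: "d > 0" "mball y0 d \<subseteq> C n"
    unfolding openin_mtopology by blast
  have y0: "y0 \<in> W"
    using U by (auto simp: C_def)
  \<comment> \<open>Approximating \<open>y0 + y\<close> and \<open>y0\<close> separately and
    subtracting moves the interior point to the origin, at the price of doubling the radius.\<close>
  have approx: "\<exists>x\<in>V. N x \<le> 2 * real n \<and> M (y - f x) < e" if y: "y \<in> W" "M y < d" "e > 0" for y e
  proof -
    have "y0 + y \<in> mball y0 d" "y0 \<in> mball y0 d"
      using y y0 d norm_on_add_mem[OF M y0 y(1)] norm_on_minus[OF M y(1)]
      by (auto simp: norm_dist_eq norm_on_zero[OF M])
    then have "y0 + y \<in> C n" "y0 \<in> C n"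
      using d by auto
    then obtain x1 x2 where x: "x1 \<in> V" "N x1 \<le> real n" "M (y0 + y - f x1) < e / 2"
      "x2 \<in> V" "N x2 \<le> real n" "M (y0 - f x2) < e / 2"
      using half_gt_zero[OF \<open>e > 0\<close>] unfolding C_def by blast
    have "y - f (x1 - x2) = (y0 + y - f x1) - (y0 - f x2)"
      by (simp add: blin_diff[OF N f x(1,4)])
    also have "M \<dots> \<le> M (y0 + y - f x1) + M (y0 - f x2)"
      by (intro norm_on_triangle_diff[OF M] norm_on_diff_mem[OF M] norm_on_add_mem[OF M]
          blin_mem[OF f] x y0 y)
    finally show ?thesis
      using x norm_on_triangle_diff[OF N x(1,4)] norm_on_diff_mem[OF N x(1,4)]
      by (intro bexI[of _ "x1 - x2"]) auto
  qed
  have "\<exists>x\<in>V. N x \<le> 4 * real n / d * M y \<and> M (y - f x) \<le> 1 / 2 * M y" if y: "y \<in> W" for y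
  proof (cases "y = 0")
    case True
    then show ?thesis
      using norm_on_zero_mem[OF N]
      by (intro bexI[of _ 0]) (auto simp: norm_on_zero[OF N] norm_on_zero[OF M] blin_zero[OF N f])
  next
    case False
    then have My: "M y > 0"
      using norm_on_nonneg[OF M y] norm_on_eq_0[OF M y] by simp
    \<comment> \<open>Scaling by \<open>c\<close> brings \<open>y\<close> to norm
      \<open>d / 2\<close>, inside the ball; after scaling back, the tolerance \<open>d / 4\<close>
      is half the norm of \<open>y\<close>.\<close>
    define c where "c = d / (2 * M y)"
    have c: "c > 0"
      using d My by (simp add: c_def)
    let ?y = "scaleC (complex_of_real c) y"
    have "M ?y = c * M y"
      using c by (simp add: norm_on_scale[OF M y])
    also have "\<dots> < d"
      using d My by (simp add: c_def)
    finally have "?y \<in> W" "M ?y < d"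
      using norm_on_scale_mem[OF M y] by auto
    from approx[OF this, of "d / 4"] obtain x where
      x: "x \<in> V" "N x \<le> 2 * real n" "M (?y - f x) < d / 4"
      using d by auto
    let ?x = "scaleC (complex_of_real (1 / c)) x"
    have "N ?x \<le> 1 / c * (2 * real n)"
      unfolding norm_on_scale[OF N x(1)] using x(2) c
      by (simp add: divide_right_mono norm_divide)
    also have "\<dots> = 4 * real n / d * M y"
      by (simp add: c_def)
    finally have 1: "N ?x \<le> 4 * real n / d * M y" .
    have "y - f ?x = scaleC (complex_of_real (1 / c)) (?y - f x)"
      using c by (simp add: blin_scale[OF f x(1)] cvec.scale_right_diff_distrib scaleC_scaleC
          flip: of_real_mult)
    then have "M (y - f ?x) = 1 / c * M (?y - f x)"
      using norm_on_scale[OF M norm_on_diff_mem[OF M \<open>?y \<in> W\<close> blin_mem[OF f x(1)]]] c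
      by (simp add: norm_divide)
    also have "\<dots> \<le> 1 / c * (d / 4)"
      using x(3) c by (intro mult_left_mono) auto
    also have "\<dots> = 1 / 2 * M y"
      using d by (simp add: c_def)
    finally show ?thesis
      using 1 norm_on_scale_mem[OF N x(1)] by blast
  qed
  from approx_surj[OF V M f _ _ this] d
  have *: "\<exists>x\<in>V. f x = y \<and> N x \<le> 8 * real n / d * M y" if "y \<in> W" for y
    using that by fastforce
  \<comment> \<open>The summand 1 keeps the constant positive when \<open>n\<close> is 0.\<close>
  have "\<exists>x\<in>V. f x = y \<and> N x \<le> (8 * real n / d + 1) * M y" if y: "y \<in> W" for y
  proof -
    obtain x where "x \<in> V" "f x = y" "N x \<le> 8 * real n / d * M y"
      using *[OF y] by blast
    then show ?thesis
      using norm_on_nonneg[OF M y] by (intro bexI[of _ x]) (auto simp: distrib_right)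
  qed
  moreover have "8 * real n / d + 1 > 0"
    using d by (simp add: add_nonneg_pos)
  ultimately show ?thesis
    using that by blast
qed

section \<open>The Hahn--Banach theorem\<close>

text \<open>The value 0 off \<open>V\<close> makes the pointwise order on \<open>V\<close> an order
  of total functions, so that minimality can be expressed by equality.\<close>

definition sublinear_on :: "'a::complex_vector set \<Rightarrow> ('a \<Rightarrow> real) \<Rightarrow> bool"
  where "sublinear_on V p \<longleftrightarrow> (\<forall>x\<in>V. \<forall>y\<in>V. p (x + y) \<le> p x + p y) \<and>
    (\<forall>t\<ge>0. \<forall>x\<in>V. p (scaleC (complex_of_real t) x) \<le> t * p x) \<and> (\<forall>x. x \<notin> V \<longrightarrow> p x = 0)"

definition seminorm_on :: "'a::complex_vector set \<Rightarrow> ('a \<Rightarrow> real) \<Rightarrow> bool"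
  where "seminorm_on V p \<longleftrightarrow> (\<forall>x\<in>V. \<forall>y\<in>V. p (x + y) \<le> p x + p y) \<and>
    (\<forall>c. \<forall>x\<in>V. p (scaleC c x) = cmod c * p x)"



context
  fixes V :: "'a::complex_vector set"
  assumes V: "csubspace V"
begin

lemma csub_mem:
  "0 \<in> V" "x \<in> V \<Longrightarrow> y \<in> V \<Longrightarrow> x + y \<in> V" "x \<in> V \<Longrightarrow> y \<in> V \<Longrightarrow> x - y \<in> V"
  "x \<in> V \<Longrightarrow> - x \<in> V" "x \<in> V \<Longrightarrow> scaleC c x \<in> V"
  using V by (auto intro: cvec.subspace_0 cvec.subspace_add cvec.subspace_diff cvec.subspace_scale
      cvec.subspace_neg)

lemma sublinear_on_zero: "sublinear_on V p \<Longrightarrow> p 0 = 0"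
proof -
  assume p: "sublinear_on V p"
  have "p (0 + 0) \<le> p 0 + p 0" "p (scaleC (complex_of_real 0) 0) \<le> 0 * p 0"
    using p csub_mem(1) unfolding sublinear_on_def by blast+
  then show ?thesis
    by simp
qed

lemma sublinear_on_minus: "sublinear_on V p \<Longrightarrow> x \<in> V \<Longrightarrow> - p (- x) \<le> p x"
proof -
  assume p: "sublinear_on V p" and x: "x \<in> V"
  have "p (x + - x) \<le> p x + p (- x)"
    using p x csub_mem(4) unfolding sublinear_on_def by blast
  then show ?thesis
    using sublinear_on_zero[OF p] by simp
qed

text \<open>The largest sublinear functional below \<open>p\<close> that is additive in the direction \<open>x\<^sub>0\<close>.\<close>

definition tilt :: "('a \<Rightarrow> real) \<Rightarrow> 'a \<Rightarrow> 'a \<Rightarrow> real"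
  where "tilt p x\<^sub>0 x =
    (if x \<in> V then INF t\<in>{0..}. p (x + scaleC (complex_of_real t) x\<^sub>0) - t * p x\<^sub>0 else 0)"

text \<open>Subadditivity is applied to the decomposition of the multiple of
  \<open>x\<^sub>0\<close> into its sum with \<open>x\<close> and \<open>- x\<close>. The bound does
  not depend on \<open>t\<close>, so the infimum defining \<open>tilt\<close> is finite.\<close>

lemma tilt_bdd:
  assumes p: "sublinear_on V p" and x0: "x\<^sub>0 \<in> V" and x: "x \<in> V" and t: "0 \<le> t"
  shows "- p (- x) \<le> p (x + scaleC (complex_of_real t) x\<^sub>0) - t * p x\<^sub>0"
proof -
  let ?tx = "scaleC (complex_of_real t) x\<^sub>0"
  have tx: "?tx \<in> V"
    using csub_mem x0 by blast
  have "t * p x\<^sub>0 \<le> p ?tx"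
  proof (cases "t = 0")
    case True
    then show ?thesis
      by (simp add: sublinear_on_zero[OF p])
  next
    case False
    then have "x\<^sub>0 = scaleC (complex_of_real (1 / t)) ?tx"
      by (simp add: scaleC_scaleC scaleC_one flip: of_real_mult)
    then have "p x\<^sub>0 \<le> 1 / t * p ?tx"
      using p tx t unfolding sublinear_on_def by (metis divide_nonneg_nonneg zero_le_one)
    then show ?thesis
      using False t by (simp add: field_simps)
  qed
  also have "p ?tx = p ((x + ?tx) + (- x))"
    by simp
  also have "\<dots> \<le> p (x + ?tx) + p (- x)"
    using p csub_mem(2)[OF x tx] csub_mem(4)[OF x] unfolding sublinear_on_def by blast
  finally show ?thesis
    by simp
qed

lemma tilt_bdd_below:
  assumes "sublinear_on V p" "x\<^sub>0 \<in> V" "x \<in> V"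
  shows "bdd_below ((\<lambda>t. p (x + scaleC (complex_of_real t) x\<^sub>0) - t * p x\<^sub>0) ` {0..})"
  using tilt_bdd[OF assms] by (intro bdd_belowI[of _ "- p (- x)"]) auto

lemma tilt_le:
  assumes "sublinear_on V p" "x\<^sub>0 \<in> V" "x \<in> V" "0 \<le> t"
  shows "tilt p x\<^sub>0 x \<le> p (x + scaleC (complex_of_real t) x\<^sub>0) - t * p x\<^sub>0"
  unfolding tilt_def using assms(3,4) by (auto intro: cINF_lower[OF tilt_bdd_below[OF assms(1-3)]])

lemma tilt_greatest:
  assumes "x \<in> V" "\<And>t. 0 \<le> t \<Longrightarrow> c \<le> p (x + scaleC (complex_of_real t) x\<^sub>0) - t * p x\<^sub>0"
  shows "c \<le> tilt p x\<^sub>0 x"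
  unfolding tilt_def using assms by (auto intro!: cINF_greatest)

text \<open>A parameter \<open>s\<close> for \<open>x\<close> and a parameter \<open>t\<close> for
  \<open>y\<close> combine to the parameter \<open>s + t\<close> for \<open>x + y\<close>; scaling
  \<open>x\<close> by \<open>c\<close> scales the parameter by \<open>c\<close>.\<close>

lemma sublinear_on_tilt:
  assumes p: "sublinear_on V p" and x0: "x\<^sub>0 \<in> V"
  shows "sublinear_on V (tilt p x\<^sub>0)"
  unfolding sublinear_on_def
proof (intro conjI ballI allI impI)
  fix x y assume x: "x \<in> V" and y: "y \<in> V"
  have "tilt p x\<^sub>0 (x + y) - (p (y + scaleC (of_real t) x\<^sub>0) - t * p x\<^sub>0) \<le> tilt p x\<^sub>0 x"
    if t: "0 \<le> t" for t
  proof (rule tilt_greatest[OF x])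
    fix s :: real assume s: "0 \<le> s"
    have "tilt p x\<^sub>0 (x + y) \<le> p (x + y + scaleC (of_real (s + t)) x\<^sub>0) - (s + t) * p x\<^sub>0"
      using s t by (intro tilt_le[OF p x0] csub_mem x y) auto
    also have "x + y + scaleC (of_real (s + t)) x\<^sub>0 =
        (x + scaleC (of_real s) x\<^sub>0) + (y + scaleC (of_real t) x\<^sub>0)"
      by (simp add: scaleC_add_left)
    also have "p \<dots> \<le> p (x + scaleC (of_real s) x\<^sub>0) + p (y + scaleC (of_real t) x\<^sub>0)"
      using p csub_mem(2)[OF x csub_mem(5)[OF x0]] csub_mem(2)[OF y csub_mem(5)[OF x0]]
      unfolding sublinear_on_def by blast
    finally show "tilt p x\<^sub>0 (x + y) - (p (y + scaleC (of_real t) x\<^sub>0) - t * p x\<^sub>0)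
        \<le> p (x + scaleC (of_real s) x\<^sub>0) - s * p x\<^sub>0"
      by (simp add: algebra_simps)
  qed
  then have "tilt p x\<^sub>0 (x + y) - tilt p x\<^sub>0 x \<le> tilt p x\<^sub>0 y"
    by (intro tilt_greatest[OF y]) (simp add: algebra_simps)
  then show "tilt p x\<^sub>0 (x + y) \<le> tilt p x\<^sub>0 x + tilt p x\<^sub>0 y"
    by simp
next
  fix x and c :: real assume x: "x \<in> V" and c: "0 \<le> c"
  show "tilt p x\<^sub>0 (scaleC (of_real c) x) \<le> c * tilt p x\<^sub>0 x"
  proof (cases "c = 0")
    case True
    then show ?thesis
      using tilt_le[OF p x0 csub_mem(1), of 0] by (simp add: sublinear_on_zero[OF p])
  next
    case False
    have "1 / c * tilt p x\<^sub>0 (scaleC (of_real c) x) \<le> tilt p x\<^sub>0 x"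
    proof (rule tilt_greatest[OF x])
      fix t :: real assume t: "0 \<le> t"
      have "tilt p x\<^sub>0 (scaleC (of_real c) x) \<le>
          p (scaleC (of_real c) x + scaleC (of_real (c * t)) x\<^sub>0) - c * t * p x\<^sub>0"
        using c t by (intro tilt_le[OF p x0] csub_mem x) auto
      also have "scaleC (of_real c) x + scaleC (of_real (c * t)) x\<^sub>0 =
          scaleC (of_real c) (x + scaleC (of_real t) x\<^sub>0)"
        by (simp add: scaleC_add_right scaleC_scaleC)
      also have "p \<dots> \<le> c * p (x + scaleC (of_real t) x\<^sub>0)"
        using p c csub_mem(2)[OF x csub_mem(5)[OF x0]] unfolding sublinear_on_def by blast
      finally show "1 / c * tilt p x\<^sub>0 (scaleC (of_real c) x) \<le>
          p (x + scaleC (of_real t) x\<^sub>0) - t * p x\<^sub>0"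
        using c False by (simp add: field_simps)
    qed
    then show ?thesis
      using c False by (simp add: field_simps)
  qed
qed (simp add: tilt_def)

lemma tilt_le_self:
  "sublinear_on V p \<Longrightarrow> x\<^sub>0 \<in> V \<Longrightarrow> tilt p x\<^sub>0 x \<le> p x"
  using tilt_le[of p x\<^sub>0 x 0] by (cases "x \<in> V") (auto simp: tilt_def sublinear_on_def)

text \<open>Zorn's lemma: the infimum of a chain is finite because all members lie above the same
  \<open>- p (- x)\<close>, and it is subadditive because any two members are comparable.\<close>

lemma minimal_sublinear:
  assumes p: "sublinear_on V p"
  obtains m where "sublinear_on V m" "\<And>x. m x \<le> p x"
    "\<And>q. sublinear_on V q \<Longrightarrow> (\<And>x. q x \<le> m x) \<Longrightarrow> q = m"
proof -
  define A where "A = {q. sublinear_on V q \<and> (\<forall>x. q x \<le> p x)}"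
  \<comment> \<open>The order is reversed, so that a maximal element for \<open>P\<close> is a
    minimal functional.\<close>
  define P where "P q\<^sub>1 q\<^sub>2 \<longleftrightarrow> (\<forall>x. q\<^sub>2 x \<le> q\<^sub>1 x)" for q\<^sub>1 q\<^sub>2 :: "'a \<Rightarrow> real"
  have "\<exists>m\<in>A. \<forall>a\<in>A. P m a \<longrightarrow> a = m"
  proof (rule predicate_Zorn)
    show "partial_order_on A (relation_of P A)"
      by (rule partial_order_on_relation_ofI)
        (auto simp: P_def fun_eq_iff intro: order_trans order_antisym)
    fix C assume C: "C \<in> Chains (relation_of P A)"
    then have CA: "C \<subseteq> A" and tot: "\<And>a b. a \<in> C \<Longrightarrow> b \<in> C \<Longrightarrow> P a b \<or> P b a"
      by (auto simp: Chains_def relation_of_def)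
    show "\<exists>u\<in>A. \<forall>a\<in>C. P a u"
    proof (cases "C = {}")
      case True
      then show ?thesis
        using p by (auto simp: A_def)
    next
      case False
      define u where "u x = (if x \<in> V then INF q\<in>C. q x else 0)" for x
      have "bdd_below ((\<lambda>q. q x) ` C)" if x: "x \<in> V" for x
      proof (rule bdd_belowI)
        fix y assume "y \<in> (\<lambda>q. q x) ` C"
        then obtain q where q: "q \<in> C" "y = q x"
          by blast
        then have "- q (- x) \<le> y" "q (- x) \<le> p (- x)"
          using CA sublinear_on_minus[OF _ x] by (auto simp: A_def)
        then show "- p (- x) \<le> y"
          by simp
      qed
      then have u_le: "u x \<le> q x" if "x \<in> V" "q \<in> C" for x q
        unfolding u_def using that by (auto intro: cINF_lower)
      have u_ge: "c \<le> u x" if "x \<in> V" "\<And>q. q \<in> C \<Longrightarrow> c \<le> q x" for x c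
        unfolding u_def using that False by (auto intro!: cINF_greatest)
      have q: "sublinear_on V q" if "q \<in> C" for q
        using CA that by (auto simp: A_def)
      have "sublinear_on V u"
        unfolding sublinear_on_def
      proof (intro conjI ballI allI impI)
        fix x y assume x: "x \<in> V" and y: "y \<in> V"
        have "u (x + y) \<le> q\<^sub>1 x + q\<^sub>2 y" if q12: "q\<^sub>1 \<in> C" "q\<^sub>2 \<in> C" for q\<^sub>1 q\<^sub>2
        proof -
          obtain r where r: "r \<in> C" "r x \<le> q\<^sub>1 x" "r y \<le> q\<^sub>2 y"
            using tot[OF q12] q12 unfolding P_def by blast
          have "u (x + y) \<le> r (x + y)"
            by (rule u_le[OF csub_mem(2)[OF x y] r(1)])
          also have "\<dots> \<le> r x + r y"
            using q[OF r(1)] x y unfolding sublinear_on_def by blast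
          finally show ?thesis
            using r by simp
        qed
        then have "u (x + y) - q\<^sub>2 y \<le> u x" if "q\<^sub>2 \<in> C" for q\<^sub>2
          using that by (intro u_ge[OF x]) (simp add: diff_le_eq)
        then have "u (x + y) - u x \<le> u y"
          by (intro u_ge[OF y]) (simp add: algebra_simps)
        then show "u (x + y) \<le> u x + u y"
          by simp
      next
        fix x and t :: real assume x: "x \<in> V" and t: "0 \<le> t"
        show "u (scaleC (of_real t) x) \<le> t * u x"
        proof (cases "t = 0")
          case True
          obtain r where "r \<in> C"
            using False by blast
          then show ?thesis
            using u_le[OF csub_mem(1), of r] sublinear_on_zero[OF q, of r] True by simp
        next
          case False
          have "1 / t * u (scaleC (of_real t) x) \<le> u x"
          proof (rule u_ge[OF x])
            fix r assume r: "r \<in> C"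
            have "u (scaleC (of_real t) x) \<le> r (scaleC (of_real t) x)"
              by (rule u_le[OF csub_mem(5)[OF x] r])
            also have "\<dots> \<le> t * r x"
              using q[OF r] t x unfolding sublinear_on_def by blast
            finally show "1 / t * u (scaleC (of_real t) x) \<le> r x"
              using False t by (simp add: field_simps)
          qed
          then show ?thesis
            using False t by (simp add: field_simps)
        qed
      qed (simp add: u_def)
      moreover have u_le': "u x \<le> a x" if "a \<in> C" for a x
        using u_le[OF _ that, of x] q[OF that] by (cases "x \<in> V") (auto simp: u_def sublinear_on_def)
      moreover obtain r where "r \<in> C"
        using False by blast
      moreover from this CA have "r x \<le> p x" for x
        by (auto simp: A_def)
      ultimately have "sublinear_on V u \<and> (\<forall>x. u x \<le> p x)"
        using order_trans[OF u_le'] by simp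
      then have "u \<in> A"
        by (simp add: A_def)
      then show ?thesis
        using u_le' by (intro bexI[of _ u]) (simp_all add: P_def)
    qed
  qed
  then obtain m where m: "m \<in> A" "\<And>a. a \<in> A \<Longrightarrow> P m a \<Longrightarrow> a = m"
    by blast
  show ?thesis
  proof (rule that)
    show "sublinear_on V m" "m x \<le> p x" for x
      using m by (auto simp: A_def)
    fix q assume "sublinear_on V q" "\<And>x. q x \<le> m x"
    then show "q = m"
      using m(1) by (intro m(2)) (auto simp: A_def P_def intro: order_trans)
  qed
qed

text \<open>A minimal sublinear functional equals each of its own tilts, which makes it odd and
  hence additive. Minimising below \<open>tilt p x\<^sub>0\<close> instead of below \<open>p\<close>
  is what secures the value at \<open>x\<^sub>0\<close>.\<close>

lemma hahn_banach_real:
  assumes p: "sublinear_on V p" and x0: "x\<^sub>0 \<in> V"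
  obtains m where "\<And>x y. x \<in> V \<Longrightarrow> y \<in> V \<Longrightarrow> m (x + y) = m x + m y"
    "\<And>t x. x \<in> V \<Longrightarrow> m (scaleC (complex_of_real t) x) = t * m x"
    "\<And>x. m x \<le> p x" "m x\<^sub>0 = p x\<^sub>0"
proof -
  obtain m where m: "sublinear_on V m" "\<And>x. m x \<le> tilt p x\<^sub>0 x"
    and min: "\<And>q. sublinear_on V q \<Longrightarrow> (\<And>x. q x \<le> m x) \<Longrightarrow> q = m"
    using minimal_sublinear[OF sublinear_on_tilt[OF p x0]] by blast
  have tm: "tilt m y = m" if "y \<in> V" for y
    by (rule min[OF sublinear_on_tilt[OF m(1) that] tilt_le_self[OF m(1) that]])
  have neg: "m (- y) = - m y" if y: "y \<in> V" for y
  proof -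
    have "m (- y) = tilt m y (- y)"
      by (simp only: tm[OF y])
    also have "\<dots> \<le> m (- y + scaleC (of_real 1) y) - 1 * m y"
      by (intro tilt_le[OF m(1) y] csub_mem y) simp
    finally show ?thesis
      using sublinear_on_minus[OF m(1) y] sublinear_on_zero[OF m(1)] by (simp add: scaleC_one)
  qed
  have le: "m (x + y) \<le> m x + m y" if "x \<in> V" "y \<in> V" for x y
    using m(1) that unfolding sublinear_on_def by blast
  have scl: "m (scaleC (of_real t) x) \<le> t * m x" if "x \<in> V" "0 \<le> t" for t x
    using m(1) that unfolding sublinear_on_def by blast
  have sc: "m (scaleC (of_real t) x) = t * m x" if x: "x \<in> V" and t: "0 \<le> t" for t x
    using scl[OF x t] scl[OF csub_mem(4)[OF x] t] neg[OF x] neg[OF csub_mem(5)[OF x]]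
    by simp
  show ?thesis
  proof (rule that)
    show "m (x + y) = m x + m y" if x: "x \<in> V" and y: "y \<in> V" for x y
      using le[OF x y] le[OF csub_mem(4)[OF x] csub_mem(4)[OF y]]
        neg[OF x] neg[OF y] neg[OF csub_mem(2)[OF x y]] by simp
    show "m (scaleC (of_real t) x) = t * m x" if x: "x \<in> V" for t x
      using sc[OF x, of t] sc[OF x, of "- t"] neg[OF csub_mem(5)[OF x], of "of_real (- t)"]
      by (cases "0 \<le> t") (auto simp: cvec.scale_minus_left)
    show "m x \<le> p x" for x
      using m(2) tilt_le_self[OF p x0] order_trans by blast
    \<comment> \<open>The parameter 1 in the tilt gives the upper bound \<open>- p x\<^sub>0\<close>
      at \<open>- x\<^sub>0\<close>.\<close>
    have "m (- x\<^sub>0) \<le> tilt p x\<^sub>0 (- x\<^sub>0)"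
      by (rule m(2))
    also have "\<dots> \<le> p (- x\<^sub>0 + scaleC (of_real 1) x\<^sub>0) - 1 * p x\<^sub>0"
      by (intro tilt_le[OF p x0] csub_mem x0) simp
    finally have "p x\<^sub>0 \<le> m x\<^sub>0"
      using sublinear_on_zero[OF p] neg[OF x0] by (simp add: scaleC_one)
    then show "m x\<^sub>0 = p x\<^sub>0"
      using m(2)[of x\<^sub>0] tilt_le_self[OF p x0, of x\<^sub>0] by simp
  qed
qed

lemma seminorm_on_nonneg: "seminorm_on V p \<Longrightarrow> x \<in> V \<Longrightarrow> 0 \<le> p x"
proof -
  assume p: "seminorm_on V p" and x: "x \<in> V"
  have "p (x + scaleC (- 1) x) \<le> p x + p (scaleC (- 1) x)" "p (scaleC (- 1) x) = cmod (- 1) * p x"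
    "p (scaleC 0 x) = cmod 0 * p x"
    using p x csub_mem(5)[OF x] unfolding seminorm_on_def by blast+
  then show ?thesis
    by (simp add: cvec.scale_minus_left)
qed

lemma seminorm_on_diff: "seminorm_on V p \<Longrightarrow> x \<in> V \<Longrightarrow> y \<in> V \<Longrightarrow> p (x - y) \<le> p x + p y"
proof -
  assume p: "seminorm_on V p" and x: "x \<in> V" and y: "y \<in> V"
  have "p (x + scaleC (- 1) y) \<le> p x + p (scaleC (- 1) y)" "p (scaleC (- 1) y) = cmod (- 1) * p y"
    using p x y csub_mem(5)[OF y] unfolding seminorm_on_def by blast+
  then show ?thesis
    by (simp add: cvec.scale_minus_left)
qed

text \<open>The real functional \<open>m\<close> is the real part of a unique complex linear one.
  The modulus of the latter is bounded by rotating the argument until the value is real and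
  nonnegative.\<close>

theorem hahn_banach:
  assumes p: "seminorm_on V p" and x0: "x\<^sub>0 \<in> V"
  obtains \<psi> :: "'a \<Rightarrow> complex" where "\<And>x y. x \<in> V \<Longrightarrow> y \<in> V \<Longrightarrow> \<psi> (x + y) = \<psi> x + \<psi> y"
    "\<And>c x. x \<in> V \<Longrightarrow> \<psi> (scaleC c x) = c * \<psi> x"
    "\<And>x. x \<in> V \<Longrightarrow> cmod (\<psi> x) \<le> p x" "\<psi> x\<^sub>0 = of_real (p x\<^sub>0)"
proof -
  have "sublinear_on V (\<lambda>x. if x \<in> V then p x else 0)"
    using p csub_mem by (auto simp: sublinear_on_def seminorm_on_def)
  from hahn_banach_real[OF this x0] obtain m where
    add: "\<And>x y. x \<in> V \<Longrightarrow> y \<in> V \<Longrightarrow> m (x + y) = m x + m y"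
    and sc: "\<And>t x. x \<in> V \<Longrightarrow> m (scaleC (complex_of_real t) x) = t * m x"
    and "\<And>x. m x \<le> (if x \<in> V then p x else 0)" "m x\<^sub>0 = (if x\<^sub>0 \<in> V then p x\<^sub>0 else 0)"
    by blast
  then have m0: "m x\<^sub>0 = p x\<^sub>0" and "\<And>x. m x \<le> (if x \<in> V then p x else 0)"
    using x0 by auto
  then have le: "m x \<le> p x" if "x \<in> V" for x
    using that by metis
  define \<psi> where "\<psi> x = Complex (m x) (- m (scaleC \<i> x))" for x
  have m_sc: "m (scaleC c x) = Re c * m x + Im c * m (scaleC \<i> x)" if x: "x \<in> V" for c x
  proof -
    have "scaleC c x = scaleC (of_real (Re c)) x + scaleC (of_real (Im c)) (scaleC \<i> x)"
      by (subst complex_eq[of c]) (simp add: scaleC_add_left scaleC_scaleC mult.commute)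
    then have "m (scaleC c x) = m (scaleC (of_real (Re c)) x) + m (scaleC (of_real (Im c)) (scaleC \<i> x))"
      using add[OF csub_mem(5)[OF x] csub_mem(5)[OF csub_mem(5)[OF x]]] by simp
    then show ?thesis
      unfolding sc[OF x] sc[OF csub_mem(5)[OF x]] .
  qed
  have add': "\<psi> (x + y) = \<psi> x + \<psi> y" if "x \<in> V" "y \<in> V" for x y
    using that by (simp add: \<psi>_def add csub_mem scaleC_add_right complex_eq_iff)
  have sc': "\<psi> (scaleC c x) = c * \<psi> x" if x: "x \<in> V" for c x
  proof -
    have "m (scaleC \<i> (scaleC c x)) = Re (\<i> * c) * m x + Im (\<i> * c) * m (scaleC \<i> x)"
      unfolding scaleC_scaleC by (rule m_sc[OF x])
    then show ?thesis
      using m_sc[OF x, of c] by (simp only: \<psi>_def complex_eq_iff) simp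
  qed
  have bound: "cmod (\<psi> x) \<le> p x" if x: "x \<in> V" for x
  proof (cases "\<psi> x = 0")
    case True
    then show ?thesis
      using seminorm_on_nonneg[OF p x] by simp
  next
    case False
    define c where "c = cnj (\<psi> x) / cmod (\<psi> x)"
    have "c * \<psi> x = (cnj (\<psi> x) * \<psi> x) / cmod (\<psi> x)"
      by (simp add: c_def)
    also have "cnj (\<psi> x) * \<psi> x = of_real (cmod (\<psi> x)) * of_real (cmod (\<psi> x))"
      using complex_norm_square[of "\<psi> x"] by (simp add: mult.commute power2_eq_square)
    finally have "c * \<psi> x = cmod (\<psi> x)"
      using False by simp
    then have "cmod (\<psi> x) = Re (\<psi> (scaleC c x))"
      by (simp add: sc'[OF x])
    also have "\<dots> = m (scaleC c x)"
      by (simp add: \<psi>_def)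
    also have "\<dots> \<le> p (scaleC c x)"
      by (rule le[OF csub_mem(5)[OF x]])
    also have "\<dots> = cmod c * p x"
      using p x unfolding seminorm_on_def by blast
    also have "cmod c = 1"
      using False by (simp add: c_def norm_divide)
    finally show ?thesis
      by simp
  qed
  \<comment> \<open>The real part already attains the bound on the modulus, so the imaginary part
    vanishes.\<close>
  have "\<psi> x\<^sub>0 = of_real (p x\<^sub>0)"
  proof (rule complex_eqI)
    show "Re (\<psi> x\<^sub>0) = Re (of_real (p x\<^sub>0))"
      by (simp add: \<psi>_def m0)
    then have "(cmod (\<psi> x\<^sub>0))\<^sup>2 = (p x\<^sub>0)\<^sup>2 + (Im (\<psi> x\<^sub>0))\<^sup>2"
      by (simp add: cmod_power2)
    moreover have "(cmod (\<psi> x\<^sub>0))\<^sup>2 \<le> (p x\<^sub>0)\<^sup>2"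
      by (rule power_mono[OF bound[OF x0]]) simp
    ultimately have "(Im (\<psi> x\<^sub>0))\<^sup>2 \<le> 0"
      by simp
    then show "Im (\<psi> x\<^sub>0) = Im (of_real (p x\<^sub>0))"
      by simp
  qed
  then show ?thesis
    using that add' sc' bound by blast
qed

end

section \<open>Norming functionals, dual bases and finite-dimensional spaces\<close>

lemma seminorm_on_norm: "norm_on V N \<Longrightarrow> seminorm_on V N"
  by (auto simp: seminorm_on_def norm_on_def)

lemma norming_functional:
  assumes N: "norm_on V N" and x0: "x\<^sub>0 \<in> V"
  obtains \<psi> where "blin V N UNIV norm \<psi>" "\<And>x. x \<in> V \<Longrightarrow> cmod (\<psi> x) \<le> N x" "\<psi> x\<^sub>0 = of_real (N x\<^sub>0)"
proof -
  obtain \<psi> :: "'a \<Rightarrow> complex" where \<psi>: "\<And>x y. x \<in> V \<Longrightarrow> y \<in> V \<Longrightarrow> \<psi> (x + y) = \<psi> x + \<psi> y"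
    "\<And>c x. x \<in> V \<Longrightarrow> \<psi> (scaleC c x) = c * \<psi> x"
    "\<And>x. x \<in> V \<Longrightarrow> cmod (\<psi> x) \<le> N x" "\<psi> x\<^sub>0 = of_real (N x\<^sub>0)"
    using hahn_banach[OF norm_on_subspace[OF N] seminorm_on_norm[OF N] x0] by blast
  have "blin V N UNIV norm \<psi>"
    by (rule blinI[where K = 1]) (auto simp: \<psi> scaleC_complex_def)
  then show ?thesis
    using that \<psi> by blast
qed

lemma sum_fun_apply:
  fixes f :: "'c \<Rightarrow> 'a \<Rightarrow> 'b::comm_monoid_add"
  shows "(\<Sum>i\<in>A. f i) x = (\<Sum>i\<in>A. f i x)"
  by (induction A rule: infinite_finite_induct) simp_all

text \<open>Biorthogonalisation by induction: the part \<open>z'\<close> of the new vector outside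
  the old span gets a functional by Hahn-Banach, which is corrected to vanish on the old basis; then
  the old functionals are corrected to vanish on \<open>z\<close>.\<close>

lemma dual_basis:
  assumes N: "norm_on V N" and "finite B" "B \<subseteq> V" "cvec.independent B"
  shows "\<exists>h. \<forall>b\<in>B. blin V N UNIV norm (h b :: 'a::complex_vector \<Rightarrow> complex) \<and>
    (\<forall>c\<in>B. h b c = (if b = c then 1 else 0))"
  using assms(2-4)
proof (induction B)
  case (insert z B)
  have ind: "cvec.independent B" and z: "z \<notin> cspan B"
    using insert.prems insert.hyps by (auto simp: cvec.independent_insert)
  have BV: "B \<subseteq> V" and zV: "z \<in> V"
    using insert.prems by auto
  from insert.IH[OF BV ind] obtain h where h: "\<And>b. b \<in> B \<Longrightarrow> blin V N UNIV norm (h b :: 'a \<Rightarrow> complex)"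
    "\<And>b c. b \<in> B \<Longrightarrow> c \<in> B \<Longrightarrow> h b c = (if b = c then 1 else 0)"
    by blast
  define z' where "z' = z - (\<Sum>b\<in>B. scaleC (h b z) b)"
  have "(\<Sum>b\<in>B. scaleC (h b z) b) \<in> cspan B"
    by (intro cvec.span_sum cvec.span_scale cvec.span_base)
  then have z'0: "z' \<noteq> 0"
    using z by (auto simp: z'_def)
  have sumV: "(\<Sum>b\<in>B. scaleC (h b z) b) \<in> V"
    using BV by (intro norm_on_sum_mem[OF N] norm_on_scale_mem[OF N]) auto
  have z'V: "z' \<in> V"
    unfolding z'_def by (rule norm_on_diff_mem[OF N zV sumV])
  have Nz': "N z' \<noteq> 0"
    using norm_on_eq_0[OF N z'V] z'0 by simp
  obtain g0 :: "'a \<Rightarrow> complex" where g0: "blin V N UNIV norm g0" "g0 z' = of_real (N z')"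
    using norming_functional[OF N z'V] by blast
  define g where "g x = scaleC (of_real (1 / N z')) (g0 x)" for x
  have "blin V N UNIV norm g"
    unfolding g_def by (rule blin_scale_map[OF g0(1) norm_on_norm])
  moreover have "g z' = 1"
    using Nz' by (simp add: g_def g0 scaleC_complex_def)
  ultimately have g: "blin V N UNIV norm g" "g z' = 1" .
  define g' where "g' x = g x - (\<Sum>b\<in>B. scaleC (g b) (h b x))" for x
  have g': "blin V N UNIV norm g'"
    unfolding g'_def
    by (rule blin_diff_map[OF g(1) blin_sum_map[OF blin_scale_map[OF h(1) norm_on_norm] norm_on_norm]
          norm_on_norm])
  have g'B: "g' c = 0" if "c \<in> B" for c
  proof -
    have "(\<Sum>b\<in>B. scaleC (g b) (h b c)) = (\<Sum>b\<in>B. if b = c then g c else 0)"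
      using that by (intro sum.cong refl) (simp add: h scaleC_complex_def)
    then show ?thesis
      using that insert.hyps by (simp add: g'_def)
  qed
  \<comment> \<open>Correcting \<open>g\<close> on \<open>B\<close> has the same effect at
    \<open>z\<close> as replacing \<open>z\<close> by \<open>z'\<close>, so the corrected functional
    takes the value 1 there.\<close>
  have "g z' = g z - (\<Sum>b\<in>B. h b z * g b)"
    unfolding z'_def blin_diff[OF N g(1) zV sumV] using BV
    by (subst blin_sum[OF N g(1)])
      (auto simp: norm_on_scale_mem[OF N] subset_iff blin_scale[OF g(1)] scaleC_complex_def intro!: sum.cong)
  then have g'z: "g' z = 1"
    using g(2) by (simp add: g'_def scaleC_complex_def mult.commute)
  define h' where "h' b x = (if b = z then g' x else h b x - scaleC (h b z) (g' x))" for b x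
  show ?case
  proof (intro exI[of _ h'] ballI conjI)
    fix b assume b: "b \<in> insert z B"
    show "blin V N UNIV norm (h' b)"
    proof (cases "b = z")
      case True
      then show ?thesis
        using g' by (simp add: h'_def[abs_def])
    next
      case False
      then have "blin V N UNIV norm (\<lambda>x. h b x - scaleC (h b z) (g' x))"
        using b by (intro blin_diff_map[OF h(1) blin_scale_map[OF g' norm_on_norm] norm_on_norm]) auto
      then show ?thesis
        using False by (simp add: h'_def[abs_def])
    qed
    fix c assume c: "c \<in> insert z B"
    show "h' b c = (if b = c then 1 else 0)"
      using b c insert.hyps(2) by (auto simp: h'_def g'z g'B h(2) scaleC_complex_def)
  qed
qed auto

lemma dual_basis_expand:
  assumes N: "norm_on V N" and B: "finite B" "B \<subseteq> V"
    and h: "\<And>b. b \<in> B \<Longrightarrow> blin V N UNIV norm (h b :: 'a::complex_vector \<Rightarrow> complex)"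
      "\<And>b c. b \<in> B \<Longrightarrow> c \<in> B \<Longrightarrow> h b c = (if b = c then 1 else 0)"
    and u: "u \<in> cspan B"
  shows "(\<Sum>b\<in>B. scaleC (h b u) b) = u"
proof -
  obtain a where a: "u = (\<Sum>b\<in>B. scaleC (a b) b)"
    using u unfolding cvec.span_finite[OF B(1)] by auto
  have "h b u = a b" if b: "b \<in> B" for b
  proof -
    have "h b u = (\<Sum>c\<in>B. h b (scaleC (a c) c))"
      unfolding a using B by (intro blin_sum[OF N h(1)[OF b]] norm_on_scale_mem[OF N]) auto
    also have "\<dots> = (\<Sum>c\<in>B. if b = c then a b else 0)"
      using B b by (intro sum.cong refl) (auto simp: blin_scale[OF h(1)[OF b]] h(2) scaleC_complex_def)
    finally show ?thesis
      using B b by simp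
  qed
  then show ?thesis
    using a by simp
qed

lemma finite_basis:
  assumes "G \<subseteq> cspan B" "finite B" "csubspace G"
  obtains B' where "finite B'" "card B' \<le> card B" "B' \<subseteq> G" "cvec.independent B'" "G = cspan B'"
proof -
  obtain B' where B': "B' \<subseteq> G" "cvec.independent B'" "G \<subseteq> cspan B'"
    using cvec.maximal_independent_subset by blast
  then have "finite B' \<and> card B' \<le> card B"
    using cvec.independent_span_bound[OF assms(2), of B'] assms(1) by blast
  moreover have "cspan B' \<subseteq> G"
    by (rule cvec.span_minimal[OF B'(1) assms(3)])
  ultimately show ?thesis
    using that B' by blast
qed

text \<open>The functionals embed \<open>Z\<close> linearly into a coordinate space of dimension
  \<open>r\<close>.\<close>

lemma independent_card_le_functionals:
  fixes h :: "nat \<Rightarrow> 'a::complex_vector \<Rightarrow> complex"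
  assumes N: "norm_on V N" and Z: "csubspace Z" "Z \<subseteq> V"
    and h: "\<And>l. l < r \<Longrightarrow> blin V N UNIV norm (h l)"
    and inj: "\<And>x. x \<in> Z \<Longrightarrow> (\<And>l. l < r \<Longrightarrow> h l x = 0) \<Longrightarrow> x = 0"
    and B: "B \<subseteq> Z" "cvec.independent B"
  shows "finite B \<and> card B \<le> r"
proof -
  \<comment> \<open>Coordinate space is modelled by sequences that vanish from \<open>r\<close> on,
    spanned by the unit sequences \<open>e\<close>.\<close>
  define \<Phi> where "\<Phi> x = (\<lambda>l. if l < r then h l x else 0)" for x
  define e where "e k = (\<lambda>l. if l = k then 1 else 0 :: complex)" for k :: nat
  have inj': "x = y" if "x \<in> Z" "y \<in> Z" "\<Phi> x = \<Phi> y" for x y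
  proof -
    have "h l (x - y) = 0" if "l < r" for l
    proof -
      have "h l x = h l y"
        using fun_cong[OF \<open>\<Phi> x = \<Phi> y\<close>, of l] that by (simp add: \<Phi>_def)
      then show ?thesis
        using blin_diff[OF N h[OF that], of x y] \<open>x \<in> Z\<close> \<open>y \<in> Z\<close> Z(2) by auto
    qed
    then have "x - y = 0"
      using inj cvec.subspace_diff[OF Z(1)] that by blast
    then show ?thesis
      by simp
  qed
  have le: "card B0 \<le> r" if B0: "B0 \<subseteq> B" "finite B0" for B0
  proof -
    have B0Z: "B0 \<subseteq> Z" and ind: "cvec.independent B0"
      using B0 B cvec.independent_mono by auto
    have inj_on: "inj_on \<Phi> B0"
      using inj' B0Z by (auto simp: inj_on_def)
    have "cvec.independent (\<Phi> ` B0)"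
    proof (rule cvec.independent_if_scalars_zero)
      fix f y assume s: "(\<Sum>y\<in>\<Phi> ` B0. scaleC (f y) y) = 0" and y: "y \<in> \<Phi> ` B0"
      obtain b where b: "b \<in> B0" "y = \<Phi> b"
        using y by blast
      let ?u = "\<Sum>b\<in>B0. scaleC (f (\<Phi> b)) b"
      have uZ: "?u \<in> Z"
        using B0Z by (intro cvec.subspace_sum[OF Z(1)] cvec.subspace_scale[OF Z(1)]) auto
      have "h l ?u = 0" if l: "l < r" for l
      proof -
        have "h l ?u = (\<Sum>b\<in>B0. h l (scaleC (f (\<Phi> b)) b))"
          using B0Z Z(2) by (intro blin_sum[OF N h[OF l]] norm_on_scale_mem[OF N]) auto
        also have "\<dots> = (\<Sum>b\<in>B0. scaleC (f (\<Phi> b)) (\<Phi> b) l)"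
          using B0Z Z(2) l
          by (intro sum.cong refl)
            (auto simp: blin_scale[OF h[OF l]] subset_iff scaleC_fun_def \<Phi>_def)
        also have "\<dots> = (\<Sum>y\<in>\<Phi> ` B0. scaleC (f y) y) l"
          by (simp add: sum.reindex[OF inj_on] sum_fun_apply)
        finally show ?thesis
          by (simp add: s)
      qed
      then have "?u = 0"
        using inj uZ by blast
      then show "f y = 0"
        using cvec.independentD[OF ind B0(2) order_refl, of "\<lambda>b. f (\<Phi> b)" b] b by simp
    qed (use B0 in simp)
    moreover have "\<Phi> ` B0 \<subseteq> cspan (e ` {..<r})"
    proof
      fix y assume "y \<in> \<Phi> ` B0"
      then obtain b where "y = \<Phi> b"
        by blast
      then have "y = (\<Sum>l<r. scaleC (h l b) (e l))"
        by (auto simp: fun_eq_iff \<Phi>_def e_def sum_fun_apply scaleC_fun_def scaleC_complex_def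
            if_distrib[of "\<lambda>u. _ * u"] cong: if_cong)
      then show "y \<in> cspan (e ` {..<r})"
        by (simp only:) (intro cvec.span_sum cvec.span_scale cvec.span_base imageI)
    qed
    ultimately have "card (\<Phi> ` B0) \<le> card (e ` {..<r})"
      using cvec.independent_span_bound[of "e ` {..<r}" "\<Phi> ` B0"] by simp
    also have "\<dots> \<le> r"
      using card_image_le[of "{..<r}" e] by simp
    finally show ?thesis
      by (simp add: card_image[OF inj_on])
  qed
  have "finite B"
  proof (rule ccontr)
    assume "infinite B"
    then obtain B0 where "finite B0" "card B0 = Suc r" "B0 \<subseteq> B"
      using infinite_arbitrarily_large by blast
    then show False
      using le[of B0] by simp
  qed
  then show ?thesis
    using le by blast
qed

lemma finite_dim_if_independent_bounded:
  assumes "\<And>B. B \<subseteq> Z \<Longrightarrow> cvec.independent B \<Longrightarrow> finite B \<and> card B \<le> r"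
  obtains B where "finite B" "card B \<le> r" "B \<subseteq> Z" "cvec.independent B" "Z \<subseteq> cspan B"
proof -
  obtain B where B: "B \<subseteq> Z" "cvec.independent B" "Z \<subseteq> cspan B"
    using cvec.maximal_independent_subset[of Z] by blast
  with assms[of B] that[of B] show ?thesis
    by simp
qed

text \<open>If \<open>f - f T f\<close> has finite rank, then \<open>T\<close> can be corrected on the finite-dimensional
  space \<open>(f - f T f) V\<close>, which lies in the range of \<open>f\<close>, to a generalised inverse.\<close>

lemma generalised_inverse:
  fixes f :: "'a::complex_vector \<Rightarrow> 'b::complex_vector"
  assumes N: "norm_on V N" and M: "norm_on W M" and f: "blin V N W M f" and T: "blin W M V N T"
    and B: "finite B" "\<And>x. x \<in> V \<Longrightarrow> f x - f (T (f x)) \<in> cspan B"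
  shows "\<exists>g. blin W M V N g \<and> (\<forall>x\<in>V. f (g (f x)) = f x)"
proof -
  define D where "D x = f x - f (T (f x))" for x
  have D: "blin V N W M D"
    unfolding D_def by (rule blin_diff_map[OF f blin_comp[OF blin_comp[OF f T M] f N] M])
  have DB: "D ` V \<subseteq> cspan B"
    using B(2) unfolding D_def by blast
  obtain B' where
    B': "finite B'" "card B' \<le> card B" "B' \<subseteq> D ` V" "cvec.independent B'" "D ` V = cspan B'"
    by (rule finite_basis[OF DB B(1) csubspace_blin_image[OF N D]])
  have B'W: "B' \<subseteq> W"
    using B'(3) blin_mem[OF D] by blast
  from dual_basis[OF M B'(1) B'W B'(4)] obtain h where
    h: "\<And>b. b \<in> B' \<Longrightarrow> blin W M UNIV norm (h b :: 'b \<Rightarrow> complex)"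
      "\<And>b c. b \<in> B' \<Longrightarrow> c \<in> B' \<Longrightarrow> h b c = (if b = c then 1 else 0)"
    by blast
  \<comment> \<open>The residual \<open>D x\<close> is \<open>f (x - T (f x))\<close>, so every
    basis vector of the residual space has a preimage under \<open>f\<close>.\<close>
  have "\<forall>b\<in>B'. \<exists>v\<in>V. f v = b"
  proof
    fix b assume "b \<in> B'"
    then obtain x where x: "x \<in> V" "b = D x"
      using B'(3) by blast
    have "T (f x) \<in> V"
      by (intro blin_mem[OF T] blin_mem[OF f] x)
    then have "x - T (f x) \<in> V" "f (x - T (f x)) = b"
      using x by (simp_all add: norm_on_diff_mem[OF N] blin_diff[OF N f] D_def)
    then show "\<exists>v\<in>V. f v = b"
      by blast
  qed
  then obtain v where v: "\<And>b. b \<in> B' \<Longrightarrow> v b \<in> V \<and> f (v b) = b"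
    by metis
  \<comment> \<open>A lift of the residual \<open>y - f (T y)\<close> is added to
    \<open>T y\<close>. For \<open>y\<close> in the range of \<open>f\<close> the residual lies in
    \<open>cspan B'\<close>, where the dual basis reproduces it, so
    \<open>f (g y) = y\<close>.\<close>
  define g where "g y = T y + (\<Sum>b\<in>B'. scaleC (h b (y - f (T y))) (v b))" for y
  have R: "blin W M W M (\<lambda>y. y - f (T y))"
    by (rule blin_diff_map[OF blin_id blin_comp[OF T f N] M])
  show ?thesis
  proof (intro exI[of _ g] conjI ballI)
    show "blin W M V N g"
      unfolding g_def
      by (rule blin_add_map[OF T blin_sum_map[OF
            blin_functional_scale[OF blin_comp[OF R h(1) M] N] N] N]) (use v in blast)+
    fix x assume x: "x \<in> V"
    have Tfx: "T (f x) \<in> V"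
      by (intro blin_mem[OF T] blin_mem[OF f] x)
    have "f (\<Sum>b\<in>B'. scaleC (h b (D x)) (v b)) = (\<Sum>b\<in>B'. f (scaleC (h b (D x)) (v b)))"
      using v by (intro blin_sum[OF N f] norm_on_scale_mem[OF N]) auto
    also have "\<dots> = (\<Sum>b\<in>B'. scaleC (h b (D x)) b)"
      using v by (intro sum.cong refl) (simp add: blin_scale[OF f])
    also have "\<dots> = D x"
      using B'(5) x by (intro dual_basis_expand[OF M B'(1) B'W h]) auto
    finally have "f (\<Sum>b\<in>B'. scaleC (h b (D x)) (v b)) = D x" .
    moreover have "(\<Sum>b\<in>B'. scaleC (h b (D x)) (v b)) \<in> V"
      using v by (intro norm_on_sum_mem[OF N] norm_on_scale_mem[OF N]) auto
    ultimately show "f (g (f x)) = f x"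
      using Tfx by (simp add: g_def D_def[symmetric] blin_add[OF f]) (simp add: D_def)
  qed
qed

text \<open>If the adjoint of \<open>f\<close> were bounded below, successive approximation would
  make \<open>f\<close> onto. So some vector stays away from the images of balls, and Hahn-Banach
  for a seminorm that combines the distance to \<open>f v\<close> with a cost \<open>e * N v\<close>
  yields a functional that the adjoint nearly annihilates.\<close>

lemma adjoint_small:
  assumes V: "banach_on V N" and W: "banach_on W M" and f: "blin V N W M f"
    and surj: "y\<^sub>0 \<in> W" "y\<^sub>0 \<notin> f ` V" and e: "0 < e"
  obtains x\<^sub>0 and \<psi> :: "'b::complex_vector \<Rightarrow> complex" where "x\<^sub>0 \<in> W" "M x\<^sub>0 = 1" "\<psi> x\<^sub>0 = 1"
    "blin W M UNIV norm \<psi>" "\<And>x. x \<in> W \<Longrightarrow> cmod (\<psi> x) \<le> 2 * M x"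
    "\<And>v. v \<in> V \<Longrightarrow> cmod (\<psi> (f v)) \<le> e * N v"
proof -
  note N = banach_on_norm_on[OF V] and M = banach_on_norm_on[OF W]
  \<comment> \<open>Otherwise \<open>approx_surj\<close> with \<open>K = 1 / e\<close> and
    \<open>q = 1 / 2\<close> would reach \<open>y\<^sub>0\<close>.\<close>
  have "\<exists>y\<in>W. \<forall>x\<in>V. \<not> (N x \<le> 1 / e * M y \<and> M (y - f x) \<le> 1 / 2 * M y)"
  proof (rule ccontr)
    assume "\<not> ?thesis"
    then have "\<exists>x\<in>V. N x \<le> 1 / e * M y \<and> M (y - f x) \<le> 1 / 2 * M y" if "y \<in> W" for y
      using that by blast
    from approx_surj[OF V M f _ _ this surj(1)] e surj(2) show False
      by auto
  qed
  then obtain y where y: "y \<in> W"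
    and yf: "\<And>x. x \<in> V \<Longrightarrow> N x \<le> 1 / e * M y \<Longrightarrow> 1 / 2 * M y < M (y - f x)"
    by force
  have "0 \<le> 1 / e * M y"
    using e norm_on_nonneg[OF M y] by simp
  then have My: "M y > 0"
    using yf[OF norm_on_zero_mem[OF N]] by (simp add: norm_on_zero[OF N] blin_zero[OF N f])
  define x\<^sub>0 where "x\<^sub>0 = scaleC (of_real (1 / M y)) y"
  have x0: "x\<^sub>0 \<in> W" "M x\<^sub>0 = 1"
    using My norm_on_scale_mem[OF M y] norm_on_scale[OF M y]
    by (auto simp: x\<^sub>0_def norm_divide)
  have x0f: "1 / 2 < M (x\<^sub>0 - f v)" if v: "v \<in> V" "N v \<le> 1 / e" for v
  proof -
    let ?v = "scaleC (of_real (M y)) v"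
    have "?v \<in> V" "N ?v \<le> 1 / e * M y"
      using v My mult_right_mono[OF v(2), of "M y"]
      by (auto simp: norm_on_scale_mem[OF N] norm_on_scale[OF N] mult.commute)
    then have "1 / 2 * M y < M (y - f ?v)"
      by (rule yf)
    also have "y - f ?v = scaleC (of_real (M y)) (x\<^sub>0 - f v)"
      using My by (simp add: x\<^sub>0_def blin_scale[OF f v(1)] cvec.scale_right_diff_distrib scaleC_scaleC
          scaleC_one flip: of_real_mult)
    also have "M \<dots> = M y * M (x\<^sub>0 - f v)"
      using My norm_on_scale[OF M norm_on_diff_mem[OF M x0(1) blin_mem[OF f v(1)]]] by simp
    finally show ?thesis
      using My by (simp add: mult.commute)
  qed
  \<comment> \<open>The infimum \<open>p\<close> is the largest seminorm below \<open>2 * M\<close>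
    whose value at \<open>f v\<close> is at most \<open>e * N v\<close>. The factor 2 compensates
    for the distance \<open>1 / 2\<close> found above, so that \<open>p x\<^sub>0\<close> is at
    least 1.\<close>
  define F where "F u v = e * N v + 2 * M (u - f v)" for u v
  define p where "p u = (INF v\<in>V. F u v)" for u
  have F_nn: "0 \<le> F u v" if "u \<in> W" "v \<in> V" for u v
    unfolding F_def using that e
    by (intro add_nonneg_nonneg mult_nonneg_nonneg norm_on_nonneg[OF N] norm_on_nonneg[OF M]
        norm_on_diff_mem[OF M] blin_mem[OF f]) auto
  have p_le: "p u \<le> F u v" if "u \<in> W" "v \<in> V" for u v
    unfolding p_def using that F_nn by (auto intro!: cINF_lower bdd_belowI[of _ 0])
  have p_ge: "c \<le> p u" if "\<And>v. v \<in> V \<Longrightarrow> c \<le> F u v" for u c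
    unfolding p_def using that norm_on_zero_mem[OF N] by (auto intro!: cINF_greatest)
  have F_add: "F (u + u') (v + v') \<le> F u v + F u' v'"
    if u: "u \<in> W" "u' \<in> W" and v: "v \<in> V" "v' \<in> V" for u u' v v'
  proof -
    have "(u + u') - f (v + v') = (u - f v) + (u' - f v')"
      by (simp add: blin_add[OF f v])
    then have "M ((u + u') - f (v + v')) \<le> M (u - f v) + M (u' - f v')"
      using norm_on_triangle[OF M norm_on_diff_mem[OF M u(1) blin_mem[OF f v(1)]]
          norm_on_diff_mem[OF M u(2) blin_mem[OF f v(2)]]] by (simp only:)
    moreover have "e * N (v + v') \<le> e * N v + e * N v'"
      using mult_left_mono[OF norm_on_triangle[OF N v], of e] e by (simp add: distrib_left)
    ultimately show ?thesis
      by (simp add: F_def)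
  qed
  have F_scale: "F (scaleC c u) (scaleC c v) = cmod c * F u v" if "u \<in> W" "v \<in> V" for u v c
  proof -
    have "scaleC c u - f (scaleC c v) = scaleC c (u - f v)"
      by (simp add: blin_scale[OF f that(2)] cvec.scale_right_diff_distrib)
    then have "M (scaleC c u - f (scaleC c v)) = cmod c * M (u - f v)"
      using norm_on_scale[OF M norm_on_diff_mem[OF M that(1) blin_mem[OF f that(2)]]] by simp
    then show ?thesis
      by (simp add: F_def norm_on_scale[OF N that(2)] algebra_simps)
  qed
  have p_scale_le: "p (scaleC c u) \<le> cmod c * p u" if u: "u \<in> W" for u c
  proof (cases "c = 0")
    case True
    then show ?thesis
      using p_le[OF norm_on_zero_mem[OF M] norm_on_zero_mem[OF N]]
      by (simp add: F_def norm_on_zero[OF N] norm_on_zero[OF M] blin_zero[OF N f])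
  next
    case False
    have "p (scaleC c u) / cmod c \<le> p u"
    proof (rule p_ge)
      fix v assume v: "v \<in> V"
      have "p (scaleC c u) \<le> cmod c * F u v"
        using p_le[OF norm_on_scale_mem[OF M u] norm_on_scale_mem[OF N v], of c c]
        by (simp add: F_scale[OF u v])
      then show "p (scaleC c u) / cmod c \<le> F u v"
        using False by (simp add: field_simps)
    qed
    then show ?thesis
      using False by (simp add: field_simps)
  qed
  have sn: "seminorm_on W p"
    unfolding seminorm_on_def
  proof (intro conjI ballI allI)
    fix u u' assume u: "u \<in> W" "u' \<in> W"
    have "p (u + u') - F u' v' \<le> p u" if v': "v' \<in> V" for v'
    proof (rule p_ge)
      fix v assume v: "v \<in> V"
      have "p (u + u') \<le> F (u + u') (v + v')"
        by (intro p_le norm_on_add_mem[OF M] norm_on_add_mem[OF N] u v v')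
      also have "\<dots> \<le> F u v + F u' v'"
        by (rule F_add[OF u v v'])
      finally show "p (u + u') - F u' v' \<le> F u v"
        by simp
    qed
    then have "p (u + u') - p u \<le> p u'"
      by (intro p_ge) (simp add: algebra_simps)
    then show "p (u + u') \<le> p u + p u'"
      by simp
  next
    fix u c assume u: "u \<in> W"
    show "p (scaleC c u) = cmod c * p u"
    proof (cases "c = 0")
      case True
      have "0 \<le> p 0"
        by (intro p_ge F_nn norm_on_zero_mem[OF M])
      then show ?thesis
        using p_scale_le[OF u, of c] True by simp
    next
      case False
      have "p (scaleC (1 / c) (scaleC c u)) \<le> cmod (1 / c) * p (scaleC c u)"
        by (rule p_scale_le[OF norm_on_scale_mem[OF M u]])
      then have "p u * cmod c \<le> p (scaleC c u)"
        using False by (simp add: scaleC_scaleC scaleC_one norm_divide field_simps)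
      then show ?thesis
        using p_scale_le[OF u, of c] by (simp add: mult.commute)
    qed
  qed
  \<comment> \<open>A long \<open>v\<close> costs \<open>e * N v\<close>, which is at least 1; for a
    short \<open>v\<close> the distance term alone exceeds 1.\<close>
  have p0: "1 \<le> p x\<^sub>0"
  proof (rule p_ge)
    fix v assume v: "v \<in> V"
    have nn: "0 \<le> N v" "0 \<le> M (x\<^sub>0 - f v)"
      by (intro norm_on_nonneg[OF N] norm_on_nonneg[OF M] norm_on_diff_mem[OF M] blin_mem[OF f] v x0)+
    show "1 \<le> F x\<^sub>0 v"
    proof (cases "N v \<le> 1 / e")
      case True
      then show ?thesis
        using x0f[OF v True] nn e by (simp add: F_def add_increasing)
    next
      case False
      then have "1 \<le> e * N v"
        using e by (simp add: field_simps)
      then show ?thesis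
        using nn by (simp add: F_def)
    qed
  qed
  have p_M: "p x \<le> 2 * M x" if "x \<in> W" for x
    using p_le[OF that norm_on_zero_mem[OF N]]
    by (simp add: F_def norm_on_zero[OF N] blin_zero[OF N f])
  have p_f: "p (f v) \<le> e * N v" if "v \<in> V" for v
    using p_le[OF blin_mem[OF f that] that] by (simp add: F_def norm_on_zero[OF M])
  obtain \<phi> :: "'b \<Rightarrow> complex" where \<phi>: "\<And>x y. x \<in> W \<Longrightarrow> y \<in> W \<Longrightarrow> \<phi> (x + y) = \<phi> x + \<phi> y"
    "\<And>c x. x \<in> W \<Longrightarrow> \<phi> (scaleC c x) = c * \<phi> x"
    "\<And>x. x \<in> W \<Longrightarrow> cmod (\<phi> x) \<le> p x" "\<phi> x\<^sub>0 = of_real (p x\<^sub>0)"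
    using hahn_banach[OF norm_on_subspace[OF M] sn x0(1)] by blast
  \<comment> \<open>Dividing by \<open>p x\<^sub>0\<close>, which is at least 1, normalises the
    value at \<open>x\<^sub>0\<close> without spoiling the bounds.\<close>
  define \<psi> where "\<psi> x = \<phi> x / of_real (p x\<^sub>0)" for x
  have \<psi>_le: "cmod (\<psi> x) \<le> p x" if "x \<in> W" for x
  proof -
    have "cmod (\<psi> x) = cmod (\<phi> x) / p x\<^sub>0"
      using p0 by (simp add: \<psi>_def norm_divide)
    also have "\<dots> \<le> cmod (\<phi> x) / 1"
      using p0 by (intro divide_left_mono) auto
    finally show ?thesis
      using \<phi>(3)[OF that] by simp
  qed
  show ?thesis
  proof (rule that[OF x0])
    show "\<psi> x\<^sub>0 = 1"
      using p0 by (simp add: \<psi>_def \<phi>)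
    show le: "cmod (\<psi> x) \<le> 2 * M x" if "x \<in> W" for x
      using \<psi>_le[OF that] p_M[OF that] by simp
    show "cmod (\<psi> (f v)) \<le> e * N v" if "v \<in> V" for v
      using \<psi>_le[OF blin_mem[OF f that]] p_f[OF that] by simp
    show "blin W M UNIV norm \<psi>"
      by (rule blinI[where K = 2]) (auto simp: \<psi>_def \<phi> add_divide_distrib scaleC_complex_def le[unfolded \<psi>_def])
  qed
qed

lemma bounded_inverse:
  assumes V: "banach_on V N" and W: "banach_on W M" and f: "blin V N W M f" and bij: "bij_betw f V W"
  obtains g where "blin W M V N g" "\<And>x. x \<in> V \<Longrightarrow> g (f x) = x" "\<And>y. y \<in> W \<Longrightarrow> f (g y) = y"
proof -
  note N = banach_on_norm_on[OF V] and M = banach_on_norm_on[OF W]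
  obtain K where K: "K > 0" "\<And>y. y \<in> W \<Longrightarrow> \<exists>x\<in>V. f x = y \<and> N x \<le> K * M y"
    using open_mapping[OF V W f bij_betw_imp_surj_on[OF bij]] by blast
  define g where "g = inv_into V f"
  have gf: "g (f x) = x" if "x \<in> V" for x
    unfolding g_def by (rule bij_betw_inv_into_left[OF bij that])
  have fg: "f (g y) = y" if "y \<in> W" for y
    unfolding g_def by (rule bij_betw_inv_into_right[OF bij that])
  have gV: "g y \<in> V" if "y \<in> W" for y
    using that bij unfolding g_def by (simp add: bij_betw_imp_surj_on inv_into_into)
  show ?thesis
  proof (rule that[OF _ gf fg])
    show "blin W M V N g"
    proof (rule blinI[where K = K])
      show "g (x + y) = g x + g y" if "x \<in> W" "y \<in> W" for x y
      proof -
        have "f (g x + g y) = x + y"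
          using that by (simp add: blin_add[OF f] gV fg)
        then show ?thesis
          using gf[of "g x + g y"] that norm_on_add_mem[OF N gV gV] by simp
      qed
      show "g (scaleC c x) = scaleC c (g x)" if "x \<in> W" for c x
      proof -
        have "f (scaleC c (g x)) = scaleC c x"
          using that by (simp add: blin_scale[OF f] gV fg)
        then show ?thesis
          using gf[of "scaleC c (g x)"] that norm_on_scale_mem[OF N gV] by simp
      qed
      show "N (g y) \<le> K * M y" if "y \<in> W" for y
        using K(2)[OF that] gf by auto
    qed (rule gV)
  qed
qed

lemma blin_restrict:
  assumes f: "blin V N W M f" and "V' \<subseteq> V"
  shows "blin V' N W M f"
proof -
  obtain K where "\<forall>x\<in>V. M (f x) \<le> K * N x"
    using f unfolding blin_def by blast
  with assms(2) show ?thesis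
    by (intro blinI[where K = K] blin_mem[OF f] blin_add[OF f] blin_scale[OF f]) auto
qed

lemma blin_corestrict:
  assumes f: "blin V N W M f" and "f ` V \<subseteq> W'"
  shows "blin V N W' M f"
proof -
  obtain K where "\<forall>x\<in>V. M (f x) \<le> K * N x"
    using f unfolding blin_def by blast
  with assms(2) show ?thesis
    by (intro blinI[where K = K] blin_add[OF f] blin_scale[OF f]) auto
qed

section \<open>Precompact seminorms\<close>

text \<open>For \<open>q x = M (U x)\<close> with a linear \<open>U\<close> and a complete norm
  \<open>M\<close> this says that \<open>U\<close> is compact. Using the seminorm keeps the operator
  and its target out of the estimates.\<close>

definition precompact_on :: "'a::ab_group_add set \<Rightarrow> ('a \<Rightarrow> real) \<Rightarrow> ('a \<Rightarrow> real) \<Rightarrow> bool"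
  where "precompact_on V N q \<longleftrightarrow> (\<forall>s C. (\<forall>n. s n \<in> V \<and> N (s n) \<le> C) \<longrightarrow>
    (\<exists>r::nat \<Rightarrow> nat. strict_mono r \<and> cauchy_on q (s \<circ> r)))"

lemma cauchy_on_subseq: "cauchy_on q s \<Longrightarrow> strict_mono r \<Longrightarrow> cauchy_on q (s \<circ> r)"
  unfolding cauchy_on_def
proof (intro allI impI)
  fix e :: real assume s: "\<forall>e>0. \<exists>M. \<forall>m\<ge>M. \<forall>n\<ge>M. q (s m - s n) < e" and r: "strict_mono r" and "e > 0"
  then obtain M where M: "\<And>m n. m \<ge> M \<Longrightarrow> n \<ge> M \<Longrightarrow> q (s m - s n) < e"
    by blast
  have "r m \<ge> M" if "m \<ge> M" for m
    using seq_suble[OF r, of m] that by simp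
  then show "\<exists>M. \<forall>m\<ge>M. \<forall>n\<ge>M. q ((s \<circ> r) m - (s \<circ> r) n) < e"
    using M by (intro exI[of _ M]) auto
qed

lemma cauchy_onD: "cauchy_on q s \<Longrightarrow> 0 < e \<Longrightarrow> \<exists>M. \<forall>m\<ge>M. \<forall>n\<ge>M. q (s m - s n) < e"
  by (simp add: cauchy_on_def)

lemma precompact_onD:
  assumes "precompact_on V N q" "\<And>n. s n \<in> V" "\<And>n. N (s n) \<le> C"
  shows "\<exists>r::nat \<Rightarrow> nat. strict_mono r \<and> cauchy_on q (s \<circ> r)"
  using assms(1)[unfolded precompact_on_def, rule_format, of s C] assms(2,3) by simp

lemma cauchy_on_add:
  assumes "cauchy_on p t" "cauchy_on q t"
  shows "cauchy_on (\<lambda>x. p x + q x) t"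
  unfolding cauchy_on_def
proof (intro allI impI)
  fix e :: real assume "e > 0"
  then have e: "e / 2 > 0"
    by simp
  obtain M where M: "\<And>m n. m \<ge> M \<Longrightarrow> n \<ge> M \<Longrightarrow> p (t m - t n) < e / 2"
    using cauchy_onD[OF assms(1) e] by blast
  obtain M' where M': "\<And>m n. m \<ge> M' \<Longrightarrow> n \<ge> M' \<Longrightarrow> q (t m - t n) < e / 2"
    using cauchy_onD[OF assms(2) e] by blast
  show "\<exists>M. \<forall>m\<ge>M. \<forall>n\<ge>M. p (t m - t n) + q (t m - t n) < e"
  proof (intro exI allI impI)
    fix m n assume "max M M' \<le> m" "max M M' \<le> n"
    then show "p (t m - t n) + q (t m - t n) < e"
      using M[of m n] M'[of m n] by simp
  qed
qed

lemma precompact_on_add: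
  fixes V :: "'a::ab_group_add set"
  assumes p: "precompact_on V N p" and q: "precompact_on V N q"
  shows "precompact_on V N (\<lambda>x. p x + q x)"
  unfolding precompact_on_def
proof (intro allI impI)
  fix s :: "nat \<Rightarrow> 'a" and C assume s: "\<forall>n. s n \<in> V \<and> N (s n) \<le> C"
  have "s n \<in> V" "N (s n) \<le> C" for n
    using s by simp_all
  from precompact_onD[where s = s, OF p this] obtain r :: "nat \<Rightarrow> nat"
    where r: "strict_mono r" "cauchy_on p (s \<circ> r)"
    by (elim exE conjE)
  have "(s \<circ> r) n \<in> V" "N ((s \<circ> r) n) \<le> C" for n
    using s by simp_all
  from precompact_onD[where s = "s \<circ> r", OF q this] obtain r' :: "nat \<Rightarrow> nat"
    where r': "strict_mono r'" "cauchy_on q (s \<circ> r \<circ> r')"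
    by (elim exE conjE)
  have "cauchy_on (\<lambda>x. p x + q x) (s \<circ> r \<circ> r')"
    by (rule cauchy_on_add[OF cauchy_on_subseq[OF r(2) r'(1)] r'(2)])
  then have "cauchy_on (\<lambda>x. p x + q x) (s \<circ> (r \<circ> r'))"
    by (simp only: o_assoc)
  moreover have "strict_mono (r \<circ> r')"
    by (rule strict_mono_o[OF r(1) r'(1)])
  ultimately show "\<exists>r::nat \<Rightarrow> nat. strict_mono r \<and> cauchy_on (\<lambda>x. p x + q x) (s \<circ> r)"
    by (intro exI[of _ "r \<circ> r'"] conjI)
qed

lemma precompact_on_zero: "precompact_on V N (\<lambda>x. 0)"
  unfolding precompact_on_def cauchy_on_def
  by (intro allI impI exI[of _ id] conjI) (auto simp: strict_mono_id)

lemma precompact_on_sum: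
  assumes "\<And>i. i \<in> A \<Longrightarrow> precompact_on V N (q i)"
  shows "precompact_on V N (\<lambda>x. \<Sum>i\<in>A. q i x)"
  using assms
  by (induction A rule: infinite_finite_induct) (simp_all add: precompact_on_zero precompact_on_add)

lemma precompact_on_comp:
  fixes V :: "'a::complex_vector set"
  assumes N: "norm_on V N" and U: "blin V N W M U" and q: "precompact_on W M q"
  shows "precompact_on V N (\<lambda>x. q (U x))"
  unfolding precompact_on_def
proof (intro allI impI)
  fix s :: "nat \<Rightarrow> 'a" and C assume s: "\<forall>n. s n \<in> V \<and> N (s n) \<le> C"
  obtain K where K: "K > 0" "\<And>x. x \<in> V \<Longrightarrow> M (U x) \<le> K * N x"
    using blin_bound[OF N U] by blast
  have "M (U (s n)) \<le> K * C" for n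
  proof -
    have "M (U (s n)) \<le> K * N (s n)"
      using s by (intro K(2)) blast
    also have "\<dots> \<le> K * C"
      using s K(1) by (intro mult_left_mono) auto
    finally show ?thesis .
  qed
  then have "(U \<circ> s) n \<in> W" "M ((U \<circ> s) n) \<le> K * C" for n
    using s blin_mem[OF U] by simp_all
  from precompact_onD[where s = "U \<circ> s", OF q this] obtain r :: "nat \<Rightarrow> nat"
    where r: "strict_mono r" "cauchy_on q (U \<circ> s \<circ> r)"
    by (elim exE conjE)
  have "cauchy_on (\<lambda>x. q (U x)) (s \<circ> r)"
    by (rule cauchy_on_mono[OF r(2)]) (use s in \<open>simp add: blin_diff[OF N U]\<close>)
  then show "\<exists>r::nat \<Rightarrow> nat. strict_mono r \<and> cauchy_on (\<lambda>x. q (U x)) (s \<circ> r)"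
    using r(1) by (intro exI[of _ r] conjI)
qed

lemma precompact_on_functional:
  assumes N: "norm_on V N" and h: "blin V N UNIV norm (h :: _ \<Rightarrow> complex)"
  shows "precompact_on V N (\<lambda>x. cmod (h x))"
proof -
  have "precompact_on (UNIV :: complex set) norm norm"
    unfolding precompact_on_def
  proof (intro allI impI)
    fix s :: "nat \<Rightarrow> complex" and C assume "\<forall>n. s n \<in> UNIV \<and> norm (s n) \<le> C"
    then have "bounded (range s)"
      by (auto simp: bounded_iff)
    then obtain l and r :: "nat \<Rightarrow> nat" where "strict_mono r" "(s \<circ> r) \<longlonglongrightarrow> l"
      using bounded_imp_convergent_subsequence by blast
    then show "\<exists>r::nat \<Rightarrow> nat. strict_mono r \<and> cauchy_on norm (s \<circ> r)"
      unfolding cauchy_on_norm_iff using LIMSEQ_imp_Cauchy by blast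
  qed
  from precompact_on_comp[OF N h this] show ?thesis .
qed

text \<open>A form of Peetre's lemma.\<close>

lemma drop_precompact:
  assumes V: "banach_on V N" and P: "seminorm_on V P" and PC: "\<And>x. x \<in> V \<Longrightarrow> P x \<le> C * N x"
    and P0: "\<And>x. x \<in> V \<Longrightarrow> P x = 0 \<Longrightarrow> x = 0"
    and q: "precompact_on V N q" and est: "\<And>x. x \<in> V \<Longrightarrow> N x \<le> K * P x + q x"
  shows "\<exists>K'>0. \<forall>x\<in>V. N x \<le> K' * P x"
proof (rule ccontr)
  assume no: "\<not> ?thesis"
  note N = banach_on_norm_on[OF V]
  note sub = norm_on_subspace[OF N]
  have P_scale: "P (scaleC c x) = cmod c * P x" if "x \<in> V" for c x
    using P that unfolding seminorm_on_def by blast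
  \<comment> \<open>Failure of the claim for every constant gives unit vectors on which
    \<open>P\<close> tends to 0.\<close>
  have "\<exists>x\<in>V. N x = 1 \<and> P x \<le> 1 / real (Suc n)" for n
  proof -
    obtain x where x: "x \<in> V" "real (Suc n) * P x < N x"
      using no by (auto simp: not_le dest!: spec[of _ "real (Suc n)"])
    have Px: "0 \<le> P x"
      by (rule seminorm_on_nonneg[OF sub P x(1)])
    then have Nx: "0 < N x"
      using x(2) by (smt (verit) mult_nonneg_nonneg of_nat_0_le_iff)
    have "P (scaleC (of_real (1 / N x)) x) \<le> 1 / real (Suc n)"
      using x Nx by (simp add: P_scale norm_divide field_simps)
    moreover have "N (scaleC (of_real (1 / N x)) x) = 1"
      using x Nx by (simp add: norm_on_scale[OF N] norm_divide)
    ultimately show ?thesis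
      using norm_on_scale_mem[OF N x(1)] by blast
  qed
  then obtain s where s: "\<And>n. s n \<in> V" "\<And>n. N (s n) = 1" "\<And>n. P (s n) \<le> 1 / real (Suc n)"
    by metis
  from precompact_onD[where s = s, OF q s(1) eq_refl[OF s(2)]] obtain r :: "nat \<Rightarrow> nat"
    where r: "strict_mono r" "cauchy_on q (s \<circ> r)"
    by (elim exE conjE)
  define t where "t = s \<circ> r"
  have t: "t n \<in> V" "N (t n) = 1" "P (t n) \<le> 1 / real (Suc n)" for n
  proof -
    show "t n \<in> V" "N (t n) = 1"
      using s by (simp_all add: t_def)
    have "n \<le> r n"
      by (rule seq_suble[OF r(1)])
    then have "1 / real (Suc (r n)) \<le> 1 / real (Suc n)"
      by (intro divide_left_mono) auto
    then show "P (t n) \<le> 1 / real (Suc n)"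
      using s(3)[of "r n"] by (simp add: t_def)
  qed
  have Pnn: "0 \<le> P x" if "x \<in> V" for x
    by (rule seminorm_on_nonneg[OF sub P that])
  have Pt: "(\<lambda>n. P (t n)) \<longlonglongrightarrow> 0"
    by (rule tendsto_0_le_seq[OF LIMSEQ_inverse_real_of_nat])
      (use t Pnn in \<open>auto simp: inverse_eq_divide\<close>)
  \<comment> \<open>Along the subsequence \<open>q\<close> is Cauchy and \<open>P\<close> tends to
    0, so the estimate makes it Cauchy for \<open>N\<close>. Its limit would be a unit vector on
    which \<open>P\<close> vanishes.\<close>
  have "cauchy_on N t"
    unfolding cauchy_on_def
  proof (intro allI impI)
    fix e :: real assume e: "e > 0"
    \<comment> \<open>Positive and above \<open>K\<close>, whatever the sign of
      \<open>K\<close>.\<close>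
    define K0 where "K0 = \<bar>K\<bar> + 1"
    have "e / 2 > 0" "e / (4 * K0) > 0" "K0 > 0"
      using e by (auto simp: K0_def)
    obtain M where M: "\<And>m n. m \<ge> M \<Longrightarrow> n \<ge> M \<Longrightarrow> q (t m - t n) < e / 2"
      using cauchy_onD[OF r(2) \<open>e / 2 > 0\<close>] unfolding t_def by blast
    obtain M' where M': "\<And>n. n \<ge> M' \<Longrightarrow> P (t n) < e / (4 * K0)"
      using order_tendstoD(2)[OF Pt \<open>e / (4 * K0) > 0\<close>] unfolding eventually_sequentially by blast
    show "\<exists>M. \<forall>m\<ge>M. \<forall>n\<ge>M. N (t m - t n) < e"
    proof (intro exI allI impI)
      fix m n assume mn: "max M M' \<le> m" "max M M' \<le> n"
      have P': "P (t m - t n) \<le> P (t m) + P (t n)"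
        by (rule seminorm_on_diff[OF sub P t(1) t(1)])
      have d: "t m - t n \<in> V"
        by (rule norm_on_diff_mem[OF N t(1) t(1)])
      have "N (t m - t n) \<le> K * P (t m - t n) + q (t m - t n)"
        by (rule est[OF d])
      also have "K * P (t m - t n) \<le> K0 * P (t m - t n)"
        using Pnn[OF d] by (intro mult_right_mono) (auto simp: K0_def)
      also have "K0 * P (t m - t n) \<le> K0 * (e / (4 * K0) + e / (4 * K0))"
        using P' M'[of m] M'[of n] mn \<open>K0 > 0\<close> by (intro mult_left_mono) auto
      also have "\<dots> = e / 2"
        using \<open>K0 > 0\<close> by (simp add: field_simps)
      also have "q (t m - t n) < e / 2"
        using M mn by simp
      finally show "N (t m - t n) < e"
        by simp
    qed
  qed
  then obtain l where l: "l \<in> V" "(\<lambda>n. N (t n - l)) \<longlonglongrightarrow> 0"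
    by (rule banach_onD[OF V t(1)])
  have "P l \<le> P (t n) + C * N (t n - l)" for n
  proof -
    have "P l \<le> P (t n) + P (t n - l)"
      using seminorm_on_diff[OF sub P t(1) norm_on_diff_mem[OF N t(1) l(1)], of n n] by simp
    then show ?thesis
      using PC[OF norm_on_diff_mem[OF N t(1) l(1)], of n] by simp
  qed
  moreover have "(\<lambda>n. P (t n) + C * N (t n - l)) \<longlonglongrightarrow> 0"
    using tendsto_add[OF Pt tendsto_mult_left[OF l(2), of C]] by simp
  ultimately have "P l \<le> 0"
    using LIMSEQ_le_const by blast
  then have "l = 0"
    using P0[OF l(1)] Pnn[OF l(1)] by simp
  then have "(\<lambda>n. 1 :: real) \<longlonglongrightarrow> 0"
    using l(2) t(2) by simp
  then show False
    by (simp add: LIMSEQ_const_iff)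
qed

text \<open>The exponents are raised one coordinate at a time, so that every argument about joint
  powers only has to merge the exponents \<open>a\<close> and \<open>b\<close> in a single
  coordinate \<open>i\<close> while the others stay fixed.\<close>

lemma exponent_induct:
  fixes P :: "('i::finite \<Rightarrow> nat) \<Rightarrow> bool"
  assumes one: "P (\<lambda>_. 1)"
    and step: "\<And>e i a b. P (e(i := a)) \<Longrightarrow> P (e(i := b)) \<Longrightarrow> P (e(i := a + b))"
    and k: "1 \<le> k"
  shows "P (\<lambda>_. k)"
proof -
  have "P (\<lambda>i. if i \<in> I then k else 1)" for I :: "'i set"
    using finite[of I]
  proof (induction I)
    case (insert i I)
    let ?e = "\<lambda>j. if j \<in> I then k else 1"
    have e1: "?e(i := 1) = ?e"
      using insert.hyps by auto
    have "P (?e(i := a))" if "1 \<le> a" for a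
      using that
    proof (induction a rule: dec_induct)
      case base
      then show ?case
        using insert.IH unfolding e1 .
    next
      case (step a)
      have "P (?e(i := 1))"
        using insert.IH unfolding e1 .
      from assms(2)[OF step.IH this] show ?case
        by (simp only: Suc_eq_plus1)
    qed
    from this[OF k] have "P (?e(i := k))" .
    also have "?e(i := k) = (\<lambda>j. if j \<in> insert i I then k else 1)"
      by auto
    finally show ?case .
  qed (use one in simp)
  from this[of UNIV] show ?thesis
    by simp
qed

section \<open>Codimension and decreasing chains of subspaces\<close>

lemma codim_finite_iff:
  "codim V W < \<infinity> \<longleftrightarrow> (\<exists>B. finite B \<and> cspan (W \<union> B) = V)"
proof
  assume *: "codim V W < \<infinity>"
  show "\<exists>B. finite B \<and> cspan (W \<union> B) = V"
  proof (rule ccontr)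
    assume "\<not> ?thesis"
    then have ne: "{B. finite B \<and> cspan (W \<union> B) = V} = {}"
      by blast
    have "codim V W = \<infinity>"
      unfolding codim_def ne by (simp add: Inf_enat_def)
    then show False
      using * by simp
  qed
next
  assume "\<exists>B. finite B \<and> cspan (W \<union> B) = V"
  then obtain B where B: "finite B \<and> cspan (W \<union> B) = V" ..
  then have "codim V W \<le> enat (card B)"
    unfolding codim_def by (intro INF_lower) simp
  then show "codim V W < \<infinity>"
    by (rule le_less_trans) simp
qed

lemma codim_zero_iff:
  assumes "csubspace W"
  shows "codim V W = 0 \<longleftrightarrow> W = V"
proof
  assume 0: "codim V W = 0"
  then have "codim V W < \<infinity>"
    by simp
  then obtain B0 where B0: "B0 \<in> {B. finite B \<and> cspan (W \<union> B) = V}"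
    unfolding codim_finite_iff by blast
  have "(INF B\<in>{B. finite B \<and> cspan (W \<union> B) = V}. enat (card B)) \<in>
      (\<lambda>B. enat (card B)) ` {B. finite B \<and> cspan (W \<union> B) = V}"
    by (rule wellorder_InfI[OF imageI[OF B0]])
  then obtain B where "finite B" "cspan (W \<union> B) = V" "enat (card B) = 0"
    using 0 unfolding codim_def by auto
  then have "cspan W = V"
    by (simp add: zero_enat_def)
  then show "W = V"
    using cvec.span_eq_iff[of W] assms by simp
next
  assume "W = V"
  then have "cspan (W \<union> {}) = V"
    using cvec.span_eq_iff[of W] assms by simp
  then have "codim V W \<le> enat (card ({} :: 'a set))"
    unfolding codim_def by (intro INF_lower) simp
  then show "codim V W = 0"
    by (simp add: zero_enat_def[symmetric])
qed

lemma cdim_finite_iff: "cdim W < \<infinity> \<longleftrightarrow> (\<exists>B. finite B \<and> W \<subseteq> cspan B)"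
  by (simp add: cdim_def)

text \<open>Steinitz exchange in the quotient by \<open>M\<close>, phrased with spans so that no
  quotient space is formed.\<close>

lemma exchange_modulo:
  assumes M: "csubspace M" and B: "finite B" and v: "v \<in> cspan (M \<union> B)" "v \<notin> M"
  shows "\<exists>b\<in>B. cspan (M \<union> B) \<subseteq> cspan (insert v (M \<union> (B - {b})))"
  using B v
proof (induction B)
  case empty
  have "cspan M = M"
    using M by simp
  with empty(1) have "v \<in> M"
    by (simp only: Un_empty_right)
  with empty(2) show ?case
    by simp
next
  case (insert b B)
  show ?case
  proof (cases "v \<in> cspan (M \<union> B)")
    case True
    then obtain c where c: "c \<in> B" "cspan (M \<union> B) \<subseteq> cspan (insert v (M \<union> (B - {c})))"
      using insert by blast
    have "c \<noteq> b"
      using c insert.hyps by blast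
    have "M \<union> insert b B \<subseteq> cspan (insert v (M \<union> (insert b B - {c})))"
    proof -
      have "cspan (insert v (M \<union> (B - {c}))) \<subseteq> cspan (insert v (M \<union> (insert b B - {c})))"
        by (intro cvec.span_mono) auto
      then have "M \<union> B \<subseteq> cspan (insert v (M \<union> (insert b B - {c})))"
        using c(2) cvec.span_superset[of "M \<union> B"] by blast
      moreover have "b \<in> cspan (insert v (M \<union> (insert b B - {c})))"
        using \<open>c \<noteq> b\<close> by (intro cvec.span_base) auto
      ultimately show ?thesis
        by blast
    qed
    then have "cspan (M \<union> insert b B) \<subseteq> cspan (insert v (M \<union> (insert b B - {c})))"
      by (rule cvec.span_minimal) simp
    then show ?thesis
      using c(1) by blast
  next
    case False
    have "v \<in> cspan (insert b (M \<union> B))"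
      using insert.prems by simp
    then have "b \<in> cspan (insert v (M \<union> B))"
      using cvec.in_span_insert False by blast
    moreover have "M \<union> B \<subseteq> cspan (insert v (M \<union> B))"
      using cvec.span_superset[of "insert v (M \<union> B)"] by blast
    ultimately have "M \<union> insert b B \<subseteq> cspan (insert v (M \<union> B))"
      by blast
    then have "cspan (M \<union> insert b B) \<subseteq> cspan (insert v (M \<union> B))"
      by (rule cvec.span_minimal) simp
    moreover have "insert b B - {b} = B"
      using insert.hyps by blast
    ultimately show ?thesis
      by force
  qed
qed

text \<open>The chain stops where the codimension is maximal: a vector of \<open>M k\<^sub>0\<close>
  outside a later \<open>M k\<close> could be exchanged into a smallest spanning set modulo
  \<open>M k\<close>, making the codimension of \<open>M k\<^sub>0\<close> smaller than that of
  \<open>M k\<close>.\<close>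

lemma decreasing_subspaces_stabilise:
  fixes M :: "nat \<Rightarrow> 'a::complex_vector set"
  assumes M: "\<And>k. csubspace (M k)" "\<And>k l. k \<le> l \<Longrightarrow> M l \<subseteq> M k"
    and B: "\<And>k. \<exists>B. finite B \<and> card B \<le> r \<and> cspan (M k \<union> B) = V"
  shows "\<exists>k\<^sub>0. \<forall>k\<ge>k\<^sub>0. M k = M k\<^sub>0"
proof -
  define Q where "Q k c \<longleftrightarrow> (\<exists>B. finite B \<and> card B = c \<and> cspan (M k \<union> B) = V)" for k c
  define d where "d k = (LEAST c. Q k c)" for k
  have ex: "\<exists>c\<le>r. Q k c" for k
    using B[of k] unfolding Q_def by blast
  have Qd: "Q k (d k)" for k
    unfolding d_def using ex[of k] LeastI[of "Q k"] by blast
  have d_le: "d k \<le> c" if "Q k c" for k c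
    unfolding d_def using that by (rule Least_le)
  have dr: "d k \<le> r" for k
    using ex[of k] d_le order_trans by blast
  then have "finite (range d)"
    by (intro finite_subset[of "range d" "{..r}"]) auto
  then have "Max (range d) \<in> range d"
    by (intro Max_in) auto
  then obtain k\<^sub>0 where k0: "d k\<^sub>0 = Max (range d)"
    by auto
  have max: "d k \<le> d k\<^sub>0" for k
    unfolding k0 using \<open>finite (range d)\<close> by simp
  have "M k = M k\<^sub>0" if k: "k\<^sub>0 \<le> k" for k
  proof (rule ccontr)
    assume "M k \<noteq> M k\<^sub>0"
    then obtain v where v: "v \<in> M k\<^sub>0" "v \<notin> M k"
      using M(2)[OF k] by blast
    obtain B where B: "finite B" "card B = d k" "cspan (M k \<union> B) = V"
      using Qd[of k] unfolding Q_def by blast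
    obtain B0 where B0: "cspan (M k\<^sub>0 \<union> B0) = V"
      using Qd[of k\<^sub>0] unfolding Q_def by blast
    have "v \<in> V"
      using v(1) B0 cvec.span_superset[of "M k\<^sub>0 \<union> B0"] by blast
    then obtain b where b: "b \<in> B" "V \<subseteq> cspan (insert v (M k \<union> (B - {b})))"
      using exchange_modulo[OF M(1) B(1), of v k] v(2) B(3) by blast
    have "cspan (insert v (M k \<union> (B - {b}))) \<subseteq> cspan (M k\<^sub>0 \<union> (B - {b}))"
      using M(2)[OF k] v(1) by (intro cvec.span_mono) auto
    moreover have "cspan (M k\<^sub>0 \<union> (B - {b})) \<subseteq> V"
    proof (rule cvec.span_minimal)
      show "M k\<^sub>0 \<union> (B - {b}) \<subseteq> V"
        using B0 B(3) cvec.span_superset[of "M k\<^sub>0 \<union> B0"] cvec.span_superset[of "M k \<union> B"] by blast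
      show "csubspace V"
        unfolding B(3)[symmetric] by simp
    qed
    ultimately have "cspan (M k\<^sub>0 \<union> (B - {b})) = V"
      using b by blast
    then have "Q k\<^sub>0 (card (B - {b}))"
      unfolding Q_def using B(1) by blast
    then have "d k\<^sub>0 \<le> card (B - {b})"
      by (rule d_le)
    also have "\<dots> < card B"
      using B(1) b(1) by (intro psubset_card_mono) auto
    finally show False
      using max[of k] B(2) by simp
  qed
  then show ?thesis
    by blast
qed

lemma bounded_clinear_iff_blin: "bounded_clinear f \<longleftrightarrow> blin UNIV norm UNIV norm f"
proof
  assume f: "bounded_clinear f"
  then have "bounded_linear f" and sc: "\<And>c x. f (scaleC c x) = scaleC c (f x)"
    by (simp_all add: bounded_clinear_def)
  interpret bounded_linear f by fact
  obtain K where K: "\<And>x. norm (f x) \<le> norm x * K"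
    using bounded by blast
  show "blin UNIV norm UNIV norm f"
    by (rule blinI[where K = K]) (use K in \<open>auto simp: add sc mult.commute\<close>)
next
  assume f: "blin UNIV norm UNIV norm f"
  obtain K where K: "K > 0" "\<And>x. x \<in> UNIV \<Longrightarrow> norm (f x) \<le> K * norm x"
    using blin_bound[OF norm_on_norm f] by blast
  have "bounded_linear f"
    by (rule bounded_linear_intro[where K = K])
      (use blin_add[OF f] blin_scale[OF f] K in \<open>auto simp: scaleR_scaleC mult.commute\<close>)
  then show "bounded_clinear f"
    using blin_scale[OF f] by (simp add: bounded_clinear_def)
qed

section \<open>Powers of commuting tuples\<close>

definition comm_ops :: "'a::complex_vector set \<Rightarrow> ('a \<Rightarrow> real) \<Rightarrow> ('i \<Rightarrow> 'a \<Rightarrow> 'a) \<Rightarrow> bool"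
  where "comm_ops V N T \<longleftrightarrow> (\<forall>i. blin V N V N (T i)) \<and> (\<forall>i j. \<forall>x\<in>V. T i (T j x) = T j (T i x))"

definition powt :: "('i \<Rightarrow> 'a \<Rightarrow> 'a) \<Rightarrow> nat \<Rightarrow> 'i \<Rightarrow> 'a \<Rightarrow> 'a"
  where "powt T k = (\<lambda>i. T i ^^ k)"

lemma powt_1 [simp]: "powt T 1 = T" "powt T (Suc 0) = T"
  by (simp_all add: powt_def fun_eq_iff)

text \<open>A bound instead of the value in \<open>enat\<close>, because the same \<open>r\<close>
  has to serve all powers.\<close>

definition codim_le :: "'a::complex_vector set \<Rightarrow> 'a set \<Rightarrow> nat \<Rightarrow> bool"
  where "codim_le V W r \<longleftrightarrow> (\<exists>B. finite B \<and> card B \<le> r \<and> cspan (W \<union> B) = V)"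

text \<open>Phrased with independent subsets, so that it passes to subsets at once and can be
  checked on an increasing union.\<close>

definition fdim_le :: "'a::complex_vector set \<Rightarrow> nat \<Rightarrow> bool"
  where "fdim_le W r \<longleftrightarrow> (\<forall>B. B \<subseteq> W \<longrightarrow> cvec.independent B \<longrightarrow> finite B \<and> card B \<le> r)"

lemma fdim_le_basis:
  assumes "fdim_le Z r"
  obtains B where "finite B" "card B \<le> r" "B \<subseteq> Z" "cvec.independent B" "Z \<subseteq> cspan B"
proof -
  have "\<And>B. B \<subseteq> Z \<Longrightarrow> cvec.independent B \<Longrightarrow> finite B \<and> card B \<le> r"
    using assms by (simp add: fdim_le_def)
  then show ?thesis
    by (rule finite_dim_if_independent_bounded[of Z r thesis, OF _ that])
qed

lemma fdim_leI_span: "W \<subseteq> cspan B \<Longrightarrow> finite B \<Longrightarrow> card B \<le> r \<Longrightarrow> fdim_le W r"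
  unfolding fdim_le_def
proof (intro allI impI)
  fix B' assume "W \<subseteq> cspan B" "finite B" "card B \<le> r" "B' \<subseteq> W" "cvec.independent B'"
  moreover from this have "B' \<subseteq> cspan B"
    by blast
  ultimately show "finite B' \<and> card B' \<le> r"
    using cvec.independent_span_bound[of B B'] by auto
qed

lemma cdim_finite_iff_fdim_le: "cdim W < \<infinity> \<longleftrightarrow> (\<exists>r. fdim_le W r)"
  unfolding cdim_finite_iff
proof
  assume "\<exists>B. finite B \<and> W \<subseteq> cspan B"
  then obtain B where "finite B" "W \<subseteq> cspan B"
    by blast
  then show "\<exists>r. fdim_le W r"
    using fdim_leI_span[of W B "card B"] by blast
next
  assume "\<exists>r. fdim_le W r"
  then obtain r where "fdim_le W r" ..
  then obtain B where "finite B" "card B \<le> r" "B \<subseteq> W" "cvec.independent B" "W \<subseteq> cspan B"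
    by (rule fdim_le_basis)
  then show "\<exists>B. finite B \<and> W \<subseteq> cspan B"
    by blast
qed

context
  fixes V :: "'a::complex_vector set" and N and T :: "'i::finite \<Rightarrow> 'a \<Rightarrow> 'a"
  assumes N: "norm_on V N" and T: "comm_ops V N T"
begin

lemma comm_ops_blin: "blin V N V N (T i)"
  using T by (simp add: comm_ops_def)

lemma comm_ops_blin_pow: "blin V N V N (T i ^^ k)"
proof (induction k)
  case 0
  then show ?case
    using blin_id[of V N] by (simp add: id_def)
next
  case (Suc k)
  then show ?case
    using blin_comp[OF Suc comm_ops_blin N, of i] by (simp add: o_def)
qed

lemma comm_ops_commute:
  assumes "x \<in> V"
  shows "(T i ^^ a) ((T j ^^ b) x) = (T j ^^ b) ((T i ^^ a) x)"
proof -
  have c: "T i (T j x) = T j (T i x)" if "x \<in> V" for i j x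
    using T that by (simp add: comm_ops_def)
  have 1: "T i ((T j ^^ b) x) = (T j ^^ b) (T i x)" if "x \<in> V" for i j b x
  proof (induction b)
    case (Suc b)
    have "T i (T j ((T j ^^ b) x)) = T j (T i ((T j ^^ b) x))"
      by (rule c[OF blin_mem[OF comm_ops_blin_pow that]])
    then show ?case
      using Suc by simp
  qed simp
  show ?thesis
    using assms by (induction a) (simp_all add: 1 blin_mem[OF comm_ops_blin_pow])
qed

lemma comm_ops_powt: "comm_ops V N (powt T k)"
  by (simp add: comm_ops_def powt_def comm_ops_blin_pow comm_ops_commute)

lemma blin_hat: "blin (PiC UNIV V) (pn UNIV N) V N (hat T)"
  unfolding hat_def
  by (rule blin_sum_map[OF blin_comp[OF blin_component[OF N finite UNIV_I] comm_ops_blin N] N])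

lemma blin_tilde: "blin V N (PiC UNIV V) (pn UNIV N) (tilde T)"
  unfolding tilde_def[abs_def]
  using blin_tuple[OF N finite, of UNIV V N T] comm_ops_blin by simp

lemma M_sum_eq: "M_sum V k T = hat (powt T k) ` PiC UNIV V"
proof
  show "M_sum V k T \<subseteq> hat (powt T k) ` PiC UNIV V"
  proof
    fix y assume "y \<in> M_sum V k T"
    then obtain u where u: "y = (\<Sum>i\<in>UNIV. u i)" "\<And>i. u i \<in> (T i ^^ k) ` V"
      by (auto simp: M_sum_def)
    then have "\<forall>i. \<exists>x. x \<in> V \<and> u i = (T i ^^ k) x"
      by blast
    then obtain x where "\<And>i. x i \<in> V \<and> u i = (T i ^^ k) (x i)"
      by metis
    then have "y = hat (powt T k) x" "x \<in> PiC UNIV V"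
      by (simp_all add: u(1) hat_def powt_def PiC_UNIV)
    then show "y \<in> hat (powt T k) ` PiC UNIV V"
      by blast
  qed
  show "hat (powt T k) ` PiC UNIV V \<subseteq> M_sum V k T"
    by (auto simp: M_sum_def hat_def powt_def PiC_UNIV)
qed

lemma null_tilde_powt_mono:
  assumes "k \<le> l"
  shows "null_tilde V (powt T k) \<subseteq> null_tilde V (powt T l)"
proof
  fix x assume x: "x \<in> null_tilde V (powt T k)"
  then have xV: "x \<in> V" and z: "(T i ^^ k) x = 0" for i
    by (auto simp: null_tilde_def tilde_def powt_def fun_eq_iff)
  have "(T i ^^ l) x = (T i ^^ (l - k)) ((T i ^^ k) x)" for i
    using assms by (simp flip: funpow_add[THEN fun_cong, unfolded o_def])
  then have "(T i ^^ l) x = 0" for i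
    using z[of i] blin_zero[OF N comm_ops_blin_pow] by simp
  then show "x \<in> null_tilde V (powt T l)"
    using xV by (simp add: null_tilde_def tilde_def powt_def fun_eq_iff)
qed

end

context
  fixes V :: "'a::complex_vector set" and N and T :: "'i::finite \<Rightarrow> 'a \<Rightarrow> 'a"
  assumes N: "norm_on V N" and T: "comm_ops V N T"
begin

lemma csubspace_M_sum: "csubspace (M_sum V k T)"
  unfolding M_sum_eq[OF N T]
  by (rule csubspace_blin_image[OF norm_on_PiC[OF N finite] blin_hat[OF N comm_ops_powt[OF N T]]])

lemma M_sum_subset: "M_sum V k T \<subseteq> V"
  unfolding M_sum_eq[OF N T]
  using blin_mem[OF blin_hat[OF N comm_ops_powt[OF N T]]] by blast

lemma M_sum_mono:
  assumes "k \<le> l"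
  shows "M_sum V l T \<subseteq> M_sum V k T"
proof
  fix y assume "y \<in> M_sum V l T"
  then obtain u where u: "y = (\<Sum>i\<in>UNIV. u i)" "\<And>i. u i \<in> (T i ^^ l) ` V"
    by (auto simp: M_sum_def)
  have "u i \<in> (T i ^^ k) ` V" for i
  proof -
    obtain x where x: "x \<in> V" "u i = (T i ^^ l) x"
      using u(2) by blast
    have "(T i ^^ l) x = (T i ^^ k) ((T i ^^ (l - k)) x)"
      using assms by (simp flip: funpow_add[THEN fun_cong, unfolded o_def])
    then show ?thesis
      using x blin_mem[OF comm_ops_blin_pow[OF N T] x(1)] by simp
  qed
  then show "y \<in> M_sum V k T"
    unfolding M_sum_def u(1) by blast
qed

text \<open>The spaces \<open>M_sum V k T\<close> decrease, so a uniform bound on their codimensions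
  makes them stabilise, and \<open>R_infty\<close> is then one of them.\<close>

lemma codim_R_infty_iff:
  "codim V (R_infty V T) < \<infinity> \<longleftrightarrow> (\<exists>r. \<forall>k\<ge>1. codim_le V (M_sum V k T) r)"
proof
  assume "codim V (R_infty V T) < \<infinity>"
  then obtain B where B: "finite B" "cspan (R_infty V T \<union> B) = V"
    unfolding codim_finite_iff by blast
  have "codim_le V (M_sum V k T) (card B)" if k: "k \<ge> 1" for k
  proof -
    have "R_infty V T \<subseteq> M_sum V k T"
      using k by (auto simp: R_infty_def)
    then have "V \<subseteq> cspan (M_sum V k T \<union> B)"
      using B(2) cvec.span_mono[of "R_infty V T \<union> B" "M_sum V k T \<union> B"] by blast
    moreover have "M_sum V k T \<union> B \<subseteq> V"
      using M_sum_subset B(2) cvec.span_superset[of "R_infty V T \<union> B"] by blast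
    then have "cspan (M_sum V k T \<union> B) \<subseteq> V"
      by (rule cvec.span_minimal[OF _ norm_on_subspace[OF N]])
    ultimately show ?thesis
      unfolding codim_le_def using B(1) by blast
  qed
  then show "\<exists>r. \<forall>k\<ge>1. codim_le V (M_sum V k T) r"
    by blast
next
  assume "\<exists>r. \<forall>k\<ge>1. codim_le V (M_sum V k T) r"
  then obtain r where r: "\<And>k. k \<ge> 1 \<Longrightarrow> codim_le V (M_sum V k T) r"
    by blast
  \<comment> \<open>The index is \<open>Suc k\<close> since the intersection starts at the first
    power.\<close>
  have "\<exists>k0. \<forall>k\<ge>k0. M_sum V (Suc k) T = M_sum V (Suc k0) T"
  proof (rule decreasing_subspaces_stabilise)
    show "csubspace (M_sum V (Suc k) T)" for k
      by (rule csubspace_M_sum)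
    show "M_sum V (Suc l) T \<subseteq> M_sum V (Suc k) T" if "k \<le> l" for k l
      using that by (intro M_sum_mono) simp
    show "\<exists>B. finite B \<and> card B \<le> r \<and> cspan (M_sum V (Suc k) T \<union> B) = V" for k
      using r[of "Suc k"] by (simp add: codim_le_def)
  qed
  then obtain k0 where k0: "\<And>k. k \<ge> k0 \<Longrightarrow> M_sum V (Suc k) T = M_sum V (Suc k0) T"
    by blast
  have "M_sum V (Suc k0) T \<subseteq> M_sum V k T" if "k \<ge> 1" for k
  proof (cases "k \<le> Suc k0")
    case True
    then show ?thesis
      by (rule M_sum_mono)
  next
    case False
    then have "k0 \<le> k - 1" "Suc (k - 1) = k"
      by auto
    then show ?thesis
      using k0[of "k - 1"] by simp
  qed
  then have "R_infty V T = M_sum V (Suc k0) T"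
    by (auto simp: R_infty_def)
  then show "codim V (R_infty V T) < \<infinity>"
    unfolding codim_finite_iff using r[of "Suc k0"] by (auto simp: codim_le_def)
qed

lemma N_infty_eq: "N_infty V T = (\<Union>k\<in>{1..}. null_tilde V (powt T k))"
  by (auto simp: N_infty_def null_tilde_def tilde_def powt_def fun_eq_iff)

text \<open>The joint null spaces increase with \<open>k\<close>, so every finite independent subset
  of their union lies in a single one of them.\<close>

lemma cdim_N_infty_iff:
  "cdim (N_infty V T) < \<infinity> \<longleftrightarrow> (\<exists>r. \<forall>k\<ge>1. fdim_le (null_tilde V (powt T k)) r)"
  unfolding cdim_finite_iff_fdim_le
proof
  assume "\<exists>r. fdim_le (N_infty V T) r"
  then obtain r where r: "fdim_le (N_infty V T) r" ..
  have "fdim_le (null_tilde V (powt T k)) r" if "k \<ge> 1" for k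
    unfolding fdim_le_def
  proof (intro allI impI)
    fix B assume B: "B \<subseteq> null_tilde V (powt T k)" "cvec.independent B"
    have "B \<subseteq> N_infty V T"
      using B(1) that unfolding N_infty_eq by blast
    then show "finite B \<and> card B \<le> r"
      using r B(2) by (simp add: fdim_le_def)
  qed
  then show "\<exists>r. \<forall>k\<ge>1. fdim_le (null_tilde V (powt T k)) r"
    by blast
next
  assume "\<exists>r. \<forall>k\<ge>1. fdim_le (null_tilde V (powt T k)) r"
  then obtain r where r: "\<And>k. k \<ge> 1 \<Longrightarrow> fdim_le (null_tilde V (powt T k)) r"
    by blast
  have fin: "card B \<le> r" if B: "finite B" "B \<subseteq> N_infty V T" "cvec.independent B" for B
  proof -
    have "\<forall>b\<in>B. \<exists>k. k \<ge> 1 \<and> b \<in> null_tilde V (powt T k)"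
      using B(2) unfolding N_infty_eq by auto
    then obtain k where k: "\<And>b. b \<in> B \<Longrightarrow> k b \<ge> 1 \<and> b \<in> null_tilde V (powt T (k b))"
      by metis
    \<comment> \<open>Inserting 1 keeps the maximum defined and at least 1 when \<open>B\<close> is
      empty.\<close>
    define l where "l = Max (insert 1 (k ` B))"
    have "k b \<le> l" if "b \<in> B" for b
      unfolding l_def using that B(1) by (intro Max_ge) auto
    then have "b \<in> null_tilde V (powt T l)" if "b \<in> B" for b
      using null_tilde_powt_mono[OF N T, of "k b" l] k[OF that] that by blast
    moreover have "l \<ge> 1"
      unfolding l_def using B(1) by (intro Max_ge) auto
    ultimately show ?thesis
      using r[of l] B(3) by (auto simp: fdim_le_def)
  qed
  have "finite B \<and> card B \<le> r" if B: "B \<subseteq> N_infty V T" "cvec.independent B" for B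
  proof -
    have "finite B"
    proof (rule ccontr)
      assume "infinite B"
      then obtain B0 where B0: "finite B0" "card B0 = Suc r" "B0 \<subseteq> B"
        using infinite_arbitrarily_large by blast
      then show False
        using fin[of B0] B cvec.independent_mono[OF B(2) B0(3)] by auto
    qed
    then show ?thesis
      using fin B by blast
  qed
  then show "\<exists>r. fdim_le (N_infty V T) r"
    by (auto simp: fdim_le_def)
qed

end

section \<open>Closed range and lower estimates\<close>

lemma csubspace_null_tilde:
  fixes T :: "'i::finite \<Rightarrow> 'a::complex_vector \<Rightarrow> 'a"
  assumes "norm_on V N" "comm_ops V N T"
  shows "csubspace (null_tilde V T)"
proof -
  have "null_tilde V T = {x \<in> V. tilde T x = 0}"
    by (simp add: null_tilde_def)
  then show ?thesis
    using csubspace_eq_blin[OF assms(1) blin_tilde[OF assms] blin_zero_map[OF norm_on_PiC[OF assms(1) finite]]]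
    by simp
qed

lemma null_tilde_subset: "null_tilde V T \<subseteq> V"
  by (auto simp: null_tilde_def)

text \<open>The open mapping theorem for the closed range supplies a short preimage of
  \<open>tilde T x\<close>. It differs from \<open>x\<close> by a kernel vector, which a projection
  \<open>pr\<close> of finite rank onto the kernel recovers; the precompact term dominates the norm
  of \<open>pr x\<close>.\<close>

lemma upper_semi_Fredholm_estimate:
  assumes V: "banach_on V N" and T: "comm_ops V N (T :: 'i::finite \<Rightarrow> 'a::complex_vector \<Rightarrow> 'a)"
    and F: "upper_semi_Fredholm V N T"
  shows "\<exists>K q. precompact_on V N q \<and> (\<forall>x\<in>V. N x \<le> K * pn UNIV N (tilde T x) + q x)"
proof -
  note N = banach_on_norm_on[OF V]
  note NP = norm_on_PiC[OF N finite, of UNIV]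
  note f = blin_tilde[OF N T]
  have R: "closed_on (PiC UNIV V) (pn UNIV N) (tilde T ` V)"
    using F by (simp add: upper_semi_Fredholm_def range_tilde_def closedin_power_topology_iff[OF N])
  have BR: "banach_on (tilde T ` V) (pn UNIV N)"
    by (rule banach_on_closed[OF banach_on_PiC[OF V finite] R csubspace_blin_image[OF N f]])
  obtain K where K: "K > 0" "\<And>y. y \<in> tilde T ` V \<Longrightarrow> \<exists>x\<in>V. tilde T x = y \<and> N x \<le> K * pn UNIV N y"
    using open_mapping[OF V BR blin_corestrict[OF f order_refl] refl] by blast
  obtain r where "fdim_le (null_tilde V T) r"
    using F unfolding upper_semi_Fredholm_def cdim_finite_iff_fdim_le by blast
  then obtain B where B: "finite B" "card B \<le> r" "B \<subseteq> null_tilde V T" "cvec.independent B"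
    "null_tilde V T \<subseteq> cspan B"
    by (rule fdim_le_basis)
  have BV: "B \<subseteq> V"
    using B(3) null_tilde_subset by blast
  from dual_basis[OF N B(1) BV B(4)] obtain h where
    h: "\<And>b. b \<in> B \<Longrightarrow> blin V N UNIV norm (h b :: 'a \<Rightarrow> complex)"
      "\<And>b c. b \<in> B \<Longrightarrow> c \<in> B \<Longrightarrow> h b c = (if b = c then 1 else 0)"
    by blast
  define pr where "pr x = (\<Sum>b\<in>B. scaleC (h b x) b)" for x
  have pr: "blin V N V N pr"
    unfolding pr_def by (rule blin_sum_map[OF blin_functional_scale[OF h(1) N] N]) (use BV in auto)
  define q where "q x = (\<Sum>b\<in>B. cmod (scaleC (of_real (N b)) (h b x)))" for x
  have q: "precompact_on V N q"
    unfolding q_def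
    by (rule precompact_on_sum[OF precompact_on_functional[OF N blin_scale_map[OF h(1) norm_on_norm]]])
  have prq: "N (pr x) \<le> q x" for x
  proof -
    have "N (pr x) \<le> (\<Sum>b\<in>B. N (scaleC (h b x) b))"
      unfolding pr_def using BV by (intro norm_on_sum_le[OF N] norm_on_scale_mem[OF N]) auto
    also have "\<dots> = q x"
      unfolding q_def using BV norm_on_nonneg[OF N]
      by (intro sum.cong refl) (auto simp: norm_on_scale[OF N] scaleC_complex_def norm_mult subset_iff)
    finally show ?thesis .
  qed
  obtain C where C: "C > 0" "\<And>x. x \<in> V \<Longrightarrow> N (pr x) \<le> C * N x"
    using blin_bound[OF N pr] by blast
  have "N x \<le> ((1 + C) * K) * pn UNIV N (tilde T x) + q x" if x: "x \<in> V" for x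
  proof -
    obtain x' where x': "x' \<in> V" "tilde T x' = tilde T x" "N x' \<le> K * pn UNIV N (tilde T x)"
      using K(2)[of "tilde T x"] x by blast
    have d: "x - x' \<in> V"
      by (rule norm_on_diff_mem[OF N x x'(1)])
    have "x - x' \<in> null_tilde V T"
      using d x'(2) by (simp add: null_tilde_def blin_diff[OF N f x x'(1)])
    then have "pr (x - x') = x - x'"
      unfolding pr_def using B(5) by (intro dual_basis_expand[OF N B(1) BV h]) auto
    then have "x = x' + (pr x - pr x')"
      by (simp add: blin_diff[OF N pr x x'(1)])
    then have "N x \<le> N x' + N (pr x - pr x')"
      using norm_on_triangle[OF N x'(1) norm_on_diff_mem[OF N blin_mem[OF pr x] blin_mem[OF pr x'(1)]]]
      by simp
    also have "N (pr x - pr x') \<le> N (pr x) + N (pr x')"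
      by (rule norm_on_triangle_diff[OF N blin_mem[OF pr x] blin_mem[OF pr x'(1)]])
    finally have "N x \<le> (1 + C) * N x' + q x"
      using C(2)[OF x'(1)] prq[of x] by (simp add: algebra_simps)
    also have "(1 + C) * N x' \<le> (1 + C) * (K * pn UNIV N (tilde T x))"
      using C(1) x'(3) by (intro mult_left_mono) auto
    finally show ?thesis
      by (simp add: mult.assoc)
  qed
  then show ?thesis
    using q by (intro exI[of _ "(1 + C) * K"] exI[of _ q] conjI) auto
qed

lemma seminorm_on_comp:
  assumes f: "blin V N W M f" and M: "norm_on W M"
  shows "seminorm_on V (\<lambda>x. M (f x))"
  unfolding seminorm_on_def
  by (auto simp: blin_add[OF f] blin_scale[OF f] norm_on_scale[OF M] blin_mem[OF f]
      intro!: norm_on_triangle[OF M] blin_mem[OF f])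

lemma seminorm_on_add: "seminorm_on V p \<Longrightarrow> seminorm_on V q \<Longrightarrow> seminorm_on V (\<lambda>x. p x + q x)"
  unfolding seminorm_on_def
proof (intro conjI ballI allI; elim conjE)
  fix x y assume "x \<in> V" "y \<in> V" "\<forall>x\<in>V. \<forall>y\<in>V. p (x + y) \<le> p x + p y"
    "\<forall>x\<in>V. \<forall>y\<in>V. q (x + y) \<le> q x + q y"
  then have "p (x + y) \<le> p x + p y" "q (x + y) \<le> q x + q y"
    by blast+
  then show "p (x + y) + q (x + y) \<le> p x + q x + (p y + q y)"
    by simp
qed (simp add: distrib_left)

lemma seminorm_on_sum:
  assumes "\<And>i. i \<in> A \<Longrightarrow> seminorm_on V (p i)"
  shows "seminorm_on V (\<lambda>x. \<Sum>i\<in>A. p i x)"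
  using assms
  by (induction A rule: infinite_finite_induct) (simp_all add: seminorm_on_add, simp_all add: seminorm_on_def)

text \<open>Peetre's lemma with \<open>P\<close> composed of \<open>tilde T\<close> and the
  functionals. Whatever the origin of the precompact term, any finite family of functionals that
  separates the kernel can replace it.\<close>

lemma tilde_estimate_functionals:
  fixes h :: "'c \<Rightarrow> 'a::complex_vector \<Rightarrow> complex" and T :: "'i::finite \<Rightarrow> 'a \<Rightarrow> 'a"
  assumes V: "banach_on V N" and T: "comm_ops V N T"
    and q: "precompact_on V N q" and est: "\<And>x. x \<in> V \<Longrightarrow> N x \<le> K * pn UNIV N (tilde T x) + q x"
    and B: "finite B" and h: "\<And>b. b \<in> B \<Longrightarrow> blin V N UNIV norm (h b)"
    and inj: "\<And>x. x \<in> null_tilde V T \<Longrightarrow> (\<And>b. b \<in> B \<Longrightarrow> h b x = 0) \<Longrightarrow> x = 0"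
  shows "\<exists>K'>0. \<forall>x\<in>V. N x \<le> K' * (pn UNIV N (tilde T x) + (\<Sum>b\<in>B. cmod (h b x)))"
proof -
  note N = banach_on_norm_on[OF V]
  note NP = norm_on_PiC[OF N finite, of UNIV]
  note f = blin_tilde[OF N T]
  let ?P = "\<lambda>x. pn UNIV N (tilde T x) + (\<Sum>b\<in>B. cmod (h b x))"
  obtain C where C: "C > 0" "\<And>x. x \<in> V \<Longrightarrow> pn UNIV N (tilde T x) \<le> C * N x"
    using blin_bound[OF N f] by blast
  have "\<forall>b\<in>B. \<exists>D. \<forall>x\<in>V. cmod (h b x) \<le> D * N x"
    using h unfolding blin_def by blast
  then obtain D where D: "\<And>b x. b \<in> B \<Longrightarrow> x \<in> V \<Longrightarrow> cmod (h b x) \<le> D b * N x"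
    by metis
  have nn: "0 \<le> pn UNIV N (tilde T x)" if "x \<in> V" for x
    by (rule norm_on_nonneg[OF NP blin_mem[OF f that]])
  have nn': "0 \<le> (\<Sum>b\<in>B. cmod (h b x))" for x
    by (intro sum_nonneg) simp
  show ?thesis
  proof (rule drop_precompact[OF V _ _ _ q, where C = "C + sum D B" and K = "\<bar>K\<bar>"])
    show "seminorm_on V ?P"
      by (rule seminorm_on_add[OF seminorm_on_comp[OF f NP]
            seminorm_on_sum[OF seminorm_on_comp[OF h norm_on_norm]]])
    fix x assume x: "x \<in> V"
    have "(\<Sum>b\<in>B. cmod (h b x)) \<le> sum D B * N x"
      unfolding sum_distrib_right by (intro sum_mono D x)
    then show "?P x \<le> (C + sum D B) * N x"
      using C(2)[OF x] by (simp add: distrib_right)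
    have "N x \<le> K * pn UNIV N (tilde T x) + q x"
      by (rule est[OF x])
    also have "K * pn UNIV N (tilde T x) \<le> \<bar>K\<bar> * ?P x"
      using nn[OF x] nn'[of x] by (intro mult_mono) auto
    finally show "N x \<le> \<bar>K\<bar> * ?P x + q x"
      by simp
    assume "?P x = 0"
    then have 0: "pn UNIV N (tilde T x) = 0" "(\<Sum>b\<in>B. cmod (h b x)) = 0"
      using nn[OF x] nn'[of x] by linarith+
    have "x \<in> null_tilde V T"
      using 0(1) x norm_on_eq_0[OF NP blin_mem[OF f x]] by (simp add: null_tilde_def)
    moreover have "h b x = 0" if "b \<in> B" for b
      using 0(2) that B by (simp add: sum_nonneg_eq_0_iff)
    ultimately show "x = 0"
      by (rule inj)
  qed
qed

text \<open>On the kernel the estimate leaves only the functionals, which bounds the dimension by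
  their number. For closedness of the range they are exchanged for a dual basis of the kernel:
  removing the kernel part of a preimage makes the dual basis vanish on it, but not the given
  functionals.\<close>

lemma upper_semi_Fredholm_if_estimate:
  fixes g :: "nat \<Rightarrow> 'a::complex_vector \<Rightarrow> complex" and T :: "'i::finite \<Rightarrow> 'a \<Rightarrow> 'a"
  assumes V: "banach_on V N" and T: "comm_ops V N T"
    and g: "\<And>l. l < r \<Longrightarrow> blin V N UNIV norm (g l)"
    and est: "\<And>x. x \<in> V \<Longrightarrow> N x \<le> K * pn UNIV N (tilde T x) + (\<Sum>l<r. cmod (g l x))"
  shows "upper_semi_Fredholm V N T \<and> fdim_le (null_tilde V T) r"
proof -
  note N = banach_on_norm_on[OF V]
  note NP = norm_on_PiC[OF N finite, of UNIV]
  note f = blin_tilde[OF N T]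
  have dim: "fdim_le (null_tilde V T) r"
    unfolding fdim_le_def
  proof (intro allI impI)
    fix B assume "B \<subseteq> null_tilde V T" "cvec.independent B"
    then show "finite B \<and> card B \<le> r"
    proof (rule independent_card_le_functionals[OF N csubspace_null_tilde[OF N T] null_tilde_subset g, rotated 2])
      fix x assume x: "x \<in> null_tilde V T" and "\<And>l. l < r \<Longrightarrow> g l x = 0"
      then have "N x \<le> 0"
        using est[of x] by (simp add: null_tilde_def norm_on_zero[OF NP])
      then show "x = 0"
        using x norm_on_nonneg[OF N, of x] norm_on_eq_0[OF N, of x] null_tilde_subset by force
    qed
  qed
  then obtain B where B: "finite B" "card B \<le> r" "B \<subseteq> null_tilde V T" "cvec.independent B"
    "null_tilde V T \<subseteq> cspan B"
    by (rule fdim_le_basis)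
  have BV: "B \<subseteq> V"
    using B(3) null_tilde_subset by blast
  from dual_basis[OF N B(1) BV B(4)] obtain h where
    h: "\<And>b. b \<in> B \<Longrightarrow> blin V N UNIV norm (h b :: 'a \<Rightarrow> complex)"
      "\<And>b c. b \<in> B \<Longrightarrow> c \<in> B \<Longrightarrow> h b c = (if b = c then 1 else 0)"
    by blast
  have "\<exists>K'>0. \<forall>x\<in>V. N x \<le> K' * (pn UNIV N (tilde T x) + (\<Sum>b\<in>B. cmod (h b x)))"
  proof (rule tilde_estimate_functionals[OF V T _ est B(1) h(1)])
    show "precompact_on V N (\<lambda>x. \<Sum>l<r. cmod (g l x))"
      by (rule precompact_on_sum[OF precompact_on_functional[OF N g]]) simp
    fix x assume x: "x \<in> null_tilde V T" "\<And>b. b \<in> B \<Longrightarrow> h b x = 0"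
    have "(\<Sum>b\<in>B. scaleC (h b x) b) = x"
      using x(1) B(5) by (intro dual_basis_expand[OF N B(1) BV h]) auto
    then show "x = 0"
      using x(2) by simp
  qed
  then obtain K' where K': "K' > 0" "\<And>x. x \<in> V \<Longrightarrow>
      N x \<le> K' * (pn UNIV N (tilde T x) + (\<Sum>b\<in>B. cmod (h b x)))"
    by blast
  \<comment> \<open>Subtracts the kernel part: \<open>pr x\<close> has the same image as
    \<open>x\<close> and is annihilated by all \<open>h b\<close>.\<close>
  define pr where "pr x = x - (\<Sum>b\<in>B. scaleC (h b x) b)" for x
  have pr: "blin V N V N pr"
    unfolding pr_def
    by (rule blin_diff_map[OF blin_id blin_sum_map[OF blin_functional_scale[OF h(1) N] N] N])
      (use BV in auto)
  have fpr: "tilde T (pr x) = tilde T x" if x: "x \<in> V" for x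
  proof -
    have sV: "(\<Sum>b\<in>B. scaleC (h b x) b) \<in> V"
      using BV by (intro norm_on_sum_mem[OF N] norm_on_scale_mem[OF N]) auto
    have "(\<Sum>b\<in>B. scaleC (h b x) b) \<in> null_tilde V T"
      using B(3) csubspace_null_tilde[OF N T]
      by (intro cvec.subspace_sum cvec.subspace_scale) auto
    then show ?thesis
      unfolding pr_def blin_diff[OF N f x sV] by (simp add: null_tilde_def)
  qed
  have hpr: "h b (pr x) = 0" if b: "b \<in> B" and x: "x \<in> V" for b x
  proof -
    have sV: "\<And>c. c \<in> B \<Longrightarrow> scaleC (h c x) c \<in> V"
      using BV by (intro norm_on_scale_mem[OF N]) auto
    have "h b (\<Sum>c\<in>B. scaleC (h c x) c) = (\<Sum>c\<in>B. h b (scaleC (h c x) c))"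
      by (rule blin_sum[OF N h(1)[OF b]]) (rule sV)
    also have "\<dots> = (\<Sum>c\<in>B. if b = c then h c x else 0)"
      using BV by (intro sum.cong refl)
        (auto simp: blin_scale[OF h(1)[OF b]] h(2)[OF b] scaleC_complex_def subset_iff)
    also have "\<dots> = h b x"
      using b B(1) by simp
    finally show ?thesis
      using blin_diff[OF N h(1)[OF b] x norm_on_sum_mem[OF N sV, of B "\<lambda>c. c"]]
      by (simp add: pr_def)
  qed
  have "closed_on (PiC UNIV V) (pn UNIV N) (tilde T ` V)"
    unfolding closed_on_def
  proof (intro conjI allI impI)
    show "tilde T ` V \<subseteq> PiC UNIV V"
      using blin_mem[OF f] by blast
    fix s l assume a: "(\<forall>n. s n \<in> tilde T ` V) \<and> l \<in> PiC UNIV V \<and> (\<lambda>n. pn UNIV N (s n - l)) \<longlonglongrightarrow> 0"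
    then have "\<forall>n. \<exists>x. x \<in> V \<and> s n = tilde T x"
      by blast
    then obtain x where x: "\<And>n. x n \<in> V" "\<And>n. s n = tilde T (x n)"
      by metis
    define y where "y n = pr (x n)" for n
    have y: "y n \<in> V" "tilde T (y n) = s n" "\<And>b. b \<in> B \<Longrightarrow> h b (y n) = 0" for n
      using blin_mem[OF pr x(1)] fpr[OF x(1)] hpr[OF _ x(1)] x(2) by (simp_all add: y_def)
    have "cauchy_on (pn UNIV N) s"
      using a by (intro cauchy_onI_lim[OF NP, of s l]) (use x blin_mem[OF f] in auto)
    then have c: "cauchy_on (\<lambda>z. K' * pn UNIV N z) s"
      unfolding cauchy_on_def
    proof (intro allI impI)
      fix e :: real
      assume *: "\<forall>e>0. \<exists>M. \<forall>m\<ge>M. \<forall>n\<ge>M. pn UNIV N (s m - s n) < e" and "e > 0"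
      then have "\<exists>M. \<forall>m\<ge>M. \<forall>n\<ge>M. pn UNIV N (s m - s n) < e / K'"
        using K'(1) by simp
      then show "\<exists>M. \<forall>m\<ge>M. \<forall>n\<ge>M. K' * pn UNIV N (s m - s n) < e"
        using K'(1) by (simp add: field_simps)
    qed
    \<comment> \<open>The functionals vanish on differences of the \<open>y n\<close>, so the
      estimate carries the Cauchy property over from the images.\<close>
    have "cauchy_on N y"
    proof (rule cauchy_on_mono[OF c])
      fix m n
      have d: "y m - y n \<in> V"
        by (rule norm_on_diff_mem[OF N y(1) y(1)])
      have "h b (y m - y n) = 0" if "b \<in> B" for b
        using blin_diff[OF N h(1)[OF that] y(1) y(1)] y(3)[OF that] by simp
      then show "N (y m - y n) \<le> K' * pn UNIV N (s m - s n)"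
        using K'(2)[OF d] by (simp add: blin_diff[OF N f y(1) y(1)] y(2))
    qed
    then obtain u where u: "u \<in> V" "(\<lambda>n. N (y n - u)) \<longlonglongrightarrow> 0"
      by (rule banach_onD[OF V y(1)])
    have "(\<lambda>n. pn UNIV N (s n - tilde T u)) \<longlonglongrightarrow> 0"
      using blin_lim[OF N NP f y(1) u] by (simp add: y(2))
    then have "l = tilde T u"
      using a u(1) x blin_mem[OF f] by (intro norm_on_lim_unique[OF NP, of s]) auto
    then show "l \<in> tilde T ` V"
      using u(1) by blast
  qed
  then show ?thesis
    using dim unfolding upper_semi_Fredholm_def range_tilde_def closedin_power_topology_iff[OF N]
      cdim_finite_iff_fdim_le by blast
qed

lemma blin_fst:
  assumes "norm_on V N" "norm_on W M"
  shows "blin (V \<times> W) (\<lambda>x. N (fst x) + M (snd x)) V N fst"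
  by (rule blinI[where K = 1]) (auto simp: scaleC_prod_def intro: norm_on_nonneg[OF assms(2)])

lemma blin_snd:
  assumes "norm_on V N" "norm_on W M"
  shows "blin (V \<times> W) (\<lambda>x. N (fst x) + M (snd x)) W M snd"
  by (rule blinI[where K = 1]) (auto simp: scaleC_prod_def intro: norm_on_nonneg[OF assms(1)])

lemma blin_cspan:
  assumes f: "blin V N W M f" and V: "csubspace V" and B: "B \<subseteq> V" and u: "u \<in> cspan B"
  shows "f u \<in> cspan (f ` B)"
proof -
  have "u \<in> V \<and> f u \<in> cspan (f ` B)"
    using u
  proof (induction rule: cvec.span_induct_alt)
    case base
    have "f 0 = 0"
      using blin_scale[OF f cvec.subspace_0[OF V], of 0] by simp
    then show ?case
      using cvec.subspace_0[OF V] cvec.span_zero by simp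
  next
    case (step c x y)
    then have "x \<in> V" "scaleC c x \<in> V" "y \<in> V"
      using B cvec.subspace_scale[OF V] by auto
    then have "scaleC c x + y \<in> V" "f (scaleC c x + y) = scaleC c (f x) + f y"
      by (simp_all add: cvec.subspace_add[OF V] blin_add[OF f] blin_scale[OF f])
    moreover have "scaleC c (f x) + f y \<in> cspan (f ` B)"
      using step by (intro cvec.span_add[OF cvec.span_scale[OF cvec.span_base]]) auto
    ultimately show ?case
      by simp
  qed
  then show ?thesis ..
qed

section \<open>Inverses of tuples modulo finite rank\<close>

text \<open>Invertibility modulo finite-rank operators: of the row \<open>hat T\<close> from the
  right here, of the column \<open>tilde T\<close> from the left in the next definition. The
  one-sided inverse is split into its coordinates.\<close>

definition right_inv_mod :: "'a::complex_vector set \<Rightarrow> ('a \<Rightarrow> real) \<Rightarrow> ('i::finite \<Rightarrow> 'a \<Rightarrow> 'a) \<Rightarrow> bool"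
  where "right_inv_mod V N T \<longleftrightarrow> (\<exists>C B. (\<forall>i. blin V N V N (C i)) \<and> finite B \<and> B \<subseteq> V \<and>
    (\<forall>y\<in>V. y - (\<Sum>i\<in>UNIV. T i (C i y)) \<in> cspan B))"

definition left_inv_mod :: "'a::complex_vector set \<Rightarrow> ('a \<Rightarrow> real) \<Rightarrow> ('i::finite \<Rightarrow> 'a \<Rightarrow> 'a) \<Rightarrow> bool"
  where "left_inv_mod V N T \<longleftrightarrow> (\<exists>D B. (\<forall>i. blin V N V N (D i)) \<and> finite B \<and> B \<subseteq> V \<and>
    (\<forall>x\<in>V. x - (\<Sum>i\<in>UNIV. D i (T i x)) \<in> cspan B))"

lemma right_inv_modI:
  assumes "\<And>i. blin V N V N (C i)" "finite B" "B \<subseteq> V"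
    "\<And>y. y \<in> V \<Longrightarrow> y - (\<Sum>i\<in>UNIV. T i (C i y)) \<in> cspan B"
  shows "right_inv_mod V N T"
  unfolding right_inv_mod_def using assms by (intro exI[of _ C] exI[of _ B]) simp

lemma left_inv_modI:
  assumes "\<And>i. blin V N V N (D i)" "finite B" "B \<subseteq> V"
    "\<And>x. x \<in> V \<Longrightarrow> x - (\<Sum>i\<in>UNIV. D i (T i x)) \<in> cspan B"
  shows "left_inv_mod V N T"
  unfolding left_inv_mod_def using assms by (intro exI[of _ D] exI[of _ B]) simp

lemma direct_complementE:
  fixes W :: "('i::finite \<Rightarrow> 'a::complex_vector) set"
  assumes "has_direct_complement (power_topology V N) W" and N: "norm_on V N"
  obtains U where "csubspace U" "closed_on (PiC UNIV V) (pn UNIV N) U" "W \<inter> U = {0}"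
    "\<And>x. x \<in> PiC UNIV V \<Longrightarrow> \<exists>w u. w \<in> W \<and> u \<in> U \<and> x = w + u" "U \<subseteq> PiC UNIV V"
proof -
  obtain U where U: "csubspace U" "closed_on (PiC UNIV V) (pn UNIV N) U" "W \<inter> U = {0}"
    "{w + u | w u. w \<in> W \<and> u \<in> U} = PiC UNIV V"
    using assms(1) unfolding has_direct_complement_def closedin_power_topology_iff[OF N]
      topspace_power_topology[OF N] by blast
  have "\<exists>w u. w \<in> W \<and> u \<in> U \<and> x = w + u" if "x \<in> PiC UNIV V" for x
    using that unfolding U(4)[symmetric] by blast
  moreover have "U \<subseteq> PiC UNIV V"
    using U(2) by (simp add: closed_on_def)
  ultimately show ?thesis
    using that[of U] U(1-3) by simp
qed

text \<open>A set of least cardinality that spans \<open>V\<close> together with \<open>M\<close> is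
  independent modulo \<open>M\<close>, because a vector with nonzero coefficient in a relation could
  be dropped.\<close>

lemma complement_basis_modulo:
  assumes "csubspace M" "codim_le V M r"
  obtains B where "finite B" "B \<subseteq> V" "cspan (M \<union> B) = V"
    "\<And>c. (\<Sum>b\<in>B. scaleC (c b) b) \<in> M \<Longrightarrow> \<forall>b\<in>B. c b = 0"
proof -
  define Q where "Q n \<longleftrightarrow> (\<exists>B. finite B \<and> card B = n \<and> cspan (M \<union> B) = V)" for n
  have "\<exists>n. Q n"
    using assms(2) by (auto simp: codim_le_def Q_def)
  then have "Q (LEAST n. Q n)"
    by (rule LeastI_ex)
  then obtain B where B: "finite B" "card B = (LEAST n. Q n)" "cspan (M \<union> B) = V"
    unfolding Q_def by blast
  show ?thesis
  proof (rule that[OF B(1) _ B(3)])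
    show "B \<subseteq> V"
      using B(3) cvec.span_superset[of "M \<union> B"] by blast
    fix c assume c: "(\<Sum>b\<in>B. scaleC (c b) b) \<in> M"
    show "\<forall>b\<in>B. c b = 0"
    proof (rule ccontr)
      assume "\<not> ?thesis"
      then obtain b where b: "b \<in> B" "c b \<noteq> 0"
        by blast
      let ?S = "cspan (M \<union> (B - {b}))"
      have "scaleC (c b) b = (\<Sum>b\<in>B. scaleC (c b) b) - (\<Sum>b\<in>B - {b}. scaleC (c b) b)"
        using B(1) b(1) by (simp add: sum.remove[of B b])
      also have "\<dots> \<in> ?S"
      proof (rule cvec.span_diff)
        show "(\<Sum>b\<in>B. scaleC (c b) b) \<in> ?S"
          using c by (intro cvec.span_base) simp
        show "(\<Sum>b\<in>B - {b}. scaleC (c b) b) \<in> ?S"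
          by (intro cvec.span_sum cvec.span_scale cvec.span_base) simp
      qed
      finally have "scaleC (1 / c b) (scaleC (c b) b) \<in> ?S"
        by (rule cvec.span_scale)
      then have bS: "b \<in> ?S"
        using b(2) by (simp add: scaleC_scaleC scaleC_one)
      have "M \<union> B \<subseteq> ?S"
      proof
        fix x assume "x \<in> M \<union> B"
        then show "x \<in> ?S"
          using bS by (cases "x = b") (auto intro: cvec.span_base)
      qed
      then have "V \<subseteq> ?S"
        unfolding B(3)[symmetric] by (rule cvec.span_minimal) simp
      moreover have "?S \<subseteq> V"
        unfolding B(3)[symmetric] by (rule cvec.span_mono) blast
      ultimately have "Q (card (B - {b}))"
        unfolding Q_def using B(1) by blast
      then have "(LEAST n. Q n) \<le> card (B - {b})"
        by (rule Least_le)
      moreover have "card (B - {b}) < card B"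
        using B(1) b(1) by (intro psubset_card_mono) auto
      ultimately show False
        using B(2) by simp
    qed
  qed
qed

lemma span_UnE:
  assumes "x \<in> cspan (M \<union> B)" "csubspace M" "finite B"
  obtains m c where "m \<in> M" "x = m + (\<Sum>b\<in>B. scaleC (c b) b)"
proof -
  have "cspan M = M"
    using assms(2) by simp
  have "x \<in> {x + y | x y. x \<in> cspan M \<and> y \<in> cspan B}"
    using assms(1) unfolding cvec.span_Un .
  then obtain m v where "m \<in> M" "v \<in> cspan B" "x = m + v"
    unfolding \<open>cspan M = M\<close> by blast
  moreover from this obtain c where "v = (\<Sum>b\<in>B. scaleC (c b) b)"
    unfolding cvec.span_finite[OF assms(3)] by auto
  ultimately show ?thesis
    using that[of m c] by simp
qed

text \<open>On a closed complement of its kernel \<open>hat T\<close> is injective, and adding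
  coordinates for a complement of its range makes it a bijection of Banach spaces. The first
  component of the bounded inverse is the right inverse.\<close>

lemma right_inv_mod_if_split:
  fixes T :: "'i::finite \<Rightarrow> 'a::complex_vector \<Rightarrow> 'a"
  assumes V: "banach_on V N" and T: "comm_ops V N T" and fin: "codim_le V (M_sum V 1 T) r"
    and comp: "has_direct_complement (power_topology V N) (null_hat V T)"
  shows "right_inv_mod V N T"
proof -
  note N = banach_on_norm_on[OF V]
  note NP = norm_on_PiC[OF N finite, of UNIV]
  note f = blin_hat[OF N T]
  obtain U where U: "csubspace U" "closed_on (PiC UNIV V) (pn UNIV N) U" "null_hat V T \<inter> U = {0}"
    "\<And>x. x \<in> PiC UNIV V \<Longrightarrow> \<exists>w u. w \<in> null_hat V T \<and> u \<in> U \<and> x = w + u" "U \<subseteq> PiC UNIV V"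
    by (rule direct_complementE[OF comp N]) (rule that)
  have BU: "banach_on U (pn UNIV N)"
    by (rule banach_on_closed[OF banach_on_PiC[OF V finite] U(2,1)])
  note NU = banach_on_norm_on[OF BU]
  obtain B where B: "finite B" "B \<subseteq> V" "cspan (M_sum V 1 T \<union> B) = V"
    "\<And>c. (\<Sum>b\<in>B. scaleC (c b) b) \<in> M_sum V 1 T \<Longrightarrow> \<forall>b\<in>B. c b = 0"
    by (rule complement_basis_modulo[OF csubspace_M_sum[OF N T] fin]) (rule that)
  let ?P = "PiC B (UNIV :: complex set)" and ?n = "pn B (norm :: complex \<Rightarrow> real)"
  have BP: "banach_on ?P ?n"
    by (rule banach_on_PiC[OF banach_on_norm B(1)])
  note NB = banach_on_norm_on[OF BP]
  let ?X = "U \<times> ?P" and ?nX = "\<lambda>x. pn UNIV N (fst x) + ?n (snd x)"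
  have BX: "banach_on ?X ?nX"
    by (rule banach_on_prod[OF BU BP])
  define \<Psi> where "\<Psi> x = hat T (fst x) + (\<Sum>b\<in>B. scaleC (snd x b) b)" for x
  have "blin ?X ?nX V N (\<lambda>x. scaleC (snd x b) b)" if "b \<in> B" for b
    using blin_functional_scale[OF blin_comp[OF blin_snd[OF NU NB]
          blin_component[OF norm_on_norm B(1) that] NB] N] B(2) that by blast
  then have \<Psi>: "blin ?X ?nX V N \<Psi>"
    unfolding \<Psi>_def
    by (intro blin_add_map[OF blin_comp[OF blin_fst[OF NU NB] blin_restrict[OF f U(5)] NU]
          blin_sum_map[OF _ N] N])
  have M1: "M_sum V 1 T = hat T ` PiC UNIV V"
    using M_sum_eq[OF N T, of 1] by simp
  have bij: "bij_betw \<Psi> ?X V"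
    unfolding bij_betw_def
  proof
    show "inj_on \<Psi> ?X"
    proof (rule inj_onI)
      fix x y assume x: "x \<in> ?X" and y: "y \<in> ?X" and eq: "\<Psi> x = \<Psi> y"
      have d: "fst y - fst x \<in> U"
        using x y cvec.subspace_diff[OF U(1)] by auto
      have "(\<Sum>b\<in>B. scaleC (snd x b - snd y b) b) = hat T (fst y) - hat T (fst x)"
        using eq by (simp add: \<Psi>_def cvec.scale_left_diff_distrib sum_subtractf algebra_simps)
      also have "\<dots> = hat T (fst y - fst x)"
        using x y U(5) by (subst blin_diff[OF NP f]) auto
      finally have e: "(\<Sum>b\<in>B. scaleC (snd x b - snd y b) b) = hat T (fst y - fst x)" .
      also have "\<dots> \<in> M_sum V 1 T"
        unfolding M1 using d U(5) by blast
      finally have "\<forall>b\<in>B. snd x b - snd y b = 0"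
        by (rule B(4))
      then have 0: "\<forall>b\<in>B. snd x b = snd y b"
        by simp
      then have "snd x = snd y"
        using x y by (auto simp: PiC_def fun_eq_iff)
      moreover have "hat T (fst y - fst x) = 0"
        using e 0 by simp
      then have "fst y - fst x \<in> null_hat V T \<inter> U"
        using d U(5) by (auto simp: null_hat_def PiC_UNIV)
      then have "fst y - fst x = 0"
        unfolding U(3) by simp
      ultimately show "x = y"
        by (simp add: prod_eq_iff)
    qed
    show "\<Psi> ` ?X = V"
    proof
      show "\<Psi> ` ?X \<subseteq> V"
        using blin_mem[OF \<Psi>] by blast
      show "V \<subseteq> \<Psi> ` ?X"
      proof
        fix y assume "y \<in> V"
        then have "y \<in> cspan (M_sum V 1 T \<union> B)"
          unfolding B(3) .
        then obtain m c where m: "m \<in> M_sum V 1 T" "y = m + (\<Sum>b\<in>B. scaleC (c b) b)"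
          by (rule span_UnE[OF _ csubspace_M_sum[OF N T] B(1)])
        obtain x where x: "x \<in> PiC UNIV V" "m = hat T x"
          using m(1) unfolding M1 by blast
        obtain w u where wu: "w \<in> null_hat V T" "u \<in> U" "x = w + u"
          using U(4)[OF x(1)] by blast
        have "hat T x = hat T w + hat T u"
          unfolding wu(3) using wu(1,2) U(5) by (intro blin_add[OF f]) (auto simp: null_hat_def PiC_UNIV)
        then have "m = hat T u"
          using wu(1) x(2) by (simp add: null_hat_def)
        moreover have "(\<Sum>b\<in>B. scaleC (if b \<in> B then c b else 0) b) = (\<Sum>b\<in>B. scaleC (c b) b)"
          by (intro sum.cong) auto
        ultimately have "y = \<Psi> (u, \<lambda>b. if b \<in> B then c b else 0)"
          using m(2) by (simp add: \<Psi>_def)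
        moreover have "(u, \<lambda>b. if b \<in> B then c b else 0) \<in> ?X"
          using wu(2) by (simp add: PiC_def)
        ultimately show "y \<in> \<Psi> ` ?X"
          by blast
      qed
    qed
  qed
  obtain g where g: "blin V N ?X ?nX g" "\<And>x. x \<in> ?X \<Longrightarrow> g (\<Psi> x) = x" "\<And>y. y \<in> V \<Longrightarrow> \<Psi> (g y) = y"
    by (rule bounded_inverse[OF BX V \<Psi> bij]) (rule that)
  have C: "blin V N (PiC UNIV V) (pn UNIV N) (\<lambda>y. fst (g y))"
    by (rule blin_comp[OF g(1) _ banach_on_norm_on[OF BX]])
      (rule blin_comp[OF blin_fst[OF NU NB] blin_restrict[OF blin_id U(5)] NU])
  show ?thesis
  proof (rule right_inv_modI[OF _ B(1,2)])
    show "blin V N V N (\<lambda>y. fst (g y) i)" for i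
      by (rule blin_comp[OF C blin_component[OF N finite UNIV_I] NP])
    fix y assume y: "y \<in> V"
    have "y = hat T (fst (g y)) + (\<Sum>b\<in>B. scaleC (snd (g y) b) b)"
      using g(3)[OF y] by (simp add: \<Psi>_def)
    then have "y - (\<Sum>i\<in>UNIV. T i (fst (g y) i)) = (\<Sum>b\<in>B. scaleC (snd (g y) b) b)"
      unfolding hat_def by (metis add_diff_cancel_left')
    also have "\<dots> \<in> cspan B"
      by (intro cvec.span_sum cvec.span_scale cvec.span_base)
    finally show "y - (\<Sum>i\<in>UNIV. T i (fst (g y) i)) \<in> cspan B" .
  qed
qed

text \<open>The dual construction: \<open>tilde T\<close> on the null space of a projection onto its
  kernel, together with a closed complement of its range, gives a bijection onto the power. The
  first component of the bounded inverse is the left inverse.\<close>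

lemma left_inv_mod_if_split:
  fixes T :: "'i::finite \<Rightarrow> 'a::complex_vector \<Rightarrow> 'a"
  assumes V: "banach_on V N" and T: "comm_ops V N T" and F: "upper_semi_Fredholm V N T"
    and comp: "has_direct_complement (power_topology V N) (range_tilde V T)"
  shows "left_inv_mod V N T"
proof -
  note N = banach_on_norm_on[OF V]
  note NP = norm_on_PiC[OF N finite, of UNIV]
  note f = blin_tilde[OF N T]
  note BPV = banach_on_PiC[OF V finite, of UNIV]
  obtain U where U: "csubspace U" "closed_on (PiC UNIV V) (pn UNIV N) U" "range_tilde V T \<inter> U = {0}"
    "\<And>x. x \<in> PiC UNIV V \<Longrightarrow> \<exists>w u. w \<in> range_tilde V T \<and> u \<in> U \<and> x = w + u" "U \<subseteq> PiC UNIV V"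
    by (rule direct_complementE[OF comp N]) (rule that)
  have BU: "banach_on U (pn UNIV N)"
    by (rule banach_on_closed[OF BPV U(2,1)])
  note NU = banach_on_norm_on[OF BU]
  obtain r where "fdim_le (null_tilde V T) r"
    using F unfolding upper_semi_Fredholm_def cdim_finite_iff_fdim_le by blast
  then obtain B where B: "finite B" "card B \<le> r" "B \<subseteq> null_tilde V T" "cvec.independent B"
    "null_tilde V T \<subseteq> cspan B"
    by (rule fdim_le_basis)
  have BV: "B \<subseteq> V"
    using B(3) null_tilde_subset by blast
  from dual_basis[OF N B(1) BV B(4)] obtain h where
    h: "\<And>b. b \<in> B \<Longrightarrow> blin V N UNIV norm (h b :: 'a \<Rightarrow> complex)"
      "\<And>b c. b \<in> B \<Longrightarrow> c \<in> B \<Longrightarrow> h b c = (if b = c then 1 else 0)"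
    by blast
  define pr where "pr x = (\<Sum>b\<in>B. scaleC (h b x) b)" for x
  have pr: "blin V N V N pr"
    unfolding pr_def by (rule blin_sum_map[OF blin_functional_scale[OF h(1) N] N]) (use BV in auto)
  have pr_span: "pr x \<in> cspan B" for x
    unfolding pr_def by (intro cvec.span_sum cvec.span_scale cvec.span_base)
  have pr_id: "pr x = x" if "x \<in> cspan B" for x
    unfolding pr_def using that by (intro dual_basis_expand[OF N B(1) BV h]) auto
  have span_null: "cspan B \<subseteq> null_tilde V T"
    by (rule cvec.span_minimal[OF B(3) csubspace_null_tilde[OF N T]])
  let ?Y = "{x \<in> V. pr x = 0}"
  have BY: "banach_on ?Y N"
    by (rule banach_on_closed[OF V closed_on_eq_blin[OF N N pr blin_zero_map[OF N]]
          csubspace_eq_blin[OF N pr blin_zero_map[OF N]]])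
  note NY = banach_on_norm_on[OF BY]
  let ?X = "?Y \<times> U" and ?nX = "\<lambda>x. N (fst x) + pn UNIV N (snd x)"
  have BX: "banach_on ?X ?nX"
    by (rule banach_on_prod[OF BY BU])
  define \<Psi> where "\<Psi> x = tilde T (fst x) + snd x" for x
  have YV: "?Y \<subseteq> V"
    by blast
  have \<Psi>: "blin ?X ?nX (PiC UNIV V) (pn UNIV N) \<Psi>"
    unfolding \<Psi>_def
    by (rule blin_add_map[OF blin_comp[OF blin_fst[OF NY NU] blin_restrict[OF f YV] NY]
          blin_comp[OF blin_snd[OF NY NU] blin_restrict[OF blin_id U(5)] NU] NP])
  have res: "x - pr x \<in> ?Y" "tilde T (x - pr x) = tilde T x" if x: "x \<in> V" for x
  proof -
    have "pr (x - pr x) = 0"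
      using blin_diff[OF N pr x blin_mem[OF pr x]] pr_id[OF pr_span] by simp
    then show "x - pr x \<in> ?Y"
      using norm_on_diff_mem[OF N x blin_mem[OF pr x]] by simp
    have "tilde T (pr x) = 0"
      using span_null pr_span by (auto simp: null_tilde_def)
    then show "tilde T (x - pr x) = tilde T x"
      using blin_diff[OF N f x blin_mem[OF pr x]] by simp
  qed
  have bij: "bij_betw \<Psi> ?X (PiC UNIV V)"
    unfolding bij_betw_def
  proof
    show "inj_on \<Psi> ?X"
    proof (rule inj_onI)
      fix x y assume x: "x \<in> ?X" and y: "y \<in> ?X" and eq: "\<Psi> x = \<Psi> y"
      have xy: "fst x \<in> V" "fst y \<in> V" "pr (fst x) = 0" "pr (fst y) = 0"
        using x y by auto
      have d: "snd y - snd x \<in> U"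
        using x y cvec.subspace_diff[OF U(1)] by auto
      have "tilde T (fst x - fst y) = tilde T (fst x) - tilde T (fst y)"
        by (rule blin_diff[OF N f xy(1,2)])
      also have "\<dots> = snd y - snd x"
        using eq by (simp add: \<Psi>_def algebra_simps)
      finally have e: "tilde T (fst x - fst y) = snd y - snd x" .
      have dV: "fst x - fst y \<in> V"
        by (rule norm_on_diff_mem[OF N xy(1,2)])
      then have "snd y - snd x \<in> range_tilde V T \<inter> U"
        using d unfolding e[symmetric] range_tilde_def by blast
      then have 0: "snd y - snd x = 0"
        unfolding U(3) by simp
      then have "fst x - fst y \<in> null_tilde V T"
        using e dV by (simp add: null_tilde_def)
      then have "pr (fst x - fst y) = fst x - fst y"
        using B(5) by (intro pr_id) auto
      then have "fst x - fst y = 0"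
        using blin_diff[OF N pr xy(1,2)] xy(3,4) by simp
      then show "x = y"
        using 0 by (simp add: prod_eq_iff)
    qed
    show "\<Psi> ` ?X = PiC UNIV V"
    proof
      show "\<Psi> ` ?X \<subseteq> PiC UNIV V"
        using blin_mem[OF \<Psi>] by blast
      show "PiC UNIV V \<subseteq> \<Psi> ` ?X"
      proof
        fix y :: "'i \<Rightarrow> 'a" assume "y \<in> PiC UNIV V"
        then obtain w u where wu: "w \<in> range_tilde V T" "u \<in> U" "y = w + u"
          using U(4) by blast
        then obtain x where x: "x \<in> V" "w = tilde T x"
          unfolding range_tilde_def by blast
        have "y = \<Psi> (x - pr x, u)"
          using res(2)[OF x(1)] wu(3) x(2) by (simp add: \<Psi>_def)
        moreover have "(x - pr x, u) \<in> ?X"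
          using res(1)[OF x(1)] wu(2) by simp
        ultimately show "y \<in> \<Psi> ` ?X"
          by blast
      qed
    qed
  qed
  obtain g where g: "blin (PiC UNIV V) (pn UNIV N) ?X ?nX g" "\<And>x. x \<in> ?X \<Longrightarrow> g (\<Psi> x) = x"
    "\<And>y. y \<in> PiC UNIV V \<Longrightarrow> \<Psi> (g y) = y"
    by (rule bounded_inverse[OF BX BPV \<Psi> bij]) (rule that)
  define D where "D w = fst (g w)" for w
  have D: "blin (PiC UNIV V) (pn UNIV N) V N D"
    unfolding D_def
    by (rule blin_comp[OF g(1) _ banach_on_norm_on[OF BX]])
      (rule blin_comp[OF blin_fst[OF NY NU] blin_restrict[OF blin_id YV] NY])
  \<comment> \<open>\<open>e i\<close> embeds the space as the \<open>i\<close>-th coordinate;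
    composing \<open>D\<close> with it splits \<open>D\<close> into coordinates.\<close>
  define e where "e i v = (\<lambda>j. if j = i then v else 0 :: 'a)" for i :: 'i and v
  have e: "blin V N (PiC UNIV V) (pn UNIV N) (e i)" for i
  proof -
    have "blin V N (PiC UNIV V) (pn UNIV N) (\<lambda>v j. if j \<in> UNIV then (if j = i then v else 0) else 0)"
    proof (rule blin_tuple[OF N finite])
      show "blin V N V N (\<lambda>v. if j = i then v else 0)" for j
        using blin_id[of V N] blin_zero_map[OF N] by (cases "j = i") simp_all
    qed
    then show ?thesis
      by (simp add: e_def[abs_def])
  qed
  show ?thesis
  proof (rule left_inv_modI[OF _ B(1) BV])
    show "blin V N V N (\<lambda>v. D (e i v))" for i
      by (rule blin_comp[OF e D NP])
    fix x assume x: "x \<in> V"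
    have Tx: "T i x \<in> V" for i
      by (rule blin_mem[OF comm_ops_blin[OF N T] x])
    have "(\<Sum>i\<in>UNIV. D (e i (T i x))) = D (\<Sum>i\<in>UNIV. e i (T i x))"
      by (rule blin_sum[OF NP D, symmetric]) (rule blin_mem[OF e Tx])
    also have "(\<Sum>i\<in>UNIV. e i (T i x)) = tilde T x"
      by (simp add: fun_eq_iff tilde_def e_def sum_fun_apply)
    also have "D (tilde T x) = D (\<Psi> (x - pr x, 0))"
      by (simp add: \<Psi>_def res(2)[OF x])
    also have "\<dots> = x - pr x"
      unfolding D_def using res(1)[OF x] cvec.subspace_0[OF U(1)] by (subst g(2)) auto
    finally show "x - (\<Sum>i\<in>UNIV. D (e i (T i x))) \<in> cspan B"
      using pr_span by simp
  qed
qed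

text \<open>If \<open>y\<close> is solved with exponents \<open>e(i := a)\<close>, the coordinate
  \<open>C i y\<close> can in turn be solved with exponents \<open>e(i := b)\<close> and
  substituted; the terms are sorted by commuting the powers. The spanning sets of the residuals are
  joined and grow with \<open>k\<close>, so only existence is taken from here.\<close>

lemma right_inv_mod_pow:
  assumes N: "norm_on V N" and T: "comm_ops V N T" and R: "right_inv_mod V N T" and k: "1 \<le> k"
  shows "right_inv_mod V N (powt T k)"
proof -
  have "right_inv_mod V N (\<lambda>i. T i ^^ k)"
  proof (rule exponent_induct[where P = "\<lambda>e. right_inv_mod V N (\<lambda>i. T i ^^ e i)", OF _ _ k])
    show "right_inv_mod V N (\<lambda>i. T i ^^ 1)"
      using R by simp
    fix e i a b
    assume a: "right_inv_mod V N (\<lambda>j. T j ^^ (e(i := a)) j)"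
      and b: "right_inv_mod V N (\<lambda>j. T j ^^ (e(i := b)) j)"
    obtain C B where C: "\<And>j. blin V N V N (C j)" and B: "finite B" "B \<subseteq> V"
      and CB: "\<And>y. y \<in> V \<Longrightarrow> y - (\<Sum>j\<in>UNIV. (T j ^^ (e(i := a)) j) (C j y)) \<in> cspan B"
      using a unfolding right_inv_mod_def by blast
    obtain C' B' where C': "\<And>j. blin V N V N (C' j)" and B': "finite B'" "B' \<subseteq> V"
      and CB': "\<And>y. y \<in> V \<Longrightarrow> y - (\<Sum>j\<in>UNIV. (T j ^^ (e(i := b)) j) (C' j y)) \<in> cspan B'"
      using b unfolding right_inv_mod_def by blast
    define A where "A = T i ^^ a"
    have A: "blin V N V N A"
      unfolding A_def by (rule comm_ops_blin_pow[OF N T])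
    \<comment> \<open>In coordinate \<open>i\<close> the two solutions compose; elsewhere the second
      one is added after applying \<open>T i ^^ a\<close>.\<close>
    define E where "E j = (if j = i then (\<lambda>y. C' i (C i y)) else (\<lambda>y. C j y + A (C' j (C i y))))" for j
    have E: "blin V N V N (E j)" for j
      using blin_comp[OF C C' N] blin_add_map[OF C blin_comp[OF blin_comp[OF C C' N] A N] N]
      by (simp add: E_def)
    show "right_inv_mod V N (\<lambda>j. T j ^^ (e(i := a + b)) j)"
    proof (rule right_inv_modI[where C = E and B = "B \<union> A ` B'"])
      show "B \<union> A ` B' \<subseteq> V"
        using B(2) B'(2) blin_mem[OF A] by blast
      fix y assume y: "y \<in> V"
      have Cy: "C j y \<in> V" and C'C: "C' j (C i y) \<in> V" for j
        using blin_mem[OF C y] blin_mem[OF C' blin_mem[OF C y]] by auto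
      have split: "(\<Sum>j\<in>UNIV. (T j ^^ (e(i := c)) j) (z j)) =
          (T i ^^ c) (z i) + (\<Sum>j\<in>UNIV - {i}. (T j ^^ e j) (z j))" for c and z :: "'b \<Rightarrow> 'a"
        by (simp add: sum.remove[of UNIV i])
      let ?S = "\<Sum>j\<in>UNIV - {i}. (T j ^^ e j) (C j y)"
      let ?S' = "\<Sum>j\<in>UNIV - {i}. (T j ^^ e j) (C' j (C i y))"
      have S'V: "?S' \<in> V"
        by (intro norm_on_sum_mem[OF N] blin_mem[OF comm_ops_blin_pow[OF N T]] C'C)
      have "(\<Sum>j\<in>UNIV - {i}. (T j ^^ e j) (E j y)) =
          (\<Sum>j\<in>UNIV - {i}. (T j ^^ e j) (C j y) + A ((T j ^^ e j) (C' j (C i y))))"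
        by (intro sum.cong refl)
          (simp add: E_def A_def blin_add[OF comm_ops_blin_pow[OF N T] Cy]
            blin_mem[OF comm_ops_blin_pow[OF N T] C'C] comm_ops_commute[OF N T C'C])
      also have "\<dots> = ?S + A ?S'"
        unfolding sum.distrib
        by (subst blin_sum[OF N A]) (auto intro: blin_mem[OF comm_ops_blin_pow[OF N T]] C'C)
      finally have s1: "(\<Sum>j\<in>UNIV - {i}. (T j ^^ e j) (E j y)) = ?S + A ?S'" .
      have s2: "(T i ^^ (a + b)) (E i y) = A ((T i ^^ b) (C' i (C i y)))"
        by (simp add: E_def A_def funpow_add)
      have "A (C i y - ((T i ^^ b) (C' i (C i y)) + ?S')) =
          A (C i y) - (A ((T i ^^ b) (C' i (C i y))) + A ?S')"
        by (simp add: blin_diff[OF N A] blin_add[OF A] Cy S'V norm_on_add_mem[OF N]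
            blin_mem[OF comm_ops_blin_pow[OF N T] C'C])
      then have "y - (\<Sum>j\<in>UNIV. (T j ^^ (e(i := a + b)) j) (E j y)) =
          (y - (\<Sum>j\<in>UNIV. (T j ^^ (e(i := a)) j) (C j y))) +
          A (C i y - (\<Sum>j\<in>UNIV. (T j ^^ (e(i := b)) j) (C' j (C i y))))"
        unfolding split s1 s2 by (simp add: A_def algebra_simps)
      also have "\<dots> \<in> cspan (B \<union> A ` B')"
      proof (rule cvec.span_add)
        show "y - (\<Sum>j\<in>UNIV. (T j ^^ (e(i := a)) j) (C j y)) \<in> cspan (B \<union> A ` B')"
          using CB[OF y] cvec.span_mono[of B "B \<union> A ` B'"] by blast
        show "A (C i y - (\<Sum>j\<in>UNIV. (T j ^^ (e(i := b)) j) (C' j (C i y)))) \<in> cspan (B \<union> A ` B')"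
          using blin_cspan[OF A norm_on_subspace[OF N] B'(2) CB'[OF Cy]]
            cvec.span_mono[of "A ` B'" "B \<union> A ` B'"] by blast
      qed
      finally show "y - (\<Sum>j\<in>UNIV. (T j ^^ (e(i := a + b)) j) (E j y)) \<in> cspan (B \<union> A ` B')" .
    qed (use B B' E in auto)
  qed
  then show ?thesis
    by (simp add: powt_def)
qed

text \<open>Mirror image of \<open>right_inv_mod_pow\<close>: the second left inverse is inserted at
  \<open>A x\<close> under \<open>D i\<close>.\<close>

lemma left_inv_mod_pow:
  assumes N: "norm_on V N" and T: "comm_ops V N T" and R: "left_inv_mod V N T" and k: "1 \<le> k"
  shows "left_inv_mod V N (powt T k)"
proof -
  have "left_inv_mod V N (\<lambda>i. T i ^^ k)"
  proof (rule exponent_induct[where P = "\<lambda>e. left_inv_mod V N (\<lambda>i. T i ^^ e i)", OF _ _ k])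
    show "left_inv_mod V N (\<lambda>i. T i ^^ 1)"
      using R by simp
    fix e i a b
    assume a: "left_inv_mod V N (\<lambda>j. T j ^^ (e(i := a)) j)"
      and b: "left_inv_mod V N (\<lambda>j. T j ^^ (e(i := b)) j)"
    obtain D B where D: "\<And>j. blin V N V N (D j)" and B: "finite B" "B \<subseteq> V"
      and DB: "\<And>x. x \<in> V \<Longrightarrow> x - (\<Sum>j\<in>UNIV. D j ((T j ^^ (e(i := a)) j) x)) \<in> cspan B"
      using a unfolding left_inv_mod_def by blast
    obtain D' B' where D': "\<And>j. blin V N V N (D' j)" and B': "finite B'" "B' \<subseteq> V"
      and DB': "\<And>x. x \<in> V \<Longrightarrow> x - (\<Sum>j\<in>UNIV. D' j ((T j ^^ (e(i := b)) j) x)) \<in> cspan B'"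
      using b unfolding left_inv_mod_def by blast
    define A where "A = T i ^^ a"
    have A: "blin V N V N A"
      unfolding A_def by (rule comm_ops_blin_pow[OF N T])
    define E where "E j = (if j = i then (\<lambda>x. D i (D' i x)) else (\<lambda>x. D j x + D i (D' j (A x))))" for j
    have E: "blin V N V N (E j)" for j
      using blin_comp[OF D' D N] blin_add_map[OF D blin_comp[OF blin_comp[OF A D' N] D N] N]
      by (simp add: E_def)
    show "left_inv_mod V N (\<lambda>j. T j ^^ (e(i := a + b)) j)"
    proof (rule left_inv_modI[where D = E and B = "B \<union> D i ` B'"])
      show "B \<union> D i ` B' \<subseteq> V"
        using B(2) B'(2) blin_mem[OF D] by blast
      fix x assume x: "x \<in> V"
      have Ax: "A x \<in> V"
        by (rule blin_mem[OF A x])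
      have TV: "(T j ^^ n) u \<in> V" if "u \<in> V" for j n u
        by (rule blin_mem[OF comm_ops_blin_pow[OF N T] that])
      have split: "(\<Sum>j\<in>UNIV. F j ((T j ^^ (e(i := c)) j) z)) =
          F i ((T i ^^ c) z) + (\<Sum>j\<in>UNIV - {i}. F j ((T j ^^ e j) z))" for c z and F :: "'b \<Rightarrow> 'a \<Rightarrow> 'a"
        by (simp add: sum.remove[of UNIV i])
      let ?S = "\<Sum>j\<in>UNIV - {i}. D j ((T j ^^ e j) x)"
      let ?S' = "\<Sum>j\<in>UNIV - {i}. D' j ((T j ^^ e j) (A x))"
      have S'V: "?S' \<in> V"
        by (intro norm_on_sum_mem[OF N] blin_mem[OF D'] TV Ax)
      have "(\<Sum>j\<in>UNIV - {i}. E j ((T j ^^ e j) x)) =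
          (\<Sum>j\<in>UNIV - {i}. D j ((T j ^^ e j) x) + D i (D' j ((T j ^^ e j) (A x))))"
        by (intro sum.cong refl) (simp add: E_def A_def comm_ops_commute[OF N T x])
      also have "\<dots> = ?S + D i ?S'"
        unfolding sum.distrib
        by (subst blin_sum[OF N D]) (auto intro: blin_mem[OF D'] TV Ax)
      finally have s1: "(\<Sum>j\<in>UNIV - {i}. E j ((T j ^^ e j) x)) = ?S + D i ?S'" .
      have s2: "E i ((T i ^^ (a + b)) x) = D i (D' i ((T i ^^ b) (A x)))"
        by (simp add: E_def A_def add.commute[of a b] funpow_add)
      have "D i (A x - (D' i ((T i ^^ b) (A x)) + ?S')) =
          D i (A x) - (D i (D' i ((T i ^^ b) (A x))) + D i ?S')"
        by (simp add: blin_diff[OF N D] blin_add[OF D] Ax S'V norm_on_add_mem[OF N]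
            blin_mem[OF D'] TV)
      then have "x - (\<Sum>j\<in>UNIV. E j ((T j ^^ (e(i := a + b)) j) x)) =
          (x - (\<Sum>j\<in>UNIV. D j ((T j ^^ (e(i := a)) j) x))) +
          D i (A x - (\<Sum>j\<in>UNIV. D' j ((T j ^^ (e(i := b)) j) (A x))))"
        unfolding split s1 s2 by (simp add: A_def algebra_simps)
      also have "\<dots> \<in> cspan (B \<union> D i ` B')"
      proof (rule cvec.span_add)
        show "x - (\<Sum>j\<in>UNIV. D j ((T j ^^ (e(i := a)) j) x)) \<in> cspan (B \<union> D i ` B')"
          using DB[OF x] cvec.span_mono[of B "B \<union> D i ` B'"] by blast
        show "D i (A x - (\<Sum>j\<in>UNIV. D' j ((T j ^^ (e(i := b)) j) (A x)))) \<in> cspan (B \<union> D i ` B')"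
          using blin_cspan[OF D norm_on_subspace[OF N] B'(2) DB'[OF Ax]]
            cvec.span_mono[of "D i ` B'" "B \<union> D i ` B'"] by blast
      qed
      finally show "x - (\<Sum>j\<in>UNIV. E j ((T j ^^ (e(i := a + b)) j) x)) \<in> cspan (B \<union> D i ` B')" .
    qed (use B B' E in auto)
  qed
  then show ?thesis
    by (simp add: powt_def)
qed

lemma hat_generalised_inverse:
  fixes T :: "'i::finite \<Rightarrow> 'a::complex_vector \<Rightarrow> 'a"
  assumes N: "norm_on V N" and T: "comm_ops V N T" and R: "right_inv_mod V N T"
  obtains g where "blin V N (PiC UNIV V) (pn UNIV N) g"
    "\<And>x. x \<in> PiC UNIV V \<Longrightarrow> hat T (g (hat T x)) = hat T x"
proof -
  note NP = norm_on_PiC[OF N finite, of UNIV]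
  note f = blin_hat[OF N T]
  obtain C B where C: "\<And>i. blin V N V N (C i)" and B: "finite B"
    "\<And>y. y \<in> V \<Longrightarrow> y - (\<Sum>i\<in>UNIV. T i (C i y)) \<in> cspan B"
    using R unfolding right_inv_mod_def by blast
  have W: "blin V N (PiC UNIV V) (pn UNIV N) (\<lambda>y i. C i y)"
    using blin_tuple[OF N finite, of UNIV V N C] C by simp
  have fWf: "hat T x - hat T (\<lambda>i. C i (hat T x)) \<in> cspan B" if "x \<in> PiC UNIV V" for x
    using B(2)[OF blin_mem[OF f that]] by (simp add: hat_def)
  show ?thesis
    using generalised_inverse[OF NP N f W B(1), OF fWf] that by auto
qed

lemma tilde_generalised_inverse:
  fixes T :: "'i::finite \<Rightarrow> 'a::complex_vector \<Rightarrow> 'a"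
  assumes N: "norm_on V N" and T: "comm_ops V N T" and R: "left_inv_mod V N T"
  obtains g where "blin (PiC UNIV V) (pn UNIV N) V N g"
    "\<And>x. x \<in> V \<Longrightarrow> tilde T (g (tilde T x)) = tilde T x"
proof -
  note NP = norm_on_PiC[OF N finite, of UNIV]
  note f = blin_tilde[OF N T]
  obtain D B where D: "\<And>i. blin V N V N (D i)" and B: "finite B" "B \<subseteq> V"
    "\<And>x. x \<in> V \<Longrightarrow> x - (\<Sum>i\<in>UNIV. D i (T i x)) \<in> cspan B"
    using R unfolding left_inv_mod_def by blast
  have W: "blin (PiC UNIV V) (pn UNIV N) V N (\<lambda>w. \<Sum>i\<in>UNIV. D i (w i))"
    by (rule blin_sum_map[OF blin_comp[OF blin_component[OF N finite UNIV_I] D N] N])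
  have fB: "finite (tilde T ` B)"
    using B(1) by simp
  have fWf: "tilde T x - tilde T (\<Sum>i\<in>UNIV. D i (tilde T x i)) \<in> cspan (tilde T ` B)"
    if x: "x \<in> V" for x
  proof -
    have "(\<Sum>i\<in>UNIV. D i (tilde T x i)) \<in> V"
      by (rule blin_mem[OF W blin_mem[OF f x]])
    moreover have "x - (\<Sum>i\<in>UNIV. D i (tilde T x i)) \<in> cspan B"
      using B(3)[OF x] by (simp add: tilde_def)
    ultimately show ?thesis
      using blin_cspan[OF f norm_on_subspace[OF N] B(2)] blin_diff[OF N f x] by metis
  qed
  show ?thesis
    using generalised_inverse[OF N NP f W fB, OF fWf] that by auto
qed

text \<open>A generalised inverse \<open>g\<close> of \<open>hat T\<close> makes \<open>1 - hat T g\<close> a projection along the range of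
  \<open>hat T\<close>, so its rank is the codimension of that range.\<close>

lemma right_inverse_codim:
  fixes T :: "'i::finite \<Rightarrow> 'a::complex_vector \<Rightarrow> 'a"
  assumes N: "norm_on V N" and T: "comm_ops V N T" and R: "right_inv_mod V N T"
    and c: "codim_le V (M_sum V 1 T) r"
  shows "\<exists>C B. (\<forall>i. blin V N V N (C i)) \<and> finite B \<and> B \<subseteq> V \<and> card B \<le> r \<and>
    (\<forall>y\<in>V. y - (\<Sum>i\<in>UNIV. T i (C i y)) \<in> cspan B)"
proof -
  note NP = norm_on_PiC[OF N finite, of UNIV]
  note f = blin_hat[OF N T]
  obtain g where g: "blin V N (PiC UNIV V) (pn UNIV N) g"
    "\<And>x. x \<in> PiC UNIV V \<Longrightarrow> hat T (g (hat T x)) = hat T x"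
    by (rule hat_generalised_inverse[OF N T R]) (rule that)
  \<comment> \<open>\<open>Q\<close> vanishes on the range of \<open>hat T\<close>, so its image is
    spanned by the images of the vectors that span \<open>V\<close> together with that
    range.\<close>
  define Q where "Q y = y - hat T (g y)" for y
  have Q: "blin V N V N Q"
    unfolding Q_def by (rule blin_diff_map[OF blin_id blin_comp[OF g(1) f NP] N])
  obtain B' where B': "finite B'" "card B' \<le> r" "cspan (M_sum V 1 T \<union> B') = V"
    using c unfolding codim_le_def by blast
  have B'V: "B' \<subseteq> V"
    using B'(3) cvec.span_superset[of "M_sum V 1 T \<union> B'"] by blast
  show ?thesis
  proof (intro exI conjI allI ballI)
    show "blin V N V N (\<lambda>y. g y i)" for i
      by (rule blin_comp[OF g(1) blin_component[OF N finite UNIV_I] NP])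
    show "finite (Q ` B')" "card (Q ` B') \<le> r"
      using B'(1,2) card_image_le[OF B'(1), of Q] by auto
    show "Q ` B' \<subseteq> V"
      using B'V blin_mem[OF Q] by blast
    fix y assume y: "y \<in> V"
    then have "y \<in> cspan (M_sum V 1 T \<union> B')"
      unfolding B'(3) .
    then obtain m c where m: "m \<in> M_sum V 1 T" "y = m + (\<Sum>b\<in>B'. scaleC (c b) b)"
      by (rule span_UnE[OF _ csubspace_M_sum[OF N T] B'(1)])
    obtain x where x: "x \<in> PiC UNIV V" "m = hat T x"
      using m(1) M_sum_eq[OF N T, of 1] by auto
    have mV: "m \<in> V"
      using x blin_mem[OF f] by blast
    have sV: "(\<Sum>b\<in>B'. scaleC (c b) b) \<in> V"
      using B'V by (intro norm_on_sum_mem[OF N] norm_on_scale_mem[OF N]) auto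
    have "Q m = 0"
      using g(2)[OF x(1)] x(2) by (simp add: Q_def)
    then have "Q y = Q (\<Sum>b\<in>B'. scaleC (c b) b)"
      unfolding m(2) by (simp add: blin_add[OF Q mV sV])
    also have "\<dots> \<in> cspan (Q ` B')"
      by (rule blin_cspan[OF Q norm_on_subspace[OF N] B'V])
        (intro cvec.span_sum cvec.span_scale cvec.span_base)
    finally show "y - (\<Sum>i\<in>UNIV. T i (g y i)) \<in> cspan (Q ` B')"
      by (simp add: Q_def hat_def)
  qed
qed

text \<open>With a generalised inverse \<open>g\<close> the residual
  \<open>x - g (tilde T x)\<close> lies in the kernel, so a basis of the kernel serves as
  \<open>B\<close>.\<close>

lemma left_inverse_dim:
  fixes T :: "'i::finite \<Rightarrow> 'a::complex_vector \<Rightarrow> 'a"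
  assumes N: "norm_on V N" and T: "comm_ops V N T" and R: "left_inv_mod V N T"
    and d: "fdim_le (null_tilde V T) r"
  shows "\<exists>D B. (\<forall>i. blin V N V N (D i)) \<and> finite B \<and> B \<subseteq> V \<and> card B \<le> r \<and>
    (\<forall>x\<in>V. x - (\<Sum>i\<in>UNIV. D i (T i x)) \<in> cspan B)"
proof -
  note NP = norm_on_PiC[OF N finite, of UNIV]
  note f = blin_tilde[OF N T]
  obtain g where g: "blin (PiC UNIV V) (pn UNIV N) V N g"
    "\<And>x. x \<in> V \<Longrightarrow> tilde T (g (tilde T x)) = tilde T x"
    by (rule tilde_generalised_inverse[OF N T R]) (rule that)
  obtain B' where B': "finite B'" "card B' \<le> r" "B' \<subseteq> null_tilde V T" "cvec.independent B'"
    "null_tilde V T \<subseteq> cspan B'"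
    using d by (rule fdim_le_basis)
  define e where "e i v = (\<lambda>j. if j = i then v else 0 :: 'a)" for i :: 'i and v
  have e: "blin V N (PiC UNIV V) (pn UNIV N) (e i)" for i
  proof -
    have "blin V N (PiC UNIV V) (pn UNIV N) (\<lambda>v j. if j \<in> UNIV then (if j = i then v else 0) else 0)"
    proof (rule blin_tuple[OF N finite])
      show "blin V N V N (\<lambda>v. if j = i then v else 0)" for j
        using blin_id[of V N] blin_zero_map[OF N] by (cases "j = i") simp_all
    qed
    then show ?thesis
      by (simp add: e_def[abs_def])
  qed
  show ?thesis
  proof (intro exI conjI allI ballI)
    show "blin V N V N (\<lambda>v. g (e i v))" for i
      by (rule blin_comp[OF e g(1) NP])
    show "B' \<subseteq> V"
      using B'(3) null_tilde_subset by blast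
    fix x assume x: "x \<in> V"
    have Tx: "T i x \<in> V" for i
      by (rule blin_mem[OF comm_ops_blin[OF N T] x])
    have "(\<Sum>i\<in>UNIV. g (e i (T i x))) = g (\<Sum>i\<in>UNIV. e i (T i x))"
      by (rule blin_sum[OF NP g(1), symmetric]) (rule blin_mem[OF e Tx])
    also have "(\<Sum>i\<in>UNIV. e i (T i x)) = tilde T x"
      by (simp add: fun_eq_iff tilde_def e_def sum_fun_apply)
    finally have s: "(\<Sum>i\<in>UNIV. g (e i (T i x))) = g (tilde T x)" .
    have gx: "g (tilde T x) \<in> V"
      by (rule blin_mem[OF g(1) blin_mem[OF f x]])
    have "x - g (tilde T x) \<in> null_tilde V T"
      using norm_on_diff_mem[OF N x gx] g(2)[OF x] blin_diff[OF N f x gx]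
      by (simp add: null_tilde_def)
    then show "x - (\<Sum>i\<in>UNIV. g (e i (T i x))) \<in> cspan B'"
      using B'(5) s by auto
  qed (fact B'(1,2))+
qed

text \<open>For a generalised inverse \<open>g\<close>, the map \<open>g (hat T x)\<close> is a
  bounded projection of the power along the kernel; its fixed points form the complement.\<close>

lemma null_hat_complement:
  fixes T :: "'i::finite \<Rightarrow> 'a::complex_vector \<Rightarrow> 'a"
  assumes N: "norm_on V N" and T: "comm_ops V N T" and R: "right_inv_mod V N T"
  shows "has_direct_complement (power_topology V N) (null_hat V T)"
proof -
  note NP = norm_on_PiC[OF N finite, of UNIV]
  note f = blin_hat[OF N T]
  obtain g where g: "blin V N (PiC UNIV V) (pn UNIV N) g"
    "\<And>x. x \<in> PiC UNIV V \<Longrightarrow> hat T (g (hat T x)) = hat T x"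
    by (rule hat_generalised_inverse[OF N T R]) (rule that)
  note gf = blin_comp[OF f g(1) N]
  let ?U = "{x \<in> PiC UNIV V. g (hat T x) = x}"
  have null: "null_hat V T = {x \<in> PiC UNIV V. hat T x = 0}"
    by (auto simp: null_hat_def PiC_UNIV)
  show ?thesis
    unfolding has_direct_complement_def closedin_power_topology_iff[OF N] topspace_power_topology[OF N]
  proof (intro exI[of _ ?U] conjI)
    show "csubspace ?U"
      by (rule csubspace_eq_blin[OF NP gf blin_id])
    show "closed_on (PiC UNIV V) (pn UNIV N) ?U"
      by (rule closed_on_eq_blin[OF NP NP gf blin_id])
    show "null_hat V T \<inter> ?U = {0}"
      using norm_on_zero_mem[OF NP] blin_zero[OF NP f] blin_zero[OF N g(1)] by (auto simp: null)
    show "{w + u |w u. w \<in> null_hat V T \<and> u \<in> ?U} = PiC UNIV V"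
    proof (intro equalityI subsetI)
      fix x :: "'i \<Rightarrow> 'a" assume x: "x \<in> PiC UNIV V"
      have gx: "g (hat T x) \<in> PiC UNIV V"
        by (rule blin_mem[OF gf x])
      have "x - g (hat T x) \<in> null_hat V T"
        using norm_on_diff_mem[OF NP x gx] blin_diff[OF NP f x gx] g(2)[OF x] by (simp add: null)
      moreover have "g (hat T x) \<in> ?U"
        using gx g(2)[OF x] by simp
      moreover have "x = (x - g (hat T x)) + g (hat T x)"
        by simp
      ultimately show "x \<in> {w + u |w u. w \<in> null_hat V T \<and> u \<in> ?U}"
        by blast
    qed (auto simp: null intro: norm_on_add_mem[OF NP])
  qed
qed

text \<open>For a generalised inverse \<open>g\<close>, the map \<open>tilde T (g w)\<close> is a
  bounded projection. The range of \<open>tilde T\<close> is its set of fixed points, hence closed,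
  and its null space is the complement.\<close>

lemma range_tilde_complement:
  fixes T :: "'i::finite \<Rightarrow> 'a::complex_vector \<Rightarrow> 'a"
  assumes N: "norm_on V N" and T: "comm_ops V N T" and R: "left_inv_mod V N T"
  shows "closedin (power_topology V N) (range_tilde V T)"
    and "has_direct_complement (power_topology V N) (range_tilde V T)"
proof -
  note NP = norm_on_PiC[OF N finite, of UNIV]
  note f = blin_tilde[OF N T]
  obtain g where g: "blin (PiC UNIV V) (pn UNIV N) V N g"
    "\<And>x. x \<in> V \<Longrightarrow> tilde T (g (tilde T x)) = tilde T x"
    by (rule tilde_generalised_inverse[OF N T R]) (rule that)
  note fg = blin_comp[OF g(1) f N]
  have ran: "range_tilde V T = {w \<in> PiC UNIV V. tilde T (g w) = w}"
    using blin_mem[OF f] blin_mem[OF g(1)] g(2) unfolding range_tilde_def by force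
  show "closedin (power_topology V N) (range_tilde V T)"
    unfolding closedin_power_topology_iff[OF N] ran
    by (rule closed_on_eq_blin[OF NP NP fg blin_id])
  let ?U = "{w \<in> PiC UNIV V. tilde T (g w) = 0}"
  show "has_direct_complement (power_topology V N) (range_tilde V T)"
    unfolding has_direct_complement_def closedin_power_topology_iff[OF N] topspace_power_topology[OF N]
  proof (intro exI[of _ ?U] conjI)
    show "csubspace ?U"
      by (rule csubspace_eq_blin[OF NP fg blin_zero_map[OF NP]])
    show "closed_on (PiC UNIV V) (pn UNIV N) ?U"
      by (rule closed_on_eq_blin[OF NP NP fg blin_zero_map[OF NP]])
    show "range_tilde V T \<inter> ?U = {0}"
      unfolding ran using norm_on_zero_mem[OF NP] blin_zero[OF N f] blin_zero[OF NP g(1)] by auto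
    show "{w + u |w u. w \<in> range_tilde V T \<and> u \<in> ?U} = PiC UNIV V"
    proof (intro equalityI subsetI)
      fix w :: "'i \<Rightarrow> 'a" assume w: "w \<in> PiC UNIV V"
      have gw: "tilde T (g w) \<in> PiC UNIV V"
        by (rule blin_mem[OF fg w])
      have e: "tilde T (g (tilde T (g w))) = tilde T (g w)"
        by (rule g(2)[OF blin_mem[OF g(1) w]])
      have "tilde T (g w) \<in> range_tilde V T"
        unfolding ran using gw e by simp
      moreover have "w - tilde T (g w) \<in> ?U"
        using norm_on_diff_mem[OF NP w gw] blin_diff[OF NP fg w gw] e by simp
      moreover have "w = tilde T (g w) + (w - tilde T (g w))"
        by simp
      ultimately show "w \<in> {w + u |w u. w \<in> range_tilde V T \<and> u \<in> ?U}"
        by blast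
    qed (auto simp: ran intro: norm_on_add_mem[OF NP])
  qed
qed

lemma codim_le_if_right_inverse:
  fixes T :: "'i::finite \<Rightarrow> 'a::complex_vector \<Rightarrow> 'a"
  assumes N: "norm_on V N" and T: "comm_ops V N T" and C: "\<And>i. blin V N V N (C i)"
    and B: "finite B" "B \<subseteq> V" "card B \<le> r"
    and CB: "\<And>y. y \<in> V \<Longrightarrow> y - (\<Sum>i\<in>UNIV. T i (C i y)) \<in> cspan B"
  shows "codim_le V (M_sum V 1 T) r"
  unfolding codim_le_def
proof (intro exI[of _ B] conjI B)
  let ?S = "cspan (M_sum V 1 T \<union> B)"
  have "y \<in> ?S" if y: "y \<in> V" for y
  proof -
    have "(\<lambda>i. C i y) \<in> PiC UNIV V"
      using blin_mem[OF C y] by (simp add: PiC_UNIV)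
    then have "hat T (\<lambda>i. C i y) \<in> M_sum V 1 T"
      using M_sum_eq[OF N T, of 1] by simp
    then have "(\<Sum>i\<in>UNIV. T i (C i y)) \<in> ?S"
      unfolding hat_def by (intro cvec.span_base) simp
    moreover have "y - (\<Sum>i\<in>UNIV. T i (C i y)) \<in> ?S"
      using CB[OF y] cvec.span_mono[of B "M_sum V 1 T \<union> B"] by blast
    ultimately have "(\<Sum>i\<in>UNIV. T i (C i y)) + (y - (\<Sum>i\<in>UNIV. T i (C i y))) \<in> ?S"
      by (rule cvec.span_add)
    then show ?thesis
      by simp
  qed
  moreover have "?S \<subseteq> V"
    by (rule cvec.span_minimal[OF _ norm_on_subspace[OF N]])
      (use M_sum_subset[OF N T, of 1] B(2) in blast)
  ultimately show "?S = V"
    by blast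
qed

lemma fdim_le_if_left_inverse:
  fixes T :: "'i::finite \<Rightarrow> 'a::complex_vector \<Rightarrow> 'a"
  assumes N: "norm_on V N" and D: "\<And>i. blin V N V N (D i)"
    and B: "finite B" "card B \<le> r"
    and DB: "\<And>x. x \<in> V \<Longrightarrow> x - (\<Sum>i\<in>UNIV. D i (T i x)) \<in> cspan B"
  shows "fdim_le (null_tilde V T) r"
proof (rule fdim_leI_span[OF _ B])
  show "null_tilde V T \<subseteq> cspan B"
  proof
    fix x assume "x \<in> null_tilde V T"
    then have x: "x \<in> V" "\<And>i. T i x = 0"
      by (auto simp: null_tilde_def tilde_def fun_eq_iff)
    then show "x \<in> cspan B"
      using DB[OF x(1)] blin_zero[OF N D] by simp
  qed
qed

text \<open>The substitution of \<open>right_inv_mod_pow\<close> with no residual. It keeps the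
  codimension 0 at all powers for points outside the defect spectrum.\<close>

lemma hat_pow_surj:
  fixes T :: "'i::finite \<Rightarrow> 'a::complex_vector \<Rightarrow> 'a"
  assumes N: "norm_on V N" and T: "comm_ops V N T" and surj: "M_sum V 1 T = V" and k: "1 \<le> k"
  shows "M_sum V k T = V"
proof -
  have "\<forall>y\<in>V. \<exists>x. (\<forall>j. x j \<in> V) \<and> y = (\<Sum>j\<in>UNIV. (T j ^^ k) (x j))"
  proof (rule exponent_induct[where P = "\<lambda>e. \<forall>y\<in>V. \<exists>x. (\<forall>j. x j \<in> V) \<and> y = (\<Sum>j\<in>UNIV. (T j ^^ e j) (x j))",
        OF _ _ k])
    show "\<forall>y\<in>V. \<exists>x. (\<forall>j. x j \<in> V) \<and> y = (\<Sum>j\<in>UNIV. (T j ^^ 1) (x j))"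
    proof
      fix y assume "y \<in> V"
      then have "y \<in> hat T ` PiC UNIV V"
        using surj M_sum_eq[OF N T, of 1] by simp
      then show "\<exists>x. (\<forall>j. x j \<in> V) \<and> y = (\<Sum>j\<in>UNIV. (T j ^^ 1) (x j))"
        by (auto simp: hat_def PiC_UNIV)
    qed
    fix e :: "'i \<Rightarrow> nat" and i a b
    assume a: "\<forall>y\<in>V. \<exists>x. (\<forall>j. x j \<in> V) \<and> y = (\<Sum>j\<in>UNIV. (T j ^^ (e(i := a)) j) (x j))"
      and b: "\<forall>y\<in>V. \<exists>x. (\<forall>j. x j \<in> V) \<and> y = (\<Sum>j\<in>UNIV. (T j ^^ (e(i := b)) j) (x j))"
    show "\<forall>y\<in>V. \<exists>x. (\<forall>j. x j \<in> V) \<and> y = (\<Sum>j\<in>UNIV. (T j ^^ (e(i := a + b)) j) (x j))"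
    proof
      fix y assume "y \<in> V"
      then obtain x where x: "\<And>j. x j \<in> V" "y = (\<Sum>j\<in>UNIV. (T j ^^ (e(i := a)) j) (x j))"
        using a by blast
      obtain x' where x': "\<And>j. x' j \<in> V" "x i = (\<Sum>j\<in>UNIV. (T j ^^ (e(i := b)) j) (x' j))"
        using b x(1)[of i] by blast
      define A where "A = T i ^^ a"
      have A: "blin V N V N A"
        unfolding A_def by (rule comm_ops_blin_pow[OF N T])
      note P = comm_ops_blin_pow[OF N T]
      define z where "z j = (if j = i then x' i else x j + A (x' j))" for j
      have zV: "z j \<in> V" for j
        using x(1) x'(1) blin_mem[OF A] by (simp add: z_def norm_on_add_mem[OF N])
      have split: "(\<Sum>j\<in>UNIV. (T j ^^ (e(i := c)) j) (u j)) =
          (T i ^^ c) (u i) + (\<Sum>j\<in>UNIV - {i}. (T j ^^ e j) (u j))" for c u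
        by (simp add: sum.remove[of UNIV i])
      let ?S' = "\<Sum>j\<in>UNIV - {i}. (T j ^^ e j) (x' j)"
      have S'V: "?S' \<in> V"
        by (intro norm_on_sum_mem[OF N] blin_mem[OF P] x')
      have "A (x i) = A ((T i ^^ b) (x' i)) + A ?S'"
        unfolding x'(2) split by (rule blin_add[OF A blin_mem[OF P x'(1)] S'V])
      moreover have "(\<Sum>j\<in>UNIV - {i}. (T j ^^ e j) (z j)) =
          (\<Sum>j\<in>UNIV - {i}. (T j ^^ e j) (x j) + A ((T j ^^ e j) (x' j)))"
        by (intro sum.cong refl)
          (simp add: z_def A_def blin_add[OF P x(1)] blin_mem[OF P x'(1)] comm_ops_commute[OF N T x'(1)])
      moreover have "\<dots> = (\<Sum>j\<in>UNIV - {i}. (T j ^^ e j) (x j)) + A ?S'"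
        unfolding sum.distrib
        by (subst blin_sum[OF N A]) (auto intro: blin_mem[OF P] x')
      ultimately have "y = (\<Sum>j\<in>UNIV. (T j ^^ (e(i := a + b)) j) (z j))"
        unfolding x(2) split by (simp add: z_def A_def funpow_add algebra_simps)
      then show "\<exists>x. (\<forall>j. x j \<in> V) \<and> y = (\<Sum>j\<in>UNIV. (T j ^^ (e(i := a + b)) j) (x j))"
        using zV by blast
    qed
  qed
  then have "V \<subseteq> M_sum V k T"
    unfolding M_sum_def by fast
  then show ?thesis
    using M_sum_subset[OF N T] by blast
qed

text \<open>If \<open>x\<close> is killed with exponents \<open>e(i := a + b)\<close>, then
  \<open>(T i ^^ a) x\<close> is killed with exponents \<open>e(i := b)\<close> and is therefore 0;
  now \<open>x\<close> is killed with exponents \<open>e(i := a)\<close>.\<close>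

lemma tilde_pow_inj:
  fixes T :: "'i::finite \<Rightarrow> 'a::complex_vector \<Rightarrow> 'a"
  assumes N: "norm_on V N" and T: "comm_ops V N T" and inj: "null_tilde V T = {0}" and k: "1 \<le> k"
  shows "null_tilde V (powt T k) = {0}"
proof -
  have "\<forall>x\<in>V. (\<forall>j. (T j ^^ k) x = 0) \<longrightarrow> x = 0"
  proof (rule exponent_induct[where P = "\<lambda>e. \<forall>x\<in>V. (\<forall>j. (T j ^^ e j) x = 0) \<longrightarrow> x = 0", OF _ _ k])
    show "\<forall>x\<in>V. (\<forall>j. (T j ^^ 1) x = 0) \<longrightarrow> x = 0"
      using inj by (auto simp: null_tilde_def tilde_def fun_eq_iff)
    fix e :: "'i \<Rightarrow> nat" and i a b
    assume a: "\<forall>x\<in>V. (\<forall>j. (T j ^^ (e(i := a)) j) x = 0) \<longrightarrow> x = 0"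
      and b: "\<forall>x\<in>V. (\<forall>j. (T j ^^ (e(i := b)) j) x = 0) \<longrightarrow> x = 0"
    show "\<forall>x\<in>V. (\<forall>j. (T j ^^ (e(i := a + b)) j) x = 0) \<longrightarrow> x = 0"
    proof (intro ballI impI)
      fix x assume x: "x \<in> V" and z: "\<forall>j. (T j ^^ (e(i := a + b)) j) x = 0"
      let ?u = "(T i ^^ a) x"
      have "(T j ^^ (e(i := b)) j) ?u = 0" for j
      proof (cases "j = i")
        case True
        have "(T i ^^ (a + b)) x = 0"
          using z[rule_format, of i] by simp
        then show ?thesis
          using True by (simp add: add.commute[of a b] funpow_add)
      next
        case False
        then have "(T j ^^ e j) x = 0"
          using z[rule_format, of j] by simp
        then show ?thesis
          using False comm_ops_commute[OF N T x, where i = j and a = "e j" and j = i and b = a] blin_zero[OF N comm_ops_blin_pow[OF N T]]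
          by simp
      qed
      then have "?u = 0"
        using b blin_mem[OF comm_ops_blin_pow[OF N T] x] by blast
      then have "(T j ^^ (e(i := a)) j) x = 0" for j
        using z[rule_format, of j] by (cases "j = i") auto
      then show "x = 0"
        using a x by blast
    qed
  qed
  then show ?thesis
    using norm_on_zero_mem[OF N] blin_zero[OF N comm_ops_blin_pow[OF N T]]
    by (auto simp: null_tilde_def tilde_def powt_def fun_eq_iff)
qed

section \<open>Lower estimates and approximate null vectors\<close>

text \<open>The substitute for closed range that is inherited by powers;
  \<open>upper_semi_Browder\<close> provides closed range for the tuple itself, not for its
  powers.\<close>

definition lower_estimate :: "'a::complex_vector set \<Rightarrow> ('a \<Rightarrow> real) \<Rightarrow> ('i::finite \<Rightarrow> 'a \<Rightarrow> 'a) \<Rightarrow> bool"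
  where "lower_estimate V N T \<longleftrightarrow>
    (\<exists>K>0. \<exists>q. precompact_on V N q \<and> (\<forall>x\<in>V. N x \<le> K * (\<Sum>i\<in>UNIV. N (T i x)) + q x))"

lemma lower_estimateI:
  fixes T :: "'i::finite \<Rightarrow> 'a::complex_vector \<Rightarrow> 'a"
  assumes N: "norm_on V N" and T: "comm_ops V N T"
    and q: "precompact_on V N q" and est: "\<And>x. x \<in> V \<Longrightarrow> N x \<le> K * (\<Sum>i\<in>UNIV. N (T i x)) + q x"
  shows "lower_estimate V N T"
proof -
  have "N x \<le> (\<bar>K\<bar> + 1) * (\<Sum>i\<in>UNIV. N (T i x)) + q x" if x: "x \<in> V" for x
  proof -
    have "0 \<le> (\<Sum>i\<in>UNIV. N (T i x))"
      by (intro sum_nonneg norm_on_nonneg[OF N] blin_mem[OF comm_ops_blin[OF N T]] x)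
    then have "K * (\<Sum>i\<in>UNIV. N (T i x)) \<le> (\<bar>K\<bar> + 1) * (\<Sum>i\<in>UNIV. N (T i x))"
      by (intro mult_right_mono) auto
    then show ?thesis
      using est[OF x] by simp
  qed
  then show ?thesis
    unfolding lower_estimate_def using q by (intro exI[of _ "\<bar>K\<bar> + 1"] conjI exI[of _ q]) auto
qed

lemma precompact_on_scale:
  fixes V :: "'a::ab_group_add set"
  assumes q: "precompact_on V N q" and c: "0 < c"
  shows "precompact_on V N (\<lambda>x. c * q x)"
  unfolding precompact_on_def
proof (intro allI impI)
  fix s :: "nat \<Rightarrow> 'a" and C assume s: "\<forall>n. s n \<in> V \<and> N (s n) \<le> C"
  have "s n \<in> V" "N (s n) \<le> C" for n
    using s by simp_all
  from precompact_onD[where s = s, OF q this] obtain r :: "nat \<Rightarrow> nat"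
    where r: "strict_mono r" "cauchy_on q (s \<circ> r)"
    by (elim exE conjE)
  have "cauchy_on (\<lambda>x. c * q x) (s \<circ> r)"
    unfolding cauchy_on_def
  proof (intro allI impI)
    fix e :: real assume "e > 0"
    then have "e / c > 0"
      using c by simp
    from cauchy_onD[OF r(2) this] show "\<exists>M. \<forall>m\<ge>M. \<forall>n\<ge>M. c * q ((s \<circ> r) m - (s \<circ> r) n) < e"
      using c by (simp add: field_simps)
  qed
  then show "\<exists>r::nat \<Rightarrow> nat. strict_mono r \<and> cauchy_on (\<lambda>x. c * q x) (s \<circ> r)"
    using r(1) by (intro exI[of _ r] conjI)
qed

text \<open>The second estimate is applied to \<open>(T i ^^ a) x\<close> inside the first. The
  other powers commute past \<open>T i ^^ a\<close> at the cost of its bound \<open>L\<close>, and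
  the precompact terms combine.\<close>

lemma lower_estimate_pow:
  fixes T :: "'i::finite \<Rightarrow> 'a::complex_vector \<Rightarrow> 'a"
  assumes N: "norm_on V N" and T: "comm_ops V N T" and est: "lower_estimate V N T" and k: "1 \<le> k"
  shows "lower_estimate V N (powt T k)"
proof -
  have "lower_estimate V N (\<lambda>j. T j ^^ k)"
  proof (rule exponent_induct[where P = "\<lambda>e. lower_estimate V N (\<lambda>j. T j ^^ e j)", OF _ _ k])
    show "lower_estimate V N (\<lambda>j. T j ^^ 1)"
      using est by simp
    fix e :: "'i \<Rightarrow> nat" and i a b
    assume a: "lower_estimate V N (\<lambda>j. T j ^^ (e(i := a)) j)"
      and b: "lower_estimate V N (\<lambda>j. T j ^^ (e(i := b)) j)"
    obtain K q where K: "K > 0" and q: "precompact_on V N q"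
      and Kq: "\<And>x. x \<in> V \<Longrightarrow> N x \<le> K * (\<Sum>j\<in>UNIV. N ((T j ^^ (e(i := a)) j) x)) + q x"
      using a unfolding lower_estimate_def by blast
    obtain K' q' where K': "K' > 0" and q': "precompact_on V N q'"
      and Kq': "\<And>x. x \<in> V \<Longrightarrow> N x \<le> K' * (\<Sum>j\<in>UNIV. N ((T j ^^ (e(i := b)) j) x)) + q' x"
      using b unfolding lower_estimate_def by blast
    note P = comm_ops_blin_pow[OF N T]
    obtain L where L: "L > 0" "\<And>x. x \<in> V \<Longrightarrow> N ((T i ^^ a) x) \<le> L * N x"
      using blin_bound[OF N P] by blast
    let ?q = "\<lambda>x. K * q' ((T i ^^ a) x) + q x"
    \<comment> \<open>Dominates the resulting coefficients: \<open>K * K'\<close> for coordinate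
      \<open>i\<close> and \<open>K * K' * L + K\<close> for the others.\<close>
    let ?C = "K + K * K' * (1 + L)"
    show "lower_estimate V N (\<lambda>j. T j ^^ (e(i := a + b)) j)"
      unfolding lower_estimate_def
    proof (intro exI conjI ballI)
      show "?C > 0"
        using K K' L(1) by (simp add: add_pos_pos)
      show "precompact_on V N ?q"
        by (rule precompact_on_add[OF precompact_on_comp[OF N P precompact_on_scale[OF q' K]] q])
      fix x assume x: "x \<in> V"
      have Tx: "(T i ^^ a) x \<in> V"
        by (rule blin_mem[OF P x])
      have nn: "0 \<le> N ((T j ^^ n) x)" for j n
        by (rule norm_on_nonneg[OF N blin_mem[OF P x]])
      have split: "(\<Sum>j\<in>UNIV. N ((T j ^^ (e(i := c)) j) z)) =
          N ((T i ^^ c) z) + (\<Sum>j\<in>UNIV - {i}. N ((T j ^^ e j) z))" for c z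
        by (simp add: sum.remove[of UNIV i])
      let ?s = "\<Sum>j\<in>UNIV - {i}. N ((T j ^^ e j) x)"
      let ?t = "N ((T i ^^ (a + b)) x)"
      have s: "0 \<le> ?s"
        by (intro sum_nonneg nn)
      have "(\<Sum>j\<in>UNIV - {i}. N ((T j ^^ e j) ((T i ^^ a) x))) \<le> (\<Sum>j\<in>UNIV - {i}. L * N ((T j ^^ e j) x))"
        unfolding comm_ops_commute[OF N T x, where j = i and b = a]
        by (intro sum_mono L(2) blin_mem[OF P x])
      then have "N ((T i ^^ b) ((T i ^^ a) x)) + (\<Sum>j\<in>UNIV - {i}. N ((T j ^^ e j) ((T i ^^ a) x)))
          \<le> ?t + L * ?s"
        by (simp add: sum_distrib_left add.commute[of a b] funpow_add)
      then have "K' * (\<Sum>j\<in>UNIV. N ((T j ^^ (e(i := b)) j) ((T i ^^ a) x))) \<le> K' * (?t + L * ?s)"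
        unfolding split using K' by (intro mult_left_mono) auto
      then have "N ((T i ^^ a) x) \<le> K' * (?t + L * ?s) + q' ((T i ^^ a) x)"
        using Kq'[OF Tx] by linarith
      then have "K * N ((T i ^^ a) x) \<le> K * (K' * (?t + L * ?s) + q' ((T i ^^ a) x))"
        using K by (intro mult_left_mono) auto
      then have "N x \<le> K * (K' * (?t + L * ?s)) + K * ?s + ?q x"
        using Kq[OF x] unfolding split by (simp add: distrib_left)
      also have "K * (K' * (?t + L * ?s)) + K * ?s \<le> ?C * (?t + ?s)"
      proof -
        have "K * (K' * (?t + L * ?s)) + K * ?s = K * K' * ?t + (K * K' * L + K) * ?s"
          by (simp add: algebra_simps)
        also have "\<dots> \<le> ?C * ?t + ?C * ?s"
        proof (rule add_mono[OF mult_right_mono[OF _ nn] mult_right_mono[OF _ s]])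
          have "0 \<le> K * K'" "0 \<le> K * K' * L" "?C = K + K * K' + K * K' * L"
            using K K' L(1) by (simp_all add: distrib_left)
          then show "K * K' \<le> ?C" "K * K' * L + K \<le> ?C"
            using K by linarith+
        qed
        finally show ?thesis
          by (simp add: distrib_left)
      qed
      finally show "N x \<le> ?C * (\<Sum>j\<in>UNIV. N ((T j ^^ (e(i := a + b)) j) x)) + ?q x"
        unfolding split by simp
    qed
  qed
  then show ?thesis
    by (simp add: powt_def)
qed

lemma pn_tilde: "pn UNIV N (tilde T x) = (\<Sum>i\<in>UNIV. N (T i x))"
  by (simp add: pn_def tilde_def)

text \<open>Dual basis functionals of the kernel replace the precompact term. Their number matters:
  it becomes the dimension bound for the factors, and \<open>r\<close> is common to all
  powers.\<close>

lemma lower_estimate_functionals: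
  fixes T :: "'i::finite \<Rightarrow> 'a::complex_vector \<Rightarrow> 'a"
  assumes V: "banach_on V N" and T: "comm_ops V N T" and est: "lower_estimate V N T"
    and d: "fdim_le (null_tilde V T) r"
  obtains K and h :: "nat \<Rightarrow> 'a \<Rightarrow> complex" where "K > 0" "\<And>l. l < r \<Longrightarrow> blin V N UNIV norm (h l)"
    "\<And>x. x \<in> V \<Longrightarrow> N x \<le> K * ((\<Sum>i\<in>UNIV. N (T i x)) + (\<Sum>l<r. cmod (h l x)))"
proof -
  note N = banach_on_norm_on[OF V]
  obtain K q where K: "K > 0" and q: "precompact_on V N q"
    and Kq: "\<And>x. x \<in> V \<Longrightarrow> N x \<le> K * pn UNIV N (tilde T x) + q x"
    using est unfolding lower_estimate_def pn_tilde by blast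
  obtain B where B: "finite B" "card B \<le> r" "B \<subseteq> null_tilde V T" "cvec.independent B"
    "null_tilde V T \<subseteq> cspan B"
    using d by (rule fdim_le_basis)
  have BV: "B \<subseteq> V"
    using B(3) null_tilde_subset by blast
  from dual_basis[OF N B(1) BV B(4)] obtain h where
    h: "\<And>b. b \<in> B \<Longrightarrow> blin V N UNIV norm (h b :: 'a \<Rightarrow> complex)"
      "\<And>b c. b \<in> B \<Longrightarrow> c \<in> B \<Longrightarrow> h b c = (if b = c then 1 else 0)"
    by blast
  have "\<exists>K'>0. \<forall>x\<in>V. N x \<le> K' * (pn UNIV N (tilde T x) + (\<Sum>b\<in>B. cmod (h b x)))"
  proof (rule tilde_estimate_functionals[OF V T q Kq B(1) h(1)])
    fix x assume x: "x \<in> null_tilde V T" "\<And>b. b \<in> B \<Longrightarrow> h b x = 0"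
    have "(\<Sum>b\<in>B. scaleC (h b x) b) = x"
      using x(1) B(5) by (intro dual_basis_expand[OF N B(1) BV h]) auto
    then show "x = 0"
      using x(2) by simp
  qed
  then obtain K' where K': "K' > 0" "\<And>x. x \<in> V \<Longrightarrow>
      N x \<le> K' * (pn UNIV N (tilde T x) + (\<Sum>b\<in>B. cmod (h b x)))"
    by blast
  obtain \<beta> where \<beta>: "bij_betw \<beta> {0..<card B} B"
    using ex_bij_betw_nat_finite[OF B(1)] by blast
  \<comment> \<open>Zero functionals bring the number up to \<open>r\<close>.\<close>
  define g where "g l = (if l < card B then h (\<beta> l) else (\<lambda>_. 0))" for l
  have \<beta>B: "\<beta> l \<in> B" if "l < card B" for l
    using bij_betwE[OF \<beta>] that by simp
  have sum: "(\<Sum>l<r. cmod (g l x)) = (\<Sum>b\<in>B. cmod (h b x))" for x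
  proof -
    have "(\<Sum>l<r. cmod (g l x)) = (\<Sum>l<card B. cmod (g l x))"
      using B(2) by (intro sum.mono_neutral_right) (auto simp: g_def)
    also have "\<dots> = (\<Sum>l\<in>{0..<card B}. cmod (h (\<beta> l) x))"
      by (intro sum.cong) (auto simp: g_def)
    also have "\<dots> = (\<Sum>b\<in>B. cmod (h b x))"
      by (rule sum.reindex_bij_betw[OF \<beta>])
    finally show ?thesis .
  qed
  show ?thesis
  proof (rule that[OF K'(1)])
    show "blin V N UNIV norm (g l)" if "l < r" for l
    proof (cases "l < card B")
      case True
      then show ?thesis
        using h(1)[OF \<beta>B[OF True]] by (simp add: g_def)
    next
      case False
      have "blin V N UNIV norm (\<lambda>_. 0 :: complex)"
        by (rule blin_zero_map[OF norm_on_norm])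
      then show ?thesis
        using False by (simp add: g_def)
    qed
    show "N x \<le> K' * ((\<Sum>i\<in>UNIV. N (T i x)) + (\<Sum>l<r. cmod (g l x)))" if "x \<in> V" for x
      unfolding sum using K'(2)[OF that] by (simp add: pn_tilde)
  qed
qed

text \<open>The open mapping theorem for \<open>hat T\<close> enlarged by coefficients of
  \<open>B\<close>, so that preimage and coefficients are bounded together.\<close>

lemma hat_open_modulo:
  fixes T :: "'i::finite \<Rightarrow> 'a::complex_vector \<Rightarrow> 'a"
  assumes V: "banach_on V N" and T: "comm_ops V N T" and c: "codim_le V (M_sum V 1 T) r"
  obtains B K where "finite B" "card B \<le> r" "B \<subseteq> V" "K > 0"
    "\<And>y. y \<in> V \<Longrightarrow> \<exists>w c. (\<forall>i. w i \<in> V) \<and> y = hat T w + (\<Sum>b\<in>B. scaleC (c b) b) \<and>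
      (\<Sum>i\<in>UNIV. N (w i)) \<le> K * N y \<and> (\<Sum>b\<in>B. cmod (c b)) \<le> K * N y"
proof -
  note N = banach_on_norm_on[OF V]
  note NP = norm_on_PiC[OF N finite, of UNIV]
  note f = blin_hat[OF N T]
  obtain B where B: "finite B" "card B \<le> r" "cspan (M_sum V 1 T \<union> B) = V"
    using c unfolding codim_le_def by blast
  have BV: "B \<subseteq> V"
    using B(3) cvec.span_superset[of "M_sum V 1 T \<union> B"] by blast
  let ?W = "PiC UNIV V :: ('i \<Rightarrow> 'a) set"
  let ?P = "PiC B (UNIV :: complex set)" and ?n = "pn B (norm :: complex \<Rightarrow> real)"
  have BW: "banach_on ?W (pn UNIV N)"
    by (rule banach_on_PiC[OF V finite])
  have BP: "banach_on ?P ?n"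
    by (rule banach_on_PiC[OF banach_on_norm B(1)])
  note NB = banach_on_norm_on[OF BP]
  let ?X = "?W \<times> ?P" and ?nX = "\<lambda>x. pn UNIV N (fst x) + ?n (snd x)"
  have BX: "banach_on ?X ?nX"
    by (rule banach_on_prod[OF BW BP])
  define \<Psi> where "\<Psi> x = hat T (fst x) + (\<Sum>b\<in>B. scaleC (snd x b) b)" for x
  have "blin ?X ?nX V N (\<lambda>x. scaleC (snd x b) b)" if "b \<in> B" for b
    using blin_functional_scale[OF blin_comp[OF blin_snd[OF NP NB]
          blin_component[OF norm_on_norm B(1) that] NB] N] BV that by blast
  then have \<Psi>: "blin ?X ?nX V N \<Psi>"
    unfolding \<Psi>_def
    by (intro blin_add_map[OF blin_comp[OF blin_fst[OF NP NB] f NP] blin_sum_map[OF _ N] N])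
  have "V \<subseteq> \<Psi> ` ?X"
  proof
    fix y assume "y \<in> V"
    then have "y \<in> cspan (M_sum V 1 T \<union> B)"
      unfolding B(3) .
    then obtain m c where m: "m \<in> M_sum V 1 T" "y = m + (\<Sum>b\<in>B. scaleC (c b) b)"
      by (rule span_UnE[OF _ csubspace_M_sum[OF N T] B(1)])
    obtain x where x: "x \<in> ?W" "m = hat T x"
      using m(1) M_sum_eq[OF N T, of 1] by auto
    have "(\<Sum>b\<in>B. scaleC (if b \<in> B then c b else 0) b) = (\<Sum>b\<in>B. scaleC (c b) b)"
      by (intro sum.cong) auto
    then have "y = \<Psi> (x, \<lambda>b. if b \<in> B then c b else 0)"
      using m(2) x(2) by (simp add: \<Psi>_def)
    moreover have "(x, \<lambda>b. if b \<in> B then c b else 0) \<in> ?X"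
      using x(1) by (simp add: PiC_def)
    ultimately show "y \<in> \<Psi> ` ?X"
      by blast
  qed
  then have surj: "\<Psi> ` ?X = V"
    using blin_mem[OF \<Psi>] by blast
  obtain K where K: "K > 0" "\<And>y. y \<in> V \<Longrightarrow> \<exists>x\<in>?X. \<Psi> x = y \<and> ?nX x \<le> K * N y"
    using open_mapping[OF BX V \<Psi> surj] by blast
  show ?thesis
  proof (rule that[OF B(1,2) BV K(1)])
    fix y assume "y \<in> V"
    then obtain x where x: "x \<in> ?X" "\<Psi> x = y" "?nX x \<le> K * N y"
      using K(2) by blast
    have "0 \<le> pn UNIV N (fst x)" "0 \<le> ?n (snd x)"
      using x(1) by (auto intro: norm_on_nonneg[OF NP] norm_on_nonneg[OF NB])
    then have "pn UNIV N (fst x) \<le> K * N y" "?n (snd x) \<le> K * N y"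
      using x(3) by linarith+
    then show "\<exists>w c. (\<forall>i. w i \<in> V) \<and> y = hat T w + (\<Sum>b\<in>B. scaleC (c b) b) \<and>
        (\<Sum>i\<in>UNIV. N (w i)) \<le> K * N y \<and> (\<Sum>b\<in>B. cmod (c b)) \<le> K * N y"
      using x(1,2) by (intro exI[of _ "fst x"] exI[of _ "snd x"]) (auto simp: \<Psi>_def pn_def PiC_UNIV)
  qed
qed

text \<open>This says that the column \<open>tilde T\<close> is not bounded below on unit
  vectors.\<close>

definition approx_null :: "('i \<Rightarrow> 'a \<Rightarrow> 'a::complex_normed_vector) \<Rightarrow> bool"
  where "approx_null T \<longleftrightarrow> (\<forall>e>0. \<exists>z. norm z = 1 \<and> (\<forall>i. norm (T i z) \<le> e))"

text \<open>Scaling turns the gap \<open>e\<close> on unit vectors into a lower bound with constant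
  \<open>1 / e\<close>, to which \<open>upper_semi_Fredholm_if_estimate\<close> applies with no
  functionals.\<close>

lemma not_approx_null:
  fixes T :: "'i::finite \<Rightarrow> 'a::complex_banach \<Rightarrow> 'a"
  assumes T: "comm_ops UNIV norm T" and n: "\<not> approx_null T"
  shows "null_tilde UNIV T = {0} \<and> closedin (power_topology UNIV norm) (range_tilde UNIV T)"
proof -
  obtain e where e: "e > 0" "\<And>z. norm z = 1 \<Longrightarrow> \<exists>i. e < norm (T i z)"
    using n unfolding approx_null_def by (auto simp: not_le)
  have est: "norm x \<le> 1 / e * pn UNIV norm (tilde T x)" for x
  proof (cases "x = 0")
    case False
    let ?z = "scaleC (of_real (1 / norm x)) x"
    have "norm ?z = 1"
      using False by (simp add: norm_scaleC norm_divide)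
    then obtain i where "e < norm (T i ?z)"
      using e(2) by blast
    also have "norm (T i ?z) = norm (T i x) / norm x"
      by (simp add: blin_scale[OF comm_ops_blin[OF norm_on_norm T]] norm_scaleC norm_divide)
    finally have "e * norm x < norm (T i x)"
      using False by (simp add: field_simps)
    also have "\<dots> \<le> pn UNIV norm (tilde T x)"
      unfolding pn_tilde by (rule member_le_sum) auto
    finally show ?thesis
      using e(1) by (simp add: field_simps)
  qed (use e(1) in \<open>simp add: pn_def sum_nonneg divide_nonneg_pos\<close>)
  have "upper_semi_Fredholm UNIV norm T \<and> fdim_le (null_tilde UNIV T) 0"
    by (rule upper_semi_Fredholm_if_estimate[OF banach_on_norm T, where g = "\<lambda>_ _. 0" and K = "1 / e"])
      (use est in auto)
  moreover have "null_tilde UNIV T = {0}"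
  proof -
    have "x = 0" if "x \<in> null_tilde UNIV T" for x
      using est[of x] that by (simp add: null_tilde_def pn_def)
    moreover have "0 \<in> null_tilde UNIV T"
      by (rule cvec.subspace_0[OF csubspace_null_tilde[OF norm_on_norm T]])
    ultimately show ?thesis
      by blast
  qed
  ultimately show ?thesis
    by (simp add: upper_semi_Fredholm_def)
qed

text \<open>The same vectors work, since \<open>T i ^^ k\<close> is \<open>T i ^^ (k - 1)\<close>
  after \<open>T i\<close>; the tolerance is divided by a common bound \<open>M\<close> for the
  operators \<open>T i ^^ (k - 1)\<close>.\<close>

lemma approx_null_powt:
  fixes T :: "'i::finite \<Rightarrow> 'a::complex_banach \<Rightarrow> 'a"
  assumes T: "comm_ops UNIV norm T" and n: "approx_null T" and k: "1 \<le> k"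
  shows "approx_null (powt T k)"
  unfolding approx_null_def
proof (intro allI impI)
  fix e :: real assume e: "e > 0"
  note P = comm_ops_blin_pow[OF norm_on_norm T]
  have "\<forall>i. \<exists>L>0. \<forall>x. norm ((T i ^^ (k - 1)) x) \<le> L * norm x"
  proof
    fix i
    obtain L where "L > 0" "\<And>x. x \<in> UNIV \<Longrightarrow> norm ((T i ^^ (k - 1)) x) \<le> L * norm x"
      using blin_bound[OF norm_on_norm P] by blast
    then show "\<exists>L>0. \<forall>x. norm ((T i ^^ (k - 1)) x) \<le> L * norm x"
      by blast
  qed
  then obtain L where L: "\<And>i. L i > 0" "\<And>i x. norm ((T i ^^ (k - 1)) x) \<le> L i * norm x"
    by metis
  define M where "M = (\<Sum>i\<in>UNIV. L i) + 1"
  have M: "L i \<le> M" for i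
    unfolding M_def using member_le_sum[of i UNIV L] L(1) by (simp add: less_imp_le add_increasing2)
  then have "M > 0"
    using L(1) less_le_trans by blast
  then obtain z where z: "norm z = 1" "\<And>i. norm (T i z) \<le> e / M"
    using n e unfolding approx_null_def by (metis divide_pos_pos)
  have "norm ((T i ^^ k) z) \<le> e" for i
  proof -
    have "(T i ^^ k) z = (T i ^^ (k - 1)) (T i z)"
      using k by (cases k) (simp_all add: funpow_swap1)
    then have "norm ((T i ^^ k) z) \<le> L i * norm (T i z)"
      using L(2) by simp
    also have "\<dots> \<le> M * (e / M)"
      using M z(2) \<open>M > 0\<close> by (intro mult_mono) auto
    finally show ?thesis
      using \<open>M > 0\<close> by simp
  qed
  then show "\<exists>z. norm z = 1 \<and> (\<forall>i. norm (powt T k i z) \<le> e)"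
    using z(1) by (auto simp: powt_def)
qed

text \<open>The points are chosen greedily: one at which some member of \<open>Z\<close> does not
  vanish, then recursively points for the members vanishing there, whose dimension has dropped. In
  use \<open>Z\<close> consists of functionals, and the points supply evaluations in place of
  functionals on the dual.\<close>

lemma separating_points:
  fixes Z :: "('b \<Rightarrow> complex) set"
  assumes "csubspace Z" "fdim_le Z r"
  shows "\<exists>E. finite E \<and> card E \<le> r \<and> (\<forall>\<phi>\<in>Z. (\<forall>x\<in>E. \<phi> x = 0) \<longrightarrow> \<phi> = 0)"
  using assms
proof (induction r arbitrary: Z)
  case 0
  have "\<phi> = 0" if "\<phi> \<in> Z" for \<phi>
  proof (rule ccontr)
    assume "\<phi> \<noteq> 0"
    then have "cvec.independent {\<phi>}"
      by simp
    then show False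
      using "0.prems"(2) that unfolding fdim_le_def by (auto dest: spec[of _ "{\<phi>}"])
  qed
  then show ?case
    by (intro exI[of _ "{}"] conjI ballI impI) (simp, simp, blast)
next
  case (Suc r)
  show ?case
  proof (cases "Z \<subseteq> {0}")
    case True
    then show ?thesis
      by (intro exI[of _ "{}"] conjI ballI impI) (simp, simp, blast)
  next
    case False
    then obtain \<phi> where \<phi>: "\<phi> \<in> Z" "\<phi> \<noteq> 0"
      by blast
    then obtain x where x: "\<phi> x \<noteq> 0"
      by (auto simp: fun_eq_iff)
    let ?Z = "{\<psi> \<in> Z. \<psi> x = 0}"
    have sub: "csubspace ?Z"
    proof (rule cvec.subspaceI)
      show "0 \<in> ?Z"
        using csub_mem(1)[OF Suc.prems(1)] by simp
      show "\<psi> + \<psi>' \<in> ?Z" if "\<psi> \<in> ?Z" "\<psi>' \<in> ?Z" for \<psi> \<psi>'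
        using that csub_mem(2)[OF Suc.prems(1)] by simp
      fix c \<psi> assume \<psi>: "\<psi> \<in> ?Z"
      have "scaleC c \<psi> x = 0"
        using \<psi> by (simp add: scaleC_fun_def)
      then show "scaleC c \<psi> \<in> ?Z"
        using \<psi> csub_mem(5)[OF Suc.prems(1)] by simp
    qed
    have "fdim_le ?Z r"
      unfolding fdim_le_def
    proof (intro allI impI)
      fix B assume B: "B \<subseteq> ?Z" "cvec.independent B"
      have "cspan B \<subseteq> ?Z"
        by (rule cvec.span_minimal[OF B(1) sub])
      then have n: "\<phi> \<notin> cspan B"
        using x by blast
      then have ind: "cvec.independent (insert \<phi> B)"
        using B(2) by (rule cvec.independent_insertI)
      have "insert \<phi> B \<subseteq> Z"
        using B(1) \<phi>(1) by blast
      from Suc.prems(2)[unfolded fdim_le_def, rule_format, OF this ind]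
      have "finite (insert \<phi> B) \<and> card (insert \<phi> B) \<le> Suc r" .
      moreover have "\<phi> \<notin> B"
        using n cvec.span_base by blast
      ultimately show "finite B \<and> card B \<le> r"
        by auto
    qed
    from Suc.IH[OF sub this] obtain E where E: "finite E" "card E \<le> r"
      "\<And>\<psi>. \<psi> \<in> ?Z \<Longrightarrow> (\<forall>y\<in>E. \<psi> y = 0) \<Longrightarrow> \<psi> = 0"
      by blast
    show ?thesis
    proof (intro exI[of _ "insert x E"] conjI ballI impI)
      show "card (insert x E) \<le> Suc r"
        using E(1,2) card_insert_le_m1[of "Suc r" E x] by simp
      show "\<psi> = 0" if "\<psi> \<in> Z" "\<forall>y\<in>insert x E. \<psi> y = 0" for \<psi>
        using E(3)[of \<psi>] that by simp
    qed (use E in simp)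
  qed
qed

abbreviation bclin :: "('a::complex_normed_vector \<Rightarrow> 'b::complex_normed_vector) \<Rightarrow> bool"
  where "bclin \<equiv> blin UNIV norm UNIV norm"

lemma bclin_bounded_linear: "bclin f \<Longrightarrow> bounded_linear f"
  by (simp flip: bounded_clinear_iff_blin add: bounded_clinear_def)

lemma bclin_onorm: "bclin f \<Longrightarrow> norm (f x) \<le> onorm f * norm x"
  by (rule onorm[OF bclin_bounded_linear])

lemma norming_functional_UNIV:
  fixes x :: "'a::complex_normed_vector"
  shows "\<exists>\<phi> :: 'a \<Rightarrow> complex. bclin \<phi> \<and> (\<forall>z. cmod (\<phi> z) \<le> norm z) \<and> \<phi> x = of_real (norm x)"
proof -
  obtain \<phi> :: "'a \<Rightarrow> complex" where "bclin \<phi>" "\<And>z. z \<in> UNIV \<Longrightarrow> cmod (\<phi> z) \<le> norm z"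
    "\<phi> x = of_real (norm x)"
    by (rule norming_functional[OF norm_on_norm UNIV_I, of x]) (rule that)
  then show ?thesis
    by (intro exI[of _ \<phi>]) simp
qed

lemma sum_UNIV_sum:
  fixes F :: "'n::finite + 'm::finite \<Rightarrow> 'c::comm_monoid_add"
  shows "(\<Sum>i\<in>UNIV. F i) = (\<Sum>i\<in>UNIV. F (Inl i)) + (\<Sum>j\<in>UNIV. F (Inr j))"
  using sum.Plus[of UNIV UNIV F] by simp

lemma UNIV_subspace_span: "cspan X = UNIV" if "\<And>x. x \<in> cspan X"
  using that by blast

section \<open>Duality\<close>

definition ext_space :: "'c set \<Rightarrow> (('n \<Rightarrow> 'a::complex_normed_vector) \<times> ('c \<Rightarrow> complex)) set"
  where "ext_space E = UNIV \<times> PiC E UNIV"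

definition ext_norm :: "'c set \<Rightarrow> ('n::finite \<Rightarrow> 'a::complex_normed_vector) \<times> ('c \<Rightarrow> complex) \<Rightarrow> real"
  where "ext_norm E x = pn UNIV norm (fst x) + pn E norm (snd x)"

text \<open>The row \<open>hat S\<close> enlarged by finitely many extra vectors. These form an
  indexed family \<open>p\<close>, because different operators evaluated at one point may give the
  same vector.\<close>

definition ext_hat :: "('n::finite \<Rightarrow> 'a \<Rightarrow> 'a::complex_normed_vector) \<Rightarrow> 'c set \<Rightarrow> ('c \<Rightarrow> 'a) \<Rightarrow>
    ('n \<Rightarrow> 'a) \<times> ('c \<Rightarrow> complex) \<Rightarrow> 'a"
  where "ext_hat S E p x = hat S (fst x) + (\<Sum>b\<in>E. scaleC (snd x b) (p b))"

context
  fixes S :: "'n::finite \<Rightarrow> 'a::complex_banach \<Rightarrow> 'a" and E :: "'c set" and p :: "'c \<Rightarrow> 'a"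
  assumes S: "comm_ops UNIV norm S" and E: "finite E"
begin

lemma banach_on_ext: "banach_on (ext_space E :: (('n \<Rightarrow> 'a) \<times> ('c \<Rightarrow> complex)) set) (ext_norm E)"
  unfolding ext_space_def ext_norm_def[abs_def]
  using banach_on_prod[OF banach_on_PiC[OF banach_on_norm finite, of UNIV] banach_on_PiC[OF banach_on_norm E]]
  by simp

lemma blin_ext_hat: "blin (ext_space E) (ext_norm E) UNIV norm (ext_hat S E p)"
proof -
  have NP: "norm_on (UNIV :: ('n \<Rightarrow> 'a) set) (pn UNIV norm)"
    using norm_on_PiC[OF norm_on_norm finite, of UNIV] by simp
  have NB: "norm_on (PiC E (UNIV :: complex set)) (pn E norm)"
    by (rule norm_on_PiC[OF norm_on_norm E])
  have f: "blin UNIV (pn UNIV norm) UNIV norm (hat S)"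
    using blin_hat[OF norm_on_norm S] by simp
  have "blin (ext_space E :: (('n \<Rightarrow> 'a) \<times> ('c \<Rightarrow> complex)) set) (ext_norm E) UNIV norm (\<lambda>x. scaleC (snd x b) (p b))" if "b \<in> E" for b
    unfolding ext_space_def ext_norm_def[abs_def]
    by (rule blin_functional_scale[OF blin_comp[OF blin_snd[OF NP NB]
          blin_component[OF norm_on_norm E that] NB] norm_on_norm UNIV_I])
  moreover have "blin (ext_space E) (ext_norm E) UNIV norm (\<lambda>x. hat S (fst x))"
    unfolding ext_space_def ext_norm_def[abs_def]
    by (rule blin_comp[OF blin_fst[OF NP NB] f NP])
  ultimately show ?thesis
    unfolding ext_hat_def[abs_def]
    by (intro blin_add_map[OF _ blin_sum_map[OF _ norm_on_norm] norm_on_norm])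
qed

lemma codim_le_if_ext_hat_surj:
  assumes "\<And>y. y \<in> (ext_hat S E p) ` (ext_space E)" and r: "card E \<le> r"
  shows "codim_le UNIV (M_sum UNIV 1 S) r"
  unfolding codim_le_def
proof (intro exI[of _ "p ` E"] conjI UNIV_subspace_span)
  show "card (p ` E) \<le> r"
    using card_image_le[OF E, of p] r by simp
  fix y
  let ?S = "cspan (M_sum UNIV 1 S \<union> p ` E)"
  obtain x where x: "y = (ext_hat S E p) x"
    using assms(1)[of y] by blast
  have "hat S (fst x) \<in> M_sum UNIV 1 S"
    using M_sum_eq[OF norm_on_norm S, of 1] by simp
  then have "hat S (fst x) \<in> ?S"
    by (intro cvec.span_base) simp
  moreover have "(\<Sum>b\<in>E. scaleC (snd x b) (p b)) \<in> ?S"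
    by (intro cvec.span_sum cvec.span_scale cvec.span_base) simp
  ultimately show "y \<in> ?S"
    unfolding x ext_hat_def by (rule cvec.span_add)
qed (use E in simp)

text \<open>Solving up to a factor \<open>q\<close> below 1, modulo the vectors \<open>p b\<close>,
  is enough: \<open>approx_surj\<close> for \<open>ext_hat\<close> makes the solution exact.\<close>

lemma codim_le_if_approx:
  assumes q: "0 \<le> q" "q < 1" and K: "0 \<le> K" and r: "card E \<le> r"
    and approx: "\<And>y. \<exists>u c. (\<Sum>i\<in>UNIV. norm (u i)) \<le> K * norm y \<and> (\<Sum>b\<in>E. cmod (c b)) \<le> K * norm y \<and>
      norm (y - (hat S u + (\<Sum>b\<in>E. scaleC (c b) (p b)))) \<le> q * norm y"
  shows "codim_le UNIV (M_sum UNIV 1 S) r"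
proof (rule codim_le_if_ext_hat_surj[OF _ r])
  fix y
  \<comment> \<open>The factor 2 adds the bound for the coefficients to that for the
    vectors.\<close>
  have "\<exists>x\<in>(ext_space E). (ext_norm E) x \<le> (2 * K) * norm y \<and> norm (y - (ext_hat S E p) x) \<le> q * norm y" for y
  proof -
    obtain u c where uc: "(\<Sum>i\<in>UNIV. norm (u i)) \<le> K * norm y" "(\<Sum>b\<in>E. cmod (c b)) \<le> K * norm y"
      "norm (y - (hat S u + (\<Sum>b\<in>E. scaleC (c b) (p b)))) \<le> q * norm y"
      using approx by blast
    define c' where "c' b = (if b \<in> E then c b else 0)" for b
    have "(\<Sum>b\<in>E. scaleC (c' b) (p b)) = (\<Sum>b\<in>E. scaleC (c b) (p b))"
      "(\<Sum>b\<in>E. cmod (c' b)) = (\<Sum>b\<in>E. cmod (c b))"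
      by (auto intro!: sum.cong simp: c'_def)
    then show ?thesis
      using uc by (intro bexI[of _ "(u, c')"])
        (auto simp: ext_norm_def ext_hat_def pn_def ext_space_def PiC_def c'_def)
  qed
  then have "\<exists>x\<in>(ext_space E). (ext_hat S E p) x = y \<and> (ext_norm E) x \<le> (2 * K) / (1 - q) * norm y"
    using q K by (intro approx_surj[OF banach_on_ext norm_on_norm blin_ext_hat]) auto
  then show "y \<in> (ext_hat S E p) ` (ext_space E)"
    by blast
qed

end

definition dual :: "('b::complex_normed_vector \<Rightarrow> complex) set"
  where "dual = {\<phi>. bclin \<phi>}"

lemma dual_bound: "\<phi> \<in> dual \<Longrightarrow> cmod (\<phi> x) \<le> onorm \<phi> * norm x"
  by (rule bclin_onorm) (simp add: dual_def)

lemma norm_on_dual: "norm_on (dual :: ('b::complex_normed_vector \<Rightarrow> complex) set) onorm"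
  unfolding norm_on_def
proof (intro conjI ballI allI)
  show "csubspace (dual :: ('b \<Rightarrow> complex) set)"
  proof (rule cvec.subspaceI)
    show "(0 :: 'b \<Rightarrow> complex) \<in> dual"
      unfolding dual_def zero_fun_def using blin_zero_map[OF norm_on_norm] by blast
    show "f + g \<in> dual" if "f \<in> dual" "g \<in> dual" for f g :: "'b \<Rightarrow> complex"
      using that blin_add_map[OF _ _ norm_on_norm, of UNIV norm f g]
      by (simp add: dual_def plus_fun_def)
    show "scaleC c f \<in> dual" if "f \<in> dual" for c and f :: "'b \<Rightarrow> complex"
      using that blin_scale_map[OF _ norm_on_norm, of UNIV norm f c]
      by (simp add: dual_def scaleC_fun_def)
  qed
  fix f :: "'b \<Rightarrow> complex" assume f: "f \<in> dual"
  then have bl: "bounded_linear f"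
    by (simp add: dual_def bclin_bounded_linear)
  show "0 \<le> onorm f"
    by (rule onorm_pos_le[OF bl])
  show "onorm f = 0 \<longleftrightarrow> f = 0"
    using onorm_eq_0[OF bl] by (simp add: fun_eq_iff)
  have le: "onorm (scaleC c f) \<le> cmod c * onorm f" if "f \<in> dual" for c and f :: "'b \<Rightarrow> complex"
  proof (rule onorm_bound)
    show "0 \<le> cmod c * onorm f"
      using that by (simp add: dual_def onorm_pos_le bclin_bounded_linear)
    show "norm (scaleC c f x) \<le> cmod c * onorm f * norm x" for x
      using mult_left_mono[OF dual_bound[OF that, of x], of "cmod c"]
      by (simp add: scaleC_fun_def norm_scaleC mult.assoc)
  qed
  show "onorm (scaleC c f) = cmod c * onorm f" for c
  proof (cases "c = 0")
    case True
    then show ?thesis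
      by (simp add: zero_fun_def onorm_zero)
  next
    case False
    have "scaleC c f \<in> dual"
      using f blin_scale_map[OF _ norm_on_norm, of UNIV norm f c]
      by (simp add: dual_def scaleC_fun_def)
    from le[OF this, of "1 / c"] have "onorm f \<le> onorm (scaleC c f) / cmod c"
      using False by (simp add: scaleC_scaleC scaleC_one norm_divide)
    then show ?thesis
      using le[OF f, of c] False by (simp add: field_simps)
  qed
  fix g :: "'b \<Rightarrow> complex" assume "g \<in> dual"
  then show "onorm (f + g) \<le> onorm f + onorm g"
    using onorm_triangle[OF bl, of g] by (simp add: dual_def bclin_bounded_linear plus_fun_def)
qed

text \<open>Cauchy functionals converge pointwise; letting one index tend to infinity in the Cauchy
  condition makes the convergence uniform on the unit ball.\<close>

lemma banach_on_dual: "banach_on (dual :: ('b::complex_normed_vector \<Rightarrow> complex) set) onorm"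
  unfolding banach_on_iff_seq
proof (intro conjI allI impI norm_on_dual)
  fix s :: "nat \<Rightarrow> 'b \<Rightarrow> complex" assume s: "\<forall>n. s n \<in> dual" and c: "cauchy_on onorm s"
  have diff: "cmod (s m x - s n x) \<le> onorm (s m - s n) * norm x" for m n x
    using dual_bound[OF norm_on_diff_mem[OF norm_on_dual s[rule_format] s[rule_format]], of m n x] by simp
  have conv: "convergent (\<lambda>n. s n x)" for x
  proof -
    have "cauchy_on norm (\<lambda>n. s n x)"
      unfolding cauchy_on_def
    proof (intro allI impI)
      fix e :: real assume "e > 0"
      then have e: "e / (norm x + 1) > 0"
        by (simp add: add_nonneg_pos)
      obtain M where M: "\<And>m n. m \<ge> M \<Longrightarrow> n \<ge> M \<Longrightarrow> onorm (s m - s n) < e / (norm x + 1)"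
        using cauchy_onD[OF c e] by blast
      show "\<exists>M. \<forall>m\<ge>M. \<forall>n\<ge>M. norm (s m x - s n x) < e"
      proof (intro exI allI impI)
        fix m n assume "M \<le> m" "M \<le> n"
        then have "onorm (s m - s n) * norm x \<le> e / (norm x + 1) * norm x"
          using M by (intro mult_right_mono) (auto simp: less_imp_le)
        also have "\<dots> < e"
        proof -
          have "0 < norm x + 1"
            by (simp add: add_nonneg_pos)
          then show ?thesis
            using \<open>e > 0\<close> by (simp add: field_simps)
        qed
        finally show "norm (s m x - s n x) < e"
          using diff[of m x n] by simp
      qed
    qed
    then show ?thesis
      unfolding cauchy_on_norm_iff Cauchy_convergent_iff .
  qed
  define \<phi> where "\<phi> x = lim (\<lambda>n. s n x)" for x
  have \<phi>: "(\<lambda>n. s n x) \<longlonglongrightarrow> \<phi> x" for x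
    using conv[of x] unfolding \<phi>_def convergent_LIMSEQ_iff .
  have unif: "\<exists>M. \<forall>n\<ge>M. \<forall>x. cmod (s n x - \<phi> x) \<le> e * norm x" if e: "e > 0" for e
  proof -
    obtain M where M: "\<And>m n. m \<ge> M \<Longrightarrow> n \<ge> M \<Longrightarrow> onorm (s m - s n) < e"
      using cauchy_onD[OF c e] by blast
    have "cmod (s n x - \<phi> x) \<le> e * norm x" if n: "n \<ge> M" for n x
    proof (rule LIMSEQ_le_const2)
      show "(\<lambda>m. cmod (s n x - s m x)) \<longlonglongrightarrow> cmod (s n x - \<phi> x)"
        by (intro tendsto_intros \<phi>)
      show "\<exists>M. \<forall>m\<ge>M. cmod (s n x - s m x) \<le> e * norm x"
      proof (intro exI allI impI)
        fix m assume "M \<le> m"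
        then have "onorm (s n - s m) * norm x \<le> e * norm x"
          using M[OF n] by (intro mult_right_mono) (auto simp: less_imp_le)
        then show "cmod (s n x - s m x) \<le> e * norm x"
          using diff[of n x m] by simp
      qed
    qed
    then show ?thesis
      by blast
  qed
  obtain M where M: "\<And>x. cmod (s M x - \<phi> x) \<le> 1 * norm x"
    using unif[of 1] by auto
  have sM: "bclin (s n)" for n
    using s by (simp add: dual_def)
  have \<phi>_dual: "\<phi> \<in> dual"
    unfolding dual_def
  proof (intro CollectI blinI[where K = "onorm (s M) + 1"])
    fix x y :: 'b and c
    have "(\<lambda>n. s n (x + y)) \<longlonglongrightarrow> \<phi> x + \<phi> y"
      using tendsto_add[OF \<phi>[of x] \<phi>[of y]] by (simp add: blin_add[OF sM])
    then show "\<phi> (x + y) = \<phi> x + \<phi> y"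
      using LIMSEQ_unique \<phi> by blast
    have "(\<lambda>n. s n (scaleC c x)) \<longlonglongrightarrow> c * \<phi> x"
      using tendsto_mult_left[OF \<phi>[of x], of c] by (simp add: blin_scale[OF sM] scaleC_complex_def)
    then show "\<phi> (scaleC c x) = scaleC c (\<phi> x)"
      unfolding scaleC_complex_def using LIMSEQ_unique \<phi> by blast
    have "cmod (\<phi> x) \<le> cmod (s M x) + cmod (s M x - \<phi> x)"
      using norm_triangle_ineq4[of "s M x" "s M x - \<phi> x"] by simp
    also have "cmod (s M x) \<le> onorm (s M) * norm x"
      using s by (intro dual_bound) simp
    also have "cmod (s M x - \<phi> x) \<le> 1 * norm x"
      by (rule M)
    finally show "norm (\<phi> x) \<le> (onorm (s M) + 1) * norm x"
      by (simp add: distrib_right)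
  qed simp
  have "(\<lambda>n. onorm (s n - \<phi>)) \<longlonglongrightarrow> 0"
  proof (rule LIMSEQ_I)
    fix e :: real assume "e > 0"
    then have "e / 2 > 0"
      by simp
    then obtain M where M: "\<And>n x. n \<ge> M \<Longrightarrow> cmod (s n x - \<phi> x) \<le> e / 2 * norm x"
      using unif by blast
    show "\<exists>M. \<forall>n\<ge>M. norm (onorm (s n - \<phi>) - 0) < e"
    proof (intro exI allI impI)
      fix n assume "M \<le> n"
      then have "onorm (s n - \<phi>) \<le> e / 2"
        using M \<open>e > 0\<close> by (intro onorm_bound) auto
      moreover have "0 \<le> onorm (s n - \<phi>)"
        using norm_on_nonneg[OF norm_on_dual norm_on_diff_mem[OF norm_on_dual s[rule_format] \<phi>_dual]] .
      ultimately show "norm (onorm (s n - \<phi>) - 0) < e"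
        using \<open>e > 0\<close> by simp
    qed
  qed
  then show "\<exists>l\<in>dual. (\<lambda>n. onorm (s n - l)) \<longlonglongrightarrow> 0"
    using \<phi>_dual by blast
qed

lemma comm_ops_dual:
  fixes T :: "'m \<Rightarrow> 'b::complex_normed_vector \<Rightarrow> 'b"
  assumes T: "comm_ops UNIV norm T"
  shows "comm_ops dual onorm (\<lambda>j \<phi>. \<phi> \<circ> T j)"
  unfolding comm_ops_def
proof (intro conjI allI ballI)
  have Tj: "bclin (T j)" for j
    using T by (simp add: comm_ops_def)
  show "blin dual onorm dual onorm (\<lambda>\<phi>. \<phi> \<circ> T j)" for j
  proof (rule blinI[where K = "onorm (T j)"])
    fix \<phi> :: "'b \<Rightarrow> complex" assume "\<phi> \<in> dual"
    then have \<phi>: "bclin \<phi>"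
      by (simp add: dual_def)
    show "\<phi> \<circ> T j \<in> dual"
      using blin_comp[OF Tj \<phi> norm_on_norm] by (simp add: dual_def o_def)
    show "onorm (\<phi> \<circ> T j) \<le> onorm (T j) * onorm \<phi>"
      using onorm_compose[OF bclin_bounded_linear[OF \<phi>] bclin_bounded_linear[OF Tj]]
      by (simp add: mult.commute)
  qed (auto simp: fun_eq_iff scaleC_fun_def)
  fix i j and \<phi> :: "'b \<Rightarrow> complex"
  have "T i (T j x) = T j (T i x)" for x
    using T by (simp add: comm_ops_def)
  then show "\<phi> \<circ> T j \<circ> T i = \<phi> \<circ> T i \<circ> T j"
    by (simp add: fun_eq_iff)
qed

section \<open>Operator ideals and their multiplication operators\<close>

context
  fixes J :: "('b::complex_banach \<Rightarrow> 'a::complex_banach) set" and \<alpha>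
  assumes J: "operator_ideal J \<alpha>"
begin

lemma ideal_banach: "banach_on J \<alpha>"
  using J by (simp add: operator_ideal_def)

lemma ideal_norm_on: "norm_on J \<alpha>"
  by (rule banach_on_norm_on[OF ideal_banach])

lemma ideal_bclin: "A \<in> J \<Longrightarrow> bclin A"
  using J by (simp add: operator_ideal_def bounded_clinear_iff_blin)

lemma ideal_rank_one:
  assumes "bclin \<phi>"
  shows "rank_one x \<phi> \<in> J" "\<alpha> (rank_one x \<phi>) = norm x * onorm \<phi>"
proof -
  have "\<forall>x\<^sub>1 x\<^sub>2'. bounded_clinear x\<^sub>2' \<longrightarrow>
      rank_one x\<^sub>1 x\<^sub>2' \<in> J \<and> \<alpha> (rank_one x\<^sub>1 x\<^sub>2') = norm x\<^sub>1 * onorm x\<^sub>2'"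
    using J unfolding operator_ideal_def by (elim conjE)
  from this[rule_format, of \<phi> x] assms
  show "rank_one x \<phi> \<in> J" "\<alpha> (rank_one x \<phi>) = norm x * onorm \<phi>"
    by (simp_all add: bounded_clinear_iff_blin)
qed

lemma ideal_rank_one_le:
  assumes "bclin \<phi>" "0 \<le> c" "\<And>z. cmod (\<phi> z) \<le> c * norm z"
  shows "\<alpha> (rank_one x \<phi>) \<le> norm x * c"
  unfolding ideal_rank_one(2)[OF assms(1)]
  by (rule mult_left_mono[OF onorm_bound[OF assms(2,3)]]) simp

lemma ideal_comp:
  assumes "A \<in> J" "bclin P" "bclin R"
  shows "P \<circ> A \<circ> R \<in> J" "\<alpha> (P \<circ> A \<circ> R) \<le> onorm P * \<alpha> A * onorm R"
proof -
  have "\<forall>A\<in>J. \<forall>S T. bounded_clinear S \<and> bounded_clinear T \<longrightarrow>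
      S \<circ> A \<circ> T \<in> J \<and> \<alpha> (S \<circ> A \<circ> T) \<le> onorm S * \<alpha> A * onorm T"
    using J unfolding operator_ideal_def by (elim conjE)
  from this[rule_format, OF assms(1), of P R] assms(2,3)
  show "P \<circ> A \<circ> R \<in> J" "\<alpha> (P \<circ> A \<circ> R) \<le> onorm P * \<alpha> A * onorm R"
    by (simp_all add: bounded_clinear_iff_blin)
qed

lemma rank_one_bclin:
  assumes "bclin \<phi>"
  shows "bclin (rank_one x \<phi>)"
  unfolding rank_one_def by (rule blin_functional_scale[OF assms norm_on_norm UNIV_I])

text \<open>Sandwiching \<open>A\<close> between rank one operators leaves a multiple of a rank one
  operator, whose ideal norm is known. Thus the ideal norm dominates the operator norm, and
  evaluation at a point is continuous on \<open>J\<close>.\<close>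

lemma ideal_norm_le:
  assumes A: "A \<in> J"
  shows "norm (A x) \<le> \<alpha> A * norm x"
proof (cases "x = 0 \<or> A x = 0")
  case True
  then show ?thesis
    using norm_on_nonneg[OF ideal_norm_on A] blin_zero[OF norm_on_norm ideal_bclin[OF A]] by auto
next
  case False
  define y where "y = A x"
  obtain \<phi> :: "'b \<Rightarrow> complex" where \<phi>: "bclin \<phi>" "\<And>z. cmod (\<phi> z) \<le> norm z" "\<phi> x = of_real (norm x)"
    using norming_functional_UNIV[of x] by blast
  obtain \<psi> :: "'a \<Rightarrow> complex" where \<psi>: "bclin \<psi>" "\<And>z. cmod (\<psi> z) \<le> norm z" "\<psi> y = of_real (norm y)"
    using norming_functional_UNIV[of y] by blast
  \<comment> \<open>This factor is cancelled at the end.\<close>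
  have pos: "0 < onorm \<phi>"
  proof (rule ccontr)
    assume "\<not> ?thesis"
    then have "onorm \<phi> * norm x \<le> 0"
      by (simp add: mult_nonpos_nonneg)
    moreover have "norm x \<le> onorm \<phi> * norm x"
      using bclin_onorm[OF \<phi>(1), of x] by (simp only: \<phi>(3) norm_of_real abs_norm_cancel)
    moreover have "0 < norm x"
      using False by simp
    ultimately show False
      by linarith
  qed
  have "rank_one y \<psi> \<circ> A \<circ> rank_one x \<phi> = rank_one (scaleC (\<psi> y) y) \<phi>"
    by (simp add: fun_eq_iff rank_one_def blin_scale[OF ideal_bclin[OF A]] blin_scale[OF \<psi>(1)]
        y_def[symmetric] scaleC_scaleC scaleC_complex_def)
  then have "norm (scaleC (\<psi> y) y) * onorm \<phi> \<le> onorm (rank_one y \<psi>) * \<alpha> A * onorm (rank_one x \<phi>)"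
    using ideal_comp(2)[OF A rank_one_bclin[OF \<psi>(1), of y] rank_one_bclin[OF \<phi>(1), of x]]
    by (simp add: ideal_rank_one(2)[OF \<phi>(1)])
  also have "\<dots> \<le> norm y * \<alpha> A * (norm x * onorm \<phi>)"
  proof (intro mult_mono)
    show "onorm (rank_one y \<psi>) \<le> norm y"
    proof (rule onorm_bound)
      show "norm (rank_one y \<psi> z) \<le> norm y * norm z" for z
        using mult_right_mono[OF \<psi>(2)[of z], of "norm y"]
        by (simp add: rank_one_def norm_scaleC mult.commute)
    qed simp
    show "onorm (rank_one x \<phi>) \<le> norm x * onorm \<phi>"
    proof (rule onorm_bound)
      show "norm (rank_one x \<phi> z) \<le> norm x * onorm \<phi> * norm z" for z
        using mult_right_mono[OF bclin_onorm[OF \<phi>(1), of z], of "norm x"]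
        by (simp add: rank_one_def norm_scaleC mult_ac)
    qed (use pos in simp)
    show "0 \<le> onorm (rank_one x \<phi>)"
      by (intro onorm_pos_le bclin_bounded_linear rank_one_bclin \<phi>)
  qed (auto simp: norm_on_nonneg[OF ideal_norm_on A])
  also have "norm (scaleC (\<psi> y) y) = norm y * norm y"
    by (simp add: norm_scaleC \<psi>(3))
  finally have "(norm y * onorm \<phi>) * norm y \<le> (norm y * onorm \<phi>) * (\<alpha> A * norm x)"
    by (simp add: mult_ac)
  moreover have "0 < norm y * onorm \<phi>"
    using pos False by (simp add: y_def)
  ultimately show ?thesis
    unfolding y_def[symmetric] by (simp only: mult_le_cancel_left_pos)
qed

lemma blin_left_mult:
  assumes P: "bclin P"
  shows "blin J \<alpha> J \<alpha> (\<lambda>A. P \<circ> A)"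
proof (rule blinI[where K = "onorm P"])
  fix A assume A: "A \<in> J"
  show "P \<circ> A \<in> J"
    using ideal_comp(1)[OF A P blin_id] by (simp add: o_def)
  have "\<alpha> (P \<circ> A) \<le> onorm P * \<alpha> A * onorm (\<lambda>x :: 'b. x)"
    using ideal_comp(2)[OF A P blin_id] by (simp add: o_def)
  also have "\<dots> \<le> onorm P * \<alpha> A * 1"
    using norm_on_nonneg[OF ideal_norm_on A] onorm_pos_le[OF bclin_bounded_linear[OF P]]
    by (intro mult_left_mono onorm_bound) auto
  finally show "\<alpha> (P \<circ> A) \<le> onorm P * \<alpha> A"
    by simp
qed (auto simp: fun_eq_iff blin_add[OF P] blin_scale[OF P] scaleC_fun_def)

lemma blin_right_mult:
  assumes P: "bclin P"
  shows "blin J \<alpha> J \<alpha> (\<lambda>A. A \<circ> P)"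
proof (rule blinI[where K = "onorm P"])
  fix A assume A: "A \<in> J"
  show "A \<circ> P \<in> J"
    using ideal_comp(1)[OF A blin_id P] by (simp add: o_def)
  have "\<alpha> (A \<circ> P) \<le> onorm (\<lambda>x :: 'a. x) * \<alpha> A * onorm P"
    using ideal_comp(2)[OF A blin_id P] by (simp add: o_def)
  also have "\<dots> \<le> 1 * \<alpha> A * onorm P"
    using norm_on_nonneg[OF ideal_norm_on A] onorm_pos_le[OF bclin_bounded_linear[OF P]]
    by (intro mult_right_mono onorm_bound) auto
  finally show "\<alpha> (A \<circ> P) \<le> onorm P * \<alpha> A"
    by (simp add: mult.commute)
qed (auto simp: fun_eq_iff scaleC_fun_def)

lemma comm_ops_left_right_mult:
  assumes S: "comm_ops UNIV norm S" and T: "comm_ops UNIV norm T"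
  shows "comm_ops J \<alpha> (left_right_mult S T)"
  unfolding comm_ops_def
proof (intro conjI allI ballI)
  have Sb: "bclin (S i)" and Tb: "bclin (T j)" for i j
    using S T by (simp_all add: comm_ops_def)
  show "blin J \<alpha> J \<alpha> (left_right_mult S T i)" for i
    by (cases i) (simp_all add: left_right_mult_def blin_left_mult[OF Sb] blin_right_mult[OF Tb])
  have Sc: "S i (S j x) = S j (S i x)" for i j x
    using S by (simp add: comm_ops_def)
  have Tc: "T i (T j x) = T j (T i x)" for i j x
    using T by (simp add: comm_ops_def)
  show "left_right_mult S T i (left_right_mult S T j A) = left_right_mult S T j (left_right_mult S T i A)"
    for i j A
    by (cases i; cases j) (auto simp: left_right_mult_def fun_eq_iff Sc, metis Tc)
qed

end

text \<open>This carries every result on a multiplication tuple over to its powers: \<open>S\<close>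
  and \<open>T\<close> are replaced by \<open>powt S k\<close> and \<open>powt T k\<close>.\<close>

lemma powt_left_right_mult: "powt (left_right_mult S T) k = left_right_mult (powt S k) (powt T k)"
proof -
  have l: "((\<lambda>A. S i \<circ> A) ^^ k) A = (S i ^^ k) \<circ> A" for i A
    by (induction k) (simp_all add: o_assoc)
  have r: "((\<lambda>A. A \<circ> T j) ^^ k) A = A \<circ> (T j ^^ k)" for j A
  proof (induction k arbitrary: A)
    case (Suc k)
    have "((\<lambda>A. A \<circ> T j) ^^ Suc k) A = ((\<lambda>A. A \<circ> T j) ^^ k) (A \<circ> T j)"
      by (simp only: funpow_Suc_right o_apply)
    also have "\<dots> = A \<circ> T j \<circ> T j ^^ k"
      by (rule Suc)
    also have "\<dots> = A \<circ> (T j ^^ Suc k)"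
      by (simp only: funpow.simps(2) o_assoc)
    finally show ?case .
  qed simp
  show ?thesis
  proof
    show "powt (left_right_mult S T) k i = left_right_mult (powt S k) (powt T k) i" for i
      by (cases i) (simp_all add: powt_def left_right_mult_def fun_eq_iff l r)
  qed
qed

lemma hat_left_right_mult:
  "hat (left_right_mult S T) w = (\<Sum>i\<in>UNIV. S i \<circ> w (Inl i)) + (\<Sum>j\<in>UNIV. w (Inr j) \<circ> T j)"
  by (simp add: hat_def sum_UNIV_sum left_right_mult_def)

section \<open>From the multiplication tuple to its factors\<close>

context
  fixes J :: "('b::complex_banach \<Rightarrow> 'a::complex_banach) set" and \<alpha>
    and S :: "'n::finite \<Rightarrow> 'a \<Rightarrow> 'a" and T :: "'m::finite \<Rightarrow> 'b \<Rightarrow> 'b"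
  assumes J: "operator_ideal J \<alpha>" and S: "comm_ops UNIV norm S" and T: "comm_ops UNIV norm T"
begin

lemmas ideal_comm_ops = comm_ops_left_right_mult[OF J S T]

lemma S_bclin: "bclin (S i)" and T_bclin: "bclin (T j)"
  using S T by (simp_all add: comm_ops_def)

lemma S_scale: "S i (scaleC c x) = scaleC c (S i x)"
  by (rule blin_scale[OF S_bclin UNIV_I])

lemma left_mult_rank_one: "S i \<circ> rank_one x \<phi> = rank_one (S i x) \<phi>"
  by (simp add: fun_eq_iff rank_one_def S_scale)

lemma right_mult_rank_one: "rank_one x \<phi> \<circ> T j = rank_one x (\<phi> \<circ> T j)"
  by (simp add: fun_eq_iff rank_one_def)

lemma hat_left_right_mult_apply:
  "hat (left_right_mult S T) w z = (\<Sum>i\<in>UNIV. S i (w (Inl i) z)) + (\<Sum>j\<in>UNIV. w (Inr j) (T j z))"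
  by (simp add: hat_left_right_mult sum_fun_apply)

lemma sum_left_right_mult_rank_one:
  "(\<Sum>i\<in>UNIV. \<alpha> (left_right_mult S T i (rank_one x \<phi>))) =
    (\<Sum>i\<in>UNIV. \<alpha> (rank_one (S i x) \<phi>)) + (\<Sum>j\<in>UNIV. \<alpha> (rank_one x (\<phi> \<circ> T j)))"
  by (simp add: sum_UNIV_sum left_right_mult_def left_mult_rank_one right_mult_rank_one)

text \<open>At an approximate null vector \<open>z\<close> of \<open>T\<close>, evaluation kills the right multiplications up to a
  small error, so solving \<open>hat (left_right_mult S T) w = x \<otimes> \<phi>\<close> modulo a finite-dimensional space approximately solves
  \<open>hat S u = x\<close> modulo a space of the same dimension.\<close>

lemma codim_le_S:
  assumes c: "codim_le J (M_sum J 1 (left_right_mult S T)) r" and n: "approx_null T"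
  shows "codim_le UNIV (M_sum UNIV 1 S) r"
proof -
  obtain B K where B: "finite B" "card B \<le> r" "B \<subseteq> J" and K: "K > 0"
    and solve: "\<And>y. y \<in> J \<Longrightarrow> \<exists>w c. (\<forall>i. w i \<in> J) \<and> y = hat (left_right_mult S T) w + (\<Sum>b\<in>B. scaleC (c b) b) \<and>
      (\<Sum>i\<in>UNIV. \<alpha> (w i)) \<le> K * \<alpha> y \<and> (\<Sum>b\<in>B. cmod (c b)) \<le> K * \<alpha> y"
    by (rule hat_open_modulo[OF ideal_banach[OF J] ideal_comm_ops c]) (rule that)
  \<comment> \<open>The solution has norm at most \<open>K * norm x\<close>, so the right
    multiplications contribute at most half of \<open>norm x\<close> at \<open>z\<close>.\<close>
  define e where "e = 1 / (2 * K)"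
  have "e > 0"
    using K by (simp add: e_def)
  then obtain z where z: "norm z = 1" "\<And>j. norm (T j z) \<le> e"
    using n unfolding approx_null_def by blast
  obtain \<phi> :: "'b \<Rightarrow> complex" where \<phi>: "bclin \<phi>" "\<And>y. cmod (\<phi> y) \<le> norm y" "\<phi> z = of_real (norm z)"
    using norming_functional_UNIV[of z] by blast
  \<comment> \<open>The finite-dimensional error survives evaluation as the family of the vectors
    \<open>b z\<close>, indexed by \<open>B\<close>, so the dimension bound is unchanged.\<close>
  show ?thesis
  proof (rule codim_le_if_approx[OF S B(1), where K = K and q = "1 / 2" and p = "\<lambda>b. b z", OF _ _ _ B(2)])
    fix x :: 'a
    let ?A = "rank_one x \<phi>"
    have A: "?A \<in> J" "\<alpha> ?A \<le> norm x"
      using ideal_rank_one(1)[OF J \<phi>(1)] ideal_rank_one_le[OF J \<phi>(1), of 1 x] \<phi>(2) by auto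
    obtain w c where w: "\<And>i. w i \<in> J" and Aw: "?A = hat (left_right_mult S T) w + (\<Sum>b\<in>B. scaleC (c b) b)"
      and wK: "(\<Sum>i\<in>UNIV. \<alpha> (w i)) \<le> K * \<alpha> ?A" and cK: "(\<Sum>b\<in>B. cmod (c b)) \<le> K * \<alpha> ?A"
      using solve[OF A(1)] by blast
    have KA: "K * \<alpha> ?A \<le> K * norm x"
      using A(2) K by (intro mult_left_mono) auto
    have nn: "0 \<le> \<alpha> (w i)" for i
      by (rule norm_on_nonneg[OF ideal_norm_on[OF J] w])
    have nl: "0 \<le> (\<Sum>i\<in>UNIV. \<alpha> (w (Inl i)))" and nr: "0 \<le> (\<Sum>j\<in>UNIV. \<alpha> (w (Inr j)))"
      by (intro sum_nonneg nn)+
    have sum: "(\<Sum>i\<in>UNIV. \<alpha> (w i)) = (\<Sum>i\<in>UNIV. \<alpha> (w (Inl i))) + (\<Sum>j\<in>UNIV. \<alpha> (w (Inr j)))"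
      by (rule sum_UNIV_sum)
    let ?u = "\<lambda>i. w (Inl i) z"
    have u: "(\<Sum>i\<in>UNIV. norm (?u i)) \<le> K * norm x"
    proof -
      have "(\<Sum>i\<in>UNIV. norm (?u i)) \<le> (\<Sum>i\<in>UNIV. \<alpha> (w (Inl i)))"
        using ideal_norm_le[OF J w, where x = z] z(1) by (intro sum_mono) simp
      then show ?thesis
        using wK KA nr unfolding sum by linarith
    qed
    have "x = ?A z"
      using \<phi>(3) z(1) by (simp add: rank_one_def scaleC_one)
    also have "\<dots> = hat S ?u + (\<Sum>j\<in>UNIV. w (Inr j) (T j z)) + (\<Sum>b\<in>B. scaleC (c b) (b z))"
      unfolding Aw by (simp add: hat_left_right_mult_apply sum_fun_apply scaleC_fun_def hat_def[of S])
    finally have "x - (hat S ?u + (\<Sum>b\<in>B. scaleC (c b) (b z))) = (\<Sum>j\<in>UNIV. w (Inr j) (T j z))"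
      by (simp add: algebra_simps)
    also have "norm \<dots> \<le> (\<Sum>j\<in>UNIV. \<alpha> (w (Inr j)) * e)"
    proof (rule sum_norm_le)
      fix j
      have "norm (w (Inr j) (T j z)) \<le> \<alpha> (w (Inr j)) * norm (T j z)"
        by (rule ideal_norm_le[OF J w])
      also have "\<dots> \<le> \<alpha> (w (Inr j)) * e"
        by (intro mult_left_mono z nn)
      finally show "norm (w (Inr j) (T j z)) \<le> \<alpha> (w (Inr j)) * e" .
    qed
    also have "\<dots> = (\<Sum>j\<in>UNIV. \<alpha> (w (Inr j))) * e"
      by (simp add: sum_distrib_right)
    also have "\<dots> \<le> K * norm x * e"
      using wK KA nl \<open>e > 0\<close> unfolding sum by (intro mult_right_mono) linarith+
    also have "\<dots> = 1 / 2 * norm x"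
      using K by (simp add: e_def)
    finally have "norm (x - (hat S ?u + (\<Sum>b\<in>B. scaleC (c b) (b z)))) \<le> 1 / 2 * norm x" .
    then show "\<exists>u c. (\<Sum>i\<in>UNIV. norm (u i)) \<le> K * norm x \<and> (\<Sum>b\<in>B. cmod (c b)) \<le> K * norm x \<and>
        norm (x - (hat S u + (\<Sum>b\<in>B. scaleC (c b) (b z)))) \<le> 1 / 2 * norm x"
      using u cK KA by (intro exI[of _ ?u] exI[of _ c]) auto
  qed (use K in auto)
qed

lemma norming_apply:
  assumes A: "A \<in> J" and psi: "\<And>x :: 'a. cmod (\<psi> x) \<le> 2 * norm x"
  shows "cmod (\<psi> (A z)) \<le> 2 * \<alpha> A * norm z"
  using psi[of "A z"] ideal_norm_le[OF J A, of z] by linarith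

text \<open>The adjoint of a row is read off coordinatewise, by testing on vectors with a single
  nonzero entry.\<close>

lemma adjoint_small_hat:
  fixes R :: "'k::finite \<Rightarrow> 'c::complex_banach \<Rightarrow> 'c"
  assumes R: "comm_ops UNIV norm R" and surj: "M_sum UNIV 1 R \<noteq> UNIV" and e: "0 < e"
  obtains x\<^sub>0 and \<psi> :: "'c \<Rightarrow> complex" where "norm x\<^sub>0 = 1" "\<psi> x\<^sub>0 = 1" "bclin \<psi>"
    "\<And>x. cmod (\<psi> x) \<le> 2 * norm x" "\<And>i v. cmod (\<psi> (R i v)) \<le> e * norm v"
proof -
  have M: "M_sum UNIV 1 R = hat R ` UNIV"
    using M_sum_eq[OF norm_on_norm R, of 1] by simp
  then obtain y where y: "y \<notin> hat R ` UNIV"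
    using surj by blast
  have BX: "banach_on (UNIV :: ('k \<Rightarrow> 'c) set) (pn UNIV norm)"
    using banach_on_PiC[OF banach_on_norm finite, of UNIV] by simp
  have f: "blin UNIV (pn UNIV norm) UNIV norm (hat R)"
    using blin_hat[OF norm_on_norm R] by simp
  obtain x\<^sub>0 and \<psi> :: "'c \<Rightarrow> complex" where x0: "x\<^sub>0 \<in> UNIV" "norm x\<^sub>0 = 1" "\<psi> x\<^sub>0 = 1" "bclin \<psi>"
    and psi: "\<And>x. x \<in> UNIV \<Longrightarrow> cmod (\<psi> x) \<le> 2 * norm x"
    and small: "\<And>v. v \<in> UNIV \<Longrightarrow> cmod (\<psi> (hat R v)) \<le> e * pn UNIV norm v"
    by (rule adjoint_small[OF BX banach_on_norm f UNIV_I y e]) (rule that)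
  show ?thesis
  proof (rule that[OF x0(2-4)])
    show "cmod (\<psi> x) \<le> 2 * norm x" for x
      using psi by simp
    fix i :: 'k and v :: 'c
    let ?v = "\<lambda>j. if j = i then v else 0"
    have "R j (?v j) = (if j = i then R i v else 0)" for j
      using blin_zero[OF norm_on_norm comm_ops_blin[OF norm_on_norm R]] by simp
    then have "hat R ?v = R i v"
      by (simp add: hat_def)
    moreover have "pn UNIV norm ?v = norm v"
      by (simp add: pn_def if_distrib[of norm] cong: if_cong)
    ultimately show "cmod (\<psi> (R i v)) \<le> e * norm v"
      using small[of ?v] by simp
  qed
qed

text \<open>Dual to \<open>codim_le_S\<close>: a functional \<psi> that nearly annihilates the
  ranges of the \<open>S i\<close> is applied, after evaluation at \<open>z\<close>, to the solution
  for \<open>rank_one x\<^sub>0 \<phi>\<close>, where \<phi> norms \<open>z\<close>. This controls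
  \<open>norm z\<close> by the \<open>T j z\<close> and by the functionals
  \<open>\<psi> (b z)\<close>, one for each element of \<open>B\<close>.\<close>

lemma upper_T:
  assumes c: "codim_le J (M_sum J 1 (left_right_mult S T)) r" and n: "M_sum UNIV 1 S \<noteq> UNIV"
  shows "upper_semi_Fredholm UNIV norm T \<and> fdim_le (null_tilde UNIV T) r"
proof -
  obtain B K where B: "finite B" "card B \<le> r" "B \<subseteq> J" and K: "K > 0"
    and solve: "\<And>y. y \<in> J \<Longrightarrow> \<exists>w c. (\<forall>i. w i \<in> J) \<and> y = hat (left_right_mult S T) w + (\<Sum>b\<in>B. scaleC (c b) b) \<and>
      (\<Sum>i\<in>UNIV. \<alpha> (w i)) \<le> K * \<alpha> y \<and> (\<Sum>b\<in>B. cmod (c b)) \<le> K * \<alpha> y"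
    by (rule hat_open_modulo[OF ideal_banach[OF J] ideal_comm_ops c]) (rule that)
  define e where "e = 1 / (2 * K)"
  have e: "e > 0"
    using K by (simp add: e_def)
  obtain x\<^sub>0 and \<psi> :: "'a \<Rightarrow> complex" where x0: "norm x\<^sub>0 = 1" "\<psi> x\<^sub>0 = 1" and psi: "bclin \<psi>"
    "\<And>x. cmod (\<psi> x) \<le> 2 * norm x" "\<And>i v. cmod (\<psi> (S i v)) \<le> e * norm v"
    by (rule adjoint_small_hat[OF S n e]) (rule that)
  obtain \<beta> where \<beta>: "bij_betw \<beta> {0..<card B} B"
    using ex_bij_betw_nat_finite[OF B(1)] by blast
  \<comment> \<open>\<open>K\<close> bounds the coefficients \<open>c b\<close>, and the 2 makes up
    for moving half of \<open>norm z\<close> to the other side.\<close>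
  define g where "g l z = scaleC (of_real (2 * K)) (\<psi> (\<beta> l z))" for l z
  have "upper_semi_Fredholm UNIV norm T \<and> fdim_le (null_tilde UNIV T) (card B)"
  proof (rule upper_semi_Fredholm_if_estimate[OF banach_on_norm T, where g = g and K = "4 * K"])
    fix l assume "l < card B"
    then have "\<beta> l \<in> J"
      using bij_betwE[OF \<beta>] B(3) by auto
    then show "bclin (g l)"
      unfolding g_def using blin_scale_map[OF blin_comp[OF ideal_bclin[OF J] psi(1) norm_on_norm] norm_on_norm]
      by blast
  next
    fix z
    obtain \<phi> :: "'b \<Rightarrow> complex" where \<phi>: "bclin \<phi>" "\<And>y. cmod (\<phi> y) \<le> norm y" "\<phi> z = of_real (norm z)"
      using norming_functional_UNIV[of z] by blast
    let ?A = "rank_one x\<^sub>0 \<phi>"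
    have A: "?A \<in> J" "\<alpha> ?A \<le> 1"
      using ideal_rank_one(1)[OF J \<phi>(1)] ideal_rank_one_le[OF J \<phi>(1), of 1 x\<^sub>0] \<phi>(2) x0(1) by auto
    obtain w c where w: "\<And>i. w i \<in> J" and Aw: "?A = hat (left_right_mult S T) w + (\<Sum>b\<in>B. scaleC (c b) b)"
      and wA: "(\<Sum>i\<in>UNIV. \<alpha> (w i)) \<le> K * \<alpha> ?A" and cA: "(\<Sum>b\<in>B. cmod (c b)) \<le> K * \<alpha> ?A"
      using solve[OF A(1)] by blast
    have KA: "K * \<alpha> ?A \<le> K"
      using K mult_left_mono[OF A(2), of K] by simp
    have wK: "(\<Sum>i\<in>UNIV. \<alpha> (w i)) \<le> K" and cK: "(\<Sum>b\<in>B. cmod (c b)) \<le> K"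
      using order_trans[OF wA KA] order_trans[OF cA KA] .
    have nn: "0 \<le> \<alpha> (w i)" for i
      by (rule norm_on_nonneg[OF ideal_norm_on[OF J] w])
    have wi: "\<alpha> (w i) \<le> K" for i
      using member_le_sum[of i UNIV "\<lambda>i. \<alpha> (w i)"] nn wK by simp
    have ci: "cmod (c b) \<le> K" if "b \<in> B" for b
      using member_le_sum[of b B "\<lambda>b. cmod (c b)"] that B(1) cK by simp
    have nr: "0 \<le> (\<Sum>j\<in>UNIV. \<alpha> (w (Inr j)))"
      by (intro sum_nonneg nn)
    have wl: "(\<Sum>i\<in>UNIV. \<alpha> (w (Inl i))) \<le> K"
      using wK nr unfolding sum_UNIV_sum by linarith
    have add: "\<psi> (x + y) = \<psi> x + \<psi> y" for x y
      by (rule blin_add[OF psi(1)]) auto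
    have sum: "\<psi> (sum f A) = (\<Sum>i\<in>A. \<psi> (f i))" for f and A :: "'z set"
      by (rule blin_sum[OF norm_on_norm psi(1)]) simp
    have "of_real (norm z) = \<psi> (?A z)"
      using \<phi>(3) x0(2) blin_scale[OF psi(1), of x\<^sub>0] by (simp add: rank_one_def scaleC_complex_def)
    also have "?A z = (\<Sum>i\<in>UNIV. S i (w (Inl i) z)) + (\<Sum>j\<in>UNIV. w (Inr j) (T j z)) + (\<Sum>b\<in>B. scaleC (c b) (b z))"
      unfolding Aw by (simp add: hat_left_right_mult_apply sum_fun_apply scaleC_fun_def)
    also have "\<psi> \<dots> = (\<Sum>i\<in>UNIV. \<psi> (S i (w (Inl i) z))) + (\<Sum>j\<in>UNIV. \<psi> (w (Inr j) (T j z)))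
        + (\<Sum>b\<in>B. c b * \<psi> (b z))"
      unfolding add blin_sum[OF norm_on_norm psi(1) UNIV_I] blin_scale[OF psi(1) UNIV_I] scaleC_complex_def ..
    finally have "norm z = cmod ((\<Sum>i\<in>UNIV. \<psi> (S i (w (Inl i) z))) + (\<Sum>j\<in>UNIV. \<psi> (w (Inr j) (T j z)))
        + (\<Sum>b\<in>B. c b * \<psi> (b z)))"
      by (metis abs_norm_cancel norm_of_real)
    also have "\<dots> \<le> cmod (\<Sum>i\<in>UNIV. \<psi> (S i (w (Inl i) z))) + cmod (\<Sum>j\<in>UNIV. \<psi> (w (Inr j) (T j z)))
        + cmod (\<Sum>b\<in>B. c b * \<psi> (b z))"
      by (intro norm_triangle_le add_right_mono norm_triangle_ineq)
    also have "cmod (\<Sum>i\<in>UNIV. \<psi> (S i (w (Inl i) z))) \<le> (\<Sum>i\<in>UNIV. e * (\<alpha> (w (Inl i)) * norm z))"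
    proof (rule sum_norm_le)
      fix i
      have "cmod (\<psi> (S i (w (Inl i) z))) \<le> e * norm (w (Inl i) z)"
        by (rule psi(3))
      also have "\<dots> \<le> e * (\<alpha> (w (Inl i)) * norm z)"
        using e by (intro mult_left_mono ideal_norm_le[OF J w]) auto
      finally show "cmod (\<psi> (S i (w (Inl i) z))) \<le> e * (\<alpha> (w (Inl i)) * norm z)" .
    qed
    also have "\<dots> = (\<Sum>i\<in>UNIV. \<alpha> (w (Inl i))) * (e * norm z)"
      by (simp add: sum_distrib_right sum_distrib_left mult_ac)
    also have "\<dots> \<le> K * (e * norm z)"
      using wl e by (intro mult_right_mono) auto
    also have "\<dots> = 1 / 2 * norm z"
      using K by (simp add: e_def)
    also have "cmod (\<Sum>j\<in>UNIV. \<psi> (w (Inr j) (T j z))) \<le> (\<Sum>j\<in>UNIV. 2 * K * norm (T j z))"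
    proof (rule sum_norm_le)
      fix j
      have "cmod (\<psi> (w (Inr j) (T j z))) \<le> 2 * \<alpha> (w (Inr j)) * norm (T j z)"
        by (rule norming_apply[OF w psi(2)])
      also have "\<dots> \<le> 2 * K * norm (T j z)"
        using wi by (intro mult_right_mono) auto
      finally show "cmod (\<psi> (w (Inr j) (T j z))) \<le> 2 * K * norm (T j z)" .
    qed
    also have "\<dots> = 2 * K * pn UNIV norm (tilde T z)"
      by (simp add: pn_tilde sum_distrib_left)
    also have "cmod (\<Sum>b\<in>B. c b * \<psi> (b z)) \<le> (\<Sum>b\<in>B. K * cmod (\<psi> (b z)))"
      using ci by (intro sum_norm_le) (auto simp: norm_mult intro: mult_right_mono)
    also have "\<dots> = (\<Sum>l\<in>{0..<card B}. K * cmod (\<psi> (\<beta> l z)))"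
      by (rule sum.reindex_bij_betw[OF \<beta>, symmetric])
    finally have "1 / 2 * norm z \<le> 2 * K * pn UNIV norm (tilde T z) + (\<Sum>l\<in>{0..<card B}. K * cmod (\<psi> (\<beta> l z)))"
      by simp
    then have "norm z \<le> 4 * K * pn UNIV norm (tilde T z) + 2 * (\<Sum>l\<in>{0..<card B}. K * cmod (\<psi> (\<beta> l z)))"
      by simp
    also have "2 * (\<Sum>l\<in>{0..<card B}. K * cmod (\<psi> (\<beta> l z))) = (\<Sum>l<card B. cmod (g l z))"
      using K by (simp add: g_def scaleC_complex_def norm_mult sum_distrib_left mult_ac atLeast0LessThan)
    finally show "norm z \<le> 4 * K * pn UNIV norm (tilde T z) + (\<Sum>l<card B. cmod (g l z))" .
  qed
  then show ?thesis
    using B(2) unfolding fdim_le_def by (meson order_trans)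
qed

text \<open>The estimate on \<open>J\<close> is tested on \<open>rank_one y \<psi>\<close> with
  \<psi> nearly annihilating the ranges of the \<open>T j\<close>, so that the right multiplications
  contribute little. Since \<open>\<psi> x\<^sub>0 = 1\<close>, evaluation at
  \<open>x\<^sub>0\<close> recovers \<open>norm y\<close>.\<close>

lemma upper_S:
  assumes est: "lower_estimate J \<alpha> (left_right_mult S T)" and d: "fdim_le (null_tilde J (left_right_mult S T)) r" and n: "M_sum UNIV 1 T \<noteq> UNIV"
  shows "upper_semi_Fredholm UNIV norm S \<and> fdim_le (null_tilde UNIV S) r"
proof -
  obtain K and h :: "nat \<Rightarrow> ('b \<Rightarrow> 'a) \<Rightarrow> complex" where K: "K > 0"
    and h: "\<And>l. l < r \<Longrightarrow> blin J \<alpha> UNIV norm (h l)"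
    and Kh: "\<And>A. A \<in> J \<Longrightarrow> \<alpha> A \<le> K * ((\<Sum>i\<in>UNIV. \<alpha> (left_right_mult S T i A)) + (\<Sum>l<r. cmod (h l A)))"
    by (rule lower_estimate_functionals[OF ideal_banach[OF J] ideal_comm_ops est d]) (rule that)
  \<comment> \<open>Divided by the number of right multiplications, whose total contribution is then
    at most half of \<open>norm y\<close>.\<close>
  define e where "e = 1 / (2 * K * CARD('m))"
  have e: "e > 0"
    using K by (simp add: e_def)
  obtain x\<^sub>0 and \<psi> :: "'b \<Rightarrow> complex" where x0: "norm x\<^sub>0 = 1" "\<psi> x\<^sub>0 = 1" and psi: "bclin \<psi>"
    "\<And>x. cmod (\<psi> x) \<le> 2 * norm x" "\<And>i v. cmod (\<psi> (T i v)) \<le> e * norm v"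
    by (rule adjoint_small_hat[OF T n e]) (rule that)
  have R: "blin UNIV norm J \<alpha> (\<lambda>y. rank_one y \<psi>)"
  proof (rule blinI[where K = 2])
    show "\<alpha> (rank_one y \<psi>) \<le> 2 * norm y" for y
      using ideal_rank_one_le[OF J psi(1) _ psi(2), of y] by simp
    show "rank_one y \<psi> \<in> J" for y
      by (rule ideal_rank_one(1)[OF J psi(1)])
  qed (auto simp: rank_one_def fun_eq_iff scaleC_add_right scaleC_fun_def
      scaleC_scaleC mult.commute)
  define g where "g l y = scaleC (of_real (2 * K)) (h l (rank_one y \<psi>))" for l y
  show ?thesis
  proof (rule upper_semi_Fredholm_if_estimate[OF banach_on_norm S, where g = g and K = "4 * K"])
    show "bclin (g l)" if "l < r" for l
      unfolding g_def
      by (rule blin_scale_map[OF blin_comp[OF R h[OF that] ideal_norm_on[OF J]] norm_on_norm])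
    fix y
    have psiT: "bclin (\<psi> \<circ> T j)" for j
      using blin_comp[OF T_bclin psi(1) norm_on_norm] by (simp add: o_def)
    have Rj: "rank_one y \<psi> \<in> J"
      by (rule ideal_rank_one(1)[OF J psi(1)])
    have "norm y = norm (rank_one y \<psi> x\<^sub>0)"
      using x0(2) by (simp add: rank_one_def scaleC_one)
    also have "\<dots> \<le> \<alpha> (rank_one y \<psi>)"
      using ideal_norm_le[OF J Rj, of x\<^sub>0] x0(1) by simp
    also have "\<dots> \<le> K * ((\<Sum>i\<in>UNIV. \<alpha> (rank_one (S i y) \<psi>)) + (\<Sum>j\<in>UNIV. \<alpha> (rank_one y (\<psi> \<circ> T j)))
        + (\<Sum>l<r. cmod (h l (rank_one y \<psi>))))"
      using Kh[OF Rj] unfolding sum_left_right_mult_rank_one .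
    also have "\<dots> \<le> K * ((\<Sum>i\<in>UNIV. norm (S i y) * 2) + (\<Sum>j\<in>(UNIV :: 'm set). norm y * e)
        + (\<Sum>l<r. cmod (h l (rank_one y \<psi>))))"
      using K e psi(2,3)
      by (intro mult_left_mono add_mono sum_mono order_refl ideal_rank_one_le[OF J psi(1)]
          ideal_rank_one_le[OF J psiT]) auto
    also have "\<dots> = 2 * K * pn UNIV norm (tilde S y) + 1 / 2 * norm y + K * (\<Sum>l<r. cmod (h l (rank_one y \<psi>)))"
      using K by (simp add: pn_tilde e_def sum_distrib_right[symmetric] field_simps)
        (simp add: sum_distrib_left)
    finally have "norm y \<le> 4 * K * pn UNIV norm (tilde S y) + 2 * K * (\<Sum>l<r. cmod (h l (rank_one y \<psi>)))"
      by simp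
    also have "2 * K * (\<Sum>l<r. cmod (h l (rank_one y \<psi>))) = (\<Sum>l<r. cmod (g l y))"
      using K by (simp add: g_def scaleC_complex_def norm_mult sum_distrib_left mult_ac)
    finally show "norm y \<le> 4 * K * pn UNIV norm (tilde S y) + (\<Sum>l<r. cmod (g l y))" .
  qed
qed

text \<open>Here the estimate on \<open>J\<close> yields one for the adjoint tuple on the dual of \<open>X\<^sub>2\<close>, with functionals
  that need not be weak-star continuous; dropping a precompact term replaces them by evaluations
  at finitely many points, which span a complement of the range.\<close>

lemma codim_le_T:
  assumes est: "lower_estimate J \<alpha> (left_right_mult S T)" and d: "fdim_le (null_tilde J (left_right_mult S T)) r" and n: "approx_null S"
  shows "codim_le UNIV (M_sum UNIV 1 T) r"
proof -
  obtain K and h :: "nat \<Rightarrow> ('b \<Rightarrow> 'a) \<Rightarrow> complex" where K: "K > 0"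
    and h: "\<And>l. l < r \<Longrightarrow> blin J \<alpha> UNIV norm (h l)"
    and Kh: "\<And>A. A \<in> J \<Longrightarrow> \<alpha> A \<le> K * ((\<Sum>i\<in>UNIV. \<alpha> (left_right_mult S T i A)) + (\<Sum>l<r. cmod (h l A)))"
    by (rule lower_estimate_functionals[OF ideal_banach[OF J] ideal_comm_ops est d]) (rule that)
  \<comment> \<open>Here the left multiplications are the small terms, and \<open>CARD('n)\<close>
    is their number.\<close>
  define e where "e = 1 / (2 * K * CARD('n))"
  have e: "e > 0"
    using K by (simp add: e_def)
  then obtain y where y: "norm y = 1" "\<And>i. norm (S i y) \<le> e"
    using n unfolding approx_null_def by blast
  let ?T' = "\<lambda>j \<phi>. \<phi> \<circ> T j :: 'b \<Rightarrow> complex"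
  note T' = comm_ops_dual[OF T]
  have bc: "bclin \<phi>" if "\<phi> \<in> dual" for \<phi> :: "'b \<Rightarrow> complex"
    using that by (simp add: dual_def)
  have on: "0 \<le> onorm \<phi>" if "\<phi> \<in> dual" for \<phi> :: "'b \<Rightarrow> complex"
    by (rule norm_on_nonneg[OF norm_on_dual that])
  have R: "blin dual onorm J \<alpha> (rank_one y)"
  proof (rule blinI[where K = 1])
    show "\<alpha> (rank_one y \<phi>) \<le> 1 * onorm \<phi>" if "\<phi> \<in> dual" for \<phi> :: "'b \<Rightarrow> complex"
      using ideal_rank_one(2)[OF J bc[OF that], of y] y(1) by simp
    show "rank_one y \<phi> \<in> J" if "\<phi> \<in> dual" for \<phi>
      by (rule ideal_rank_one(1)[OF J bc[OF that]])
  qed (auto simp: rank_one_def fun_eq_iff scaleC_add_left scaleC_fun_def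
      scaleC_scaleC scaleC_complex_def)
  define g where "g l \<phi> = scaleC (of_real (2 * K)) (h l (rank_one y \<phi>))" for l \<phi>
  have g: "blin dual onorm UNIV norm (g l)" if "l < r" for l
    unfolding g_def
    by (rule blin_scale_map[OF blin_comp[OF R h[OF that] ideal_norm_on[OF J]] norm_on_norm])
  have est': "onorm \<phi> \<le> 2 * K * pn UNIV onorm (tilde ?T' \<phi>) + (\<Sum>l<r. cmod (g l \<phi>))"
    if \<phi>: "\<phi> \<in> dual" for \<phi> :: "'b \<Rightarrow> complex"
  proof -
    have \<phi>T: "\<phi> \<circ> T j \<in> dual" for j
      by (rule blin_mem[OF comm_ops_blin[OF norm_on_dual T'] \<phi>])
    have "onorm \<phi> = \<alpha> (rank_one y \<phi>)"
      using ideal_rank_one(2)[OF J bc[OF \<phi>], of y] y(1) by simp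
    also have "\<dots> \<le> K * ((\<Sum>i\<in>UNIV. \<alpha> (rank_one (S i y) \<phi>)) + (\<Sum>j\<in>UNIV. \<alpha> (rank_one y (\<phi> \<circ> T j)))
        + (\<Sum>l<r. cmod (h l (rank_one y \<phi>))))"
      using Kh[OF ideal_rank_one(1)[OF J bc[OF \<phi>]], of y] unfolding sum_left_right_mult_rank_one .
    also have "(\<Sum>j\<in>UNIV. \<alpha> (rank_one y (\<phi> \<circ> T j))) = pn UNIV onorm (tilde ?T' \<phi>)"
      using ideal_rank_one(2)[OF J bc[OF \<phi>T], of y] y(1) by (simp add: pn_tilde)
    also have "K * ((\<Sum>i\<in>UNIV. \<alpha> (rank_one (S i y) \<phi>)) + pn UNIV onorm (tilde ?T' \<phi>)
        + (\<Sum>l<r. cmod (h l (rank_one y \<phi>)))) \<le>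
        K * ((\<Sum>i\<in>(UNIV :: 'n set). e * onorm \<phi>) + pn UNIV onorm (tilde ?T' \<phi>)
        + (\<Sum>l<r. cmod (h l (rank_one y \<phi>))))"
    proof (intro mult_left_mono add_mono sum_mono order_refl)
      show "\<alpha> (rank_one (S i y) \<phi>) \<le> e * onorm \<phi>" for i
        unfolding ideal_rank_one(2)[OF J bc[OF \<phi>]] by (rule mult_right_mono[OF y(2) on[OF \<phi>]])
    qed (use K in simp)
    also have "\<dots> = 1 / 2 * onorm \<phi> + K * pn UNIV onorm (tilde ?T' \<phi>)
        + K * (\<Sum>l<r. cmod (h l (rank_one y \<phi>)))"
      using K by (simp add: e_def field_simps)
    finally have "onorm \<phi> \<le> 2 * K * pn UNIV onorm (tilde ?T' \<phi>) + 2 * K * (\<Sum>l<r. cmod (h l (rank_one y \<phi>)))"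
      by simp
    also have "2 * K * (\<Sum>l<r. cmod (h l (rank_one y \<phi>))) = (\<Sum>l<r. cmod (g l \<phi>))"
      using K by (simp add: g_def scaleC_complex_def norm_mult sum_distrib_left mult_ac)
    finally show ?thesis .
  qed
  \<comment> \<open>The functionals \<open>g l\<close> bound the dimension of the kernel of the
    adjoint tuple by \<open>r\<close>, so at most \<open>r\<close> points suffice to separate
    it.\<close>
  have "fdim_le (null_tilde dual ?T') r"
    using upper_semi_Fredholm_if_estimate[OF banach_on_dual T' g est'] by blast
  from separating_points[OF csubspace_null_tilde[OF norm_on_dual T'] this]
  obtain E where E: "finite E" "card E \<le> r"
    "\<And>\<phi>. \<phi> \<in> null_tilde dual ?T' \<Longrightarrow> (\<forall>x\<in>E. \<phi> x = 0) \<Longrightarrow> \<phi> = 0"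
    by blast
  have ev: "blin dual onorm UNIV norm (\<lambda>\<phi> :: 'b \<Rightarrow> complex. \<phi> x)" for x
    by (rule blinI[where K = "norm x"])
      (use dual_bound in \<open>auto simp: scaleC_fun_def mult.commute\<close>)
  have "\<exists>K'>0. \<forall>\<phi>\<in>dual. onorm \<phi> \<le> K' * (pn UNIV onorm (tilde ?T' \<phi>) + (\<Sum>x\<in>E. cmod (\<phi> x)))"
  proof (rule tilde_estimate_functionals[OF banach_on_dual T' _ est' E(1), where h = "\<lambda>x \<phi>. \<phi> x"])
    show "precompact_on dual onorm (\<lambda>\<phi>. \<Sum>l<r. cmod (g l \<phi>))"
      by (rule precompact_on_sum[OF precompact_on_functional[OF norm_on_dual g]]) simp
    show "blin dual onorm UNIV norm (\<lambda>\<phi> :: 'b \<Rightarrow> complex. \<phi> x)" for x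
      by (rule ev)
    show "\<phi> = 0" if "\<phi> \<in> null_tilde dual ?T'" "\<And>x. x \<in> E \<Longrightarrow> \<phi> x = 0" for \<phi>
      using E(3)[OF that(1)] that(2) by blast
  qed
  then obtain K' where K': "K' > 0" "\<And>\<phi> :: 'b \<Rightarrow> complex. \<phi> \<in> dual \<Longrightarrow>
      onorm \<phi> \<le> K' * (pn UNIV onorm (tilde ?T' \<phi>) + (\<Sum>x\<in>E. cmod (\<phi> x)))"
    by blast
  note ext = banach_on_ext[OF T E(1)] blin_ext_hat[OF T E(1), where p = "\<lambda>x. x"]
  show ?thesis
  proof (rule codim_le_if_ext_hat_surj[OF T E(1) _ E(2), where p = "\<lambda>x. x"])
    fix y\<^sub>0
    show "y\<^sub>0 \<in> ext_hat T E (\<lambda>x. x) ` ext_space E"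
    proof (rule ccontr)
      assume nsurj: "y\<^sub>0 \<notin> ext_hat T E (\<lambda>x. x) ` ext_space E"
      \<comment> \<open>When every adjoint value and every evaluation at \<open>E\<close> is at most
        \<epsilon>, the lower estimate bounds \<open>onorm \<psi>\<close> by \<open>1 / 2\<close>,
        although \<open>\<psi> x\<^sub>0 = 1\<close> at a unit vector.\<close>
      define \<epsilon> where "\<epsilon> = 1 / (2 * K' * (CARD('m) + card E))"
      have pos: "0 < real CARD('m) + real (card E)"
        by (simp add: add_pos_nonneg)
      have \<epsilon>: "\<epsilon> > 0"
        unfolding \<epsilon>_def using K'(1) pos by simp
      obtain x\<^sub>0 and \<psi> :: "'b \<Rightarrow> complex" where x0: "x\<^sub>0 \<in> UNIV" "norm x\<^sub>0 = 1" "\<psi> x\<^sub>0 = 1" and psi: "bclin \<psi>"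
        "\<And>x. x \<in> UNIV \<Longrightarrow> cmod (\<psi> x) \<le> 2 * norm x"
        "\<And>v. v \<in> ext_space E \<Longrightarrow> cmod (\<psi> (ext_hat T E (\<lambda>x. x) v)) \<le> \<epsilon> * ext_norm E v"
        by (rule adjoint_small[OF ext(1) banach_on_norm ext(2) UNIV_I nsurj \<epsilon>]) (rule that)
      have \<psi>: "\<psi> \<in> dual"
        using psi(1) by (simp add: dual_def)
      have T0: "T j 0 = 0" for j
        by (rule blin_zero[OF norm_on_norm T_bclin])
      have 1: "onorm (\<psi> \<circ> T j) \<le> \<epsilon>" for j
      proof (rule onorm_bound)
        fix v
        let ?v = "(\<lambda>i. if i = j then v else 0, \<lambda>_. 0) :: ('m \<Rightarrow> 'b) \<times> ('b \<Rightarrow> complex)"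
        have "hat T (fst ?v) = (\<Sum>i\<in>UNIV. if i = j then T j v else 0)"
          unfolding hat_def by (intro sum.cong) (auto simp: T0)
        then have "ext_hat T E (\<lambda>x. x) ?v = T j v"
          by (simp add: ext_hat_def)
        moreover have "ext_norm E ?v = norm v"
          by (simp add: ext_norm_def pn_def if_distrib[of norm] cong: if_cong)
        moreover have "?v \<in> ext_space E"
          by (simp add: ext_space_def PiC_def)
        ultimately show "norm ((\<psi> \<circ> T j) v) \<le> \<epsilon> * norm v"
          using psi(3)[of ?v] by simp
      qed (use \<epsilon> in simp)
      have 2: "cmod (\<psi> x) \<le> \<epsilon>" if x: "x \<in> E" for x
      proof -
        let ?v = "(\<lambda>_. 0, \<lambda>b. if b = x then 1 else 0) :: ('m \<Rightarrow> 'b) \<times> ('b \<Rightarrow> complex)"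
        have "(\<Sum>b\<in>E. scaleC (snd ?v b) b) = (\<Sum>b\<in>E. if b = x then x else 0)"
          by (intro sum.cong) (auto simp: scaleC_one)
        then have "ext_hat T E (\<lambda>x. x) ?v = x"
          using x E(1) by (simp add: ext_hat_def hat_def T0)
        moreover have "ext_norm E ?v = 1"
          using x E(1) by (simp add: ext_norm_def pn_def if_distrib[of norm] cong: if_cong)
        moreover have "?v \<in> ext_space E"
          using x by (auto simp: ext_space_def PiC_def)
        ultimately show ?thesis
          using psi(3)[of ?v] by simp
      qed
      have "1 \<le> onorm \<psi>"
        using dual_bound[OF \<psi>, of x\<^sub>0] x0(2,3) by simp
      also have "\<dots> \<le> K' * (pn UNIV onorm (tilde ?T' \<psi>) + (\<Sum>x\<in>E. cmod (\<psi> x)))"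
        by (rule K'(2)[OF \<psi>])
      also have "\<dots> \<le> K' * ((\<Sum>j\<in>(UNIV :: 'm set). \<epsilon>) + (\<Sum>x\<in>E. \<epsilon>))"
        unfolding pn_tilde using K'(1) 1 2 by (intro mult_left_mono add_mono sum_mono) auto
      also have "\<dots> = K' * (\<epsilon> * (real CARD('m) + real (card E)))"
        by (simp add: algebra_simps)
      also have "\<dots> = 1 / 2"
        using K'(1) pos by (simp add: \<epsilon>_def)
      finally show False
        by simp
    qed
  qed
qed

end

section \<open>Inverses of the multiplication tuple\<close>

text \<open>\<open>right_inv_mod\<close> with the rank of the residual bounded by \<open>r\<close>,
  the quantity that must stay bounded along the powers.\<close>

definition right_data :: "'a::complex_vector set \<Rightarrow> ('a \<Rightarrow> real) \<Rightarrow> ('i::finite \<Rightarrow> 'a \<Rightarrow> 'a) \<Rightarrow> nat \<Rightarrow> bool"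
  where "right_data V N T r \<longleftrightarrow> (\<exists>C B. (\<forall>i. blin V N V N (C i)) \<and> finite B \<and> B \<subseteq> V \<and> card B \<le> r \<and>
    (\<forall>y\<in>V. y - (\<Sum>i\<in>UNIV. T i (C i y)) \<in> cspan B))"

definition left_data :: "'a::complex_vector set \<Rightarrow> ('a \<Rightarrow> real) \<Rightarrow> ('i::finite \<Rightarrow> 'a \<Rightarrow> 'a) \<Rightarrow> nat \<Rightarrow> bool"
  where "left_data V N T r \<longleftrightarrow> (\<exists>D B. (\<forall>i. blin V N V N (D i)) \<and> finite B \<and> B \<subseteq> V \<and> card B \<le> r \<and>
    (\<forall>x\<in>V. x - (\<Sum>i\<in>UNIV. D i (T i x)) \<in> cspan B))"

lemma right_dataI:
  assumes "\<And>i. blin V N V N (C i)" "finite B" "B \<subseteq> V" "card B \<le> r"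
    "\<And>y. y \<in> V \<Longrightarrow> y - (\<Sum>i\<in>UNIV. T i (C i y)) \<in> cspan B"
  shows "right_data V N T r"
  unfolding right_data_def using assms by (intro exI[of _ C] exI[of _ B]) simp

lemma left_dataI:
  assumes "\<And>i. blin V N V N (D i)" "finite B" "B \<subseteq> V" "card B \<le> r"
    "\<And>x. x \<in> V \<Longrightarrow> x - (\<Sum>i\<in>UNIV. D i (T i x)) \<in> cspan B"
  shows "left_data V N T r"
  unfolding left_data_def using assms by (intro exI[of _ D] exI[of _ B]) simp

lemma right_dataE:
  assumes "right_data V N T r"
  obtains C B where "\<And>i. blin V N V N (C i)" "finite B" "B \<subseteq> V" "card B \<le> r"
    "\<And>y. y \<in> V \<Longrightarrow> y - (\<Sum>i\<in>UNIV. T i (C i y)) \<in> cspan B"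
proof -
  obtain C B where "(\<forall>i. blin V N V N (C i)) \<and> finite B \<and> B \<subseteq> V \<and> card B \<le> r \<and>
    (\<forall>y\<in>V. y - (\<Sum>i\<in>UNIV. T i (C i y)) \<in> cspan B)"
    using assms unfolding right_data_def by (elim exE)
  then show ?thesis
    by (intro that[of C B]) simp_all
qed

lemma left_dataE:
  assumes "left_data V N T r"
  obtains D B where "\<And>i. blin V N V N (D i)" "finite B" "B \<subseteq> V" "card B \<le> r"
    "\<And>x. x \<in> V \<Longrightarrow> x - (\<Sum>i\<in>UNIV. D i (T i x)) \<in> cspan B"
proof -
  obtain D B where "(\<forall>i. blin V N V N (D i)) \<and> finite B \<and> B \<subseteq> V \<and> card B \<le> r \<and>
    (\<forall>x\<in>V. x - (\<Sum>i\<in>UNIV. D i (T i x)) \<in> cspan B)"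
    using assms unfolding left_data_def by (elim exE)
  then show ?thesis
    by (intro that[of D B]) simp_all
qed

section \<open>Split Browder conditions in terms of inverses of all powers\<close>

lemma M_sum_powt: "M_sum V 1 (powt T k) = M_sum V k T"
  by (simp add: M_sum_def powt_def)

context
  fixes V :: "'a::complex_vector set" and N and T :: "'i::finite \<Rightarrow> 'a \<Rightarrow> 'a"
  assumes V: "banach_on V N" and T: "comm_ops V N T"
begin

text \<open>A right inverse of each power comes from the first power by composition. The rank bound
  is obtained afterwards from the codimension and hence does not depend on \<open>k\<close>.\<close>

lemma right_data_powt:
  assumes c: "\<And>k. 1 \<le> k \<Longrightarrow> codim_le V (M_sum V k T) s"
    and comp: "has_direct_complement (power_topology V N) (null_hat V T)" and k: "1 \<le> k"
  shows "right_data V N (powt T k) s"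
proof -
  note N = banach_on_norm_on[OF V]
  have "right_inv_mod V N (powt T k)"
    by (rule right_inv_mod_pow[OF N T right_inv_mod_if_split[OF V T c[OF order_refl] comp] k])
  moreover have "codim_le V (M_sum V 1 (powt T k)) s"
    using c[OF k] unfolding M_sum_powt .
  ultimately show ?thesis
    unfolding right_data_def by (rule right_inverse_codim[OF N comm_ops_powt[OF N T]])
qed

lemma left_data_powt:
  assumes d: "\<And>k. 1 \<le> k \<Longrightarrow> fdim_le (null_tilde V (powt T k)) s"
    and F: "closedin (power_topology V N) (range_tilde V T)"
    and comp: "has_direct_complement (power_topology V N) (range_tilde V T)" and k: "1 \<le> k"
  shows "left_data V N (powt T k) s"
proof -
  note N = banach_on_norm_on[OF V]
  have "fdim_le (null_tilde V T) s"
    using d[of 1] by simp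
  then have "upper_semi_Fredholm V N T"
    using F unfolding upper_semi_Fredholm_def cdim_finite_iff_fdim_le by blast
  then have "left_inv_mod V N (powt T k)"
    by (intro left_inv_mod_pow[OF N T _ k] left_inv_mod_if_split[OF V T _ comp])
  then show ?thesis
    unfolding left_data_def by (rule left_inverse_dim[OF N comm_ops_powt[OF N T] _ d[OF k]])
qed

text \<open>The ranks bound the codimensions at all powers, which settles \<open>R_infty\<close>;
  the complement comes from the inverse at the first power.\<close>

lemma lower_split_if_right_data:
  assumes "\<And>k. 1 \<le> k \<Longrightarrow> right_data V N (powt T k) r"
  shows "codim V (R_infty V T) < \<infinity>"
    and "has_direct_complement (power_topology V N) (null_hat V T)"
proof -
  note N = banach_on_norm_on[OF V]
  have "codim_le V (M_sum V k T) r" if k: "1 \<le> k" for k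
  proof -
    obtain C B where C: "\<And>i. blin V N V N (C i)" "finite B" "B \<subseteq> V" "card B \<le> r"
      "\<And>y. y \<in> V \<Longrightarrow> y - (\<Sum>i\<in>UNIV. powt T k i (C i y)) \<in> cspan B"
      by (rule right_dataE[OF assms[OF k]]) (rule that)
    have "codim_le V (M_sum V 1 (powt T k)) r"
      by (rule codim_le_if_right_inverse[OF N comm_ops_powt[OF N T] C])
    then show ?thesis
      unfolding M_sum_powt .
  qed
  then show "codim V (R_infty V T) < \<infinity>"
    unfolding codim_R_infty_iff[OF N T] by blast
  have "right_data V N T r"
    using assms[of 1] by simp
  then obtain C B where C: "\<And>i. blin V N V N (C i)" "finite B" "B \<subseteq> V" "card B \<le> r"
    "\<And>y. y \<in> V \<Longrightarrow> y - (\<Sum>i\<in>UNIV. T i (C i y)) \<in> cspan B"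
    by (rule right_dataE) (rule that)
  show "has_direct_complement (power_topology V N) (null_hat V T)"
    by (rule null_hat_complement[OF N T right_inv_modI[OF C(1-3,5)]])
qed

lemma upper_split_if_left_data:
  assumes "\<And>k. 1 \<le> k \<Longrightarrow> left_data V N (powt T k) r"
  shows "upper_semi_Browder V N T"
    and "has_direct_complement (power_topology V N) (range_tilde V T)"
proof -
  note N = banach_on_norm_on[OF V]
  have d: "fdim_le (null_tilde V (powt T k)) r" if k: "1 \<le> k" for k
  proof -
    obtain D B where D: "\<And>i. blin V N V N (D i)" "finite B" "B \<subseteq> V" "card B \<le> r"
      "\<And>x. x \<in> V \<Longrightarrow> x - (\<Sum>i\<in>UNIV. D i (powt T k i x)) \<in> cspan B"
      by (rule left_dataE[OF assms[OF k]]) (rule that)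
    show ?thesis
      by (rule fdim_le_if_left_inverse[OF N D(1,2,4,5)])
  qed
  have "left_data V N T r"
    using assms[of 1] by simp
  then obtain D B where D: "\<And>i. blin V N V N (D i)" "finite B" "B \<subseteq> V" "card B \<le> r"
    "\<And>x. x \<in> V \<Longrightarrow> x - (\<Sum>i\<in>UNIV. D i (T i x)) \<in> cspan B"
    by (rule left_dataE) (rule that)
  note R = range_tilde_complement[OF N T left_inv_modI[OF D(1-3,5)]]
  show "has_direct_complement (power_topology V N) (range_tilde V T)"
    by (rule R(2))
  have "cdim (N_infty V T) < \<infinity>"
    unfolding cdim_N_infty_iff[OF N T] using d by blast
  moreover have "fdim_le (null_tilde V T) r"
    using d[of 1] by simp
  ultimately show "upper_semi_Browder V N T"
    unfolding upper_semi_Browder_def upper_semi_Fredholm_def cdim_finite_iff_fdim_le[of "null_tilde V T"]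
    using R(1) by blast
qed

end

context
  fixes J :: "('b::complex_banach \<Rightarrow> 'a::complex_banach) set" and \<alpha>
    and S :: "'n::finite \<Rightarrow> 'a \<Rightarrow> 'a" and T :: "'m::finite \<Rightarrow> 'b \<Rightarrow> 'b"
  assumes J: "operator_ideal J \<alpha>" and S: "comm_ops UNIV norm S" and T: "comm_ops UNIV norm T"
begin

text \<open>Expansion in bases of the two finite-dimensional target spaces writes the sandwich as a
  combination of rank one operators that do not depend on \<open>A\<close>; only the coefficients
  \<open>h b (Q (A b'))\<close> do. There are at most \<open>s * t\<close> of these operators, and
  they lie in the ideal.\<close>

lemma finite_rank_sandwich:
  fixes Q :: "'a \<Rightarrow> 'a" and Q' :: "'b \<Rightarrow> 'b"
  assumes Q: "bclin Q" "\<And>y. Q y \<in> cspan B" "finite B" "card B \<le> s"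
    and Q': "bclin Q'" "\<And>x. Q' x \<in> cspan B'" "finite B'" "card B' \<le> t"
  obtains E where "finite E" "E \<subseteq> J" "card E \<le> s * t" "\<And>A. A \<in> J \<Longrightarrow> Q \<circ> A \<circ> Q' \<in> cspan E"
proof -
  obtain F where F: "finite F" "card F \<le> card B" "F \<subseteq> cspan B" "cvec.independent F" "cspan B = cspan F"
    by (rule finite_basis[OF order_refl Q(3) cvec.subspace_span]) (rule that)
  obtain F' where F': "finite F'" "card F' \<le> card B'" "F' \<subseteq> cspan B'" "cvec.independent F'" "cspan B' = cspan F'"
    by (rule finite_basis[OF order_refl Q'(3) cvec.subspace_span]) (rule that)
  from dual_basis[OF norm_on_norm F(1) subset_UNIV F(4)] obtain h where
    h: "\<And>b. b \<in> F \<Longrightarrow> bclin (h b :: 'a \<Rightarrow> complex)"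
      "\<And>b c. b \<in> F \<Longrightarrow> c \<in> F \<Longrightarrow> h b c = (if b = c then 1 else 0)"
    by blast
  from dual_basis[OF norm_on_norm F'(1) subset_UNIV F'(4)] obtain h' where
    h': "\<And>b. b \<in> F' \<Longrightarrow> bclin (h' b :: 'b \<Rightarrow> complex)"
      "\<And>b c. b \<in> F' \<Longrightarrow> c \<in> F' \<Longrightarrow> h' b c = (if b = c then 1 else 0)"
    by blast
  define R where "R p = rank_one (fst p) (\<lambda>x. h' (snd p) (Q' x))" for p :: "'a \<times> 'b"
  define E where "E = R ` (F \<times> F')"
  have exp: "Q y = (\<Sum>b\<in>F. scaleC (h b (Q y)) b)" for y
    using Q(2)[of y] F(5) by (intro dual_basis_expand[OF norm_on_norm F(1) subset_UNIV h, symmetric]) auto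
  have exp': "Q' x = (\<Sum>b\<in>F'. scaleC (h' b (Q' x)) b)" for x
    using Q'(2)[of x] F'(5) by (intro dual_basis_expand[OF norm_on_norm F'(1) subset_UNIV h', symmetric]) auto
  show ?thesis
  proof (rule that)
    show "finite E"
      unfolding E_def using F(1) F'(1) by simp
    show "E \<subseteq> J"
    proof
      fix A assume "A \<in> E"
      then obtain b b' where b: "b' \<in> F'" "A = rank_one b (\<lambda>x. h' b' (Q' x))"
        by (auto simp: E_def R_def)
      show "A \<in> J"
        unfolding b(2) by (rule ideal_rank_one(1)[OF J blin_comp[OF Q'(1) h'(1)[OF b(1)] norm_on_norm]])
    qed
    have "card E \<le> card (F \<times> F')"
      unfolding E_def by (rule card_image_le) (use F(1) F'(1) in simp)
    also have "\<dots> \<le> s * t"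
      unfolding card_cartesian_product
      using order_trans[OF F(2) Q(4)] order_trans[OF F'(2) Q'(4)] by (rule mult_le_mono)
    finally show "card E \<le> s * t" .
    fix A assume A: "A \<in> J"
    note QA = blin_comp[OF ideal_bclin[OF J A] Q(1) norm_on_norm]
    have "Q \<circ> A \<circ> Q' = (\<Sum>b'\<in>F'. \<Sum>b\<in>F. scaleC (h b (Q (A b'))) (R (b, b')))"
    proof
      fix x
      have "(Q \<circ> A \<circ> Q') x = Q (A (\<Sum>b'\<in>F'. scaleC (h' b' (Q' x)) b'))"
        using exp'[of x] by simp
      also have "\<dots> = (\<Sum>b'\<in>F'. Q (A (scaleC (h' b' (Q' x)) b')))"
        by (rule blin_sum[OF norm_on_norm QA]) simp
      also have "\<dots> = (\<Sum>b'\<in>F'. scaleC (h' b' (Q' x)) (Q (A b')))"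
        by (simp add: blin_scale[OF QA])
      also have "\<dots> = (\<Sum>b'\<in>F'. \<Sum>b\<in>F. scaleC (h b (Q (A b'))) (scaleC (h' b' (Q' x)) b))"
      proof (rule sum.cong[OF refl])
        fix b'
        have "scaleC (h' b' (Q' x)) (Q (A b')) =
            scaleC (h' b' (Q' x)) (\<Sum>b\<in>F. scaleC (h b (Q (A b'))) b)"
          using exp[of "A b'"] by simp
        then show "scaleC (h' b' (Q' x)) (Q (A b')) =
            (\<Sum>b\<in>F. scaleC (h b (Q (A b'))) (scaleC (h' b' (Q' x)) b))"
          by (simp add: cvec.scale_sum_right scaleC_scaleC mult.commute)
      qed
      finally show "(Q \<circ> A \<circ> Q') x = (\<Sum>b'\<in>F'. \<Sum>b\<in>F. scaleC (h b (Q (A b'))) (R (b, b'))) x"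
        by (simp add: sum_fun_apply scaleC_fun_def R_def rank_one_def)
    qed
    also have "\<dots> \<in> cspan E"
      unfolding E_def by (intro cvec.span_sum cvec.span_scale cvec.span_base imageI) simp
    finally show "Q \<circ> A \<circ> Q' \<in> cspan E" .
  qed
qed

lemma bclin_residual_right:
  assumes "\<And>i. bclin (C i)"
  shows "bclin (\<lambda>y. y - (\<Sum>i\<in>UNIV. S i (C i y)))" and "bclin (\<lambda>y. y - (\<Sum>i\<in>UNIV. C i (S i y)))"
  by (rule blin_diff_map[OF blin_id blin_sum_map[OF blin_comp[OF assms S_bclin[OF J S T] norm_on_norm] norm_on_norm] norm_on_norm]
      blin_diff_map[OF blin_id blin_sum_map[OF blin_comp[OF S_bclin[OF J S T] assms norm_on_norm] norm_on_norm] norm_on_norm])+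

lemma bclin_residual_left:
  assumes "\<And>i. bclin (D i)"
  shows "bclin (\<lambda>y. y - (\<Sum>i\<in>UNIV. T i (D i y)))" and "bclin (\<lambda>y. y - (\<Sum>i\<in>UNIV. D i (T i y)))"
  by (rule blin_diff_map[OF blin_id blin_sum_map[OF blin_comp[OF assms T_bclin[OF J S T] norm_on_norm] norm_on_norm] norm_on_norm]
      blin_diff_map[OF blin_id blin_sum_map[OF blin_comp[OF T_bclin[OF J S T] assms norm_on_norm] norm_on_norm] norm_on_norm])+

text \<open>With \<open>Q = 1 - \<Sum> S\<^sub>i C\<^sub>i\<close> and \<open>Q' = 1 - \<Sum> D\<^sub>j T\<^sub>j\<close>, the operators
  \<open>A \<mapsto> C\<^sub>i A\<close> and \<open>A \<mapsto> Q A D\<^sub>j\<close> invert the multiplication tuple up to \<open>A \<mapsto> Q A Q'\<close>.\<close>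

lemma right_data_left_right_mult:
  assumes C: "\<And>i. bclin (C i)" and D: "\<And>j. bclin (D j)"
    and E: "finite E" "E \<subseteq> J" "card E \<le> r"
    and QAQ: "\<And>A. A \<in> J \<Longrightarrow> (\<lambda>y. y - (\<Sum>i\<in>UNIV. S i (C i y))) \<circ> A \<circ>
      (\<lambda>x. x - (\<Sum>j\<in>UNIV. D j (T j x))) \<in> cspan E"
  shows "right_data J \<alpha> (left_right_mult S T) r"
proof (rule right_dataI[OF _ E])
  define Q where "Q y = y - (\<Sum>i\<in>UNIV. S i (C i y))" for y
  define Q' where "Q' x = x - (\<Sum>j\<in>UNIV. D j (T j x))" for x
  have Q: "bclin Q"
    unfolding Q_def by (rule bclin_residual_right(1)[OF C])
  let ?C = "case_sum (\<lambda>i A. C i \<circ> A) (\<lambda>j A. Q \<circ> A \<circ> D j)"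
  show "blin J \<alpha> J \<alpha> (?C i)" for i
    using blin_left_mult[OF J C] blin_comp[OF blin_left_mult[OF J Q] blin_right_mult[OF J D] ideal_norm_on[OF J]]
    by (cases i) simp_all
  fix A assume A: "A \<in> J"
  note QA = blin_comp[OF ideal_bclin[OF J A] Q norm_on_norm]
  have "A - (\<Sum>i\<in>UNIV. left_right_mult S T i (?C i A)) = Q \<circ> A \<circ> Q'"
  proof
    fix x
    have "(\<Sum>j\<in>UNIV. Q (A (D j (T j x)))) = Q (A (\<Sum>j\<in>UNIV. D j (T j x)))"
      by (rule blin_sum[OF norm_on_norm QA, symmetric]) simp
    also have "(\<Sum>j\<in>UNIV. D j (T j x)) = x - Q' x"
      by (simp add: Q'_def)
    also have "Q (A (x - Q' x)) = Q (A x) - Q (A (Q' x))"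
      by (rule blin_diff[OF norm_on_norm QA]) simp_all
    finally have "(\<Sum>j\<in>UNIV. Q (A (D j (T j x)))) = Q (A x) - Q (A (Q' x))" .
    moreover have "(\<Sum>i\<in>UNIV. S i (C i (A x))) = A x - Q (A x)"
      by (simp add: Q_def)
    ultimately show "(A - (\<Sum>i\<in>UNIV. left_right_mult S T i (?C i A))) x = (Q \<circ> A \<circ> Q') x"
      by (simp add: sum_UNIV_sum left_right_mult_def sum_fun_apply)
  qed
  then show "A - (\<Sum>i\<in>UNIV. left_right_mult S T i (?C i A)) \<in> cspan E"
    using QAQ[OF A] unfolding Q_def Q'_def by simp
qed

text \<open>Telescoping from the other side: \<open>A \<mapsto> D i \<circ> A \<circ> Q'\<close>
  applied to the left multiplications gives \<open>(1 - Q) A Q'\<close> in total, and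
  \<open>A \<mapsto> A \<circ> C j\<close> applied to the right ones gives
  \<open>A (1 - Q')\<close>. The sum is \<open>A - Q A Q'\<close>.\<close>

lemma left_data_left_right_mult:
  assumes D: "\<And>i. bclin (D i)" and C: "\<And>j. bclin (C j)"
    and E: "finite E" "E \<subseteq> J" "card E \<le> r"
    and QAQ: "\<And>A. A \<in> J \<Longrightarrow> (\<lambda>y. y - (\<Sum>i\<in>UNIV. D i (S i y))) \<circ> A \<circ>
      (\<lambda>x. x - (\<Sum>j\<in>UNIV. T j (C j x))) \<in> cspan E"
  shows "left_data J \<alpha> (left_right_mult S T) r"
proof (rule left_dataI[OF _ E])
  define Q where "Q y = y - (\<Sum>i\<in>UNIV. D i (S i y))" for y
  define Q' where "Q' x = x - (\<Sum>j\<in>UNIV. T j (C j x))" for x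
  have Q': "bclin Q'"
    unfolding Q'_def by (rule bclin_residual_left(1)[OF C])
  let ?D = "case_sum (\<lambda>i A. D i \<circ> A \<circ> Q') (\<lambda>j A. A \<circ> C j)"
  show "blin J \<alpha> J \<alpha> (?D i)" for i
    using blin_right_mult[OF J C] blin_comp[OF blin_left_mult[OF J D] blin_right_mult[OF J Q'] ideal_norm_on[OF J]]
    by (cases i) simp_all
  fix A assume A: "A \<in> J"
  note Ab = ideal_bclin[OF J A]
  have "A - (\<Sum>i\<in>UNIV. ?D i (left_right_mult S T i A)) = Q \<circ> A \<circ> Q'"
  proof
    fix x
    have "(\<Sum>j\<in>UNIV. A (T j (C j x))) = A (\<Sum>j\<in>UNIV. T j (C j x))"
      by (rule blin_sum[OF norm_on_norm Ab, symmetric]) simp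
    also have "(\<Sum>j\<in>UNIV. T j (C j x)) = x - Q' x"
      by (simp add: Q'_def)
    also have "A (x - Q' x) = A x - A (Q' x)"
      by (rule blin_diff[OF norm_on_norm Ab]) simp_all
    finally have "(\<Sum>j\<in>UNIV. A (T j (C j x))) = A x - A (Q' x)" .
    moreover have "(\<Sum>i\<in>UNIV. D i (S i (A (Q' x)))) = A (Q' x) - Q (A (Q' x))"
      by (simp add: Q_def)
    ultimately show "(A - (\<Sum>i\<in>UNIV. ?D i (left_right_mult S T i A))) x = (Q \<circ> A \<circ> Q') x"
      by (simp add: sum_UNIV_sum left_right_mult_def sum_fun_apply)
  qed
  then show "A - (\<Sum>i\<in>UNIV. ?D i (left_right_mult S T i A)) \<in> cspan E"
    using QAQ[OF A] unfolding Q_def Q'_def by simp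
qed

lemma zero_bclin: "bclin (\<lambda>_. 0)"
  by (rule blin_zero_map[OF norm_on_norm])

lemma ideal_zero_at_zero: "A \<in> J \<Longrightarrow> A 0 = 0"
  by (rule blin_zero[OF norm_on_norm ideal_bclin[OF J]])

lemma right_data_lower_upper:
  assumes "right_data UNIV norm S s" "left_data UNIV norm T t"
  shows "right_data J \<alpha> (left_right_mult S T) (s * t)"
proof -
  obtain C B where C: "\<And>i. bclin (C i)" and B: "finite B" "B \<subseteq> UNIV" "card B \<le> s"
    and CB: "\<And>y. y \<in> UNIV \<Longrightarrow> y - (\<Sum>i\<in>UNIV. S i (C i y)) \<in> cspan B"
    by (rule right_dataE[OF assms(1)]) (rule that)
  obtain D B' where D: "\<And>j. bclin (D j)" and B': "finite B'" "B' \<subseteq> UNIV" "card B' \<le> t"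
    and DB: "\<And>x. x \<in> UNIV \<Longrightarrow> x - (\<Sum>j\<in>UNIV. D j (T j x)) \<in> cspan B'"
    by (rule left_dataE[OF assms(2)]) (rule that)
  obtain E where E: "finite E" "E \<subseteq> J" "card E \<le> s * t" "\<And>A. A \<in> J \<Longrightarrow>
      (\<lambda>y. y - (\<Sum>i\<in>UNIV. S i (C i y))) \<circ> A \<circ> (\<lambda>x. x - (\<Sum>j\<in>UNIV. D j (T j x))) \<in> cspan E"
    by (rule finite_rank_sandwich[OF bclin_residual_right(1)[OF C] CB[OF UNIV_I] B(1,3)
          bclin_residual_left(2)[OF D] DB[OF UNIV_I] B'(1,3)]) (rule that)
  show ?thesis
    by (rule right_data_left_right_mult[OF C D E])
qed

lemma left_data_upper_lower:
  assumes "left_data UNIV norm S s" "right_data UNIV norm T t"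
  shows "left_data J \<alpha> (left_right_mult S T) (s * t)"
proof -
  obtain D B where D: "\<And>i. bclin (D i)" and B: "finite B" "B \<subseteq> UNIV" "card B \<le> s"
    and DB: "\<And>y. y \<in> UNIV \<Longrightarrow> y - (\<Sum>i\<in>UNIV. D i (S i y)) \<in> cspan B"
    by (rule left_dataE[OF assms(1)]) (rule that)
  obtain C B' where C: "\<And>j. bclin (C j)" and B': "finite B'" "B' \<subseteq> UNIV" "card B' \<le> t"
    and CB: "\<And>x. x \<in> UNIV \<Longrightarrow> x - (\<Sum>j\<in>UNIV. T j (C j x)) \<in> cspan B'"
    by (rule right_dataE[OF assms(2)]) (rule that)
  obtain E where E: "finite E" "E \<subseteq> J" "card E \<le> s * t" "\<And>A. A \<in> J \<Longrightarrow>
      (\<lambda>y. y - (\<Sum>i\<in>UNIV. D i (S i y))) \<circ> A \<circ> (\<lambda>x. x - (\<Sum>j\<in>UNIV. T j (C j x))) \<in> cspan E"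
    by (rule finite_rank_sandwich[OF bclin_residual_right(2)[OF D] DB[OF UNIV_I] B(1,3)
          bclin_residual_left(1)[OF C] CB[OF UNIV_I] B'(1,3)]) (rule that)
  show ?thesis
    by (rule left_data_left_right_mult[OF D C E])
qed

text \<open>Rank 0 makes the right inverse of \<open>S\<close> exact, so \<open>Q\<close> is 0 and
  the sandwich vanishes whatever its second factor is; the zero operators serve as
  \<open>D\<close>.\<close>

lemma right_data_delta:
  assumes "right_data UNIV norm S 0"
  shows "right_data J \<alpha> (left_right_mult S T) 0"
proof -
  obtain C B where C: "\<And>i. bclin (C i)" and B: "finite B" "B \<subseteq> UNIV" "card B \<le> 0"
    and CB: "\<And>y. y \<in> UNIV \<Longrightarrow> y - (\<Sum>i\<in>UNIV. S i (C i y)) \<in> cspan B"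
    by (rule right_dataE[OF assms]) (rule that)
  have Q: "(\<lambda>y. y - (\<Sum>i\<in>UNIV. S i (C i y))) = (\<lambda>_. 0)"
    using CB B(1,3) by (intro ext) simp
  show ?thesis
  proof (rule right_data_left_right_mult[where C = C and D = "\<lambda>_ _. 0" and E = "{}"])
    show "(\<lambda>y. y - (\<Sum>i\<in>UNIV. S i (C i y))) \<circ> A \<circ> (\<lambda>x. x - (\<Sum>j\<in>UNIV. 0)) \<in> cspan {}" for A
      unfolding Q by (simp add: o_def zero_fun_def)
  qed (use C zero_bclin in simp_all)
qed

lemma left_data_delta:
  assumes "right_data UNIV norm T 0"
  shows "left_data J \<alpha> (left_right_mult S T) 0"
proof -
  obtain C B where C: "\<And>i. bclin (C i)" and B: "finite B" "B \<subseteq> UNIV" "card B \<le> 0"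
    and CB: "\<And>y. y \<in> UNIV \<Longrightarrow> y - (\<Sum>i\<in>UNIV. T i (C i y)) \<in> cspan B"
    by (rule right_dataE[OF assms]) (rule that)
  have Q: "(\<lambda>y. y - (\<Sum>i\<in>UNIV. T i (C i y))) = (\<lambda>_. 0)"
    using CB B(1,3) by (intro ext) simp
  show ?thesis
  proof (rule left_data_left_right_mult[where D = "\<lambda>_ _. 0" and C = C and E = "{}"])
    show "(\<lambda>y. y - (\<Sum>i\<in>UNIV. 0)) \<circ> A \<circ> (\<lambda>x. x - (\<Sum>j\<in>UNIV. T j (C j x))) \<in> cspan {}" if "A \<in> J" for A
      unfolding Q using ideal_zero_at_zero[OF that] by (simp add: o_def zero_fun_def)
  qed (use C zero_bclin in simp_all)
qed

lemma left_data_pi: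
  assumes "left_data UNIV norm S 0"
  shows "left_data J \<alpha> (left_right_mult S T) 0"
proof -
  obtain D B where D: "\<And>i. bclin (D i)" and B: "finite B" "B \<subseteq> UNIV" "card B \<le> 0"
    and DB: "\<And>y. y \<in> UNIV \<Longrightarrow> y - (\<Sum>i\<in>UNIV. D i (S i y)) \<in> cspan B"
    by (rule left_dataE[OF assms]) (rule that)
  have Q: "(\<lambda>y. y - (\<Sum>i\<in>UNIV. D i (S i y))) = (\<lambda>_. 0)"
    using DB B(1,3) by (intro ext) simp
  show ?thesis
  proof (rule left_data_left_right_mult[where D = D and C = "\<lambda>_ _. 0" and E = "{}"])
    show "(\<lambda>y. y - (\<Sum>i\<in>UNIV. D i (S i y))) \<circ> A \<circ> (\<lambda>x. x - (\<Sum>j\<in>UNIV. T j 0)) \<in> cspan {}" for A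
      unfolding Q by (simp add: o_def zero_fun_def)
  qed (use D zero_bclin in simp_all)
qed

text \<open>Here the inner factor \<open>Q'\<close> is 0, and the sandwich vanishes because members
  of \<open>J\<close> map 0 to 0.\<close>

lemma right_data_pi:
  assumes "left_data UNIV norm T 0"
  shows "right_data J \<alpha> (left_right_mult S T) 0"
proof -
  obtain D B where D: "\<And>i. bclin (D i)" and B: "finite B" "B \<subseteq> UNIV" "card B \<le> 0"
    and DB: "\<And>y. y \<in> UNIV \<Longrightarrow> y - (\<Sum>i\<in>UNIV. D i (T i y)) \<in> cspan B"
    by (rule left_dataE[OF assms]) (rule that)
  have Q: "(\<lambda>y. y - (\<Sum>i\<in>UNIV. D i (T i y))) = (\<lambda>_. 0)"
    using DB B(1,3) by (intro ext) simp
  have S0: "S i 0 = 0" for i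
    by (rule blin_zero[OF norm_on_norm S_bclin[OF J S T]])
  show ?thesis
  proof (rule right_data_left_right_mult[where C = "\<lambda>_ _. 0" and D = D and E = "{}"])
    show "(\<lambda>y. y - (\<Sum>i\<in>UNIV. S i 0)) \<circ> A \<circ> (\<lambda>x. x - (\<Sum>j\<in>UNIV. D j (T j x))) \<in> cspan {}" if "A \<in> J" for A
      unfolding Q using ideal_zero_at_zero[OF that] by (simp add: o_def zero_fun_def S0)
  qed (use D zero_bclin in simp_all)
qed

end

section \<open>Complements in Hilbert spaces\<close>

context
  fixes ip :: "'a::complex_banach \<Rightarrow> 'a \<Rightarrow> complex"
  assumes ip: "inner_product_for_norm ip"
begin

lemma ip_add_left: "ip (x + y) z = ip x z + ip y z"
  by (rule ip[unfolded inner_product_for_norm_def, THEN conjunct1, rule_format])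

lemma ip_scale_left: "ip (scaleC c x) y = c * ip x y"
  by (rule ip[unfolded inner_product_for_norm_def, THEN conjunct2, THEN conjunct1, rule_format])

lemma ip_cnj: "ip y x = cnj (ip x y)"
  by (rule ip[unfolded inner_product_for_norm_def, THEN conjunct2, THEN conjunct2, THEN conjunct1, rule_format])

lemma ip_self: "ip x x = complex_of_real ((norm x)\<^sup>2)"
  by (rule ip[unfolded inner_product_for_norm_def, THEN conjunct2, THEN conjunct2, THEN conjunct2, rule_format])

lemma ip_add_right: "ip z (x + y) = ip z x + ip z y"
  unfolding ip_cnj[where y = z and x = "x + y"] ip_add_left complex_cnj_add
    ip_cnj[where y = z and x = x] ip_cnj[where y = z and x = y] by (rule refl)

lemma ip_scale_right: "ip x (scaleC c y) = cnj c * ip x y"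
  unfolding ip_cnj[where y = x and x = "scaleC c y"] ip_scale_left complex_cnj_mult
    ip_cnj[where y = x and x = y] by (rule refl)

lemma norm_sq_diff_scale:
  "(norm (x - scaleC c y))\<^sup>2 = (norm x)\<^sup>2 - 2 * Re (cnj c * ip x y) + (cmod c)\<^sup>2 * (norm y)\<^sup>2"
proof -
  have "x - scaleC c y = x + scaleC (- c) y"
    by (simp add: cvec.scale_minus_left)
  then have "ip (x - scaleC c y) (x - scaleC c y) =
      ip x x + cnj (- c) * ip x y + (- c) * ip y x + (- c) * cnj (- c) * ip y y"
    by (simp only: ip_add_left ip_add_right ip_scale_left ip_scale_right) (simp add: algebra_simps)
  also have "\<dots> = ip x x - (cnj c * ip x y + cnj (cnj c * ip x y)) + c * cnj c * ip y y"
    by (simp add: ip_cnj[of y x] algebra_simps)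
  also have "\<dots> = of_real ((norm x)\<^sup>2 - 2 * Re (cnj c * ip x y) + (cmod c)\<^sup>2 * (norm y)\<^sup>2)"
    unfolding complex_add_cnj ip_self complex_norm_square[symmetric] by simp
  finally show ?thesis
    unfolding ip_self of_real_eq_iff .
qed

lemma parallelogram: "(norm (x + y))\<^sup>2 + (norm (x - y))\<^sup>2 = 2 * (norm x)\<^sup>2 + 2 * (norm y)\<^sup>2"
  for x y :: 'a
  using norm_sq_diff_scale[of x 1 y] norm_sq_diff_scale[of x "- 1" y]
  by (simp add: cvec.scale_minus_left scaleC_one)

definition ips :: "('i::finite \<Rightarrow> 'a) \<Rightarrow> ('i \<Rightarrow> 'a) \<Rightarrow> complex"
  where "ips x y = (\<Sum>i\<in>UNIV. ip (x i) (y i))"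

text \<open>The squared Hilbert norm on the power. The sum norm \<open>pn\<close> does not come from
  an inner product, so distances are minimised in \<open>nsq\<close>, and \<open>pn\<close> enters
  through convergence.\<close>

definition nsq :: "('i::finite \<Rightarrow> 'a) \<Rightarrow> real"
  where "nsq x = (\<Sum>i\<in>UNIV. (norm (x i))\<^sup>2)"

lemma nsq_nonneg: "0 \<le> nsq x"
  unfolding nsq_def by (intro sum_nonneg) simp

lemma nsq_diff_scale: "nsq (x - scaleC c y) = nsq x - 2 * Re (cnj c * ips x y) + (cmod c)\<^sup>2 * nsq y"
  unfolding nsq_def ips_def
  by (simp add: scaleC_fun_def norm_sq_diff_scale sum.distrib sum_subtractf sum_distrib_left)

lemma nsq_parallelogram: "nsq (x + y) + nsq (x - y) = 2 * nsq x + 2 * nsq y"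
  unfolding nsq_def by (simp add: sum.distrib[symmetric] sum_distrib_left parallelogram)

lemma norm_component_le_nsq: "(norm (x i))\<^sup>2 \<le> nsq x"
  unfolding nsq_def by (rule member_le_sum) auto

lemma pn_le_nsq:
  fixes x :: "'i::finite \<Rightarrow> 'a"
  shows "pn UNIV norm x \<le> real CARD('i) * sqrt (nsq x)"
proof -
  have "pn UNIV norm x \<le> (\<Sum>i\<in>(UNIV :: 'i set). sqrt (nsq x))"
    unfolding pn_def by (intro sum_mono real_le_rsqrt norm_component_le_nsq)
  then show ?thesis
    by simp
qed

text \<open>Moving from \<open>x\<close> by \<open>t * a\<close> times \<open>y\<close>, with
  \<open>a = ips x y\<close>, trades a first-order gain for a second-order loss; for small
  \<open>t\<close> the gain wins unless \<open>a\<close> is 0.\<close>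

lemma orthogonal_if_nearest:
  assumes "\<And>c. nsq x \<le> nsq (x - scaleC c y)"
  shows "ips x y = 0"
proof -
  define a where "a = ips x y"
  \<comment> \<open>The summand 1 gives \<open>t * nsq y < 1\<close> and covers
    \<open>nsq y = 0\<close>.\<close>
  define t where "t = 1 / (nsq y + 1)"
  have t: "0 < t" "t * nsq y < 1"
    using nsq_nonneg[of y] by (auto simp: t_def field_simps)
  have "nsq x \<le> nsq x - 2 * Re (cnj (of_real t * a) * a) + (cmod (of_real t * a))\<^sup>2 * nsq y"
    using assms[of "of_real t * a"] unfolding nsq_diff_scale a_def .
  also have "Re (cnj (of_real t * a) * a) = t * (cmod a)\<^sup>2"
    by (simp add: cmod_power2) (simp add: power2_eq_square algebra_simps)
  also have "(cmod (of_real t * a))\<^sup>2 * nsq y = t * (cmod a)\<^sup>2 * (t * nsq y)"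
    by (simp add: norm_mult power_mult_distrib power2_eq_square)
  finally have "2 * (t * (cmod a)\<^sup>2) \<le> t * (cmod a)\<^sup>2 * (t * nsq y)"
    by simp
  also have "\<dots> \<le> t * (cmod a)\<^sup>2 * 1"
    using t by (intro mult_left_mono) auto
  finally have "t * (cmod a)\<^sup>2 \<le> 0"
    by simp
  then show ?thesis
    using t(1) by (simp add: mult_le_0_iff a_def)
qed

text \<open>A minimising sequence is Cauchy by the parallelogram law, because midpoints of its
  members stay in \<open>W\<close> and so have squared distance at least \<open>d\<close> from
  \<open>x\<close>.\<close>

lemma nearest_point:
  fixes W :: "('i::finite \<Rightarrow> 'a) set"
  assumes W: "csubspace W" and cl: "closed_on UNIV (pn UNIV norm) W"
  obtains w where "w \<in> W" "\<And>v. v \<in> W \<Longrightarrow> nsq (x - w) \<le> nsq (x - v)"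
proof -
  have BX: "banach_on (UNIV :: ('i \<Rightarrow> 'a) set) (pn UNIV norm)"
    using banach_on_PiC[OF banach_on_norm finite, of UNIV] by simp
  note NX = banach_on_norm_on[OF BX]
  define d where "d = (INF v\<in>W. nsq (x - v))"
  have ne: "W \<noteq> {}"
    using csub_mem(1)[OF W] by blast
  have bdd: "bdd_below ((\<lambda>v. nsq (x - v)) ` W)"
    by (rule bdd_belowI[of _ 0]) (auto simp: nsq_nonneg)
  have d_le: "d \<le> nsq (x - v)" if "v \<in> W" for v
    unfolding d_def by (rule cINF_lower[OF bdd that])
  have "\<exists>v\<in>W. nsq (x - v) < d + 1 / real (Suc n)" for n
  proof (rule ccontr)
    assume "\<not> ?thesis"
    then have "d + 1 / real (Suc n) \<le> d"
      unfolding d_def by (intro cINF_greatest[OF ne]) (auto simp: not_less)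
    then show False
      by simp
  qed
  then obtain s where s: "\<And>n. s n \<in> W" "\<And>n. nsq (x - s n) < d + 1 / real (Suc n)"
    by metis
  have close: "nsq (s m - s n) \<le> 2 / real (Suc m) + 2 / real (Suc n)" for m n
  proof -
    let ?h = "scaleC (1 / 2) (s m + s n)"
    have "?h \<in> W"
      by (intro csub_mem[OF W] s)
    then have "d \<le> nsq (x - ?h)"
      by (rule d_le)
    have "(x - s m) + (x - s n) = scaleC 2 (x - ?h)"
    proof -
      have "scaleC 2 x = x + x"
        using scaleC_add_left[of 1 1 x] by (simp add: scaleC_one)
      then show ?thesis
        by (simp add: cvec.scale_right_diff_distrib scaleC_scaleC scaleC_one algebra_simps)
    qed
    moreover have "nsq (scaleC 2 u) = 4 * nsq u" for u :: "'i \<Rightarrow> 'a"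
      by (simp add: nsq_def scaleC_fun_def norm_scaleC power_mult_distrib sum_distrib_left)
    ultimately have "nsq ((x - s m) + (x - s n)) = 4 * nsq (x - ?h)"
      by simp
    moreover have "(x - s m) - (x - s n) = s n - s m"
      by simp
    moreover have "nsq (s n - s m) = nsq (s m - s n)"
      by (simp add: nsq_def norm_minus_commute)
    ultimately have "4 * nsq (x - ?h) + nsq (s m - s n) = 2 * nsq (x - s m) + 2 * nsq (x - s n)"
      using nsq_parallelogram[of "x - s m" "x - s n"] by simp
    then show ?thesis
      using \<open>d \<le> nsq (x - ?h)\<close> s(2)[of m] s(2)[of n] by simp
  qed
  have "cauchy_on (pn UNIV norm) s"
    unfolding cauchy_on_def
  proof (intro allI impI)
    fix e :: real assume e: "e > 0"
    define c where "c = real CARD('i)"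
    have c: "c > 0"
      by (simp add: c_def)
    \<comment> \<open>\<open>pn\<close> is at most \<open>c\<close> times the Hilbert norm, and two
      errors of size \<open>2 / M\<close> must together stay below the square of
      \<open>e / c\<close>.\<close>
    obtain M :: nat where M: "4 / (e / c)\<^sup>2 < real M"
      using reals_Archimedean2 by blast
    show "\<exists>M. \<forall>m\<ge>M. \<forall>n\<ge>M. pn UNIV norm (s m - s n) < e"
    proof (intro exI allI impI)
      fix m n assume mn: "M \<le> m" "M \<le> n"
      have Mpos: "0 < real M"
        using M e c by (smt (verit) divide_nonneg_nonneg zero_le_power2)
      have "nsq (s m - s n) \<le> 2 / real (Suc m) + 2 / real (Suc n)"
        by (rule close)
      also have "\<dots> \<le> 2 / real M + 2 / real M"
        using mn Mpos by (intro add_mono divide_left_mono) auto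
      also have "\<dots> = 4 / real M"
        by simp
      also have "\<dots> < (e / c)\<^sup>2"
        using M Mpos e c by (simp add: field_simps)
      finally have "sqrt (nsq (s m - s n)) < e / c"
        using e c by (intro real_less_lsqrt) auto
      then have "c * sqrt (nsq (s m - s n)) < e"
        using c by (simp add: field_simps)
      then show "pn UNIV norm (s m - s n) < e"
        using pn_le_nsq[of "s m - s n"] by (simp add: c_def)
    qed
  qed
  then obtain w where w: "(\<lambda>n. pn UNIV norm (s n - w)) \<longlonglongrightarrow> 0"
    by (rule banach_onD[OF BX UNIV_I])
  then have wW: "w \<in> W"
    using cl s(1) unfolding closed_on_def by blast
  have comp: "(\<lambda>n. norm (s n i - w i)) \<longlonglongrightarrow> 0" for i
    using pn_tendsto_iff[OF norm_on_norm finite, where I = UNIV and s = s and l = w] w by simp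
  have "(\<lambda>n. nsq (x - s n)) \<longlonglongrightarrow> nsq (x - w)"
  proof -
    have "(\<lambda>n. s n i) \<longlonglongrightarrow> w i" for i
      using comp[of i] by (simp add: LIM_zero_iff tendsto_norm_zero_iff)
    then show ?thesis
      unfolding nsq_def by (auto intro!: tendsto_intros)
  qed
  moreover have "(\<lambda>n. d + 1 / real (Suc n)) \<longlonglongrightarrow> d + 0"
    using LIMSEQ_inverse_real_of_nat by (intro tendsto_add tendsto_const) (simp add: inverse_eq_divide)
  ultimately have "nsq (x - w) \<le> d"
    using s(2) by (intro LIMSEQ_le[where X = "\<lambda>n. nsq (x - s n)" and Y = "\<lambda>n. d + 1 / real (Suc n)"])
      (auto intro: less_imp_le)
  then have "nsq (x - w) \<le> nsq (x - v)" if "v \<in> W" for v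
    using d_le[OF that] by simp
  then show ?thesis
    using that wW by blast
qed

text \<open>Cauchy-Schwarz, from the squared distance of \<open>x\<close> to its projection onto the
  line through \<open>y\<close>.\<close>

lemma blin_ip: "bclin (\<lambda>x. ip x y)"
proof (rule blinI[where K = "norm y"])
  fix x
  show "norm (ip x y) \<le> norm y * norm x"
  proof (cases "y = 0")
    case True
    have "ip x (scaleC 0 y) = 0"
      unfolding ip_scale_right by simp
    then show ?thesis
      using True by simp
  next
    case False
    then have y: "(norm y)\<^sup>2 > 0"
      by simp
    define t where "t = 1 / (norm y)\<^sup>2"
    define a where "a = ip x y"
    have "0 \<le> (norm (x - scaleC (of_real t * a) y))\<^sup>2"
      by simp
    also have "\<dots> = (norm x)\<^sup>2 - 2 * Re (cnj (of_real t * a) * a) + (cmod (of_real t * a))\<^sup>2 * (norm y)\<^sup>2"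
      unfolding norm_sq_diff_scale a_def ..
    also have "Re (cnj (of_real t * a) * a) = t * (cmod a)\<^sup>2"
      by (simp add: cmod_power2) (simp add: power2_eq_square algebra_simps)
    also have "(cmod (of_real t * a))\<^sup>2 * (norm y)\<^sup>2 = t * (cmod a)\<^sup>2 * (t * (norm y)\<^sup>2)"
      by (simp add: norm_mult power_mult_distrib power2_eq_square)
    also have "t * (norm y)\<^sup>2 = 1"
      using False by (simp add: t_def)
    finally have "t * (cmod a)\<^sup>2 \<le> (norm x)\<^sup>2"
      by simp
    then have "(cmod a)\<^sup>2 \<le> (norm y * norm x)\<^sup>2"
      using y by (simp add: t_def field_simps power_mult_distrib)
    then show ?thesis
      unfolding a_def[symmetric] by (rule power2_le_imp_le) simp
  qed
qed (simp_all add: ip_add_left ip_scale_left scaleC_complex_def)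

text \<open>The orthogonal complement with respect to \<open>ips\<close> works; nearest points
  provide the decomposition.\<close>

lemma closed_has_direct_complement:
  fixes W :: "('i::finite \<Rightarrow> 'a) set"
  assumes W: "csubspace W" and cl: "closedin (power_topology UNIV norm) W"
  shows "has_direct_complement (power_topology UNIV norm) W"
proof -
  have cl': "closed_on UNIV (pn UNIV norm) W"
    using cl unfolding closedin_power_topology_iff[OF norm_on_norm] by simp
  have NX: "norm_on (UNIV :: ('i \<Rightarrow> 'a) set) (pn UNIV norm)"
    using norm_on_PiC[OF norm_on_norm finite, of UNIV] by simp
  have b: "blin UNIV (pn UNIV norm) UNIV norm (\<lambda>x. ips x y)" for y :: "'i \<Rightarrow> 'a"
  proof -
    have "blin UNIV (pn UNIV norm) UNIV norm (\<lambda>x :: 'i \<Rightarrow> 'a. x i)" for i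
      using blin_component[OF norm_on_norm finite UNIV_I, of i] by simp
    then have "blin UNIV (pn UNIV norm) UNIV norm (\<lambda>x :: 'i \<Rightarrow> 'a. ip (x i) (y i))" for i
      by (rule blin_comp[OF _ blin_ip norm_on_norm])
    then show ?thesis
      unfolding ips_def by (rule blin_sum_map[OF _ norm_on_norm])
  qed
  let ?U = "{u. \<forall>w\<in>W. ips u w = 0}"
  have self: "ips x x = of_real (nsq x)" for x :: "'i \<Rightarrow> 'a"
    by (simp add: ips_def nsq_def ip_self)
  show ?thesis
    unfolding has_direct_complement_def closedin_power_topology_iff[OF norm_on_norm]
      topspace_power_topology[OF norm_on_norm] PiC_UNIV_UNIV
  proof (intro exI[of _ ?U] conjI)
    have "0 \<in> {u \<in> UNIV. ips u w = 0}" for w :: "'i \<Rightarrow> 'a"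
      using blin_zero[OF NX b] by simp
    then show sub: "csubspace ?U"
      by (intro cvec.subspaceI) (auto simp: blin_add[OF b] blin_scale[OF b] scaleC_complex_def)
    show "closed_on UNIV (pn UNIV norm) ?U"
      unfolding closed_on_def
    proof (intro conjI allI impI subset_UNIV)
      fix s l assume a: "(\<forall>n. s n \<in> ?U) \<and> l \<in> UNIV \<and> (\<lambda>n. pn UNIV norm (s n - l)) \<longlonglongrightarrow> 0"
      have "ips l w = 0" if w: "w \<in> W" for w
      proof -
        have "(\<lambda>n. norm (ips (s n) w - ips l w)) \<longlonglongrightarrow> 0"
          using a by (intro blin_lim[OF NX norm_on_norm b]) auto
        then show ?thesis
          using a w by (simp add: LIMSEQ_const_iff)
      qed
      then show "l \<in> ?U"
        by simp
    qed
    show "W \<inter> ?U = {0}"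
    proof
      show "W \<inter> ?U \<subseteq> {0}"
      proof
        fix x assume "x \<in> W \<inter> ?U"
        then have "ips x x = 0"
          by blast
        then have "nsq x = 0"
          unfolding self by simp
        then have "x = 0"
          by (auto simp: nsq_def sum_nonneg_eq_0_iff fun_eq_iff)
        then show "x \<in> {0}"
          by simp
      qed
      show "{0} \<subseteq> W \<inter> ?U"
        using csub_mem(1)[OF W] csub_mem(1)[OF sub] by blast
    qed
    show "{w + u |w u. w \<in> W \<and> u \<in> ?U} = UNIV"
    proof (intro equalityI subset_UNIV subsetI)
      fix x
      obtain w where w: "w \<in> W" "\<And>v. v \<in> W \<Longrightarrow> nsq (x - w) \<le> nsq (x - v)"
        by (rule nearest_point[OF W cl']) (rule that)
      have "ips (x - w) v = 0" if v: "v \<in> W" for v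
      proof (rule orthogonal_if_nearest)
        fix c
        have e: "x - w - scaleC c v = x - (w + scaleC c v)"
          by simp
        show "nsq (x - w) \<le> nsq (x - w - scaleC c v)"
          unfolding e by (rule w(2)[OF csub_mem(2)[OF W w(1) csub_mem(5)[OF W v]]])
      qed
      then have "x - w \<in> ?U"
        by simp
      moreover have "x = w + (x - w)"
        by simp
      ultimately show "x \<in> {w + u |w u. w \<in> W \<and> u \<in> ?U}"
        using w(1) by blast
    qed
  qed
qed

end

section \<open>The spectra of the multiplication tuple\<close>

context
  fixes V :: "'a::complex_vector set" and N and P P' :: "'i::finite \<Rightarrow> 'a \<Rightarrow> 'a"
  assumes N: "norm_on V N" and P': "comm_ops V N P'" and eq: "\<And>i x. x \<in> V \<Longrightarrow> P i x = P' i x"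
begin

lemma pow_cong: "x \<in> V \<Longrightarrow> (P i ^^ k) x = (P' i ^^ k) x"
  by (induction k) (simp_all add: eq blin_mem[OF comm_ops_blin_pow[OF N P']])

lemma M_sum_cong: "M_sum V k P = M_sum V k P'"
  unfolding M_sum_def by (simp add: image_cong[OF refl pow_cong])

lemma R_infty_cong: "R_infty V P = R_infty V P'"
  by (simp add: R_infty_def M_sum_cong)

lemma null_hat_cong: "null_hat V P = null_hat V P'"
  unfolding null_hat_def hat_def using eq by auto

lemma null_tilde_cong: "null_tilde V P = null_tilde V P'"
  unfolding null_tilde_def tilde_def using eq by auto

lemma range_tilde_cong: "range_tilde V P = range_tilde V P'"
  unfolding range_tilde_def tilde_def using eq by (intro image_cong) auto

lemma N_infty_cong: "N_infty V P = N_infty V P'"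
  unfolding N_infty_def using pow_cong by auto

lemma upper_semi_Browder_cong: "upper_semi_Browder V N P = upper_semi_Browder V N P'"
  by (simp add: upper_semi_Browder_def upper_semi_Fredholm_def null_tilde_cong range_tilde_cong N_infty_cong)

end

section \<open>Shifted tuples and points of the product\<close>

lemma comm_ops_shift:
  assumes "commuting_tuple S"
  shows "comm_ops UNIV norm (shift S \<zeta>)"
proof -
  have S: "bclin (S i)" for i
    using assms by (simp add: commuting_tuple_def bounded_clinear_iff_blin)
  have c: "S i (S j x) = S j (S i x)" for i j x
    using assms by (simp add: commuting_tuple_def fun_eq_iff)
  have "bclin (\<lambda>x. S i x - scaleC (\<zeta> i) x)" for i
    by (rule blin_diff_map[OF S blin_scale_map[OF blin_id norm_on_norm] norm_on_norm])
  moreover have "shift S \<zeta> i (shift S \<zeta> j x) = shift S \<zeta> j (shift S \<zeta> i x)" for i j x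
    by (simp add: shift_def blin_diff[OF norm_on_norm S] blin_scale[OF S] c
        cvec.scale_right_diff_distrib scaleC_scaleC mult.commute)
  ultimately show ?thesis
    by (simp add: comm_ops_def shift_def)
qed

lemma mem_spec_prod: "case_sum \<zeta> \<xi> \<in> A \<times>\<^sub>s B \<longleftrightarrow> \<zeta> \<in> A \<and> \<xi> \<in> B"
proof
  assume "case_sum \<zeta> \<xi> \<in> A \<times>\<^sub>s B"
  then obtain \<zeta>' \<xi>' where e: "case_sum \<zeta> \<xi> = case_sum \<zeta>' \<xi>'" "\<zeta>' \<in> A" "\<xi>' \<in> B"
    by (auto simp: spec_prod_def)
  have "\<zeta> = \<zeta>'" "\<xi> = \<xi>'"
    using fun_cong[OF e(1), of "Inl _"] fun_cong[OF e(1), of "Inr _"] by (auto simp: fun_eq_iff)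
  then show "\<zeta> \<in> A \<and> \<xi> \<in> B"
    using e by simp
qed (auto simp: spec_prod_def)

lemma subset_sum_indexI:
  assumes "\<And>\<zeta> \<xi>. case_sum \<zeta> \<xi> \<in> A \<Longrightarrow> case_sum \<zeta> \<xi> \<in> B"
  shows "A \<subseteq> (B :: ('n + 'm \<Rightarrow> complex) set)"
proof
  fix \<mu> assume \<mu>: "\<mu> \<in> A"
  have "\<mu> = case_sum (\<lambda>i. \<mu> (Inl i)) (\<lambda>j. \<mu> (Inr j))"
    by (simp add: fun_eq_iff split: sum.split)
  then show "\<mu> \<in> B"
    using assms[of "\<lambda>i. \<mu> (Inl i)" "\<lambda>j. \<mu> (Inr j)"] \<mu> by simp
qed

section \<open>One-sided inverses for a single tuple\<close>

context
  fixes R :: "'k::finite \<Rightarrow> 'a::complex_banach \<Rightarrow> 'a"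
  assumes R: "comm_ops UNIV norm R"
begin

lemma lower_split_data:
  assumes "codim UNIV (R_infty UNIV R) < \<infinity>" "has_direct_complement (power_topology UNIV norm) (null_hat UNIV R)"
  shows "\<exists>s. \<forall>k\<ge>1. right_data UNIV norm (powt R k) s"
proof -
  obtain s where "\<And>k. 1 \<le> k \<Longrightarrow> codim_le UNIV (M_sum UNIV k R) s"
    using assms(1) unfolding codim_R_infty_iff[OF norm_on_norm R] by blast
  from right_data_powt[OF banach_on_norm R this assms(2)] show ?thesis
    by blast
qed

lemma surj_split_data:
  assumes "M_sum UNIV 1 R = UNIV" "has_direct_complement (power_topology UNIV norm) (null_hat UNIV R)" "1 \<le> k"
  shows "right_data UNIV norm (powt R k) 0"
proof (rule right_data_powt[OF banach_on_norm R _ assms(2,3)])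
  show "codim_le UNIV (M_sum UNIV k R) 0" if "1 \<le> k" for k
    unfolding codim_le_def hat_pow_surj[OF norm_on_norm R assms(1) that]
    by (intro exI[of _ "{}"]) simp
qed

lemma upper_split_data:
  assumes "upper_semi_Browder UNIV norm R" "has_direct_complement (power_topology UNIV norm) (range_tilde UNIV R)"
  shows "\<exists>s. \<forall>k\<ge>1. left_data UNIV norm (powt R k) s"
proof -
  obtain s where s: "\<And>k. 1 \<le> k \<Longrightarrow> fdim_le (null_tilde UNIV (powt R k)) s"
    using assms(1) unfolding upper_semi_Browder_def cdim_N_infty_iff[OF norm_on_norm R] by blast
  have "closedin (power_topology UNIV norm) (range_tilde UNIV R)"
    using assms(1) by (simp add: upper_semi_Browder_def upper_semi_Fredholm_def)
  from left_data_powt[OF banach_on_norm R s this assms(2)] show ?thesis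
    by blast
qed

lemma inj_split_data:
  assumes "null_tilde UNIV R = {0}" "closedin (power_topology UNIV norm) (range_tilde UNIV R)"
    "has_direct_complement (power_topology UNIV norm) (range_tilde UNIV R)" "1 \<le> k"
  shows "left_data UNIV norm (powt R k) 0"
proof (rule left_data_powt[OF banach_on_norm R _ assms(2-4)])
  show "fdim_le (null_tilde UNIV (powt R k)) 0" if "1 \<le> k" for k
    unfolding tilde_pow_inj[OF norm_on_norm R assms(1) that]
    by (rule fdim_leI_span[where B = "{}"]) auto
qed

end

section \<open>Transfer between the multiplication tuple and its factors\<close>

context
  fixes J :: "('b::complex_banach \<Rightarrow> 'a::complex_banach) set" and \<alpha>
    and S :: "'n::finite \<Rightarrow> 'a \<Rightarrow> 'a" and T :: "'m::finite \<Rightarrow> 'b \<Rightarrow> 'b"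
  assumes J: "operator_ideal J \<alpha>" and S: "comm_ops UNIV norm S" and T: "comm_ops UNIV norm T"
begin

lemmas comm_mult = comm_ops_left_right_mult[OF J S T]
lemmas comm_powt_S = comm_ops_powt[OF norm_on_norm S]
lemmas comm_powt_T = comm_ops_powt[OF norm_on_norm T]

lemma M_sum_left_right_mult:
  "M_sum J k (left_right_mult S T) = M_sum J 1 (left_right_mult (powt S k) (powt T k))"
  unfolding powt_left_right_mult[symmetric] M_sum_powt ..

lemma codim_R_infty_S:
  assumes "codim J (R_infty J (left_right_mult S T)) < \<infinity>" "approx_null T"
  shows "codim UNIV (R_infty UNIV S) < \<infinity>"
proof -
  obtain r where r: "\<And>k. 1 \<le> k \<Longrightarrow> codim_le J (M_sum J k (left_right_mult S T)) r"
    using assms(1) unfolding codim_R_infty_iff[OF ideal_norm_on[OF J] comm_mult] by blast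
  have "codim_le UNIV (M_sum UNIV k S) r" if k: "1 \<le> k" for k
    using codim_le_S[OF J comm_powt_S comm_powt_T r[OF k, unfolded M_sum_left_right_mult] approx_null_powt[OF T assms(2) k]]
    unfolding M_sum_powt .
  then show ?thesis
    unfolding codim_R_infty_iff[OF norm_on_norm S] by blast
qed

text \<open>The kernels of all powers are bounded by the same \<open>r\<close>, which settles
  \<open>N_infty\<close>; the Fredholm condition on \<open>T\<close> is the case of the first
  power.\<close>

lemma upper_semi_Browder_T:
  assumes "codim J (R_infty J (left_right_mult S T)) < \<infinity>" "M_sum UNIV 1 S \<noteq> UNIV"
  shows "upper_semi_Browder UNIV norm T"
proof -
  obtain r where r: "\<And>k. 1 \<le> k \<Longrightarrow> codim_le J (M_sum J k (left_right_mult S T)) r"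
    using assms(1) unfolding codim_R_infty_iff[OF ideal_norm_on[OF J] comm_mult] by blast
  have *: "upper_semi_Fredholm UNIV norm (powt T k) \<and> fdim_le (null_tilde UNIV (powt T k)) r" if k: "1 \<le> k" for k
  proof -
    \<comment> \<open>The spaces \<open>M_sum\<close> decrease, so a surjective power would make
      \<open>S\<close> itself surjective.\<close>
    have "M_sum UNIV 1 (powt S k) \<noteq> UNIV"
      unfolding M_sum_powt using M_sum_mono[OF norm_on_norm S k] assms(2) by blast
    then show ?thesis
      by (rule upper_T[OF J comm_powt_S comm_powt_T r[OF k, unfolded M_sum_left_right_mult]])
  qed
  have "cdim (N_infty UNIV T) < \<infinity>"
    unfolding cdim_N_infty_iff[OF norm_on_norm T] using * by blast
  then show ?thesis
    using *[of 1] by (simp add: upper_semi_Browder_def)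
qed

text \<open>Closed range enters at the first power, as a lower estimate that the powers inherit; the
  kernels of the powers are bounded through \<open>N_infty\<close>.\<close>

lemma lower_estimate_data:
  assumes "upper_semi_Browder J \<alpha> (left_right_mult S T)"
  obtains r where "\<And>k. 1 \<le> k \<Longrightarrow> lower_estimate J \<alpha> (left_right_mult (powt S k) (powt T k))"
    "\<And>k. 1 \<le> k \<Longrightarrow> fdim_le (null_tilde J (left_right_mult (powt S k) (powt T k))) r"
proof -
  have F: "upper_semi_Fredholm J \<alpha> (left_right_mult S T)" and "cdim (N_infty J (left_right_mult S T)) < \<infinity>"
    using assms by (simp_all add: upper_semi_Browder_def)
  then obtain r where r: "\<And>k. 1 \<le> k \<Longrightarrow> fdim_le (null_tilde J (powt (left_right_mult S T) k)) r"
    unfolding cdim_N_infty_iff[OF ideal_norm_on[OF J] comm_mult] by blast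
  obtain K q where "precompact_on J \<alpha> q"
    "\<And>A. A \<in> J \<Longrightarrow> \<alpha> A \<le> K * (\<Sum>i\<in>UNIV. \<alpha> (left_right_mult S T i A)) + q A"
    using upper_semi_Fredholm_estimate[OF ideal_banach[OF J] comm_mult F] unfolding pn_tilde by blast
  then have "lower_estimate J \<alpha> (left_right_mult S T)"
    by (rule lower_estimateI[OF ideal_norm_on[OF J] comm_mult])
  from lower_estimate_pow[OF ideal_norm_on[OF J] comm_mult this] show ?thesis
    using that[of r] r unfolding powt_left_right_mult by blast
qed

lemma upper_semi_Browder_S:
  assumes "upper_semi_Browder J \<alpha> (left_right_mult S T)" "M_sum UNIV 1 T \<noteq> UNIV"
  shows "upper_semi_Browder UNIV norm S"
proof -
  obtain r where r: "\<And>k. 1 \<le> k \<Longrightarrow> lower_estimate J \<alpha> (left_right_mult (powt S k) (powt T k))"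
    "\<And>k. 1 \<le> k \<Longrightarrow> fdim_le (null_tilde J (left_right_mult (powt S k) (powt T k))) r"
    by (rule lower_estimate_data[OF assms(1)]) (rule that)
  have *: "upper_semi_Fredholm UNIV norm (powt S k) \<and> fdim_le (null_tilde UNIV (powt S k)) r" if k: "1 \<le> k" for k
  proof -
    have "M_sum UNIV 1 (powt T k) \<noteq> UNIV"
      unfolding M_sum_powt using M_sum_mono[OF norm_on_norm T k] assms(2) by blast
    then show ?thesis
      by (rule upper_S[OF J comm_powt_S comm_powt_T r(1)[OF k] r(2)[OF k]])
  qed
  have "cdim (N_infty UNIV S) < \<infinity>"
    unfolding cdim_N_infty_iff[OF norm_on_norm S] using * by blast
  then show ?thesis
    using *[of 1] by (simp add: upper_semi_Browder_def)
qed

lemma codim_R_infty_T: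
  assumes "upper_semi_Browder J \<alpha> (left_right_mult S T)" "approx_null S"
  shows "codim UNIV (R_infty UNIV T) < \<infinity>"
proof -
  obtain r where r: "\<And>k. 1 \<le> k \<Longrightarrow> lower_estimate J \<alpha> (left_right_mult (powt S k) (powt T k))"
    "\<And>k. 1 \<le> k \<Longrightarrow> fdim_le (null_tilde J (left_right_mult (powt S k) (powt T k))) r"
    by (rule lower_estimate_data[OF assms(1)]) (rule that)
  have "codim_le UNIV (M_sum UNIV k T) r" if k: "1 \<le> k" for k
    using codim_le_T[OF J comm_powt_S comm_powt_T r(1)[OF k] r(2)[OF k] approx_null_powt[OF S assms(2) k]]
    unfolding M_sum_powt .
  then show ?thesis
    unfolding codim_R_infty_iff[OF norm_on_norm T] by blast
qed

text \<open>The alternatives correspond to a point outside the split defect spectrum of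
  \<open>S\<close>, outside the split approximate point spectrum of \<open>T\<close>, or outside
  both split semi-Browder spectra. The ranks on \<open>J\<close> are 0, 0 and
  \<open>s * t\<close>.\<close>

lemma lower_split_left_right_mult:
  assumes "(\<forall>k\<ge>1. right_data UNIV norm (powt S k) 0) \<or> (\<forall>k\<ge>1. left_data UNIV norm (powt T k) 0) \<or>
    (\<exists>s. \<forall>k\<ge>1. right_data UNIV norm (powt S k) s) \<and> (\<exists>t. \<forall>k\<ge>1. left_data UNIV norm (powt T k) t)"
  shows "codim J (R_infty J (left_right_mult S T)) < \<infinity> \<and>
    has_direct_complement (power_topology J \<alpha>) (null_hat J (left_right_mult S T))"
proof -
  have "\<exists>r. \<forall>k\<ge>1. right_data J \<alpha> (left_right_mult (powt S k) (powt T k)) r"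
    using assms
  proof (elim disjE conjE exE)
    assume *: "\<forall>k\<ge>1. right_data UNIV norm (powt S k) 0"
    show ?thesis
      by (rule exI[of _ 0]) (use * right_data_delta[OF J comm_powt_S comm_powt_T] in simp)
  next
    assume *: "\<forall>k\<ge>1. left_data UNIV norm (powt T k) 0"
    show ?thesis
      by (rule exI[of _ 0]) (use * right_data_pi[OF J comm_powt_S comm_powt_T] in simp)
  next
    fix s t
    assume *: "\<forall>k\<ge>1. right_data UNIV norm (powt S k) s" "\<forall>k\<ge>1. left_data UNIV norm (powt T k) t"
    show ?thesis
      by (rule exI[of _ "s * t"]) (use * right_data_lower_upper[OF J comm_powt_S comm_powt_T] in simp)
  qed
  then obtain r where "\<And>k. 1 \<le> k \<Longrightarrow> right_data J \<alpha> (powt (left_right_mult S T) k) r"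
    unfolding powt_left_right_mult by blast
  from lower_split_if_right_data[OF ideal_banach[OF J] comm_mult this] show ?thesis
    by blast
qed

lemma upper_split_left_right_mult:
  assumes "(\<forall>k\<ge>1. left_data UNIV norm (powt S k) 0) \<or> (\<forall>k\<ge>1. right_data UNIV norm (powt T k) 0) \<or>
    (\<exists>s. \<forall>k\<ge>1. left_data UNIV norm (powt S k) s) \<and> (\<exists>t. \<forall>k\<ge>1. right_data UNIV norm (powt T k) t)"
  shows "upper_semi_Browder J \<alpha> (left_right_mult S T) \<and>
    has_direct_complement (power_topology J \<alpha>) (range_tilde J (left_right_mult S T))"
proof -
  have "\<exists>r. \<forall>k\<ge>1. left_data J \<alpha> (left_right_mult (powt S k) (powt T k)) r"
    using assms
  proof (elim disjE conjE exE)
    assume *: "\<forall>k\<ge>1. left_data UNIV norm (powt S k) 0"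
    show ?thesis
      by (rule exI[of _ 0]) (use * left_data_pi[OF J comm_powt_S comm_powt_T] in simp)
  next
    assume *: "\<forall>k\<ge>1. right_data UNIV norm (powt T k) 0"
    show ?thesis
      by (rule exI[of _ 0]) (use * left_data_delta[OF J comm_powt_S comm_powt_T] in simp)
  next
    fix s t
    assume *: "\<forall>k\<ge>1. left_data UNIV norm (powt S k) s" "\<forall>k\<ge>1. right_data UNIV norm (powt T k) t"
    show ?thesis
      by (rule exI[of _ "s * t"]) (use * left_data_upper_lower[OF J comm_powt_S comm_powt_T] in simp)
  qed
  then obtain r where "\<And>k. 1 \<le> k \<Longrightarrow> left_data J \<alpha> (powt (left_right_mult S T) k) r"
    unfolding powt_left_right_mult by blast
  from upper_split_if_left_data[OF ideal_banach[OF J] comm_mult this] show ?thesis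
    by blast
qed

end

lemma sigma_delta_iff:
  assumes "commuting_tuple S"
  shows "\<zeta> \<in> sigma_delta UNIV S \<longleftrightarrow> M_sum UNIV 1 (shift S \<zeta>) \<noteq> UNIV"
  unfolding sigma_delta_def mem_Collect_eq
    codim_zero_iff[OF csubspace_M_sum[OF norm_on_norm comm_ops_shift[OF assms]]] ..

lemma approx_null_if_sigma_pi:
  fixes S :: "'n::finite \<Rightarrow> 'a::complex_banach \<Rightarrow> 'a"
  assumes "commuting_tuple S" "\<zeta> \<in> sigma_pi UNIV norm S"
  shows "approx_null (shift S \<zeta>)"
  using assms(2) not_approx_null[OF comm_ops_shift[OF assms(1), of \<zeta>]] unfolding sigma_pi_def by blast

text \<open>Null spaces of \<open>hat\<close> are closed, hence always complemented here. Ranges of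
  \<open>tilde\<close> are complemented when closed, and a point with a range that is not closed
  already belongs to both \<open>sigma_pi\<close> and \<open>sigma_B_plus\<close>.\<close>

lemma hilbert_spectra:
  fixes S :: "'n::finite \<Rightarrow> 'a::complex_banach \<Rightarrow> 'a"
  assumes ip: "\<exists>ip :: 'a \<Rightarrow> 'a \<Rightarrow> complex. inner_product_for_norm ip" and S: "commuting_tuple S"
  shows "sp_delta UNIV norm S = sigma_delta UNIV S" "sp_pi UNIV norm S = sigma_pi UNIV norm S"
    "sp_B_minus UNIV norm S = sigma_B_minus UNIV S" "sp_B_plus UNIV norm S = sigma_B_plus UNIV norm S"
proof -
  obtain ip :: "'a \<Rightarrow> 'a \<Rightarrow> complex" where ip: "inner_product_for_norm ip"
    using ip by blast
  note C = comm_ops_shift[OF S]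
  have NP: "norm_on (UNIV :: ('n \<Rightarrow> 'a) set) (pn UNIV norm)"
    using norm_on_PiC[OF norm_on_norm finite, of UNIV] by simp
  have "\<zeta> \<notin> C_minus UNIV norm S" for \<zeta>
  proof -
    have b: "blin UNIV (pn UNIV norm) UNIV norm (hat (shift S \<zeta>))"
      using blin_hat[OF norm_on_norm C] by simp
    have z: "blin UNIV (pn UNIV norm) UNIV norm (\<lambda>x :: 'n \<Rightarrow> 'a. 0 :: 'a)"
      by (rule blin_zero_map[OF norm_on_norm])
    have e: "null_hat UNIV (shift S \<zeta>) = {x \<in> UNIV. hat (shift S \<zeta>) x = 0}"
      by (simp add: null_hat_def)
    have "csubspace (null_hat UNIV (shift S \<zeta>))"
      unfolding e by (rule csubspace_eq_blin[OF NP b z])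
    moreover have "closedin (power_topology UNIV norm) (null_hat UNIV (shift S \<zeta>))"
      unfolding closedin_power_topology_iff[OF norm_on_norm] PiC_UNIV_UNIV e
      by (rule closed_on_eq_blin[OF NP norm_on_norm b z])
    ultimately show ?thesis
      using closed_has_direct_complement[OF ip] by (simp add: C_minus_def)
  qed
  then have "C_minus UNIV norm S = {}"
    by blast
  then show "sp_delta UNIV norm S = sigma_delta UNIV S" "sp_B_minus UNIV norm S = sigma_B_minus UNIV S"
    unfolding sp_delta_def sp_B_minus_eq by simp_all
  have c: "\<zeta> \<notin> C_plus UNIV norm S"
    if "closedin (power_topology UNIV norm) (range_tilde UNIV (shift S \<zeta>))" for \<zeta>
  proof -
    have "csubspace (range_tilde UNIV (shift S \<zeta>))"
      unfolding range_tilde_def by (rule csubspace_blin_image[OF norm_on_norm blin_tilde[OF norm_on_norm C]])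
    then show ?thesis
      using closed_has_direct_complement[OF ip _ that] by (simp add: C_plus_def)
  qed
  have "C_plus UNIV norm S \<subseteq> sigma_pi UNIV norm S" "C_plus UNIV norm S \<subseteq> sigma_B_plus UNIV norm S"
    using c by (auto simp: sigma_pi_def sigma_B_plus_def upper_semi_Browder_def upper_semi_Fredholm_def)
  then show "sp_pi UNIV norm S = sigma_pi UNIV norm S" "sp_B_plus UNIV norm S = sigma_B_plus UNIV norm S"
    unfolding sp_pi_def sp_B_plus_eq by blast+
qed

lemma split_data:
  fixes R :: "'k::finite \<Rightarrow> 'a::complex_banach \<Rightarrow> 'a"
  assumes R: "commuting_tuple R"
  shows "\<zeta> \<notin> sp_delta UNIV norm R \<Longrightarrow> \<forall>k\<ge>1. right_data UNIV norm (powt (shift R \<zeta>) k) 0"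
    and "\<zeta> \<notin> sp_pi UNIV norm R \<Longrightarrow> \<forall>k\<ge>1. left_data UNIV norm (powt (shift R \<zeta>) k) 0"
    and "\<zeta> \<notin> sp_B_minus UNIV norm R \<Longrightarrow> \<exists>s. \<forall>k\<ge>1. right_data UNIV norm (powt (shift R \<zeta>) k) s"
    and "\<zeta> \<notin> sp_B_plus UNIV norm R \<Longrightarrow> \<exists>s. \<forall>k\<ge>1. left_data UNIV norm (powt (shift R \<zeta>) k) s"
proof -
  note C = comm_ops_shift[OF R]
  show "\<forall>k\<ge>1. right_data UNIV norm (powt (shift R \<zeta>) k) 0" if "\<zeta> \<notin> sp_delta UNIV norm R"
    using that surj_split_data[OF C, of \<zeta>]
    unfolding sp_delta_def Un_iff sigma_delta_iff[OF R] C_minus_def mem_Collect_eq by blast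
  show "\<forall>k\<ge>1. left_data UNIV norm (powt (shift R \<zeta>) k) 0" if "\<zeta> \<notin> sp_pi UNIV norm R"
    using that inj_split_data[OF C, of \<zeta>]
    unfolding sp_pi_def Un_iff sigma_pi_def C_plus_def mem_Collect_eq by blast
  show "\<exists>s. \<forall>k\<ge>1. right_data UNIV norm (powt (shift R \<zeta>) k) s" if "\<zeta> \<notin> sp_B_minus UNIV norm R"
    using that lower_split_data[OF C, of \<zeta>] unfolding sp_B_minus_def mem_Collect_eq by blast
  show "\<exists>s. \<forall>k\<ge>1. left_data UNIV norm (powt (shift R \<zeta>) k) s" if "\<zeta> \<notin> sp_B_plus UNIV norm R"
    using that upper_split_data[OF C, of \<zeta>] unfolding sp_B_plus_def mem_Collect_eq by blast
qed

section \<open>The inclusions between the spectra\<close>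

context
  fixes J :: "('b::complex_banach \<Rightarrow> 'a::complex_banach) set" and \<alpha>
    and S :: "'n::finite \<Rightarrow> 'a \<Rightarrow> 'a" and T :: "'m::finite \<Rightarrow> 'b \<Rightarrow> 'b"
  assumes J: "operator_ideal J \<alpha>" and S: "commuting_tuple S" and T: "commuting_tuple T"
begin

text \<open>For the right multiplications this rests on the linearity of \<open>A\<close>. The two
  tuples are thus compared on \<open>J\<close> only, which is why the spectral conditions were shown
  to depend on the carrier alone.\<close>

lemma shift_left_right_mult:
  assumes "A \<in> J"
  shows "shift (left_right_mult S T) (case_sum \<zeta> \<xi>) i A = left_right_mult (shift S \<zeta>) (shift T \<xi>) i A"
  by (cases i)
    (simp_all add: left_right_mult_def shift_def fun_eq_iff scaleC_fun_def
      blin_diff[OF norm_on_norm ideal_bclin[OF J assms]] blin_scale[OF ideal_bclin[OF J assms]])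

lemmas shift_mult_facts = ideal_norm_on[OF J]
  comm_ops_left_right_mult[OF J comm_ops_shift[OF S] comm_ops_shift[OF T]] shift_left_right_mult

lemma mem_spectra_left_right_mult:
  shows "case_sum \<zeta> \<xi> \<in> sigma_B_minus J (left_right_mult S T) \<longleftrightarrow>
      \<not> codim J (R_infty J (left_right_mult (shift S \<zeta>) (shift T \<xi>))) < \<infinity>"
    and "case_sum \<zeta> \<xi> \<in> sigma_B_plus J \<alpha> (left_right_mult S T) \<longleftrightarrow>
      \<not> upper_semi_Browder J \<alpha> (left_right_mult (shift S \<zeta>) (shift T \<xi>))"
    and "case_sum \<zeta> \<xi> \<in> sp_B_minus J \<alpha> (left_right_mult S T) \<longleftrightarrow>
      \<not> (codim J (R_infty J (left_right_mult (shift S \<zeta>) (shift T \<xi>))) < \<infinity> \<and>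
        has_direct_complement (power_topology J \<alpha>) (null_hat J (left_right_mult (shift S \<zeta>) (shift T \<xi>))))"
    and "case_sum \<zeta> \<xi> \<in> sp_B_plus J \<alpha> (left_right_mult S T) \<longleftrightarrow>
      \<not> (upper_semi_Browder J \<alpha> (left_right_mult (shift S \<zeta>) (shift T \<xi>)) \<and>
        has_direct_complement (power_topology J \<alpha>) (range_tilde J (left_right_mult (shift S \<zeta>) (shift T \<xi>))))"
  unfolding sigma_B_minus_def sigma_B_plus_def sp_B_minus_def sp_B_plus_def lower_semi_Browder_def mem_Collect_eq
  by (simp_all only: R_infty_cong[OF shift_mult_facts] upper_semi_Browder_cong[OF shift_mult_facts] null_hat_cong[OF shift_mult_facts] range_tilde_cong[OF shift_mult_facts])

lemma sigma_B_minus_left_right_mult_supset: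
  "sigma_B_minus UNIV S \<times>\<^sub>s sigma_pi UNIV norm T \<union> sigma_delta UNIV S \<times>\<^sub>s sigma_B_plus UNIV norm T
    \<subseteq> sigma_B_minus J (left_right_mult S T)"
proof (rule subset_sum_indexI)
  fix \<zeta> \<xi>
  note C = J comm_ops_shift[OF S] comm_ops_shift[OF T]
  assume "case_sum \<zeta> \<xi> \<in> sigma_B_minus UNIV S \<times>\<^sub>s sigma_pi UNIV norm T \<union> sigma_delta UNIV S \<times>\<^sub>s sigma_B_plus UNIV norm T"
  then consider "\<zeta> \<in> sigma_B_minus UNIV S" "approx_null (shift T \<xi>)"
    | "M_sum UNIV 1 (shift S \<zeta>) \<noteq> UNIV" "\<xi> \<in> sigma_B_plus UNIV norm T"
    unfolding Un_iff mem_spec_prod sigma_delta_iff[OF S] using approx_null_if_sigma_pi[OF T] by blast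
  then show "case_sum \<zeta> \<xi> \<in> sigma_B_minus J (left_right_mult S T)"
    unfolding mem_spectra_left_right_mult
  proof cases
    case 1
    then show "\<not> codim J (R_infty J (left_right_mult (shift S \<zeta>) (shift T \<xi>))) < \<infinity>"
      using codim_R_infty_S[OF C] unfolding sigma_B_minus_def lower_semi_Browder_def mem_Collect_eq by blast
  next
    case 2
    then show "\<not> codim J (R_infty J (left_right_mult (shift S \<zeta>) (shift T \<xi>))) < \<infinity>"
      using upper_semi_Browder_T[OF C] unfolding sigma_B_plus_def mem_Collect_eq by blast
  qed
qed

lemma sigma_B_plus_left_right_mult_supset:
  "sigma_B_plus UNIV norm S \<times>\<^sub>s sigma_delta UNIV T \<union> sigma_pi UNIV norm S \<times>\<^sub>s sigma_B_minus UNIV T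
    \<subseteq> sigma_B_plus J \<alpha> (left_right_mult S T)"
proof (rule subset_sum_indexI)
  fix \<zeta> \<xi>
  note C = J comm_ops_shift[OF S] comm_ops_shift[OF T]
  assume "case_sum \<zeta> \<xi> \<in> sigma_B_plus UNIV norm S \<times>\<^sub>s sigma_delta UNIV T \<union> sigma_pi UNIV norm S \<times>\<^sub>s sigma_B_minus UNIV T"
  then consider "approx_null (shift S \<zeta>)" "\<xi> \<in> sigma_B_minus UNIV T"
    | "\<zeta> \<in> sigma_B_plus UNIV norm S" "M_sum UNIV 1 (shift T \<xi>) \<noteq> UNIV"
    unfolding Un_iff mem_spec_prod sigma_delta_iff[OF T] using approx_null_if_sigma_pi[OF S] by blast
  then show "case_sum \<zeta> \<xi> \<in> sigma_B_plus J \<alpha> (left_right_mult S T)"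
    unfolding mem_spectra_left_right_mult
  proof cases
    case 1
    then show "\<not> upper_semi_Browder J \<alpha> (left_right_mult (shift S \<zeta>) (shift T \<xi>))"
      using codim_R_infty_T[OF C] unfolding sigma_B_minus_def lower_semi_Browder_def mem_Collect_eq by blast
  next
    case 2
    then show "\<not> upper_semi_Browder J \<alpha> (left_right_mult (shift S \<zeta>) (shift T \<xi>))"
      using upper_semi_Browder_S[OF C] unfolding sigma_B_plus_def mem_Collect_eq by blast
  qed
qed

lemma sp_B_minus_left_right_mult_subset:
  "sp_B_minus J \<alpha> (left_right_mult S T)
    \<subseteq> sp_B_minus UNIV norm S \<times>\<^sub>s sp_pi UNIV norm T \<union> sp_delta UNIV norm S \<times>\<^sub>s sp_B_plus UNIV norm T"
proof (rule subset_sum_indexI, rule ccontr)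
  fix \<zeta> \<xi>
  assume m: "case_sum \<zeta> \<xi> \<in> sp_B_minus J \<alpha> (left_right_mult S T)"
    and "case_sum \<zeta> \<xi> \<notin> sp_B_minus UNIV norm S \<times>\<^sub>s sp_pi UNIV norm T \<union> sp_delta UNIV norm S \<times>\<^sub>s sp_B_plus UNIV norm T"
  \<comment> \<open>Of the four combinations of failing factors, those that avoid
    \<open>sp_delta\<close> for \<open>S\<close> or \<open>sp_pi\<close> for \<open>T\<close> are
    settled by an exact one-sided inverse; the remaining one uses both semi-Browder
    conditions.\<close>
  then have "\<zeta> \<notin> sp_delta UNIV norm S \<or> \<xi> \<notin> sp_pi UNIV norm T \<or> \<zeta> \<notin> sp_B_minus UNIV norm S \<and> \<xi> \<notin> sp_B_plus UNIV norm T"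
    unfolding Un_iff mem_spec_prod by blast
  then show False
    using m lower_split_left_right_mult[OF J comm_ops_shift[OF S] comm_ops_shift[OF T], of \<zeta> \<xi>]
      split_data(1,3)[OF S, of \<zeta>] split_data(2,4)[OF T, of \<xi>]
    unfolding mem_spectra_left_right_mult by argo
qed

lemma sp_B_plus_left_right_mult_subset:
  "sp_B_plus J \<alpha> (left_right_mult S T)
    \<subseteq> sp_B_plus UNIV norm S \<times>\<^sub>s sp_delta UNIV norm T \<union> sp_pi UNIV norm S \<times>\<^sub>s sp_B_minus UNIV norm T"
proof (rule subset_sum_indexI, rule ccontr)
  fix \<zeta> \<xi>
  assume m: "case_sum \<zeta> \<xi> \<in> sp_B_plus J \<alpha> (left_right_mult S T)"
    and "case_sum \<zeta> \<xi> \<notin> sp_B_plus UNIV norm S \<times>\<^sub>s sp_delta UNIV norm T \<union> sp_pi UNIV norm S \<times>\<^sub>s sp_B_minus UNIV norm T"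
  then have "\<zeta> \<notin> sp_pi UNIV norm S \<or> \<xi> \<notin> sp_delta UNIV norm T \<or> \<zeta> \<notin> sp_B_plus UNIV norm S \<and> \<xi> \<notin> sp_B_minus UNIV norm T"
    unfolding Un_iff mem_spec_prod by blast
  then show False
    using m upper_split_left_right_mult[OF J comm_ops_shift[OF S] comm_ops_shift[OF T], of \<zeta> \<xi>]
      split_data(2,4)[OF S, of \<zeta>] split_data(1,3)[OF T, of \<xi>]
    unfolding mem_spectra_left_right_mult by argo
qed

end

theorem theorem6p3:
  fixes S :: "'n::finite \<Rightarrow> 'a::complex_banach \<Rightarrow> 'a"
    and T :: "'m::finite \<Rightarrow> 'b::complex_banach \<Rightarrow> 'b"
    and J :: "('b \<Rightarrow> 'a) set"
    and \<alpha> :: "('b \<Rightarrow> 'a) \<Rightarrow> real"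
  assumes "operator_ideal J \<alpha>"
    and "commuting_tuple S"
    and "commuting_tuple T"
  shows
    "(sigma_B_minus UNIV S \<times>\<^sub>s sigma_pi UNIV norm T \<union> sigma_delta UNIV S \<times>\<^sub>s sigma_B_plus UNIV norm T
        \<subseteq> sigma_B_minus J (left_right_mult S T)) \<and>
     (sigma_B_minus J (left_right_mult S T) \<subseteq> sp_B_minus J \<alpha> (left_right_mult S T)) \<and>
     (sp_B_minus J \<alpha> (left_right_mult S T)
        \<subseteq> sp_B_minus UNIV norm S \<times>\<^sub>s sp_pi UNIV norm T \<union> sp_delta UNIV norm S \<times>\<^sub>s sp_B_plus UNIV norm T) \<and>
     (sigma_B_plus UNIV norm S \<times>\<^sub>s sigma_delta UNIV T \<union> sigma_pi UNIV norm S \<times>\<^sub>s sigma_B_minus UNIV T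
        \<subseteq> sigma_B_plus J \<alpha> (left_right_mult S T)) \<and>
     (sigma_B_plus J \<alpha> (left_right_mult S T) \<subseteq> sp_B_plus J \<alpha> (left_right_mult S T)) \<and>
     (sp_B_plus J \<alpha> (left_right_mult S T)
        \<subseteq> sp_B_plus UNIV norm S \<times>\<^sub>s sp_delta UNIV norm T \<union> sp_pi UNIV norm S \<times>\<^sub>s sp_B_minus UNIV norm T) \<and>
     ((\<exists>ip :: 'a \<Rightarrow> 'a \<Rightarrow> complex. inner_product_for_norm ip) \<and>
      (\<exists>ip :: 'b \<Rightarrow> 'b \<Rightarrow> complex. inner_product_for_norm ip) \<longrightarrow>
       sigma_B_minus UNIV S \<times>\<^sub>s sigma_pi UNIV norm T \<union> sigma_delta UNIV S \<times>\<^sub>s sigma_B_plus UNIV norm T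
         = sigma_B_minus J (left_right_mult S T) \<and>
       sigma_B_minus J (left_right_mult S T) = sp_B_minus J \<alpha> (left_right_mult S T) \<and>
       sp_B_minus J \<alpha> (left_right_mult S T)
         = sp_B_minus UNIV norm S \<times>\<^sub>s sp_pi UNIV norm T \<union> sp_delta UNIV norm S \<times>\<^sub>s sp_B_plus UNIV norm T \<and>
       sigma_B_plus UNIV norm S \<times>\<^sub>s sigma_delta UNIV T \<union> sigma_pi UNIV norm S \<times>\<^sub>s sigma_B_minus UNIV T
         = sigma_B_plus J \<alpha> (left_right_mult S T) \<and>
       sigma_B_plus J \<alpha> (left_right_mult S T) = sp_B_plus J \<alpha> (left_right_mult S T) \<and>
       sp_B_plus J \<alpha> (left_right_mult S T)
         = sp_B_plus UNIV norm S \<times>\<^sub>s sp_delta UNIV norm T \<union> sp_pi UNIV norm S \<times>\<^sub>s sp_B_minus UNIV norm T)"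
proof -
  note lower = sigma_B_minus_left_right_mult_supset[OF assms]
    Un_upper1[of "sigma_B_minus J (left_right_mult S T)" "C_minus J \<alpha> (left_right_mult S T)", folded sp_B_minus_eq]
    sp_B_minus_left_right_mult_subset[OF assms]
  note upper = sigma_B_plus_left_right_mult_supset[OF assms]
    Un_upper1[of "sigma_B_plus J \<alpha> (left_right_mult S T)" "C_plus J \<alpha> (left_right_mult S T)", folded sp_B_plus_eq]
    sp_B_plus_left_right_mult_subset[OF assms]
  show ?thesis (is "?a \<and> ?b \<and> ?c \<and> ?d \<and> ?e \<and> ?f \<and> (?H1 \<and> ?H2 \<longrightarrow> ?eqs)")
  proof (intro conjI[OF lower(1)] conjI[OF lower(2)] conjI[OF lower(3)]
      conjI[OF upper(1)] conjI[OF upper(2)] conjI[OF upper(3)] impI)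
    assume H: "?H1 \<and> ?H2"
    note hilbert_spectra[OF conjunct1[OF H] assms(2)] hilbert_spectra[OF conjunct2[OF H] assms(3)]
    note simps = this
    \<comment> \<open>Once the split spectra of \<open>S\<close> and \<open>T\<close> are replaced
      by the ordinary ones, the last set of each chain is the first, so the inclusions close up
      without examining complements in powers of \<open>J\<close>.\<close>
    have chain: "A = B \<and> B = C \<and> C = A" if "A \<subseteq> B" "B \<subseteq> C" "C \<subseteq> A" for A B C :: "('n + 'm \<Rightarrow> complex) set"
      using that by blast
    note l = chain[OF lower(1,2) lower(3)[unfolded simps]] and u = chain[OF upper(1,2) upper(3)[unfolded simps]]
    show ?eqs
      unfolding simps using l u by argo
  qed
qed

end
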